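(* Let $k$ be a commutative ring and $n,d\ge1$ integers. The Schur functor $\mathcal{F}$ and its left adjoint $\mathcal{G}_\otimes$ restrict to mutually inverse equivalences of categories \[\mathcal{F}\colon\mathsf{add}\,S\to\mathsf{add}\,M,\qquad \mathcal{G}_\otimes\colon\mathsf{add}\,M\to\mathsf{add}\,S,\] i.e. the functor $\mathcal{G}_\otimes$ restricted to $\mathsf{add}\,M$ is an inverse (up to natural isomorphism) of $\mathcal{F}|_{\mathsf{add}\,S}$.
   Context: $k$ is a commutative ring, $\mathsf{P}_k$ the category of finitely generated projective $k$-modules, $\mathsf{M}_k$ the category of all $k$-modules, $\mathfrak{S}_d$ the symmetric group on $d$ letters, acting on the right on $V^{\otimes d}$ by permuting factors. The category $\Gamma^d\mathsf{P}_k$ has the same objects as $\mathsf{P}_k$ and morphisms $\mathrm{Hom}_{\Gamma^d\mathsf{P}_k}(V,W)=(\mathrm{Hom}_k(V,W)^{\otimes d})^{\mathfrak{S}_d}$ (identified with the $\mathfrak{S}_d$-equivariant $k$-linear maps $V^{\otimes d}\to W^{\otimes d}$, composed as such). The category of strict polynomial functors is $\mathsf{Rep}\,\Gamma^d_k=\mathrm{Fun}_k(\Gamma^d\mathsf{P}_k,\mathsf{M}_k)$ ($k$-linear functors), with morphisms $\mathrm{Hom}_{\Gamma^d_k}$. $\Gamma^\omega$ is the functor $V\mapsto V^{\otimes d}$ ($\omega=(1,\dots,1)$). Schur functor: $\mathcal{F}=\mathrm{Hom}_{\Gamma^d_k}(\Gamma^\omega,-)\colon\mathsf{Rep}\,\Gamma^d_k\to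 k\mathfrak{S}_d\text{-}\mathsf{Mod}$, using $\mathrm{End}_{\Gamma^d_k}(\Gamma^\omega)\cong (k\mathfrak{S}_d)^{\mathrm{op}}$ (coming from the right permutation action on $V^{\otimes d}$). Its left adjoint is $\mathcal{G}_\otimes(N)=\bigl(V\mapsto V^{\otimes d}\otimes_{k\mathfrak{S}_d}N\bigr)$. $\Lambda(n,d)$ is the set of compositions $\lambda=(\lambda_1,\dots,\lambda_n)$ of $d$ into $n$ non-negative parts. For $\lambda\in\Lambda(n,d)$, $S^\lambda\in\mathsf{Rep}\,\Gamma^d_k$ is $V\mapsto S^{\lambda_1}V\otimes_k\cdots\otimes_k S^{\lambda_n}V$, where $S^eV$ is the module of $\mathfrak{S}_e$-coinvariants of $V^{\otimes e}$. The left $k\mathfrak{S}_d$-module $M^\lambda$ is the submodule of $(k^n)^{\otimes d}$ (with action $\sigma(v_1\otimes\dots\otimes v_d)=v_{\sigma^{-1}(1)}\otimes\dots\otimes v_{\sigma^{-1}(d)}$) spanned by the $e_{i_1}\otimes\dots\otimes e_{i_d}$ for which exactly $\lambda_l$ of the indices equal $l$ for each $l$, where $e_1,\dots,e_n$ is the standard basis of $k^n$. $\mathsf{add}\,S$ (resp. $\mathsf{add}\,M$) is the full subcategory of $\mathsf{Rep}\,\Gamma^d_k$ (resp. $k\mathfrak{S}_d\text{-}\mathsf{Mod}$) whose objects are direct summands of finite direct sums of the $S^\lambda$ (resp. $M^\lambda$), $\lambda\in\Lambda(n,d)$. *)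

theory Defs
  imports "HOL-Algebra.Module" "HOL-Algebra.AbelCoset" "HOL-Algebra.Sym_Groups"
begin

section \<open>Categories and functors\<close>

text \<open>Hom-sets of concrete categories below consist of functions that are extensional on their
  domain, so composition needs the source object as its first argument.\<close>

record ('o, 'm) cat =
  Ob :: "'o set"
  Hom :: "'o \<Rightarrow> 'o \<Rightarrow> 'm set"
  Id :: "'o \<Rightarrow> 'm"
  Comp :: "'o \<Rightarrow> 'm \<Rightarrow> 'm \<Rightarrow> 'm"

record ('o, 'm, 'p, 'q) func =
  fob :: "'o \<Rightarrow> 'p"
  fmor :: "'o \<Rightarrow> 'o \<Rightarrow> 'm \<Rightarrow> 'q"

definition is_functor :: "('o, 'm) cat \<Rightarrow> ('p, 'q) cat \<Rightarrow> ('o, 'm, 'p, 'q) func \<Rightarrow> bool" where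
  "is_functor C D F \<longleftrightarrow>
     (\<forall>X\<in>Ob C. fob F X \<in> Ob D) \<and>
     (\<forall>X\<in>Ob C. \<forall>Y\<in>Ob C. \<forall>f\<in>Hom C X Y. fmor F X Y f \<in> Hom D (fob F X) (fob F Y)) \<and>
     (\<forall>X\<in>Ob C. fmor F X X (Id C X) = Id D (fob F X)) \<and>
     (\<forall>X\<in>Ob C. \<forall>Y\<in>Ob C. \<forall>Z\<in>Ob C. \<forall>f\<in>Hom C X Y. \<forall>g\<in>Hom C Y Z.
        fmor F X Z (Comp C X g f) = Comp D (fob F X) (fmor F Y Z g) (fmor F X Y f))"

definition id_func :: "('o, 'm, 'o, 'm) func" where
  "id_func = \<lparr>fob = (\<lambda>X. X), fmor = (\<lambda>X Y f. f)\<rparr>"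

definition comp_func :: "('p, 'q, 'r, 's) func \<Rightarrow> ('o, 'm, 'p, 'q) func \<Rightarrow> ('o, 'm, 'r, 's) func" where
  "comp_func G F = \<lparr>fob = (\<lambda>X. fob G (fob F X)),
     fmor = (\<lambda>X Y f. fmor G (fob F X) (fob F Y) (fmor F X Y f))\<rparr>"

definition full_subcat :: "('o, 'm) cat \<Rightarrow> 'o set \<Rightarrow> ('o, 'm) cat" where
  "full_subcat C S = C\<lparr>Ob := S\<rparr>"


section \<open>Modules\<close>

text \<open>The library's \<open>module\<close> requires a commutative ring of scalars; modules over the group algebra
  need the same axioms over an arbitrary ring. The ring multiplication and unit of the record type
  \<open>module\<close> play no role.\<close>

locale left_module = R?: ring A + M?: abelian_group M
  for A :: "'r ring" and M :: "('r, 'a) module" +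
  assumes smult_closed: "\<lbrakk>a \<in> carrier A; x \<in> carrier M\<rbrakk> \<Longrightarrow> a \<odot>\<^bsub>M\<^esub> x \<in> carrier M"
    and smult_l_distr: "\<lbrakk>a \<in> carrier A; b \<in> carrier A; x \<in> carrier M\<rbrakk> \<Longrightarrow>
      (a \<oplus>\<^bsub>A\<^esub> b) \<odot>\<^bsub>M\<^esub> x = a \<odot>\<^bsub>M\<^esub> x \<oplus>\<^bsub>M\<^esub> b \<odot>\<^bsub>M\<^esub> x"
    and smult_r_distr: "\<lbrakk>a \<in> carrier A; x \<in> carrier M; y \<in> carrier M\<rbrakk> \<Longrightarrow>
      a \<odot>\<^bsub>M\<^esub> (x \<oplus>\<^bsub>M\<^esub> y) = a \<odot>\<^bsub>M\<^esub> x \<oplus>\<^bsub>M\<^esub> a \<odot>\<^bsub>M\<^esub> y"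
    and smult_assoc: "\<lbrakk>a \<in> carrier A; b \<in> carrier A; x \<in> carrier M\<rbrakk> \<Longrightarrow>
      (a \<otimes>\<^bsub>A\<^esub> b) \<odot>\<^bsub>M\<^esub> x = a \<odot>\<^bsub>M\<^esub> (b \<odot>\<^bsub>M\<^esub> x)"
    and smult_one: "x \<in> carrier M \<Longrightarrow> \<one>\<^bsub>A\<^esub> \<odot>\<^bsub>M\<^esub> x = x"

lemma left_module_iff_module: "cring k \<Longrightarrow> left_module k M \<longleftrightarrow> module k M"
  by (auto simp: left_module_def left_module_axioms_def module_def module_axioms_def cring.axioms)

definition mk_module ::
  "'a set \<Rightarrow> 'a \<Rightarrow> ('a \<Rightarrow> 'a \<Rightarrow> 'a) \<Rightarrow> ('r \<Rightarrow> 'a \<Rightarrow> 'a) \<Rightarrow> ('r, 'a) module" where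
  "mk_module S z pl sm =
     \<lparr>carrier = S, monoid.mult = undefined, one = undefined, zero = z, add = pl, smult = sm\<rparr>"

definition linmaps ::
  "'r ring \<Rightarrow> ('r, 'a) module \<Rightarrow> ('r, 'b) module \<Rightarrow> ('a \<Rightarrow> 'b) set" where
  "linmaps A M N = {f \<in> carrier M \<rightarrow>\<^sub>E carrier N.
     (\<forall>x\<in>carrier M. \<forall>y\<in>carrier M. f (x \<oplus>\<^bsub>M\<^esub> y) = f x \<oplus>\<^bsub>N\<^esub> f y) \<and>
     (\<forall>a\<in>carrier A. \<forall>x\<in>carrier M. f (a \<odot>\<^bsub>M\<^esub> x) = a \<odot>\<^bsub>N\<^esub> f x)}"

definition lin_isos ::
  "'r ring \<Rightarrow> ('r, 'a) module \<Rightarrow> ('r, 'b) module \<Rightarrow> ('a \<Rightarrow> 'b) set" where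
  "lin_isos A M N = {f \<in> linmaps A M N. bij_betw f (carrier M) (carrier N)}"

text \<open>\<open>LMod A\<close> is the category of left \<open>A\<close>-modules with carrier in the type \<open>'a\<close>. The type is
  arbitrary and plays the role of a universe.\<close>

definition LMod :: "'r ring \<Rightarrow> (('r, 'a) module, 'a \<Rightarrow> 'a) cat" where
  "LMod A = \<lparr>Ob = {M. left_module A M}, Hom = linmaps A, Id = (\<lambda>M. \<lambda>x\<in>carrier M. x),
     Comp = (\<lambda>M g f. compose (carrier M) g f)\<rparr>"

text \<open>Natural transformations and natural isomorphisms between functors to modules. The two
  functors may take values in modules over different carrier types.\<close>

definition nat_trans :: "'r ring \<Rightarrow> ('o, 'm) cat \<Rightarrow> ('o, 'm, ('r, 'a) module, 'a \<Rightarrow> 'a) func \<Rightarrow>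
    ('o, 'm, ('r, 'b) module, 'b \<Rightarrow> 'b) func \<Rightarrow> ('o \<Rightarrow> 'a \<Rightarrow> 'b) set" where
  "nat_trans A C F G = {\<eta> \<in> extensional (Ob C).
     (\<forall>X\<in>Ob C. \<eta> X \<in> linmaps A (fob F X) (fob G X)) \<and>
     (\<forall>X\<in>Ob C. \<forall>Y\<in>Ob C. \<forall>f\<in>Hom C X Y. \<forall>x\<in>carrier (fob F X).
        \<eta> Y (fmor F X Y f x) = fmor G X Y f (\<eta> X x))}"

definition nat_isos :: "'r ring \<Rightarrow> ('o, 'm) cat \<Rightarrow> ('o, 'm, ('r, 'a) module, 'a \<Rightarrow> 'a) func \<Rightarrow>
    ('o, 'm, ('r, 'b) module, 'b \<Rightarrow> 'b) func \<Rightarrow> ('o \<Rightarrow> 'a \<Rightarrow> 'b) set" where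
  "nat_isos A C F G =
     {\<eta> \<in> nat_trans A C F G. \<forall>X\<in>Ob C. \<eta> X \<in> lin_isos A (fob F X) (fob G X)}"

definition vcomp :: "('o, 'm) cat \<Rightarrow> ('o, 'm, ('r, 'a) module, 'a \<Rightarrow> 'a) func \<Rightarrow>
    ('o \<Rightarrow> 'b \<Rightarrow> 'c) \<Rightarrow> ('o \<Rightarrow> 'a \<Rightarrow> 'b) \<Rightarrow> 'o \<Rightarrow> 'a \<Rightarrow> 'c" where
  "vcomp C F \<beta> \<alpha> = (\<lambda>X\<in>Ob C. compose (carrier (fob F X)) (\<beta> X) (\<alpha> X))"

subsection \<open>Direct sums and direct summands\<close>

definition dsum2 :: "('r, 'a) module \<Rightarrow> ('r, 'b) module \<Rightarrow> ('r, 'a \<times> 'b) module" where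
  "dsum2 M N = mk_module (carrier M \<times> carrier N) (\<zero>\<^bsub>M\<^esub>, \<zero>\<^bsub>N\<^esub>)
     (\<lambda>(x, y) (x', y'). (x \<oplus>\<^bsub>M\<^esub> x', y \<oplus>\<^bsub>N\<^esub> y')) (\<lambda>a (x, y). (a \<odot>\<^bsub>M\<^esub> x, a \<odot>\<^bsub>N\<^esub> y))"

text \<open>Only used for finite \<open>I\<close>.\<close>

definition dsum :: "'i set \<Rightarrow> ('i \<Rightarrow> ('r, 'a) module) \<Rightarrow> ('r, 'i \<Rightarrow> 'a) module" where
  "dsum I M = mk_module (\<Pi>\<^sub>E i\<in>I. carrier (M i)) (\<lambda>i\<in>I. \<zero>\<^bsub>M i\<^esub>)
     (\<lambda>x y. \<lambda>i\<in>I. x i \<oplus>\<^bsub>M i\<^esub> y i) (\<lambda>a x. \<lambda>i\<in>I. a \<odot>\<^bsub>M i\<^esub> x i)"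

text \<open>A complement of \<open>M\<close> in \<open>N\<close> is isomorphic to a submodule of \<open>N\<close>, so it is no restriction to
  take its carrier in the type of \<open>N\<close>.\<close>

definition summand :: "'r ring \<Rightarrow> ('r, 'a) module \<Rightarrow> ('r, 'b) module \<Rightarrow> bool" where
  "summand A M N \<longleftrightarrow>
     (\<exists>M' :: ('r, 'b) module. left_module A M' \<and> lin_isos A N (dsum2 M M') \<noteq> {})"

subsection \<open>Spans, quotients and free modules\<close>

definition mspan :: "'k ring \<Rightarrow> ('k, 'a) module \<Rightarrow> 'a set \<Rightarrow> 'a set" where
  "mspan k M S = \<Inter>{H. submodule H k M \<and> S \<subseteq> H}"

definition mquot :: "('k, 'a) module \<Rightarrow> 'a set \<Rightarrow> ('k, 'a set) module" where
  "mquot M H = mk_module (a_rcosets\<^bsub>M\<^esub> H) H (\<lambda>X Y. X <+>\<^bsub>M\<^esub> Y)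
     (\<lambda>c X. \<Union>x\<in>X. H +>\<^bsub>M\<^esub> (c \<odot>\<^bsub>M\<^esub> x))"

definition free_mod :: "'k ring \<Rightarrow> 'x set \<Rightarrow> ('k, 'x \<Rightarrow> 'k) module" where
  "free_mod k X = mk_module
     {f. (\<forall>x\<in>X. f x \<in> carrier k) \<and> (\<forall>x. x \<notin> X \<longrightarrow> f x = \<zero>\<^bsub>k\<^esub>) \<and> finite {x. f x \<noteq> \<zero>\<^bsub>k\<^esub>}}
     (\<lambda>x. \<zero>\<^bsub>k\<^esub>) (\<lambda>f g x. f x \<oplus>\<^bsub>k\<^esub> g x) (\<lambda>c f x. c \<otimes>\<^bsub>k\<^esub> f x)"

definition basis_vec :: "'k ring \<Rightarrow> 'x \<Rightarrow> 'x \<Rightarrow> 'k" where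
  "basis_vec k x = (\<lambda>y. if y = x then \<one>\<^bsub>k\<^esub> else \<zero>\<^bsub>k\<^esub>)"

text \<open>A module with carrier in \<open>'a\<close> that is a direct summand of some free module is a direct summand
  of the free module on its own carrier, so bases in \<open>'a\<close> suffice.\<close>

definition projective :: "'k ring \<Rightarrow> ('k, 'a) module \<Rightarrow> bool" where
  "projective k M \<longleftrightarrow> (\<exists>X :: 'a set. summand k M (free_mod k X))"

definition fg_projectives :: "'k ring \<Rightarrow> ('k, 'a) module set" where
  "fg_projectives k = {M. module k M \<and> projective k M \<and>
     (\<exists>S. finite S \<and> S \<subseteq> carrier M \<and> mspan k M S = carrier M)}"

subsection \<open>Tensor products\<close>

text \<open>The tensor product over \<open>k\<close> of a family of modules: the free module on the product of the
  carriers modulo the relations of multilinearity.\<close>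

definition tensor_rels :: "'k ring \<Rightarrow> 'i set \<Rightarrow> ('i \<Rightarrow> ('k, 'a) module) \<Rightarrow> (('i \<Rightarrow> 'a) \<Rightarrow> 'k) set" where
  "tensor_rels k I M = (let B = free_mod k (\<Pi>\<^sub>E i\<in>I. carrier (M i)) in
     {(basis_vec k (v(i := x \<oplus>\<^bsub>M i\<^esub> y)) \<ominus>\<^bsub>B\<^esub> basis_vec k (v(i := x))) \<ominus>\<^bsub>B\<^esub> basis_vec k (v(i := y))
        | v i x y. v \<in> (\<Pi>\<^sub>E i\<in>I. carrier (M i)) \<and> i \<in> I \<and> x \<in> carrier (M i) \<and> y \<in> carrier (M i)} \<union>
     {basis_vec k (v(i := c \<odot>\<^bsub>M i\<^esub> x)) \<ominus>\<^bsub>B\<^esub> c \<odot>\<^bsub>B\<^esub> basis_vec k (v(i := x))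
        | v i c x. v \<in> (\<Pi>\<^sub>E i\<in>I. carrier (M i)) \<and> i \<in> I \<and> c \<in> carrier k \<and> x \<in> carrier (M i)})"

definition tensor ::
  "'k ring \<Rightarrow> 'i set \<Rightarrow> ('i \<Rightarrow> ('k, 'a) module) \<Rightarrow> ('k, (('i \<Rightarrow> 'a) \<Rightarrow> 'k) set) module" where
  "tensor k I M = (let B = free_mod k (\<Pi>\<^sub>E i\<in>I. carrier (M i)) in
     mquot B (mspan k B (tensor_rels k I M)))"

definition pure_tensor ::
  "'k ring \<Rightarrow> 'i set \<Rightarrow> ('i \<Rightarrow> ('k, 'a) module) \<Rightarrow> ('i \<Rightarrow> 'a) \<Rightarrow> (('i \<Rightarrow> 'a) \<Rightarrow> 'k) set" where
  "pure_tensor k I M v = (let B = free_mod k (\<Pi>\<^sub>E i\<in>I. carrier (M i)) in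
     mspan k B (tensor_rels k I M) +>\<^bsub>B\<^esub> basis_vec k v)"

text \<open>The linear map determined by its values on pure tensors.\<close>

definition tensor_lift :: "'k ring \<Rightarrow> 'i set \<Rightarrow> ('i \<Rightarrow> ('k, 'a) module) \<Rightarrow> ('k, 'b) module \<Rightarrow>
    (('i \<Rightarrow> 'a) \<Rightarrow> 'b) \<Rightarrow> (('i \<Rightarrow> 'a) \<Rightarrow> 'k) set \<Rightarrow> 'b" where
  "tensor_lift k I M N g = (THE h. h \<in> linmaps k (tensor k I M) N \<and>
     (\<forall>v\<in>(\<Pi>\<^sub>E i\<in>I. carrier (M i)). h (pure_tensor k I M v) = g v))"

text \<open>The tensor product \<open>X \<otimes>\<^sub>A N\<close> over a \<open>k\<close>-algebra \<open>A\<close>, as a \<open>k\<close>-module, where \<open>X\<close> is a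
  \<open>k\<close>-module with a \<open>k\<close>-linear right \<open>A\<close>-module structure \<open>ract\<close> and \<open>N\<close> is a left \<open>A\<close>-module.\<close>

definition btensor_rels :: "'k ring \<Rightarrow> 'r ring \<Rightarrow> ('k, 'x) module \<Rightarrow> ('x \<Rightarrow> 'r \<Rightarrow> 'x) \<Rightarrow>
    ('r, 'a) module \<Rightarrow> ('x \<times> 'a \<Rightarrow> 'k) set" where
  "btensor_rels k A X ract N = (let B = free_mod k (carrier X \<times> carrier N) in
     {(basis_vec k (x \<oplus>\<^bsub>X\<^esub> x', y) \<ominus>\<^bsub>B\<^esub> basis_vec k (x, y)) \<ominus>\<^bsub>B\<^esub> basis_vec k (x', y)
        | x x' y. x \<in> carrier X \<and> x' \<in> carrier X \<and> y \<in> carrier N} \<union>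
     {(basis_vec k (x, y \<oplus>\<^bsub>N\<^esub> y') \<ominus>\<^bsub>B\<^esub> basis_vec k (x, y)) \<ominus>\<^bsub>B\<^esub> basis_vec k (x, y')
        | x y y'. x \<in> carrier X \<and> y \<in> carrier N \<and> y' \<in> carrier N} \<union>
     {basis_vec k (c \<odot>\<^bsub>X\<^esub> x, y) \<ominus>\<^bsub>B\<^esub> c \<odot>\<^bsub>B\<^esub> basis_vec k (x, y)
        | c x y. c \<in> carrier k \<and> x \<in> carrier X \<and> y \<in> carrier N} \<union>
     {basis_vec k (ract x a, y) \<ominus>\<^bsub>B\<^esub> basis_vec k (x, a \<odot>\<^bsub>N\<^esub> y)
        | x a y. x \<in> carrier X \<and> a \<in> carrier A \<and> y \<in> carrier N})"

definition btensor :: "'k ring \<Rightarrow> 'r ring \<Rightarrow> ('k, 'x) module \<Rightarrow> ('x \<Rightarrow> 'r \<Rightarrow> 'x) \<Rightarrow>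
    ('r, 'a) module \<Rightarrow> ('k, ('x \<times> 'a \<Rightarrow> 'k) set) module" where
  "btensor k A X ract N = (let B = free_mod k (carrier X \<times> carrier N) in
     mquot B (mspan k B (btensor_rels k A X ract N)))"

definition pure_btensor :: "'k ring \<Rightarrow> 'r ring \<Rightarrow> ('k, 'x) module \<Rightarrow> ('x \<Rightarrow> 'r \<Rightarrow> 'x) \<Rightarrow>
    ('r, 'a) module \<Rightarrow> 'x \<Rightarrow> 'a \<Rightarrow> ('x \<times> 'a \<Rightarrow> 'k) set" where
  "pure_btensor k A X ract N x y = (let B = free_mod k (carrier X \<times> carrier N) in
     mspan k B (btensor_rels k A X ract N) +>\<^bsub>B\<^esub> basis_vec k (x, y))"

definition btensor_lift :: "'k ring \<Rightarrow> 'r ring \<Rightarrow> ('k, 'x) module \<Rightarrow> ('x \<Rightarrow> 'r \<Rightarrow> 'x) \<Rightarrow>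
    ('r, 'a) module \<Rightarrow> ('k, 'b) module \<Rightarrow> ('x \<Rightarrow> 'a \<Rightarrow> 'b) \<Rightarrow> ('x \<times> 'a \<Rightarrow> 'k) set \<Rightarrow> 'b" where
  "btensor_lift k A X ract N P g = (THE h. h \<in> linmaps k (btensor k A X ract N) P \<and>
     (\<forall>x\<in>carrier X. \<forall>y\<in>carrier N. h (pure_btensor k A X ract N x y) = g x y))"


section \<open>The symmetric group acting on tensor powers\<close>

type_synonym ('k, 'v) tens = "((nat \<Rightarrow> 'v) \<Rightarrow> 'k) set"
type_synonym perm = "nat \<Rightarrow> nat"

text \<open>The group algebra \<open>k\<SS>\<^sub>d\<close>, with convolution product.\<close>

definition kS :: "'k ring \<Rightarrow> nat \<Rightarrow> (perm \<Rightarrow> 'k) ring" where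
  "kS k d = (let G = sym_group d; B = free_mod k (carrier G) in
     \<lparr>carrier = carrier B,
      monoid.mult = (\<lambda>a b \<rho>. if \<rho> \<in> carrier G
                then \<Oplus>\<^bsub>k\<^esub>\<sigma>\<in>carrier G. a \<sigma> \<otimes>\<^bsub>k\<^esub> b (inv\<^bsub>G\<^esub> \<sigma> \<otimes>\<^bsub>G\<^esub> \<rho>) else \<zero>\<^bsub>k\<^esub>),
      one = basis_vec k \<one>\<^bsub>G\<^esub>, zero = \<zero>\<^bsub>B\<^esub>, add = add B\<rparr>)"

definition tpow :: "'k ring \<Rightarrow> nat \<Rightarrow> ('k, 'v) module \<Rightarrow> ('k, ('k, 'v) tens) module" where
  "tpow k d V = tensor k {1..d} (\<lambda>_. V)"

definition tpure :: "'k ring \<Rightarrow> nat \<Rightarrow> ('k, 'v) module \<Rightarrow> (nat \<Rightarrow> 'v) \<Rightarrow> ('k, 'v) tens" where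
  "tpure k d V v = pure_tensor k {1..d} (\<lambda>_. V) v"

text \<open>The right action \<open>(v\<^sub>1 \<otimes> \<dots> \<otimes> v\<^sub>d) \<sigma> = v\<^bsub>\<sigma>(1)\<^esub> \<otimes> \<dots> \<otimes> v\<^bsub>\<sigma>(d)\<^esub>\<close>, and its linear
  extension to \<open>k\<SS>\<^sub>d\<close>.\<close>

definition perm_ract ::
  "'k ring \<Rightarrow> nat \<Rightarrow> ('k, 'v) module \<Rightarrow> ('k, 'v) tens \<Rightarrow> perm \<Rightarrow> ('k, 'v) tens" where
  "perm_ract k d V x \<sigma> =
     tensor_lift k {1..d} (\<lambda>_. V) (tpow k d V) (\<lambda>v. tpure k d V (\<lambda>i\<in>{1..d}. v (\<sigma> i))) x"

definition kS_ract ::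
  "'k ring \<Rightarrow> nat \<Rightarrow> ('k, 'v) module \<Rightarrow> ('k, 'v) tens \<Rightarrow> (perm \<Rightarrow> 'k) \<Rightarrow> ('k, 'v) tens" where
  "kS_ract k d V x a =
     (\<Oplus>\<^bsub>tpow k d V\<^esub>\<sigma>\<in>carrier (sym_group d). a \<sigma> \<odot>\<^bsub>tpow k d V\<^esub> perm_ract k d V x \<sigma>)"

text \<open>The left action \<open>\<sigma> (v\<^sub>1 \<otimes> \<dots> \<otimes> v\<^sub>d) = v\<^bsub>\<sigma>\<inverse>(1)\<^esub> \<otimes> \<dots> \<otimes> v\<^bsub>\<sigma>\<inverse>(d)\<^esub>\<close>.\<close>

definition kS_lact ::
  "'k ring \<Rightarrow> nat \<Rightarrow> ('k, 'v) module \<Rightarrow> (perm \<Rightarrow> 'k) \<Rightarrow> ('k, 'v) tens \<Rightarrow> ('k, 'v) tens" where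
  "kS_lact k d V a x =
     (\<Oplus>\<^bsub>tpow k d V\<^esub>\<sigma>\<in>carrier (sym_group d).
        a \<sigma> \<odot>\<^bsub>tpow k d V\<^esub> perm_ract k d V x (inv\<^bsub>sym_group d\<^esub> \<sigma>))"


section \<open>Strict polynomial functors\<close>

text \<open>Morphisms \<open>V \<rightarrow> W\<close> of \<open>\<Gamma>\<^sup>dP\<^sub>k\<close> are the \<open>\<SS>\<^sub>d\<close>-equivariant linear maps
  \<open>V\<^sup>\<otimes>\<^sup>d \<rightarrow> W\<^sup>\<otimes>\<^sup>d\<close>. The objects are the finitely generated projective modules with carrier in the
  type \<open>'v\<close>.\<close>

definition GammaP :: "'k ring \<Rightarrow> nat \<Rightarrow> (('k, 'v) module, ('k, 'v) tens \<Rightarrow> ('k, 'v) tens) cat" where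
  "GammaP k d = \<lparr>Ob = fg_projectives k,
     Hom = (\<lambda>V W. {f \<in> linmaps k (tpow k d V) (tpow k d W).
        \<forall>\<sigma>\<in>carrier (sym_group d). \<forall>x\<in>carrier (tpow k d V).
          f (perm_ract k d V x \<sigma>) = perm_ract k d W (f x) \<sigma>}),
     Id = (\<lambda>V. \<lambda>x\<in>carrier (tpow k d V). x),
     Comp = (\<lambda>V g f. compose (carrier (tpow k d V)) g f)\<rparr>"

type_synonym ('k, 'v, 'w) spf =
  "(('k, 'v) module, ('k, 'v) tens \<Rightarrow> ('k, 'v) tens, ('k, 'w) module, 'w \<Rightarrow> 'w) func"

type_synonym ('k, 'v, 'a, 'b) spf_hom = "('k, 'v) module \<Rightarrow> 'a \<Rightarrow> 'b"

definition spf_linear :: "'k ring \<Rightarrow> nat \<Rightarrow> ('k, 'v, 'w) spf \<Rightarrow> bool" where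
  "spf_linear k d F \<longleftrightarrow> (\<forall>V\<in>Ob (GammaP k d). \<forall>W\<in>Ob (GammaP k d).
     (\<forall>f\<in>Hom (GammaP k d) V W. \<forall>g\<in>Hom (GammaP k d) V W. \<forall>x\<in>carrier (fob F V).
        fmor F V W (\<lambda>t\<in>carrier (tpow k d V). f t \<oplus>\<^bsub>tpow k d W\<^esub> g t) x
        = fmor F V W f x \<oplus>\<^bsub>fob F W\<^esub> fmor F V W g x) \<and>
     (\<forall>c\<in>carrier k. \<forall>f\<in>Hom (GammaP k d) V W. \<forall>x\<in>carrier (fob F V).
        fmor F V W (\<lambda>t\<in>carrier (tpow k d V). c \<odot>\<^bsub>tpow k d W\<^esub> f t) x
        = c \<odot>\<^bsub>fob F W\<^esub> fmor F V W f x))"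

definition Rep :: "'k ring \<Rightarrow> nat \<Rightarrow> (('k, 'v, 'w) spf, ('k, 'v, 'w, 'w) spf_hom) cat" where
  "Rep k d = \<lparr>Ob = {F. is_functor (GammaP k d) (LMod k) F \<and> spf_linear k d F},
     Hom = nat_trans k (GammaP k d),
     Id = (\<lambda>F. \<lambda>V\<in>Ob (GammaP k d). \<lambda>x\<in>carrier (fob F V). x),
     Comp = vcomp (GammaP k d)\<rparr>"

text \<open>Natural isomorphisms between functors \<open>P, Q\<close> from \<open>C\<close> to strict polynomial functors, again with
  possibly different carrier types for the values.\<close>

definition Rep_nat_isos :: "'k ring \<Rightarrow> nat \<Rightarrow> ('o, 'm) cat \<Rightarrow>
    ('o, 'm, ('k, 'v, 'a) spf, ('k, 'v, 'a, 'a) spf_hom) func \<Rightarrow>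
    ('o, 'm, ('k, 'v, 'b) spf, ('k, 'v, 'b, 'b) spf_hom) func \<Rightarrow>
    ('o \<Rightarrow> ('k, 'v, 'a, 'b) spf_hom) set" where
  "Rep_nat_isos k d C P Q = {\<epsilon> \<in> extensional (Ob C).
     (\<forall>X\<in>Ob C. \<epsilon> X \<in> nat_isos k (GammaP k d) (fob P X) (fob Q X)) \<and>
     (\<forall>X\<in>Ob C. \<forall>Y\<in>Ob C. \<forall>f\<in>Hom C X Y.
        vcomp (GammaP k d) (fob P X) (\<epsilon> Y) (fmor P X Y f)
        = vcomp (GammaP k d) (fob P X) (fmor Q X Y f) (\<epsilon> X))}"

definition spf_dsum2 :: "('k, 'v, 'a) spf \<Rightarrow> ('k, 'v, 'b) spf \<Rightarrow> ('k, 'v, 'a \<times> 'b) spf" where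
  "spf_dsum2 F G = \<lparr>fob = (\<lambda>V. dsum2 (fob F V) (fob G V)),
     fmor = (\<lambda>V W f. \<lambda>(x, y)\<in>carrier (fob F V) \<times> carrier (fob G V).
       (fmor F V W f x, fmor G V W f y))\<rparr>"

definition spf_dsum :: "'i set \<Rightarrow> ('i \<Rightarrow> ('k, 'v, 'a) spf) \<Rightarrow> ('k, 'v, 'i \<Rightarrow> 'a) spf" where
  "spf_dsum I F = \<lparr>fob = (\<lambda>V. dsum I (\<lambda>i. fob (F i) V)),
     fmor = (\<lambda>V W f. \<lambda>x\<in>(\<Pi>\<^sub>E i\<in>I. carrier (fob (F i) V)). \<lambda>i\<in>I. fmor (F i) V W f (x i))\<rparr>"

definition spf_summand :: "'k ring \<Rightarrow> nat \<Rightarrow> ('k, 'v, 'a) spf \<Rightarrow> ('k, 'v, 'b) spf \<Rightarrow> bool" where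
  "spf_summand k d F G \<longleftrightarrow> (\<exists>F' :: ('k, 'v, 'b) spf. F' \<in> Ob (Rep k d) \<and>
     nat_isos k (GammaP k d) G (spf_dsum2 F F') \<noteq> {})"

definition Gamma_omega :: "'k ring \<Rightarrow> nat \<Rightarrow> ('k, 'v, ('k, 'v) tens) spf" where
  "Gamma_omega k d = \<lparr>fob = tpow k d, fmor = (\<lambda>V W f. f)\<rparr>"


section \<open>The Schur functor and its left adjoint\<close>

text \<open>\<open>a \<in> k\<SS>\<^sub>d\<close> acts on \<open>\<phi> : \<Gamma>\<^sup>\<omega> \<rightarrow> F\<close> by precomposition with the right action of \<open>a\<close> on
  \<open>V\<^sup>\<otimes>\<^sup>d\<close>; this is a left action.\<close>

definition Schur_ob :: "'k ring \<Rightarrow> nat \<Rightarrow> ('k, 'v, 'w) spf \<Rightarrow>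
    (perm \<Rightarrow> 'k, ('k, 'v, ('k, 'v) tens, 'w) spf_hom) module" where
  "Schur_ob k d F = mk_module (nat_trans k (GammaP k d) (Gamma_omega k d) F)
     (\<lambda>V\<in>Ob (GammaP k d). \<lambda>x\<in>carrier (tpow k d V). \<zero>\<^bsub>fob F V\<^esub>)
     (\<lambda>\<phi> \<psi>. \<lambda>V\<in>Ob (GammaP k d). \<lambda>x\<in>carrier (tpow k d V). \<phi> V x \<oplus>\<^bsub>fob F V\<^esub> \<psi> V x)
     (\<lambda>a \<phi>. \<lambda>V\<in>Ob (GammaP k d). \<lambda>x\<in>carrier (tpow k d V). \<phi> V (kS_ract k d V x a))"

definition Schur :: "'k ring \<Rightarrow> nat \<Rightarrow>
    (('k, 'v, 'w) spf, ('k, 'v, 'w, 'w) spf_hom,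
     (perm \<Rightarrow> 'k, ('k, 'v, ('k, 'v) tens, 'w) spf_hom) module,
     ('k, 'v, ('k, 'v) tens, 'w) spf_hom \<Rightarrow> ('k, 'v, ('k, 'v) tens, 'w) spf_hom) func" where
  "Schur k d = \<lparr>fob = Schur_ob k d,
     fmor = (\<lambda>F F' \<alpha>. \<lambda>\<phi>\<in>carrier (Schur_ob k d F). vcomp (GammaP k d) (Gamma_omega k d) \<alpha> \<phi>)\<rparr>"

definition Gtensor_ob :: "'k ring \<Rightarrow> nat \<Rightarrow> (perm \<Rightarrow> 'k, 'a) module \<Rightarrow>
    ('k, 'v, (('k, 'v) tens \<times> 'a \<Rightarrow> 'k) set) spf" where
  "Gtensor_ob k d N =
    \<lparr>fob = (\<lambda>V. btensor k (kS k d) (tpow k d V) (kS_ract k d V) N),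
     fmor = (\<lambda>V W f. btensor_lift k (kS k d) (tpow k d V) (kS_ract k d V) N
       (btensor k (kS k d) (tpow k d W) (kS_ract k d W) N)
       (\<lambda>x y. pure_btensor k (kS k d) (tpow k d W) (kS_ract k d W) N (f x) y))\<rparr>"

definition Gtensor :: "'k ring \<Rightarrow> nat \<Rightarrow>
    ((perm \<Rightarrow> 'k, 'a) module, 'a \<Rightarrow> 'a, ('k, 'v, (('k, 'v) tens \<times> 'a \<Rightarrow> 'k) set) spf,
     ('k, 'v, (('k, 'v) tens \<times> 'a \<Rightarrow> 'k) set, (('k, 'v) tens \<times> 'a \<Rightarrow> 'k) set) spf_hom) func" where
  "Gtensor k d = \<lparr>fob = Gtensor_ob k d,
     fmor = (\<lambda>N N' g. \<lambda>V\<in>Ob (GammaP k d).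
       btensor_lift k (kS k d) (tpow k d V) (kS_ract k d V) N
         (btensor k (kS k d) (tpow k d V) (kS_ract k d V) N')
         (\<lambda>x y. pure_btensor k (kS k d) (tpow k d V) (kS_ract k d V) N' x (g y)))\<rparr>"


section \<open>The categories \<open>add S\<close> and \<open>add M\<close>\<close>

definition compositions :: "nat \<Rightarrow> nat \<Rightarrow> (nat \<Rightarrow> nat) set" where
  "compositions n d = {\<mu> \<in> {1..n} \<rightarrow>\<^sub>E UNIV. (\<Sum>l=1..n. \<mu> l) = d}"

definition sym_rel :: "'k ring \<Rightarrow> nat \<Rightarrow> ('k, 'v) module \<Rightarrow> ('k, 'v) tens set" where
  "sym_rel k e V = mspan k (tpow k e V)
     {perm_ract k e V x \<sigma> \<ominus>\<^bsub>tpow k e V\<^esub> x | x \<sigma>.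
        x \<in> carrier (tpow k e V) \<and> \<sigma> \<in> carrier (sym_group e)}"

definition sym_pow :: "'k ring \<Rightarrow> nat \<Rightarrow> ('k, 'v) module \<Rightarrow> ('k, ('k, 'v) tens set) module" where
  "sym_pow k e V = mquot (tpow k e V) (sym_rel k e V)"

definition sym_prod ::
  "'k ring \<Rightarrow> nat \<Rightarrow> ('k, 'v) module \<Rightarrow> (nat \<Rightarrow> 'v) \<Rightarrow> ('k, 'v) tens set" where
  "sym_prod k e V v = sym_rel k e V +>\<^bsub>tpow k e V\<^esub> tpure k e V v"

type_synonym ('k, 'v) stens = "((nat \<Rightarrow> ('k, 'v) tens set) \<Rightarrow> 'k) set"

definition S_ob :: "'k ring \<Rightarrow> nat \<Rightarrow> (nat \<Rightarrow> nat) \<Rightarrow> ('k, 'v) module \<Rightarrow>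
    ('k, ('k, 'v) stens) module" where
  "S_ob k n \<mu> V = tensor k {1..n} (\<lambda>l. sym_pow k (\<mu> l) V)"

text \<open>The canonical surjection \<open>V\<^sup>\<otimes>\<^sup>d \<rightarrow> S\<^sup>\<mu> V\<close>, which multiplies the first \<open>\<mu>\<^sub>1\<close> factors, the next
  \<open>\<mu>\<^sub>2\<close> factors, and so on.\<close>

definition S_proj :: "'k ring \<Rightarrow> nat \<Rightarrow> nat \<Rightarrow> (nat \<Rightarrow> nat) \<Rightarrow> ('k, 'v) module \<Rightarrow>
    ('k, 'v) tens \<Rightarrow> ('k, 'v) stens" where
  "S_proj k n d \<mu> V = tensor_lift k {1..d} (\<lambda>_. V) (S_ob k n \<mu> V)
     (\<lambda>v. pure_tensor k {1..n} (\<lambda>l. sym_pow k (\<mu> l) V)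
        (\<lambda>l\<in>{1..n}. sym_prod k (\<mu> l) V (\<lambda>j\<in>{1..\<mu> l}. v ((\<Sum>i=1..<l. \<mu> i) + j))))"

text \<open>An equivariant map \<open>f : V\<^sup>\<otimes>\<^sup>d \<rightarrow> W\<^sup>\<otimes>\<^sup>d\<close> preserves the relations defining \<open>S\<^sup>\<mu>\<close> as a quotient of
  the \<open>d\<close>-th tensor power, and \<open>S\<^sup>\<mu>(f)\<close> is the map it induces on these quotients.\<close>

definition S_fun :: "'k ring \<Rightarrow> nat \<Rightarrow> nat \<Rightarrow> (nat \<Rightarrow> nat) \<Rightarrow> ('k, 'v, ('k, 'v) stens) spf" where
  "S_fun k n d \<mu> = \<lparr>fob = S_ob k n \<mu>,
     fmor = (\<lambda>V W f. THE h. h \<in> linmaps k (S_ob k n \<mu> V) (S_ob k n \<mu> W) \<and>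
       (\<forall>x\<in>carrier (tpow k d V). h (S_proj k n d \<mu> V x) = S_proj k n d \<mu> W (f x)))\<rparr>"

definition M_mod :: "'k ring \<Rightarrow> nat \<Rightarrow> nat \<Rightarrow> (nat \<Rightarrow> nat) \<Rightarrow>
    (perm \<Rightarrow> 'k, ('k, nat \<Rightarrow> 'k) tens) module" where
  "M_mod k n d \<mu> = (let E = free_mod k {1..n}; T = tpow k d E in
     mk_module
       (mspan k T {tpure k d E (\<lambda>j\<in>{1..d}. basis_vec k (i j)) | i.
          i \<in> {1..d} \<rightarrow> {1..n} \<and> (\<forall>l\<in>{1..n}. card {j \<in> {1..d}. i j = l} = \<mu> l)})
       \<zero>\<^bsub>T\<^esub> (add T) (kS_lact k d E))"

definition add_S :: "'k ring \<Rightarrow> nat \<Rightarrow> nat \<Rightarrow>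
    (('k, 'v, 'w) spf, ('k, 'v, 'w, 'w) spf_hom) cat" where
  "add_S k n d = full_subcat (Rep k d) {F \<in> Ob (Rep k d).
     \<exists>m \<mu>. (\<forall>j<m. \<mu> j \<in> compositions n d) \<and>
       spf_summand k d F (spf_dsum {..<m::nat} (\<lambda>j. S_fun k n d (\<mu> j)))}"

definition add_M :: "'k ring \<Rightarrow> nat \<Rightarrow> nat \<Rightarrow>
    ((perm \<Rightarrow> 'k, 'a) module, 'a \<Rightarrow> 'a) cat" where
  "add_M k n d = full_subcat (LMod (kS k d)) {N \<in> Ob (LMod (kS k d)).
     \<exists>m \<mu>. (\<forall>j<m. \<mu> j \<in> compositions n d) \<and>
       summand (kS k d) N (dsum {..<m::nat} (\<lambda>j. M_mod k n d (\<mu> j)))}"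

end

theory Submission
  imports Defs
begin

text \<open>Put \<open>E = k\<^sup>d\<close>. The regular module \<open>k\<SS>\<^sub>d\<close> is a retract of \<open>E\<^sup>\<otimes>\<^sup>d\<close> as a right module: it is spanned by the translates
  of \<open>e\<^sub>1 \<otimes> \<dots> \<otimes> e\<^sub>d\<close>. By a Yoneda argument a natural transformation from \<open>\<Gamma>\<^sup>\<omega>\<close> is determined by its value at that
  vector, which makes the unit \<open>N \<rightarrow> F(G\<^sub>\<otimes>(N))\<close> invertible for every \<open>k\<SS>\<^sub>d\<close>-module \<open>N\<close>. By the triangle identity the
  counit is then invertible on functors of the form \<open>G\<^sub>\<otimes>(P)\<close>, and by naturality on their retracts. Finally
  \<open>G\<^sub>\<otimes>(M\<^sup>\<mu>) \<cong> S\<^sup>\<mu>\<close>, since both send \<open>V\<close> to the coinvariants of \<open>V\<^sup>\<otimes>\<^sup>d\<close> under the Young subgroup of \<open>\<mu>\<close>; so the two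
  functors exchange retracts of sums of the \<open>M\<^sup>\<mu>\<close> with retracts of sums of the \<open>S\<^sup>\<mu>\<close>.\<close>

section \<open>Linear algebra\<close>

text \<open>Objects of \<open>GammaP\<close> have their carriers in the fixed type
  \<open>'v\<close>, so the free module of rank \<open>d\<close> is an object only if a copy of it
  fits there; the injection of lists over \<open>k\<close> into \<open>'v\<close> in the theorem
  provides that copy. The rank is \<open>d\<close> whatever \<open>n\<close> is: \<open>n\<close>
  only decides which modules \<open>M_mod\<close> and functors \<open>S_fun\<close> occur. Composing
  the two functors changes the carrier type of the values. A direct summand is therefore handled as
  a retract, a pair of maps \<open>i\<close>, \<open>p\<close> with \<open>p i\<close> the identity,
  which every functor carries along regardless of types. The comparison with symmetric powers rests
  on \<open>M_mod\<close> being the permutation module of words with prescribed letter counts. These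
  words form one orbit, and the weakly increasing word has the Young subgroup as stabilizer, so
  every tensor can be rewritten with that word on the right. The laborious point is that
  \<open>S_ob\<close> is defined as a tensor product of quotients and must be recognized as the
  quotient of the whole tensor power by the Young subgroup at once.\<close>

lemma mk_module_simps [simp]:
  "carrier (mk_module S z pl sm) = S" "zero (mk_module S z pl sm) = z"
  "add (mk_module S z pl sm) = pl" "smult (mk_module S z pl sm) = sm"
  by (simp_all add: mk_module_def)

text \<open>Additive inverses need not be supplied: the scalar -1 produces them, provided that the
  scalar 0 acts as zero, which is therefore on the list.\<close>

lemma left_moduleI:
  assumes "ring A"
    and "\<And>x y. \<lbrakk>x \<in> carrier M; y \<in> carrier M\<rbrakk> \<Longrightarrow> x \<oplus>\<^bsub>M\<^esub> y \<in> carrier M"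
    and "\<zero>\<^bsub>M\<^esub> \<in> carrier M"
    and "\<And>x y z. \<lbrakk>x \<in> carrier M; y \<in> carrier M; z \<in> carrier M\<rbrakk> \<Longrightarrow>
      (x \<oplus>\<^bsub>M\<^esub> y) \<oplus>\<^bsub>M\<^esub> z = x \<oplus>\<^bsub>M\<^esub> (y \<oplus>\<^bsub>M\<^esub> z)"
    and "\<And>x y. \<lbrakk>x \<in> carrier M; y \<in> carrier M\<rbrakk> \<Longrightarrow> x \<oplus>\<^bsub>M\<^esub> y = y \<oplus>\<^bsub>M\<^esub> x"
    and "\<And>x. x \<in> carrier M \<Longrightarrow> \<zero>\<^bsub>M\<^esub> \<oplus>\<^bsub>M\<^esub> x = x"
    and zs: "\<And>x. x \<in> carrier M \<Longrightarrow> \<zero>\<^bsub>A\<^esub> \<odot>\<^bsub>M\<^esub> x = \<zero>\<^bsub>M\<^esub>"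
    and cl: "\<And>a x. \<lbrakk>a \<in> carrier A; x \<in> carrier M\<rbrakk> \<Longrightarrow> a \<odot>\<^bsub>M\<^esub> x \<in> carrier M"
    and ld: "\<And>a b x. \<lbrakk>a \<in> carrier A; b \<in> carrier A; x \<in> carrier M\<rbrakk> \<Longrightarrow>
      (a \<oplus>\<^bsub>A\<^esub> b) \<odot>\<^bsub>M\<^esub> x = a \<odot>\<^bsub>M\<^esub> x \<oplus>\<^bsub>M\<^esub> b \<odot>\<^bsub>M\<^esub> x"
    and "\<And>a x y. \<lbrakk>a \<in> carrier A; x \<in> carrier M; y \<in> carrier M\<rbrakk> \<Longrightarrow>
      a \<odot>\<^bsub>M\<^esub> (x \<oplus>\<^bsub>M\<^esub> y) = a \<odot>\<^bsub>M\<^esub> x \<oplus>\<^bsub>M\<^esub> a \<odot>\<^bsub>M\<^esub> y"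
    and "\<And>a b x. \<lbrakk>a \<in> carrier A; b \<in> carrier A; x \<in> carrier M\<rbrakk> \<Longrightarrow>
      (a \<otimes>\<^bsub>A\<^esub> b) \<odot>\<^bsub>M\<^esub> x = a \<odot>\<^bsub>M\<^esub> (b \<odot>\<^bsub>M\<^esub> x)"
    and one: "\<And>x. x \<in> carrier M \<Longrightarrow> \<one>\<^bsub>A\<^esub> \<odot>\<^bsub>M\<^esub> x = x"
  shows "left_module A M"
proof -
  interpret ring A by fact
  have "abelian_group M"
  proof (rule abelian_groupI)
    fix x assume x: "x \<in> carrier M"
    have "(\<ominus>\<^bsub>A\<^esub> \<one>\<^bsub>A\<^esub>) \<odot>\<^bsub>M\<^esub> x \<oplus>\<^bsub>M\<^esub> x = (\<ominus>\<^bsub>A\<^esub> \<one>\<^bsub>A\<^esub> \<oplus>\<^bsub>A\<^esub> \<one>\<^bsub>A\<^esub>) \<odot>\<^bsub>M\<^esub> x"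
      using ld[of "\<ominus>\<^bsub>A\<^esub> \<one>\<^bsub>A\<^esub>" "\<one>\<^bsub>A\<^esub>" x] x one by simp
    then show "\<exists>y\<in>carrier M. y \<oplus>\<^bsub>M\<^esub> x = \<zero>\<^bsub>M\<^esub>"
      using x zs cl[of "\<ominus>\<^bsub>A\<^esub> \<one>\<^bsub>A\<^esub>" x] by (auto simp: l_neg)
  qed (use assms in auto)
  then show ?thesis
    using assms by (auto simp: left_module_def left_module_axioms_def)
qed

context left_module
begin

declare smult_closed [simp, intro]

lemma smult_l_null [simp]: "x \<in> carrier M \<Longrightarrow> \<zero>\<^bsub>A\<^esub> \<odot>\<^bsub>M\<^esub> x = \<zero>\<^bsub>M\<^esub>"
  using smult_l_distr[of "\<zero>\<^bsub>A\<^esub>" "\<zero>\<^bsub>A\<^esub>" x] smult_closed[of "\<zero>\<^bsub>A\<^esub>" x]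
  by simp

lemma smult_r_null [simp]: "a \<in> carrier A \<Longrightarrow> a \<odot>\<^bsub>M\<^esub> \<zero>\<^bsub>M\<^esub> = \<zero>\<^bsub>M\<^esub>"
  using smult_r_distr[of a "\<zero>\<^bsub>M\<^esub>" "\<zero>\<^bsub>M\<^esub>"] smult_closed[of a "\<zero>\<^bsub>M\<^esub>"]
  by simp

lemma neg_eq_smult:
  assumes "x \<in> carrier M" shows "\<ominus>\<^bsub>M\<^esub> x = (\<ominus>\<^bsub>A\<^esub> \<one>\<^bsub>A\<^esub>) \<odot>\<^bsub>M\<^esub> x"
proof -
  have "(\<ominus>\<^bsub>A\<^esub> \<one>\<^bsub>A\<^esub>) \<odot>\<^bsub>M\<^esub> x \<oplus>\<^bsub>M\<^esub> x = (\<ominus>\<^bsub>A\<^esub> \<one>\<^bsub>A\<^esub> \<oplus>\<^bsub>A\<^esub> \<one>\<^bsub>A\<^esub>) \<odot>\<^bsub>M\<^esub> x"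
    using smult_l_distr[of "\<ominus>\<^bsub>A\<^esub> \<one>\<^bsub>A\<^esub>" "\<one>\<^bsub>A\<^esub>" x] assms smult_one by simp
  then have "(\<ominus>\<^bsub>A\<^esub> \<one>\<^bsub>A\<^esub>) \<odot>\<^bsub>M\<^esub> x \<oplus>\<^bsub>M\<^esub> x = \<zero>\<^bsub>M\<^esub>"
    using assms by (simp add: R.l_neg)
  then show ?thesis using assms smult_closed[of "\<ominus>\<^bsub>A\<^esub> \<one>\<^bsub>A\<^esub>" x] by (simp add: M.minus_equality)
qed

lemma smult_finsum:
  assumes a: "a \<in> carrier A" and "\<And>i. i \<in> I \<Longrightarrow> f i \<in> carrier M"
  shows "a \<odot>\<^bsub>M\<^esub> (\<Oplus>\<^bsub>M\<^esub>i\<in>I. f i) = (\<Oplus>\<^bsub>M\<^esub>i\<in>I. a \<odot>\<^bsub>M\<^esub> f i)"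
proof (cases "finite I")
  case True then show ?thesis using assms(2)
    by (induct I) (use a in \<open>simp_all add: Pi_def smult_r_distr smult_closed\<close>)
next
  case False then show ?thesis using a by (simp add: M.finsum_infinite)
qed

lemma finsum_smult:
  assumes x: "x \<in> carrier M" and "\<And>i. i \<in> I \<Longrightarrow> f i \<in> carrier A"
  shows "(\<Oplus>\<^bsub>A\<^esub>i\<in>I. f i) \<odot>\<^bsub>M\<^esub> x = (\<Oplus>\<^bsub>M\<^esub>i\<in>I. f i \<odot>\<^bsub>M\<^esub> x)"
proof (cases "finite I")
  case True then show ?thesis using assms(2)
    by (induct I) (use x in \<open>simp_all add: Pi_def smult_l_distr smult_closed\<close>)
next
  case False then show ?thesis using x by (simp add: M.finsum_infinite R.finsum_infinite)
qed

end

lemma (in abelian_monoid) finsum_swap: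
  assumes "finite I" "finite J" "\<And>i j. i \<in> I \<Longrightarrow> j \<in> J \<Longrightarrow> f i j \<in> carrier G"
  shows "(\<Oplus>i\<in>I. \<Oplus>j\<in>J. f i j) = (\<Oplus>j\<in>J. \<Oplus>i\<in>I. f i j)"
  using assms(1,3)
proof (induct I)
  case empty then show ?case by (simp add: finsum_zero)
next
  case (insert i I)
  then have "(\<Oplus>j\<in>J. \<Oplus>i\<in>insert i I. f i j) = (\<Oplus>j\<in>J. f i j \<oplus> (\<Oplus>i\<in>I. f i j))"
    by (intro finsum_cong') (auto simp: Pi_def intro!: finsum_closed finsum_insert)
  also have "\<dots> = (\<Oplus>j\<in>J. f i j) \<oplus> (\<Oplus>j\<in>J. \<Oplus>i\<in>I. f i j)"
    using insert by (intro finsum_addf) (auto simp: Pi_def intro!: finsum_closed)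
  finally show ?case using insert assms(2)
    by (subst finsum_insert) (auto simp: Pi_def intro!: finsum_closed)
qed

lemma (in abelian_monoid) finsum_single:
  assumes "finite I" "i \<in> I" "\<And>j. j \<in> I \<Longrightarrow> f j \<in> carrier G" "\<And>j. j \<in> I \<Longrightarrow> j \<noteq> i \<Longrightarrow> f j = \<zero>"
  shows "(\<Oplus>j\<in>I. f j) = f i"
proof -
  have "(\<Oplus>j\<in>I. f j) = (\<Oplus>j\<in>I. if i = j then f j else \<zero>)"
    using assms by (intro finsum_cong') auto
  also have "\<dots> = f i"
    using assms by (intro finsum_singleton) auto
  finally show ?thesis .
qed

lemma (in abelian_monoid) finsum_reindex_bij:
  assumes "bij_betw h I J" "\<And>j. j \<in> J \<Longrightarrow> f j \<in> carrier G"
  shows "(\<Oplus>j\<in>J. f j) = (\<Oplus>i\<in>I. f (h i))"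
  using finsum_reindex[of f h I] assms by (auto simp: bij_betw_def Pi_def)

subsection \<open>Linear maps\<close>

text \<open>Unlike the elements of \<open>linmaps\<close>, the functions below need not be extensional.\<close>

definition lin :: "'r ring \<Rightarrow> ('r, 'a) module \<Rightarrow> ('r, 'b) module \<Rightarrow> ('a \<Rightarrow> 'b) \<Rightarrow> bool" where
  "lin A M N f \<longleftrightarrow> (\<forall>x\<in>carrier M. f x \<in> carrier N) \<and>
     (\<forall>x\<in>carrier M. \<forall>y\<in>carrier M. f (x \<oplus>\<^bsub>M\<^esub> y) = f x \<oplus>\<^bsub>N\<^esub> f y) \<and>
     (\<forall>a\<in>carrier A. \<forall>x\<in>carrier M. f (a \<odot>\<^bsub>M\<^esub> x) = a \<odot>\<^bsub>N\<^esub> f x)"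

lemma linI:
  assumes "\<And>x. x \<in> carrier M \<Longrightarrow> f x \<in> carrier N"
    and "\<And>x y. \<lbrakk>x \<in> carrier M; y \<in> carrier M\<rbrakk> \<Longrightarrow> f (x \<oplus>\<^bsub>M\<^esub> y) = f x \<oplus>\<^bsub>N\<^esub> f y"
    and "\<And>a x. \<lbrakk>a \<in> carrier A; x \<in> carrier M\<rbrakk> \<Longrightarrow> f (a \<odot>\<^bsub>M\<^esub> x) = a \<odot>\<^bsub>N\<^esub> f x"
  shows "lin A M N f"
  using assms by (simp add: lin_def)

lemma lin_closed: "\<lbrakk>lin A M N f; x \<in> carrier M\<rbrakk> \<Longrightarrow> f x \<in> carrier N"
  and lin_add: "\<lbrakk>lin A M N f; x \<in> carrier M; y \<in> carrier M\<rbrakk> \<Longrightarrow> f (x \<oplus>\<^bsub>M\<^esub> y) = f x \<oplus>\<^bsub>N\<^esub> f y"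
  and lin_smult: "\<lbrakk>lin A M N f; a \<in> carrier A; x \<in> carrier M\<rbrakk> \<Longrightarrow> f (a \<odot>\<^bsub>M\<^esub> x) = a \<odot>\<^bsub>N\<^esub> f x"
  by (simp_all add: lin_def)

lemma linmaps_iff: "f \<in> linmaps A M N \<longleftrightarrow> lin A M N f \<and> f \<in> extensional (carrier M)"
  by (auto simp: linmaps_def lin_def PiE_iff)

lemma lin_linmaps: "f \<in> linmaps A M N \<Longrightarrow> lin A M N f"
  by (simp add: linmaps_iff)

lemmas linmaps_closed = lin_closed[OF lin_linmaps]
lemma lin_cong:
  assumes "left_module A M" "\<And>x. x \<in> carrier M \<Longrightarrow> f x = g x"
  shows "lin A M N f \<longleftrightarrow> lin A M N g"
proof -
  interpret left_module A M by fact
  show ?thesis using assms(2) by (simp add: lin_def)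
qed

text \<open>The passage from formulas to morphisms: hom-sets contain only extensional functions,
  while linearity looks only at values on the carrier.\<close>

lemma restrict_linmaps_iff:
  assumes "left_module A M"
  shows "restrict f (carrier M) \<in> linmaps A M N \<longleftrightarrow> lin A M N f"
  using lin_cong[OF assms, of "restrict f (carrier M)" f N] by (simp add: linmaps_iff)

lemma linmaps_eqI:
  "\<lbrakk>f \<in> linmaps A M N; g \<in> linmaps A M N'; \<And>x. x \<in> carrier M \<Longrightarrow> f x = g x\<rbrakk> \<Longrightarrow> f = g"
  by (auto simp: linmaps_iff intro: extensionalityI)

lemma lin_zero:
  assumes "left_module A M" "left_module A N" "lin A M N f"
  shows "f \<zero>\<^bsub>M\<^esub> = \<zero>\<^bsub>N\<^esub>"
proof -
  interpret M: left_module A M by fact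
  interpret N: left_module A N by fact
  have "f (\<zero>\<^bsub>A\<^esub> \<odot>\<^bsub>M\<^esub> \<zero>\<^bsub>M\<^esub>) = \<zero>\<^bsub>A\<^esub> \<odot>\<^bsub>N\<^esub> f \<zero>\<^bsub>M\<^esub>"
    using assms(3) by (intro lin_smult) auto
  then show ?thesis using lin_closed[OF assms(3), of "\<zero>\<^bsub>M\<^esub>"] by simp
qed

lemma lin_neg:
  assumes "left_module A M" "left_module A N" "lin A M N f" "x \<in> carrier M"
  shows "f (\<ominus>\<^bsub>M\<^esub> x) = \<ominus>\<^bsub>N\<^esub> f x"
proof -
  interpret M: left_module A M by fact
  interpret N: left_module A N by fact
  show ?thesis using assms(4) lin_closed[OF assms(3)] lin_smult[OF assms(3)]
    by (simp add: M.neg_eq_smult N.neg_eq_smult)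
qed

lemma lin_finsum:
  assumes "left_module A M" "left_module A N" "lin A M N f" "\<And>i. i \<in> I \<Longrightarrow> x i \<in> carrier M"
  shows "f (\<Oplus>\<^bsub>M\<^esub>i\<in>I. x i) = (\<Oplus>\<^bsub>N\<^esub>i\<in>I. f (x i))"
proof -
  interpret M: left_module A M by fact
  interpret N: left_module A N by fact
  show ?thesis
  proof (cases "finite I")
    case True then show ?thesis using assms(4)
    proof (induct I)
      case (insert i I)
      then have "f (\<Oplus>\<^bsub>M\<^esub>i\<in>insert i I. x i) = f (x i \<oplus>\<^bsub>M\<^esub> (\<Oplus>\<^bsub>M\<^esub>i\<in>I. x i))"
        by (auto simp: Pi_def intro!: arg_cong[where f=f] M.finsum_insert)
      also have "\<dots> = f (x i) \<oplus>\<^bsub>N\<^esub> f (\<Oplus>\<^bsub>M\<^esub>i\<in>I. x i)"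
        using insert assms(3) by (intro lin_add) (auto intro!: M.finsum_closed)
      also have "\<dots> = (\<Oplus>\<^bsub>N\<^esub>i\<in>insert i I. f (x i))"
        using insert lin_closed[OF assms(3)] by (subst N.finsum_insert) (auto simp: Pi_def)
      finally show ?case .
    qed (use lin_zero[OF assms(1-3)] in simp)
  next
    case False then show ?thesis using lin_zero[OF assms(1-3)]
      by (simp add: M.finsum_infinite N.finsum_infinite)
  qed
qed

lemma lin_compose: "\<lbrakk>lin A M N f; lin A N P g\<rbrakk> \<Longrightarrow> lin A M P (\<lambda>x. g (f x))"
  by (simp add: lin_def)

lemma lin_id: "lin A M M (\<lambda>x. x)"
  by (simp add: lin_def)

lemma lin_const_zero:
  assumes "left_module A N" shows "lin A M N (\<lambda>x. \<zero>\<^bsub>N\<^esub>)"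
proof -
  interpret N: left_module A N by fact
  show ?thesis by (simp add: lin_def)
qed

lemma lin_plus:
  assumes "left_module A N" "lin A M N f" "lin A M N g"
  shows "lin A M N (\<lambda>x. f x \<oplus>\<^bsub>N\<^esub> g x)"
proof -
  interpret N: left_module A N by fact
  show ?thesis using lin_closed[OF assms(2)] lin_closed[OF assms(3)]
    by (intro linI) (auto simp: lin_add[OF assms(2)] lin_add[OF assms(3)] lin_smult[OF assms(2)]
      lin_smult[OF assms(3)] N.a_ac N.smult_r_distr)
qed

lemma lin_scale:
  assumes "cring A" "left_module A N" "lin A M N f" "c \<in> carrier A"
  shows "lin A M N (\<lambda>x. c \<odot>\<^bsub>N\<^esub> f x)"
proof -
  interpret cring A by fact
  interpret N: left_module A N by fact
  show ?thesis using lin_closed[OF assms(3)] assms(4)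
    by (intro linI) (auto simp: lin_add[OF assms(3)] lin_smult[OF assms(3)] N.smult_r_distr
       N.smult_assoc[symmetric] m_comm)
qed

lemma lin_sum:
  assumes "left_module A N" "\<And>i. i \<in> I \<Longrightarrow> lin A M N (f i)"
  shows "lin A M N (\<lambda>x. \<Oplus>\<^bsub>N\<^esub>i\<in>I. f i x)"
proof -
  interpret N: left_module A N by fact
  note c = lin_closed[OF assms(2)]
  show ?thesis
  proof (rule linI)
    fix x y assume xy: "x \<in> carrier M" "y \<in> carrier M"
    have "(\<Oplus>\<^bsub>N\<^esub>i\<in>I. f i (x \<oplus>\<^bsub>M\<^esub> y)) = (\<Oplus>\<^bsub>N\<^esub>i\<in>I. f i x \<oplus>\<^bsub>N\<^esub> f i y)"
      using xy c by (intro N.finsum_cong') (auto simp: lin_add[OF assms(2)])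
    also have "\<dots> = (\<Oplus>\<^bsub>N\<^esub>i\<in>I. f i x) \<oplus>\<^bsub>N\<^esub> (\<Oplus>\<^bsub>N\<^esub>i\<in>I. f i y)"
      using xy c by (intro N.finsum_addf) auto
    finally show "(\<Oplus>\<^bsub>N\<^esub>i\<in>I. f i (x \<oplus>\<^bsub>M\<^esub> y)) = \<dots>" .
  next
    fix a x assume ax: "a \<in> carrier A" "x \<in> carrier M"
    have "(\<Oplus>\<^bsub>N\<^esub>i\<in>I. f i (a \<odot>\<^bsub>M\<^esub> x)) = (\<Oplus>\<^bsub>N\<^esub>i\<in>I. a \<odot>\<^bsub>N\<^esub> f i x)"
      using ax c by (intro N.finsum_cong') (auto simp: lin_smult[OF assms(2)])
    also have "\<dots> = a \<odot>\<^bsub>N\<^esub> (\<Oplus>\<^bsub>N\<^esub>i\<in>I. f i x)"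
      using ax c by (intro N.smult_finsum[symmetric]) auto
    finally show "(\<Oplus>\<^bsub>N\<^esub>i\<in>I. f i (a \<odot>\<^bsub>M\<^esub> x)) = \<dots>" .
  qed (use c in \<open>auto intro!: N.finsum_closed\<close>)
qed

subsection \<open>Generators, submodules and quotients\<close>

text \<open>Stated over an arbitrary ring because it serves both \<open>k\<close> and the group
  algebra; closure under negatives comes from the scalar -1.\<close>

definition submod :: "'r ring \<Rightarrow> ('r, 'a) module \<Rightarrow> 'a set \<Rightarrow> bool" where
  "submod A M H \<longleftrightarrow> H \<subseteq> carrier M \<and> \<zero>\<^bsub>M\<^esub> \<in> H \<and> (\<forall>x\<in>H. \<forall>y\<in>H. x \<oplus>\<^bsub>M\<^esub> y \<in> H) \<and>
     (\<forall>a\<in>carrier A. \<forall>x\<in>H. a \<odot>\<^bsub>M\<^esub> x \<in> H)"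

text \<open>Generation in the form of an induction principle over submodules, which avoids writing
  elements as linear combinations.\<close>

definition spans :: "'r ring \<Rightarrow> ('r, 'a) module \<Rightarrow> 'a set \<Rightarrow> bool" where
  "spans A M S \<longleftrightarrow> S \<subseteq> carrier M \<and> (\<forall>H. submod A M H \<longrightarrow> S \<subseteq> H \<longrightarrow> H = carrier M)"

lemma spans_submod: "\<lbrakk>spans A M S; submod A M H; S \<subseteq> H; x \<in> carrier M\<rbrakk> \<Longrightarrow> x \<in> H"
  by (auto simp: spans_def)

lemma submod_equalizer:
  assumes "left_module A M" "left_module A N" "lin A M N f" "lin A M N g"
  shows "submod A M {x \<in> carrier M. f x = g x}"
proof -
  interpret M: left_module A M by fact
  interpret N: left_module A N by fact
  show ?thesis
    by (auto simp: submod_def lin_add[OF assms(3)] lin_add[OF assms(4)] lin_smult[OF assms(3)]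
      lin_smult[OF assms(4)] lin_zero[OF assms(1-3)] lin_zero[OF assms(1,2,4)])
qed

text \<open>The equalizer of two linear maps is a submodule. All comparisons of maps on tensor
  products, quotients and symmetric powers below come down to this.\<close>

lemma lin_eq_on_spans:
  assumes "left_module A M" "left_module A N" "lin A M N f" "lin A M N g" "spans A M S"
    and "\<And>s. s \<in> S \<Longrightarrow> f s = g s" "x \<in> carrier M"
  shows "f x = g x"
  using spans_submod[OF assms(5) submod_equalizer[OF assms(1-4)] _ assms(7)] assms(5,6)
  by (auto simp: spans_def)

lemma submod_image:
  assumes "left_module A M" "left_module A N" "lin A M N f"
  shows "submod A N (f ` carrier M)"
proof -
  interpret M: left_module A M by fact
  show ?thesis
    unfolding submod_def
  proof (intro conjI ballI)
    show "\<zero>\<^bsub>N\<^esub> \<in> f ` carrier M" using lin_zero[OF assms] by (metis M.zero_closed imageI)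
  qed (use lin_closed[OF assms(3)] in \<open>auto simp: lin_add[OF assms(3), symmetric] lin_smult[OF assms(3), symmetric]\<close>)
qed

lemma submod_vimage:
  assumes "left_module A M" "left_module A N" "lin A M N f" "submod A N H"
  shows "submod A M {x \<in> carrier M. f x \<in> H}"
proof -
  interpret M: left_module A M by fact
  show ?thesis
    using assms(4) by (auto simp: submod_def lin_add[OF assms(3)] lin_smult[OF assms(3)] lin_zero[OF assms(1-3)])
qed

lemma submod_kernel:
  assumes "left_module A M" "left_module A N" "lin A M N f"
  shows "submod A M {x \<in> carrier M. f x = \<zero>\<^bsub>N\<^esub>}"
  by (rule submod_equalizer[OF assms lin_const_zero[OF assms(2)]])

lemma (in left_module) submod_finsum:
  assumes "submod A M H" "\<And>i. i \<in> I \<Longrightarrow> f i \<in> H"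
  shows "(\<Oplus>\<^bsub>M\<^esub>i\<in>I. f i) \<in> H"
proof (cases "finite I")
  case True then show ?thesis using assms(2)
  proof (induct I)
    case (insert i I)
    then show ?case using assms(1)
      by (subst M.finsum_insert) (auto simp: submod_def)
  qed (use assms(1) in \<open>auto simp: submod_def\<close>)
next
  case False then show ?thesis using assms(1) by (auto simp: M.finsum_infinite submod_def)
qed

lemma left_module_submod:
  assumes "left_module A M" "submod A M H" "carrier N = H" "\<zero>\<^bsub>N\<^esub> = \<zero>\<^bsub>M\<^esub>" "add N = add M" "smult N = smult M"
  shows "left_module A N"
proof -
  interpret M: left_module A M by fact
  have H: "\<And>x. x \<in> H \<Longrightarrow> x \<in> carrier M" using assms(2) by (auto simp: submod_def)
  show ?thesis
    by (rule left_moduleI)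
      (use H assms in \<open>auto simp: submod_def M.R.ring_axioms M.a_ac M.smult_l_distr M.smult_r_distr M.smult_assoc M.smult_one\<close>)
qed

lemma submodule_iff_submod:
  assumes "cring k" "left_module k M"
  shows "submodule H k M \<longleftrightarrow> submod k M H"
proof -
  interpret L: left_module k M by fact
  interpret module k M using assms left_module_iff_module by blast
  show ?thesis
  proof
    assume H: "submodule H k M"
    then show "submod k M H"
      using submoduleE[OF H] subgroup.one_closed[OF submodule.axioms(1)[OF H]] by (auto simp: submod_def)
  next
    assume H: "submod k M H"
    then show "submodule H k M"
      by (intro submoduleI) (auto simp: submod_def L.neg_eq_smult subset_iff)
  qed
qed

lemma mspan_submod:
  assumes "cring k" "left_module k M" "S \<subseteq> carrier M"
  shows "submod k M (mspan k M S)"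
proof -
  interpret M: left_module k M by fact
  have "submod k M (carrier M)" by (auto simp: submod_def)
  then have "mspan k M S \<subseteq> carrier M"
    using assms by (auto simp: mspan_def submodule_iff_submod)
  then show ?thesis
    by (auto simp: submod_def mspan_def submodule_iff_submod[OF assms(1,2)])
qed

lemma mspan_superset: "S \<subseteq> mspan k M S"
  by (auto simp: mspan_def)

lemma mspan_least:
  assumes "cring k" "left_module k M" "submod k M H" "S \<subseteq> H" shows "mspan k M S \<subseteq> H"
  using assms by (auto simp: mspan_def submodule_iff_submod)

lemma mspan_eq_carrier_iff:
  assumes "cring k" "left_module k M" "S \<subseteq> carrier M"
  shows "mspan k M S = carrier M \<longleftrightarrow> spans k M S"
proof
  show "mspan k M S = carrier M" if "spans k M S"
    using that mspan_submod[OF assms] mspan_superset[of S k M] unfolding spans_def by blast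
  show "spans k M S" if "mspan k M S = carrier M"
    unfolding spans_def
  proof (intro conjI allI impI)
    fix H assume "submod k M H" "S \<subseteq> H"
    then show "H = carrier M"
      using mspan_least[OF assms(1,2), of H S] that by (auto simp: submod_def)
  qed (rule assms(3))
qed

lemma spans_image:
  assumes "left_module A M" "left_module A N" "lin A M N f" "f ` carrier M = carrier N" "spans A M S"
  shows "spans A N (f ` S)"
  unfolding spans_def
proof (intro conjI allI impI)
  show "f ` S \<subseteq> carrier N" using assms by (auto simp: spans_def)
  fix H assume H: "submod A N H" "f ` S \<subseteq> H"
  have "{x \<in> carrier M. f x \<in> H} = carrier M"
    using assms(5) submod_vimage[OF assms(1-3) H(1)] H(2) unfolding spans_def by blast
  then have "f ` carrier M \<subseteq> H" by auto
  then show "H = carrier N" using assms(4) H(1) by (auto simp: submod_def)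
qed

text \<open>\<open>N\<close> inherits its operations from \<open>M\<close>, so a submodule of
  \<open>N\<close> is also one of \<open>M\<close>, and minimality of the span in \<open>M\<close>
  applies to it.\<close>

lemma spans_mspan:
  assumes "cring k" "left_module k M" "S \<subseteq> carrier M" "carrier N = mspan k M S"
    "\<zero>\<^bsub>N\<^esub> = \<zero>\<^bsub>M\<^esub>" "add N = add M" "\<And>c x. c \<in> carrier k \<Longrightarrow> x \<in> carrier N \<Longrightarrow> smult N c x = smult M c x"
  shows "spans k N S"
  unfolding spans_def
proof (intro conjI allI impI)
  show "S \<subseteq> carrier N" unfolding assms(4) by (rule mspan_superset)
  fix H assume H: "submod k N H" "S \<subseteq> H"
  have "submod k M H" using H(1) mspan_submod[OF assms(1-3)] assms(4-)
    by (auto simp: submod_def subset_iff)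
  then show "H = carrier N"
    using mspan_least[OF assms(1,2)] H assms(4) by (auto simp: submod_def)
qed

lemma submod_additive_subgroup:
  assumes "left_module A M" "submod A M H" shows "abelian_subgroup H M"
proof -
  interpret M: left_module A M by fact
  have "additive_subgroup H M"
    using assms(2) M.add.inv_closed
    by (intro additive_subgroupI subgroup.intro)
      (auto simp: submod_def subset_iff a_inv_def[symmetric] M.neg_eq_smult)
  then show ?thesis by (rule abelian_subgroupI3) (rule M.abelian_group_axioms)
qed

context
  fixes k :: "'k ring" and M :: "('k, 'a) module" and H
  assumes k: "cring k" and M: "left_module k M" and H: "submod k M H"
begin

interpretation M: left_module k M by (rule M)
interpretation H: abelian_subgroup H M by (rule submod_additive_subgroup[OF M H])

lemma mquot_carrier: "carrier (mquot M H) = (\<lambda>x. H +>\<^bsub>M\<^esub> x) ` carrier M"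
  by (auto simp: mquot_def A_RCOSETS_def')

lemma mquot_zero: "\<zero>\<^bsub>mquot M H\<^esub> = H +>\<^bsub>M\<^esub> \<zero>\<^bsub>M\<^esub>"
  using H by (simp add: mquot_def M.a_coset_add_zero submod_def)

lemma mquot_add:
  "\<lbrakk>x \<in> carrier M; y \<in> carrier M\<rbrakk> \<Longrightarrow>
    (H +>\<^bsub>M\<^esub> x) \<oplus>\<^bsub>mquot M H\<^esub> (H +>\<^bsub>M\<^esub> y) = H +>\<^bsub>M\<^esub> (x \<oplus>\<^bsub>M\<^esub> y)"
  by (simp add: mquot_def H.a_rcos_sum)

lemma mquot_coset_eq:
  assumes "x \<in> carrier M" "h \<in> H" shows "H +>\<^bsub>M\<^esub> (h \<oplus>\<^bsub>M\<^esub> x) = H +>\<^bsub>M\<^esub> x"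
  using M.a_repr_independence[OF _ assms(1) H.a_subgroup, of "h \<oplus>\<^bsub>M\<^esub> x"] assms
    M.a_rcosI[OF assms(2) H.a_subset assms(1)] by simp

text \<open>The scalar action on \<open>mquot\<close> is defined as a union over all
  representatives. All of them give the same coset and there is at least one, so the union is that
  coset.\<close>

lemma mquot_smult:
  assumes "c \<in> carrier k" "x \<in> carrier M"
  shows "c \<odot>\<^bsub>mquot M H\<^esub> (H +>\<^bsub>M\<^esub> x) = H +>\<^bsub>M\<^esub> (c \<odot>\<^bsub>M\<^esub> x)"
proof -
  have "H +>\<^bsub>M\<^esub> (c \<odot>\<^bsub>M\<^esub> y) = H +>\<^bsub>M\<^esub> (c \<odot>\<^bsub>M\<^esub> x)" if y: "y \<in> H +>\<^bsub>M\<^esub> x" for y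
  proof -
    obtain h where "h \<in> H" "y = h \<oplus>\<^bsub>M\<^esub> x" using y by (auto simp: a_r_coset_def')
    then show ?thesis using H assms
      by (simp add: M.smult_r_distr submod_def subset_iff mquot_coset_eq)
  qed
  moreover have "x \<in> H +>\<^bsub>M\<^esub> x"
    using M.a_rcosI[OF H.zero_closed H.a_subset assms(2)] assms by simp
  ultimately have "(\<Union>y\<in>H +>\<^bsub>M\<^esub> x. H +>\<^bsub>M\<^esub> (c \<odot>\<^bsub>M\<^esub> y)) = H +>\<^bsub>M\<^esub> (c \<odot>\<^bsub>M\<^esub> x)"
    by (metis (no_types, lifting) SUP_cong UN_constant empty_iff)
  then show ?thesis by (simp add: mquot_def)
qed

lemma mquot_proj_lin: "lin k M (mquot M H) (\<lambda>x. H +>\<^bsub>M\<^esub> x)"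
  by (rule linI) (auto simp: mquot_carrier mquot_add mquot_smult)

lemma mquot_module: "left_module k (mquot M H)"
  by (rule left_moduleI; (rule M.R.ring_axioms)?; unfold mquot_carrier mquot_zero; (elim imageE)?)
    (simp_all add: mquot_add mquot_smult M.a_assoc M.smult_l_distr
      M.smult_r_distr M.smult_assoc M.smult_one M.a_lcomm M.a_comm del: M.a_coset_add_zero)

lemma mquot_coset_eq_iff:
  assumes "x \<in> carrier M" "y \<in> carrier M"
  shows "H +>\<^bsub>M\<^esub> x = H +>\<^bsub>M\<^esub> y \<longleftrightarrow> x \<ominus>\<^bsub>M\<^esub> y \<in> H"
proof
  assume "x \<ominus>\<^bsub>M\<^esub> y \<in> H"
  from mquot_coset_eq[OF assms(2) this] show "H +>\<^bsub>M\<^esub> x = H +>\<^bsub>M\<^esub> y"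
    using assms by (simp add: M.minus_eq M.a_assoc M.l_neg)
next
  assume "H +>\<^bsub>M\<^esub> x = H +>\<^bsub>M\<^esub> y"
  moreover have "x \<in> H +>\<^bsub>M\<^esub> x"
    using M.a_rcosI[OF H.zero_closed H.a_subset assms(1)] assms by simp
  ultimately obtain h where "h \<in> H" "x = h \<oplus>\<^bsub>M\<^esub> y" by (auto simp: a_r_coset_def')
  then show "x \<ominus>\<^bsub>M\<^esub> y \<in> H"
    using assms H.a_subset by (auto simp: M.minus_eq M.a_assoc M.r_neg)
qed

text \<open>The induced map evaluates \<open>f\<close> at a chosen representative; two
  representatives differ by an element of \<open>H\<close>, which \<open>f\<close> kills.\<close>

lemma mquot_lift:
  assumes "left_module k N" "lin k M N f" "\<And>h. h \<in> H \<Longrightarrow> f h = \<zero>\<^bsub>N\<^esub>"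
  obtains g where "lin k (mquot M H) N g" "\<And>x. x \<in> carrier M \<Longrightarrow> g (H +>\<^bsub>M\<^esub> x) = f x"
proof -
  interpret N: left_module k N by fact
  define g where "g = (\<lambda>X. f (SOME x. x \<in> carrier M \<and> H +>\<^bsub>M\<^esub> x = X))"
  have g: "g (H +>\<^bsub>M\<^esub> x) = f x" if x: "x \<in> carrier M" for x
  proof -
    define y where "y = (SOME y. y \<in> carrier M \<and> H +>\<^bsub>M\<^esub> y = H +>\<^bsub>M\<^esub> x)"
    have y: "y \<in> carrier M \<and> H +>\<^bsub>M\<^esub> y = H +>\<^bsub>M\<^esub> x"
      unfolding y_def by (rule someI[of _ x]) (use x in simp)
    then have "y \<ominus>\<^bsub>M\<^esub> x \<in> H" using mquot_coset_eq_iff[of y x] x by blast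
    then have "f (y \<ominus>\<^bsub>M\<^esub> x) = \<zero>\<^bsub>N\<^esub>" by (rule assms(3))
    then have "f y \<oplus>\<^bsub>N\<^esub> \<ominus>\<^bsub>N\<^esub> f x = \<zero>\<^bsub>N\<^esub>"
      using x y by (simp add: M.minus_eq lin_add[OF assms(2)] lin_neg[OF M assms(1,2)])
    then have "f y = f x"
      using x y lin_closed[OF assms(2)] by (metis N.minus_equality N.minus_minus N.a_inv_closed)
    then show ?thesis by (simp add: g_def y_def)
  qed
  have "lin k (mquot M H) N g"
    by (rule linI) (auto simp: mquot_carrier mquot_add mquot_smult g lin_closed[OF assms(2)]
      lin_add[OF assms(2)] lin_smult[OF assms(2)])
  then show ?thesis using g that by blast
qed

end

subsection \<open>Free modules and modules given by generators and relations\<close>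

lemma free_mod_simps [simp]:
  "\<zero>\<^bsub>free_mod k X\<^esub> = (\<lambda>x. \<zero>\<^bsub>k\<^esub>)" "f \<oplus>\<^bsub>free_mod k X\<^esub> g = (\<lambda>x. f x \<oplus>\<^bsub>k\<^esub> g x)"
  "c \<odot>\<^bsub>free_mod k X\<^esub> f = (\<lambda>x. c \<otimes>\<^bsub>k\<^esub> f x)"
  by (simp_all add: free_mod_def)

lemma free_mod_carrier: "f \<in> carrier (free_mod k X) \<longleftrightarrow>
    (\<forall>x\<in>X. f x \<in> carrier k) \<and> (\<forall>x. x \<notin> X \<longrightarrow> f x = \<zero>\<^bsub>k\<^esub>) \<and> finite {x. f x \<noteq> \<zero>\<^bsub>k\<^esub>}"
  by (simp add: free_mod_def)

context
  fixes k :: "'k ring"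
  assumes k: "cring k"
begin

interpretation k: cring k by (rule k)

lemma free_mod_closed: "f \<in> carrier (free_mod k X) \<Longrightarrow> f x \<in> carrier k"
  by (cases "x \<in> X") (auto simp: free_mod_carrier)

lemma free_mod_module: "left_module k (free_mod k X)"
proof (rule left_moduleI)
  fix f g assume fg: "f \<in> carrier (free_mod k X)" "g \<in> carrier (free_mod k X)"
  have "{x. f x \<oplus>\<^bsub>k\<^esub> g x \<noteq> \<zero>\<^bsub>k\<^esub>} \<subseteq> {x. f x \<noteq> \<zero>\<^bsub>k\<^esub>} \<union> {x. g x \<noteq> \<zero>\<^bsub>k\<^esub>}" by auto
  then show "f \<oplus>\<^bsub>free_mod k X\<^esub> g \<in> carrier (free_mod k X)"
    using fg by (auto simp: free_mod_carrier elim: finite_subset)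
next
  fix c f assume f: "c \<in> carrier k" "f \<in> carrier (free_mod k X)"
  have "{x. c \<otimes>\<^bsub>k\<^esub> f x \<noteq> \<zero>\<^bsub>k\<^esub>} \<subseteq> {x. f x \<noteq> \<zero>\<^bsub>k\<^esub>}" using f by auto
  then show "c \<odot>\<^bsub>free_mod k X\<^esub> f \<in> carrier (free_mod k X)"
    using f by (auto simp: free_mod_carrier elim: finite_subset)
qed (auto simp: k.ring_axioms free_mod_closed k.a_ac k.l_distr k.r_distr k.m_ac fun_eq_iff,
  auto simp: free_mod_carrier)

lemma basis_vec_closed [simp]: "x \<in> X \<Longrightarrow> basis_vec k x \<in> carrier (free_mod k X)"
  by (auto simp: free_mod_carrier basis_vec_def)

lemma free_mod_finsum_apply:
  assumes "\<And>i. i \<in> I \<Longrightarrow> f i \<in> carrier (free_mod k X)"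
  shows "(\<Oplus>\<^bsub>free_mod k X\<^esub>i\<in>I. f i) x = (\<Oplus>\<^bsub>k\<^esub>i\<in>I. f i x)"
proof -
  interpret F: left_module k "free_mod k X" by (rule free_mod_module)
  show ?thesis
  proof (cases "finite I")
    case True then show ?thesis using assms
    proof (induct I)
      case (insert i I)
      then show ?case
        by (subst F.finsum_insert) (auto simp: free_mod_closed[of _ X] k.finsum_insert Pi_def)
    qed simp
  next
    case False then show ?thesis by (simp add: F.finsum_infinite k.finsum_infinite)
  qed
qed

lemma free_mod_expand:
  assumes f: "f \<in> carrier (free_mod k X)"
  shows "f = (\<Oplus>\<^bsub>free_mod k X\<^esub>x\<in>{x. f x \<noteq> \<zero>\<^bsub>k\<^esub>}. f x \<odot>\<^bsub>free_mod k X\<^esub> basis_vec k x)"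
proof
  interpret F: left_module k "free_mod k X" by (rule free_mod_module)
  have fin: "finite {x. f x \<noteq> \<zero>\<^bsub>k\<^esub>}" and X: "{x. f x \<noteq> \<zero>\<^bsub>k\<^esub>} \<subseteq> X"
    using f by (auto simp: free_mod_carrier)
  fix y
  have "(\<Oplus>\<^bsub>free_mod k X\<^esub>x\<in>{x. f x \<noteq> \<zero>\<^bsub>k\<^esub>}. f x \<odot>\<^bsub>free_mod k X\<^esub> basis_vec k x) y
      = (\<Oplus>\<^bsub>k\<^esub>x\<in>{x. f x \<noteq> \<zero>\<^bsub>k\<^esub>}. f x \<otimes>\<^bsub>k\<^esub> basis_vec k x y)"
    using X free_mod_closed[OF f]
    by (subst free_mod_finsum_apply) (auto intro!: F.smult_closed[unfolded free_mod_simps])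
  also have "\<dots> = f y"
  proof (cases "f y = \<zero>\<^bsub>k\<^esub>")
    case True
    then have "(\<Oplus>\<^bsub>k\<^esub>x\<in>{x. f x \<noteq> \<zero>\<^bsub>k\<^esub>}. f x \<otimes>\<^bsub>k\<^esub> basis_vec k x y) = (\<Oplus>\<^bsub>k\<^esub>x\<in>{x. f x \<noteq> \<zero>\<^bsub>k\<^esub>}. \<zero>\<^bsub>k\<^esub>)"
      using free_mod_closed[OF f] by (intro k.finsum_cong') (auto simp: basis_vec_def)
    then show ?thesis using True by simp
  next
    case False
    then show ?thesis using fin free_mod_closed[OF f]
      by (subst k.finsum_single[where i=y]) (auto simp: basis_vec_def)
  qed
  finally show "f y = (\<Oplus>\<^bsub>free_mod k X\<^esub>x\<in>{x. f x \<noteq> \<zero>\<^bsub>k\<^esub>}. f x \<odot>\<^bsub>free_mod k X\<^esub> basis_vec k x) y" by simp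
qed

lemma spans_free_mod: "spans k (free_mod k X) (basis_vec k ` X)"
  unfolding spans_def
proof (intro conjI allI impI)
  interpret F: left_module k "free_mod k X" by (rule free_mod_module)
  fix H assume H: "submod k (free_mod k X) H" "basis_vec k ` X \<subseteq> H"
  show "H = carrier (free_mod k X)"
  proof
    show "carrier (free_mod k X) \<subseteq> H"
    proof
      fix f assume f: "f \<in> carrier (free_mod k X)"
      then have "(\<Oplus>\<^bsub>free_mod k X\<^esub>x\<in>{x. f x \<noteq> \<zero>\<^bsub>k\<^esub>}. f x \<odot>\<^bsub>free_mod k X\<^esub> basis_vec k x) \<in> H"
      proof (intro F.submod_finsum[OF H(1)])
        fix x assume "x \<in> {x. f x \<noteq> \<zero>\<^bsub>k\<^esub>}"
        then have "basis_vec k x \<in> H" using f H(2) by (auto simp: free_mod_carrier)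
        then show "f x \<odot>\<^bsub>free_mod k X\<^esub> basis_vec k x \<in> H"
          using H(1) free_mod_closed[OF f] unfolding submod_def by blast
      qed
      then show "f \<in> H" using free_mod_expand[OF f] by simp
    qed
  qed (use H(1) in \<open>auto simp: submod_def\<close>)
qed auto

lemma free_mod_lift:
  assumes N: "left_module k N" and g: "\<And>x. x \<in> X \<Longrightarrow> g x \<in> carrier N"
  obtains h where "lin k (free_mod k X) N h" "\<And>x. x \<in> X \<Longrightarrow> h (basis_vec k x) = g x"
proof -
  interpret N: left_module k N by fact
  interpret F: left_module k "free_mod k X" by (rule free_mod_module)
  define h where "h f = (\<Oplus>\<^bsub>N\<^esub>x\<in>{x. f x \<noteq> \<zero>\<^bsub>k\<^esub>}. f x \<odot>\<^bsub>N\<^esub> g x)" for f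
  \<comment> \<open>The defining sum may be taken over any finite set containing the support.
    Additivity needs this, since \<open>f\<close>, \<open>f'\<close> and their sum have different
    supports.\<close>
  have h: "h f = (\<Oplus>\<^bsub>N\<^esub>x\<in>F. f x \<odot>\<^bsub>N\<^esub> g x)"
    if "f \<in> carrier (free_mod k X)" "finite F" "{x. f x \<noteq> \<zero>\<^bsub>k\<^esub>} \<subseteq> F" "F \<subseteq> X" for f F
    unfolding h_def using that g free_mod_closed[OF that(1)]
    by (intro N.add.finprod_mono_neutral_cong_left) (auto simp: subset_iff)
  have supp: "finite {x. f x \<noteq> \<zero>\<^bsub>k\<^esub>}" "{x. f x \<noteq> \<zero>\<^bsub>k\<^esub>} \<subseteq> X" if "f \<in> carrier (free_mod k X)" for f
    using that by (auto simp: free_mod_carrier)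
  have "lin k (free_mod k X) N h"
  proof (rule linI)
    fix f assume f: "f \<in> carrier (free_mod k X)"
    show "h f \<in> carrier N" unfolding h_def
      using supp[OF f] g free_mod_closed[OF f] by (intro N.finsum_closed) auto
    fix f' assume f': "f' \<in> carrier (free_mod k X)"
    let ?F = "{x. f x \<noteq> \<zero>\<^bsub>k\<^esub>} \<union> {x. f' x \<noteq> \<zero>\<^bsub>k\<^esub>}"
    have F: "finite ?F" "?F \<subseteq> X" using supp f f' by auto
    have "h (f \<oplus>\<^bsub>free_mod k X\<^esub> f') = (\<Oplus>\<^bsub>N\<^esub>x\<in>?F. (f x \<oplus>\<^bsub>k\<^esub> f' x) \<odot>\<^bsub>N\<^esub> g x)"
      using h[OF F.a_closed[OF f f'] F(1) _ F(2)] by force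
    also have "\<dots> = (\<Oplus>\<^bsub>N\<^esub>x\<in>?F. f x \<odot>\<^bsub>N\<^esub> g x \<oplus>\<^bsub>N\<^esub> f' x \<odot>\<^bsub>N\<^esub> g x)"
      using F(2) free_mod_closed[OF f] free_mod_closed[OF f'] g
      by (intro N.finsum_cong') (auto intro!: N.smult_l_distr)
    also have "\<dots> = (\<Oplus>\<^bsub>N\<^esub>x\<in>?F. f x \<odot>\<^bsub>N\<^esub> g x) \<oplus>\<^bsub>N\<^esub> (\<Oplus>\<^bsub>N\<^esub>x\<in>?F. f' x \<odot>\<^bsub>N\<^esub> g x)"
      using F(2) free_mod_closed[OF f] free_mod_closed[OF f'] g
      by (intro N.finsum_addf) (auto)
    also have "\<dots> = h f \<oplus>\<^bsub>N\<^esub> h f'" using h[OF f F(1) _ F(2)] h[OF f' F(1) _ F(2)] by auto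
    finally show "h (f \<oplus>\<^bsub>free_mod k X\<^esub> f') = h f \<oplus>\<^bsub>N\<^esub> h f'" .
  next
    fix c f assume c: "c \<in> carrier k" and f: "f \<in> carrier (free_mod k X)"
    have "h (c \<odot>\<^bsub>free_mod k X\<^esub> f) = (\<Oplus>\<^bsub>N\<^esub>x\<in>{x. f x \<noteq> \<zero>\<^bsub>k\<^esub>}. (c \<otimes>\<^bsub>k\<^esub> f x) \<odot>\<^bsub>N\<^esub> g x)"
      using h[OF F.smult_closed[OF c f] supp(1)[OF f] _ supp(2)[OF f]] c by force
    also have "\<dots> = (\<Oplus>\<^bsub>N\<^esub>x\<in>{x. f x \<noteq> \<zero>\<^bsub>k\<^esub>}. c \<odot>\<^bsub>N\<^esub> (f x \<odot>\<^bsub>N\<^esub> g x))"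
      using c free_mod_closed[OF f] supp[OF f] g by (intro N.finsum_cong') (auto intro!: N.smult_assoc)
    also have "\<dots> = c \<odot>\<^bsub>N\<^esub> h f" unfolding h_def
      using c free_mod_closed[OF f] supp[OF f] g by (intro N.smult_finsum[symmetric]) auto
    finally show "h (c \<odot>\<^bsub>free_mod k X\<^esub> f) = c \<odot>\<^bsub>N\<^esub> h f" .
  qed
  moreover have "h (basis_vec k x) = g x" if x: "x \<in> X" for x
  proof -
    have "h (basis_vec k x) = (\<Oplus>\<^bsub>N\<^esub>y\<in>{x}. basis_vec k x y \<odot>\<^bsub>N\<^esub> g y)"
      using x by (intro h basis_vec_closed) (auto simp: basis_vec_def)
    also have "\<dots> = g x" using g[OF x] by (simp add: basis_vec_def N.smult_one Pi_def)
    finally show ?thesis .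
  qed
  ultimately show ?thesis using that by blast
qed

text \<open>The module with generators \<open>X\<close> and relations \<open>R\<close>. Both kinds
  of tensor product have this form, so their universal properties are instances of one.\<close>

definition pres :: "'x set \<Rightarrow> ('x \<Rightarrow> 'k) set \<Rightarrow> ('k, ('x \<Rightarrow> 'k) set) module" where
  "pres X R = mquot (free_mod k X) (mspan k (free_mod k X) R)"

definition pgen :: "'x set \<Rightarrow> ('x \<Rightarrow> 'k) set \<Rightarrow> 'x \<Rightarrow> ('x \<Rightarrow> 'k) set" where
  "pgen X R x = mspan k (free_mod k X) R +>\<^bsub>free_mod k X\<^esub> basis_vec k x"

context
  fixes X :: "'x set" and R
  assumes R: "R \<subseteq> carrier (free_mod k X)"
begin

lemma pres_submod: "submod k (free_mod k X) (mspan k (free_mod k X) R)"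
  by (rule mspan_submod[OF k free_mod_module R])

lemma pres_module: "left_module k (pres X R)"
  unfolding pres_def by (rule mquot_module[OF k free_mod_module pres_submod])

lemma pres_proj_lin:
  "lin k (free_mod k X) (pres X R) (\<lambda>f. mspan k (free_mod k X) R +>\<^bsub>free_mod k X\<^esub> f)"
  unfolding pres_def by (rule mquot_proj_lin[OF k free_mod_module pres_submod])

lemma pres_spans: "spans k (pres X R) (pgen X R ` X)"
proof -
  have "spans k (pres X R) ((\<lambda>f. mspan k (free_mod k X) R +>\<^bsub>free_mod k X\<^esub> f) ` basis_vec k ` X)"
    by (rule spans_image[OF free_mod_module pres_module pres_proj_lin _ spans_free_mod])
      (simp add: pres_def mquot_carrier[OF k free_mod_module pres_submod])
  then show ?thesis by (simp add: image_image pgen_def)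
qed

lemma pres_rel:
  assumes "r \<in> R"
  shows "mspan k (free_mod k X) R +>\<^bsub>free_mod k X\<^esub> r = \<zero>\<^bsub>pres X R\<^esub>"
proof -
  interpret F: left_module k "free_mod k X" by (rule free_mod_module)
  have r: "r \<in> mspan k (free_mod k X) R" "r \<in> carrier (free_mod k X)"
    using assms mspan_superset[of R k "free_mod k X"] R by auto
  show ?thesis
    unfolding pres_def mquot_zero[OF k free_mod_module pres_submod]
    using mquot_coset_eq[OF k free_mod_module pres_submod F.zero_closed r(1)]
    unfolding F.r_zero[OF r(2)] .
qed

text \<open>The linear extension of \<open>g\<close> to the free module exists only inside the
  proof, so the condition on relations is imposed on every linear extension; there is just one up to
  its values off the carrier.\<close>

lemma pres_lift:
  assumes N: "left_module k N" and g: "\<And>x. x \<in> X \<Longrightarrow> g x \<in> carrier N"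
    and rel: "\<And>h r. \<lbrakk>lin k (free_mod k X) N h; \<And>x. x \<in> X \<Longrightarrow> h (basis_vec k x) = g x; r \<in> R\<rbrakk> \<Longrightarrow> h r = \<zero>\<^bsub>N\<^esub>"
  shows "\<exists>h. lin k (pres X R) N h \<and> (\<forall>x\<in>X. h (pgen X R x) = g x)"
proof -
  obtain h where h: "lin k (free_mod k X) N h" "\<And>x. x \<in> X \<Longrightarrow> h (basis_vec k x) = g x"
    using free_mod_lift[of N X g] N g by blast
  have "R \<subseteq> {f \<in> carrier (free_mod k X). h f = \<zero>\<^bsub>N\<^esub>}" using R rel[OF h] by auto
  then have "mspan k (free_mod k X) R \<subseteq> {f \<in> carrier (free_mod k X). h f = \<zero>\<^bsub>N\<^esub>}"
    by (intro mspan_least[OF k free_mod_module submod_kernel[OF free_mod_module N h(1)]])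
  then obtain h' where "lin k (pres X R) N h'"
    "\<And>f. f \<in> carrier (free_mod k X) \<Longrightarrow> h' (mspan k (free_mod k X) R +>\<^bsub>free_mod k X\<^esub> f) = h f"
    using mquot_lift[OF k free_mod_module pres_submod N h(1)] unfolding pres_def by blast
  then show ?thesis using h(2) by (auto simp: pgen_def)
qed

end

end

subsection \<open>Tensor products\<close>

lemma lin_minus:
  assumes "left_module A M" "left_module A N" "lin A M N f" "x \<in> carrier M" "y \<in> carrier M"
  shows "f (x \<ominus>\<^bsub>M\<^esub> y) = f x \<ominus>\<^bsub>N\<^esub> f y"
proof -
  interpret M: left_module A M by fact
  show ?thesis using assms(4,5) by (simp add: a_minus_def lin_add[OF assms(3)] lin_neg[OF assms(1-3)])
qed

lemma (in abelian_group) minus_eq_zero_iff: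
  "\<lbrakk>a \<in> carrier G; b \<in> carrier G\<rbrakk> \<Longrightarrow> a \<ominus> b = \<zero> \<longleftrightarrow> a = b"
  by (metis a_inv_closed minus_eq minus_equality minus_minus r_neg)

lemma (in abelian_group) minus_minus_eq_zero_iff:
  assumes "a \<in> carrier G" "b \<in> carrier G" "c \<in> carrier G"
  shows "(a \<ominus> b) \<ominus> c = \<zero> \<longleftrightarrow> a = b \<oplus> c"
proof -
  have "(a \<ominus> b) \<ominus> c = a \<ominus> (b \<oplus> c)"
    using assms by (simp add: minus_eq minus_add a_ac)
  then show ?thesis using assms minus_eq_zero_iff[of a "b \<oplus> c"] by simp
qed

text \<open>Membership in \<open>N\<close> is a clause of its own because for empty \<open>I\<close>
  there is no slot to vary and the second clause says nothing.\<close>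

definition multilin :: "'k ring \<Rightarrow> 'i set \<Rightarrow> ('i \<Rightarrow> ('k, 'a) module) \<Rightarrow> ('k, 'b) module \<Rightarrow>
    (('i \<Rightarrow> 'a) \<Rightarrow> 'b) \<Rightarrow> bool" where
  "multilin k I M N g \<longleftrightarrow> (\<forall>v\<in>\<Pi>\<^sub>E i\<in>I. carrier (M i). g v \<in> carrier N) \<and>
     (\<forall>v\<in>\<Pi>\<^sub>E i\<in>I. carrier (M i). \<forall>i\<in>I. lin k (M i) N (\<lambda>x. g (v(i := x))))"

text \<open>In the second argument only additivity is required: \<open>N\<close> is a module over
  \<open>A\<close>, and scalars reach it through the action of \<open>A\<close>.\<close>

definition balanced :: "'k ring \<Rightarrow> 'r ring \<Rightarrow> ('k, 'x) module \<Rightarrow> ('x \<Rightarrow> 'r \<Rightarrow> 'x) \<Rightarrow>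
    ('r, 'a) module \<Rightarrow> ('k, 'b) module \<Rightarrow> ('x \<Rightarrow> 'a \<Rightarrow> 'b) \<Rightarrow> bool" where
  "balanced k A X ract N P g \<longleftrightarrow> (\<forall>y\<in>carrier N. lin k X P (\<lambda>x. g x y)) \<and>
     (\<forall>x\<in>carrier X. \<forall>y\<in>carrier N. \<forall>y'\<in>carrier N. g x (y \<oplus>\<^bsub>N\<^esub> y') = g x y \<oplus>\<^bsub>P\<^esub> g x y') \<and>
     (\<forall>x\<in>carrier X. \<forall>a\<in>carrier A. \<forall>y\<in>carrier N. g (ract x a) y = g x (a \<odot>\<^bsub>N\<^esub> y))"

lemma PiE_upd: "\<lbrakk>v \<in> (\<Pi>\<^sub>E i\<in>I. S i); i \<in> I; x \<in> S i\<rbrakk> \<Longrightarrow> v(i := x) \<in> (\<Pi>\<^sub>E i\<in>I. S i)"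
  by (auto simp: PiE_iff extensional_def)

context
  fixes k :: "'k ring" and I :: "'i set" and M :: "'i \<Rightarrow> ('k, 'a) module"
  assumes k: "cring k" and M: "\<And>i. i \<in> I \<Longrightarrow> left_module k (M i)"
begin

abbreviation (input) \<open>\<Omega> \<equiv> \<Pi>\<^sub>E i\<in>I. carrier (M i)\<close>
abbreviation (input) \<open>B \<equiv> free_mod k \<Omega>\<close>

interpretation k: cring k by (rule k)
interpretation B: left_module k B by (rule free_mod_module[OF k])

lemma tensor_eq_pres: "tensor k I M = pres k \<Omega> (tensor_rels k I M)"
  by (simp add: tensor_def pres_def[OF k] Let_def)

lemma pure_tensor_eq_pgen: "pure_tensor k I M v = pgen k \<Omega> (tensor_rels k I M) v"
  by (simp add: pure_tensor_def pgen_def[OF k] Let_def)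

lemma tensor_rels_closed: "tensor_rels k I M \<subseteq> carrier B"
proof
  fix r assume "r \<in> tensor_rels k I M"
  then consider v i x y where "v \<in> \<Omega>" "i \<in> I" "x \<in> carrier (M i)" "y \<in> carrier (M i)"
      "r = (basis_vec k (v(i := x \<oplus>\<^bsub>M i\<^esub> y)) \<ominus>\<^bsub>B\<^esub> basis_vec k (v(i := x))) \<ominus>\<^bsub>B\<^esub> basis_vec k (v(i := y))"
    | v i c x where "v \<in> \<Omega>" "i \<in> I" "c \<in> carrier k" "x \<in> carrier (M i)"
      "r = basis_vec k (v(i := c \<odot>\<^bsub>M i\<^esub> x)) \<ominus>\<^bsub>B\<^esub> c \<odot>\<^bsub>B\<^esub> basis_vec k (v(i := x))"
    unfolding tensor_rels_def Let_def by blast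
  then show "r \<in> carrier B"
  proof cases
    case 1
    interpret Mi: left_module k "M i" using M 1 by simp
    show ?thesis using 1 by (auto intro!: B.minus_closed basis_vec_closed[OF k] PiE_upd)
  next
    case 2
    interpret Mi: left_module k "M i" using M 2 by simp
    show ?thesis unfolding 2(5)
      by (intro B.minus_closed B.smult_closed basis_vec_closed[OF k] PiE_upd 2 Mi.smult_closed)
  qed
qed

lemma tensor_module: "left_module k (tensor k I M)"
  unfolding tensor_eq_pres by (rule pres_module[OF k tensor_rels_closed])

lemma tensor_spans: "spans k (tensor k I M) (pure_tensor k I M ` \<Omega>)"
  using pres_spans[OF k tensor_rels_closed] by (simp add: tensor_eq_pres pure_tensor_eq_pgen)

lemma pure_tensor_closed: "v \<in> \<Omega> \<Longrightarrow> pure_tensor k I M v \<in> carrier (tensor k I M)"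
  using tensor_spans by (auto simp: spans_def)

text \<open>Each clause of multilinearity is one of the defining relations, read in the quotient
  where it becomes zero.\<close>

lemma pure_tensor_multilin: "multilin k I M (tensor k I M) (pure_tensor k I M)"
proof -
  interpret T: left_module k "tensor k I M" by (rule tensor_module)
  define \<pi> where "\<pi> f = mspan k B (tensor_rels k I M) +>\<^bsub>B\<^esub> f" for f
  have \<pi>: "lin k B (tensor k I M) \<pi>"
    unfolding \<pi>_def tensor_eq_pres by (rule pres_proj_lin[OF k tensor_rels_closed])
  have pb: "pure_tensor k I M v = \<pi> (basis_vec k v)" for v
    by (simp add: \<pi>_def pure_tensor_eq_pgen pgen_def[OF k])
  have rel: "\<pi> r = \<zero>\<^bsub>tensor k I M\<^esub>" if "r \<in> tensor_rels k I M" for r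
    using pres_rel[OF k tensor_rels_closed that] by (simp add: \<pi>_def tensor_eq_pres)
  note bc = basis_vec_closed[OF k]
  note \<pi>m = lin_minus[OF B.left_module_axioms T.left_module_axioms \<pi>]
  show ?thesis
    unfolding multilin_def
  proof (intro conjI ballI pure_tensor_closed)
    fix v i assume v: "v \<in> \<Omega>" and i: "i \<in> I"
    interpret Mi: left_module k "M i" using M i by simp
    have bv: "x \<in> carrier (M i) \<Longrightarrow> basis_vec k (v(i := x)) \<in> carrier B" for x
      using v i by (intro bc PiE_upd)
    show "lin k (M i) (tensor k I M) (\<lambda>x. pure_tensor k I M (v(i := x)))"
    proof (rule linI)
      fix x y assume x: "x \<in> carrier (M i)" and y: "y \<in> carrier (M i)"
      have "\<pi> ((basis_vec k (v(i := x \<oplus>\<^bsub>M i\<^esub> y)) \<ominus>\<^bsub>B\<^esub> basis_vec k (v(i := x))) \<ominus>\<^bsub>B\<^esub> basis_vec k (v(i := y)))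
        = \<zero>\<^bsub>tensor k I M\<^esub>"
        using v i x y unfolding tensor_rels_def Let_def by (intro rel[unfolded tensor_rels_def Let_def]) blast
      then show "pure_tensor k I M (v(i := x \<oplus>\<^bsub>M i\<^esub> y)) =
          pure_tensor k I M (v(i := x)) \<oplus>\<^bsub>tensor k I M\<^esub> pure_tensor k I M (v(i := y))"
        unfolding pb using x y
        by (simp only: \<pi>m bv Mi.a_closed B.minus_closed T.minus_minus_eq_zero_iff lin_closed[OF \<pi>])
    next
      fix c x assume c: "c \<in> carrier k" and x: "x \<in> carrier (M i)"
      have "\<pi> (basis_vec k (v(i := c \<odot>\<^bsub>M i\<^esub> x)) \<ominus>\<^bsub>B\<^esub> c \<odot>\<^bsub>B\<^esub> basis_vec k (v(i := x)))
        = \<zero>\<^bsub>tensor k I M\<^esub>"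
        using v i c x unfolding tensor_rels_def Let_def by (intro rel[unfolded tensor_rels_def Let_def]) blast
      then show "pure_tensor k I M (v(i := c \<odot>\<^bsub>M i\<^esub> x)) =
          c \<odot>\<^bsub>tensor k I M\<^esub> pure_tensor k I M (v(i := x))"
        unfolding pb using x c
        by (simp only: \<pi>m bv Mi.smult_closed B.smult_closed T.smult_closed lin_smult[OF \<pi>]
          T.minus_eq_zero_iff lin_closed[OF \<pi>])
    qed (use v i in \<open>auto intro!: pure_tensor_closed PiE_upd\<close>)
  qed
qed

lemma tensor_lift_ex:
  assumes N: "left_module k N" and g: "multilin k I M N g"
  shows "\<exists>h. lin k (tensor k I M) N h \<and> (\<forall>v\<in>\<Omega>. h (pure_tensor k I M v) = g v)"
  unfolding tensor_eq_pres pure_tensor_eq_pgen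
proof (rule pres_lift[OF k tensor_rels_closed N])
  show gc: "g v \<in> carrier N" if "v \<in> \<Omega>" for v using g that by (simp add: multilin_def)
  interpret N: left_module k N by (rule N)
  fix h r assume h: "lin k B N h" and hb: "\<And>v. v \<in> \<Omega> \<Longrightarrow> h (basis_vec k v) = g v"
    and "r \<in> tensor_rels k I M"
  note hm = lin_minus[OF B.left_module_axioms N h]
  note bc = basis_vec_closed[OF k]
  from \<open>r \<in> _\<close> consider v i x y where "v \<in> \<Omega>" "i \<in> I" "x \<in> carrier (M i)" "y \<in> carrier (M i)"
      "r = (basis_vec k (v(i := x \<oplus>\<^bsub>M i\<^esub> y)) \<ominus>\<^bsub>B\<^esub> basis_vec k (v(i := x))) \<ominus>\<^bsub>B\<^esub> basis_vec k (v(i := y))"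
    | v i c x where "v \<in> \<Omega>" "i \<in> I" "c \<in> carrier k" "x \<in> carrier (M i)"
      "r = basis_vec k (v(i := c \<odot>\<^bsub>M i\<^esub> x)) \<ominus>\<^bsub>B\<^esub> c \<odot>\<^bsub>B\<^esub> basis_vec k (v(i := x))"
    unfolding tensor_rels_def Let_def by blast
  then show "h r = \<zero>\<^bsub>N\<^esub>"
  proof cases
    case 1
    interpret Mi: left_module k "M i" using M 1 by simp
    have l: "lin k (M i) N (\<lambda>x. g (v(i := x)))" using g 1 by (simp add: multilin_def)
    have bv: "z \<in> carrier (M i) \<Longrightarrow> v(i := z) \<in> \<Omega>" for z using 1 by (intro PiE_upd)
    show ?thesis unfolding 1(5) using 1(3,4) lin_add[OF l]
      by (simp only: hm hb bv bc Mi.a_closed B.minus_closed N.minus_minus_eq_zero_iff gc N.a_closed)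
  next
    case 2
    interpret Mi: left_module k "M i" using M 2 by simp
    have l: "lin k (M i) N (\<lambda>x. g (v(i := x)))" using g 2 by (simp add: multilin_def)
    have bv: "z \<in> carrier (M i) \<Longrightarrow> v(i := z) \<in> \<Omega>" for z using 2 by (intro PiE_upd)
    show ?thesis unfolding 2(5) using 2(3,4) lin_smult[OF l]
      by (simp only: hm hb bv bc Mi.smult_closed B.smult_closed N.smult_closed N.minus_eq_zero_iff
        gc lin_smult[OF h])
  qed
qed

text \<open>\<open>tensor_lift\<close> is a definite description. Values on pure tensors fix a
  linear map on the carrier, and extensionality fixes it elsewhere; hence the restricted extension
  is the only candidate.\<close>

lemma tensor_lift:
  assumes N: "left_module k N" and g: "multilin k I M N g"
  shows tensor_lift_linmaps: "tensor_lift k I M N g \<in> linmaps k (tensor k I M) N"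
    and tensor_lift_pure: "v \<in> \<Omega> \<Longrightarrow> tensor_lift k I M N g (pure_tensor k I M v) = g v"
proof -
  obtain h where h: "lin k (tensor k I M) N h" "\<And>v. v \<in> \<Omega> \<Longrightarrow> h (pure_tensor k I M v) = g v"
    using tensor_lift_ex[OF assms] by blast
  have "\<exists>!h. h \<in> linmaps k (tensor k I M) N \<and> (\<forall>v\<in>\<Omega>. h (pure_tensor k I M v) = g v)"
  proof (rule ex1I[of _ "restrict h (carrier (tensor k I M))"])
    show *: "restrict h (carrier (tensor k I M)) \<in> linmaps k (tensor k I M) N \<and>
       (\<forall>v\<in>\<Omega>. restrict h (carrier (tensor k I M)) (pure_tensor k I M v) = g v)"
      using h by (simp add: restrict_linmaps_iff[OF tensor_module] pure_tensor_closed)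
    fix h' assume h': "h' \<in> linmaps k (tensor k I M) N \<and> (\<forall>v\<in>\<Omega>. h' (pure_tensor k I M v) = g v)"
    show "h' = restrict h (carrier (tensor k I M))"
    proof (rule linmaps_eqI)
      show "h' x = restrict h (carrier (tensor k I M)) x" if "x \<in> carrier (tensor k I M)" for x
        by (rule lin_eq_on_spans[OF tensor_module N lin_linmaps[OF conjunct1[OF h']]
            lin_linmaps[OF conjunct1[OF *]] tensor_spans _ that])
          (use * h' in auto)
    qed (rule conjunct1[OF h'], rule conjunct1[OF *])
  qed
  from theI'[OF this] show "tensor_lift k I M N g \<in> linmaps k (tensor k I M) N"
    "v \<in> \<Omega> \<Longrightarrow> tensor_lift k I M N g (pure_tensor k I M v) = g v"
    unfolding tensor_lift_def by auto
qed

lemma tensor_lin_eq: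
  assumes "left_module k N" "lin k (tensor k I M) N f" "lin k (tensor k I M) N g"
    and "\<And>v. v \<in> \<Omega> \<Longrightarrow> f (pure_tensor k I M v) = g (pure_tensor k I M v)" "x \<in> carrier (tensor k I M)"
  shows "f x = g x"
  by (rule lin_eq_on_spans[OF tensor_module assms(1-3) tensor_spans _ assms(5)]) (use assms(4) in auto)

end

section \<open>Tensor products over an algebra\<close>

context
  fixes k :: "'k ring" and A :: "'r ring" and X :: "('k, 'x) module" and ract :: "'x \<Rightarrow> 'r \<Rightarrow> 'x"
    and N :: "('r, 'a) module"
  assumes k: "cring k" and X: "left_module k X" and N: "left_module A N"
    and racts: "\<forall>x\<in>carrier X. \<forall>a\<in>carrier A. ract x a \<in> carrier X"
begin

lemmas ract = bspec[OF bspec[OF racts]]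

abbreviation (input) \<open>\<Omega>' \<equiv> carrier X \<times> carrier N\<close>
abbreviation (input) \<open>B' \<equiv> free_mod k \<Omega>'\<close>

interpretation k: cring k by (rule k)
interpretation B: left_module k B' by (rule free_mod_module[OF k])
interpretation X: left_module k X by (rule X)
interpretation N: left_module A N by (rule N)

lemma btensor_eq_pres: "btensor k A X ract N = pres k \<Omega>' (btensor_rels k A X ract N)"
  by (simp add: btensor_def pres_def[OF k] Let_def)

lemma pure_btensor_eq_pgen: "pure_btensor k A X ract N x y = pgen k \<Omega>' (btensor_rels k A X ract N) (x, y)"
  by (simp add: pure_btensor_def pgen_def[OF k] Let_def)

lemma btensor_rels_cases:
  assumes "r \<in> btensor_rels k A X ract N"
  obtains x x' y where "x \<in> carrier X" "x' \<in> carrier X" "y \<in> carrier N"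
      "r = (basis_vec k (x \<oplus>\<^bsub>X\<^esub> x', y) \<ominus>\<^bsub>B'\<^esub> basis_vec k (x, y)) \<ominus>\<^bsub>B'\<^esub> basis_vec k (x', y)"
  | x y y' where "x \<in> carrier X" "y \<in> carrier N" "y' \<in> carrier N"
      "r = (basis_vec k (x, y \<oplus>\<^bsub>N\<^esub> y') \<ominus>\<^bsub>B'\<^esub> basis_vec k (x, y)) \<ominus>\<^bsub>B'\<^esub> basis_vec k (x, y')"
  | c x y where "c \<in> carrier k" "x \<in> carrier X" "y \<in> carrier N"
      "r = basis_vec k (c \<odot>\<^bsub>X\<^esub> x, y) \<ominus>\<^bsub>B'\<^esub> c \<odot>\<^bsub>B'\<^esub> basis_vec k (x, y)"
  | x a y where "x \<in> carrier X" "a \<in> carrier A" "y \<in> carrier N"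
      "r = basis_vec k (ract x a, y) \<ominus>\<^bsub>B'\<^esub> basis_vec k (x, a \<odot>\<^bsub>N\<^esub> y)"
proof -
  from assms[unfolded btensor_rels_def Let_def Un_iff mem_Collect_eq] show ?thesis
    by (elim disjE exE conjE)
      ((rule that(1); assumption) | (rule that(2); assumption) | (rule that(3); assumption) | (rule that(4); assumption))+
qed

lemma btensor_rels_closed: "btensor_rels k A X ract N \<subseteq> carrier B'"
proof
  fix r assume "r \<in> btensor_rels k A X ract N"
  then show "r \<in> carrier B'"
    by (cases rule: btensor_rels_cases)
      (simp_all only: B.minus_closed B.smult_closed basis_vec_closed[OF k] SigmaI X.a_closed X.smult_closed
         N.a_closed N.smult_closed ract)
qed

lemma btensor_module: "left_module k (btensor k A X ract N)"
  unfolding btensor_eq_pres by (rule pres_module[OF k btensor_rels_closed])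

lemma btensor_spans:
  "spans k (btensor k A X ract N) {pure_btensor k A X ract N x y | x y. x \<in> carrier X \<and> y \<in> carrier N}"
proof -
  have "{pure_btensor k A X ract N x y | x y. x \<in> carrier X \<and> y \<in> carrier N}
    = pgen k \<Omega>' (btensor_rels k A X ract N) ` \<Omega>'"
    by (auto simp: pure_btensor_eq_pgen)
  then show ?thesis using pres_spans[OF k btensor_rels_closed] by (simp add: btensor_eq_pres)
qed

lemma pure_btensor_closed:
  "\<lbrakk>x \<in> carrier X; y \<in> carrier N\<rbrakk> \<Longrightarrow> pure_btensor k A X ract N x y \<in> carrier (btensor k A X ract N)"
  using btensor_spans by (auto simp: spans_def)

lemma pure_btensor_balanced:
  "balanced k A X ract N (btensor k A X ract N) (pure_btensor k A X ract N)"
proof -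
  let ?T = "btensor k A X ract N"
  interpret T: left_module k ?T by (rule btensor_module)
  define \<pi> where "\<pi> f = mspan k B' (btensor_rels k A X ract N) +>\<^bsub>B'\<^esub> f" for f
  have \<pi>: "lin k B' ?T \<pi>"
    unfolding \<pi>_def btensor_eq_pres by (rule pres_proj_lin[OF k btensor_rels_closed])
  have pb: "pure_btensor k A X ract N x y = \<pi> (basis_vec k (x, y))" for x y
    by (simp add: \<pi>_def pure_btensor_eq_pgen pgen_def[OF k])
  have rel: "\<pi> r = \<zero>\<^bsub>?T\<^esub>" if "r \<in> btensor_rels k A X ract N" for r
    using pres_rel[OF k btensor_rels_closed that] by (simp add: \<pi>_def btensor_eq_pres)
  note rel = rel[unfolded btensor_rels_def Let_def]
  note cl = basis_vec_closed[OF k] SigmaI X.a_closed X.smult_closed N.a_closed N.smult_closed ract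
    lin_minus[OF B.left_module_axioms T.left_module_axioms \<pi>] B.minus_closed B.smult_closed
    T.smult_closed T.a_closed lin_closed[OF \<pi>] T.minus_minus_eq_zero_iff T.minus_eq_zero_iff lin_smult[OF \<pi>]
  show ?thesis
    unfolding balanced_def
  proof (intro conjI ballI linI)
    fix x x' y assume a: "x \<in> carrier X" "x' \<in> carrier X" "y \<in> carrier N"
    have "\<pi> ((basis_vec k (x \<oplus>\<^bsub>X\<^esub> x', y) \<ominus>\<^bsub>B'\<^esub> basis_vec k (x, y)) \<ominus>\<^bsub>B'\<^esub> basis_vec k (x', y)) = \<zero>\<^bsub>?T\<^esub>"
      by (rule rel) (use a in blast)
    then show "pure_btensor k A X ract N (x \<oplus>\<^bsub>X\<^esub> x') y =
        pure_btensor k A X ract N x y \<oplus>\<^bsub>?T\<^esub> pure_btensor k A X ract N x' y"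
      unfolding pb using a by (simp only: cl)
  next
    fix x y y' assume a: "x \<in> carrier X" "y \<in> carrier N" "y' \<in> carrier N"
    have "\<pi> ((basis_vec k (x, y \<oplus>\<^bsub>N\<^esub> y') \<ominus>\<^bsub>B'\<^esub> basis_vec k (x, y)) \<ominus>\<^bsub>B'\<^esub> basis_vec k (x, y')) = \<zero>\<^bsub>?T\<^esub>"
      by (rule rel) (use a in blast)
    then show "pure_btensor k A X ract N x (y \<oplus>\<^bsub>N\<^esub> y') =
        pure_btensor k A X ract N x y \<oplus>\<^bsub>?T\<^esub> pure_btensor k A X ract N x y'"
      unfolding pb using a by (simp only: cl)
  next
    fix c x y assume a: "x \<in> carrier X" "y \<in> carrier N" "c \<in> carrier k"
    have "\<pi> (basis_vec k (c \<odot>\<^bsub>X\<^esub> x, y) \<ominus>\<^bsub>B'\<^esub> c \<odot>\<^bsub>B'\<^esub> basis_vec k (x, y)) = \<zero>\<^bsub>?T\<^esub>"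
      by (rule rel) (use a in blast)
    then show "pure_btensor k A X ract N (c \<odot>\<^bsub>X\<^esub> x) y = c \<odot>\<^bsub>?T\<^esub> pure_btensor k A X ract N x y"
      unfolding pb using a by (simp only: cl)
  next
    fix a x y assume a: "x \<in> carrier X" "y \<in> carrier N" "a \<in> carrier A"
    have "\<pi> (basis_vec k (ract x a, y) \<ominus>\<^bsub>B'\<^esub> basis_vec k (x, a \<odot>\<^bsub>N\<^esub> y)) = \<zero>\<^bsub>?T\<^esub>"
      by (rule rel) (use a in blast)
    then show "pure_btensor k A X ract N (ract x a) y = pure_btensor k A X ract N x (a \<odot>\<^bsub>N\<^esub> y)"
      unfolding pb using a by (simp only: cl)
  qed (simp add: pure_btensor_closed)
qed

lemma btensor_lift_ex:
  assumes P: "left_module k P" and g: "balanced k A X ract N P g"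
  shows "\<exists>h. lin k (btensor k A X ract N) P h \<and>
    (\<forall>x\<in>carrier X. \<forall>y\<in>carrier N. h (pure_btensor k A X ract N x y) = g x y)"
proof -
  have gl: "lin k X P (\<lambda>x. g x y)" if "y \<in> carrier N" for y
    using g that unfolding balanced_def by blast
  have gc: "g x y \<in> carrier P" if "x \<in> carrier X" "y \<in> carrier N" for x y
    using lin_closed[OF gl[OF that(2)] that(1)] .
  interpret P: left_module k P by (rule P)
  have "\<exists>h. lin k (pres k \<Omega>' (btensor_rels k A X ract N)) P h \<and>
    (\<forall>z\<in>\<Omega>'. h (pgen k \<Omega>' (btensor_rels k A X ract N) z) = (\<lambda>(x, y). g x y) z)"
  proof (rule pres_lift[OF k btensor_rels_closed P])
    fix h r assume h: "lin k B' P h" and hb: "\<And>z. z \<in> \<Omega>' \<Longrightarrow> h (basis_vec k z) = (\<lambda>(x, y). g x y) z"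
      and r: "r \<in> btensor_rels k A X ract N"
    have hb': "h (basis_vec k (x, y)) = g x y" if "x \<in> carrier X" "y \<in> carrier N" for x y
      using hb[of "(x, y)"] that by simp
    note cl = basis_vec_closed[OF k] SigmaI X.a_closed X.smult_closed N.a_closed N.smult_closed ract
      lin_minus[OF B.left_module_axioms P h] B.minus_closed B.smult_closed
      P.smult_closed P.a_closed gc P.minus_minus_eq_zero_iff P.minus_eq_zero_iff lin_smult[OF h] hb'
      lin_add[OF gl] lin_smult[OF gl]
    from r show "h r = \<zero>\<^bsub>P\<^esub>"
      by (cases rule: btensor_rels_cases)
        (simp_all only: cl, use g in \<open>unfold balanced_def, blast+\<close>)
  qed (auto simp: gc)
  then show ?thesis by (simp add: btensor_eq_pres pure_btensor_eq_pgen)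
qed

lemma btensor_lin_eq:
  assumes "left_module k P" "lin k (btensor k A X ract N) P f" "lin k (btensor k A X ract N) P g"
    and "\<And>x y. \<lbrakk>x \<in> carrier X; y \<in> carrier N\<rbrakk> \<Longrightarrow>
      f (pure_btensor k A X ract N x y) = g (pure_btensor k A X ract N x y)"
    and "z \<in> carrier (btensor k A X ract N)"
  shows "f z = g z"
  by (rule lin_eq_on_spans[OF btensor_module assms(1-3) btensor_spans _ assms(5)]) (use assms(4) in auto)

lemma btensor_lift:
  assumes P: "left_module k P" and g: "balanced k A X ract N P g"
  shows btensor_lift_linmaps: "btensor_lift k A X ract N P g \<in> linmaps k (btensor k A X ract N) P"
    and btensor_lift_pure: "\<lbrakk>x \<in> carrier X; y \<in> carrier N\<rbrakk> \<Longrightarrow>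
      btensor_lift k A X ract N P g (pure_btensor k A X ract N x y) = g x y"
proof -
  let ?T = "btensor k A X ract N"
  obtain h where h: "lin k ?T P h"
    "\<And>x y. \<lbrakk>x \<in> carrier X; y \<in> carrier N\<rbrakk> \<Longrightarrow> h (pure_btensor k A X ract N x y) = g x y"
    using btensor_lift_ex[OF assms] by blast
  have "\<exists>!h. h \<in> linmaps k ?T P \<and>
    (\<forall>x\<in>carrier X. \<forall>y\<in>carrier N. h (pure_btensor k A X ract N x y) = g x y)"
  proof (rule ex1I[of _ "restrict h (carrier ?T)"])
    show *: "restrict h (carrier ?T) \<in> linmaps k ?T P \<and>
      (\<forall>x\<in>carrier X. \<forall>y\<in>carrier N. restrict h (carrier ?T) (pure_btensor k A X ract N x y) = g x y)"
      using h by (simp add: restrict_linmaps_iff[OF btensor_module] pure_btensor_closed)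
    fix h' assume h': "h' \<in> linmaps k ?T P \<and>
      (\<forall>x\<in>carrier X. \<forall>y\<in>carrier N. h' (pure_btensor k A X ract N x y) = g x y)"
    show "h' = restrict h (carrier ?T)"
    proof (rule linmaps_eqI)
      show "h' x = restrict h (carrier ?T) x" if "x \<in> carrier ?T" for x
        by (rule btensor_lin_eq[OF P lin_linmaps[OF conjunct1[OF h']]
            lin_linmaps[OF conjunct1[OF *]] _ that]) (use * h' in auto)
    qed (rule conjunct1[OF h'], rule conjunct1[OF *])
  qed
  from theI'[OF this] show "btensor_lift k A X ract N P g \<in> linmaps k ?T P"
    "\<lbrakk>x \<in> carrier X; y \<in> carrier N\<rbrakk> \<Longrightarrow>
      btensor_lift k A X ract N P g (pure_btensor k A X ract N x y) = g x y"
    unfolding btensor_lift_def by auto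
qed

end

section \<open>Tensor powers and the group algebra\<close>

text \<open>Elements of quotient modules are sets; proving their equality by double inclusion is never
  useful.\<close>

declare equalityI [rule del]
declare sym_group_inv_equality [simp del] One_nat_def [simp del]

text \<open>The target of linear functionals: coordinates become ordinary linear maps, and
  identities for sums in modules apply to sums in \<open>k\<close>.\<close>

definition self_mod :: "'k ring \<Rightarrow> ('k, 'k) module" where
  "self_mod k = mk_module (carrier k) \<zero>\<^bsub>k\<^esub> (add k) (\<lambda>a b. a \<otimes>\<^bsub>k\<^esub> b)"

lemma self_mod_simps [simp]:
  "carrier (self_mod k) = carrier k" "\<zero>\<^bsub>self_mod k\<^esub> = \<zero>\<^bsub>k\<^esub>" "add (self_mod k) = add k"
  "a \<odot>\<^bsub>self_mod k\<^esub> b = a \<otimes>\<^bsub>k\<^esub> b"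
  by (simp_all add: self_mod_def)

lemma finsum_self_mod: "finsum (self_mod k) f I = finsum k f I"
  by (simp add: finsum_def finprod_def)

section \<open>Permutations of \<open>{1..d}\<close> and their right action on words\<close>

lemma sym_group_simps [simp]:
  "\<sigma> \<otimes>\<^bsub>sym_group d\<^esub> \<tau> = \<sigma> \<circ> \<tau>" "\<one>\<^bsub>sym_group d\<^esub> = id"
  by (simp_all add: sym_group_def)

lemma sym_group_finite [simp]: "finite (carrier (sym_group d))"
  by (simp add: sym_group_def finite_permutations)

lemma sym_group_id [simp]: "id \<in> carrier (sym_group d)"
  by (simp add: sym_group_def permutes_id)

lemma sym_group_comp [simp]:
  "\<lbrakk>\<sigma> \<in> carrier (sym_group d); \<tau> \<in> carrier (sym_group d)\<rbrakk> \<Longrightarrow> \<sigma> \<circ> \<tau> \<in> carrier (sym_group d)"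
  by (simp add: sym_group_def permutes_compose)

lemma sym_group_inv_closed [simp]:
  "\<sigma> \<in> carrier (sym_group d) \<Longrightarrow> inv\<^bsub>sym_group d\<^esub> \<sigma> \<in> carrier (sym_group d)"
  by (rule group.inv_closed[OF sym_group_is_group])

lemma sym_group_l_inv [simp]: "\<sigma> \<in> carrier (sym_group d) \<Longrightarrow> inv\<^bsub>sym_group d\<^esub> \<sigma> \<circ> \<sigma> = id"
  and sym_group_r_inv [simp]: "\<sigma> \<in> carrier (sym_group d) \<Longrightarrow> \<sigma> \<circ> inv\<^bsub>sym_group d\<^esub> \<sigma> = id"
  using group.l_inv[OF sym_group_is_group, of \<sigma> d] group.r_inv[OF sym_group_is_group, of \<sigma> d] by simp_all

lemma sym_group_inv_apply [simp]:
  "\<sigma> \<in> carrier (sym_group d) \<Longrightarrow> (inv\<^bsub>sym_group d\<^esub> \<sigma>) (\<sigma> i) = i"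
  "\<sigma> \<in> carrier (sym_group d) \<Longrightarrow> \<sigma> ((inv\<^bsub>sym_group d\<^esub> \<sigma>) i) = i"
  using sym_group_l_inv[of \<sigma> d] sym_group_r_inv[of \<sigma> d] unfolding fun_eq_iff o_def id_def by auto

lemma sym_group_inv_comp:
  "\<lbrakk>\<sigma> \<in> carrier (sym_group d); \<tau> \<in> carrier (sym_group d)\<rbrakk> \<Longrightarrow>
    inv\<^bsub>sym_group d\<^esub> (\<sigma> \<circ> \<tau>) = inv\<^bsub>sym_group d\<^esub> \<tau> \<circ> inv\<^bsub>sym_group d\<^esub> \<sigma>"
  using group.inv_mult_group[OF sym_group_is_group, of \<sigma> d \<tau>] by simp

lemma sym_group_inv_inv [simp]:
  "\<sigma> \<in> carrier (sym_group d) \<Longrightarrow> inv\<^bsub>sym_group d\<^esub> (inv\<^bsub>sym_group d\<^esub> \<sigma>) = \<sigma>"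
  using group.inv_inv[OF sym_group_is_group, of \<sigma> d] by simp

lemma sym_group_bij_left:
  assumes "\<sigma> \<in> carrier (sym_group d)"
  shows "bij_betw (\<lambda>\<tau>. \<sigma> \<circ> \<tau>) (carrier (sym_group d)) (carrier (sym_group d))"
  by (rule bij_betw_byWitness[where f'="\<lambda>\<tau>. inv\<^bsub>sym_group d\<^esub> \<sigma> \<circ> \<tau>"])
    (use assms in \<open>auto simp: o_assoc\<close>)

lemma sym_group_in [simp]: "\<lbrakk>\<sigma> \<in> carrier (sym_group d)\<rbrakk> \<Longrightarrow> \<sigma> i \<in> {1..d} \<longleftrightarrow> i \<in> {1..d}"
  using permutes_in_image[of \<sigma> "{1..d}" i] by (simp add: sym_group_def)

lemma sym_group_bij: "\<sigma> \<in> carrier (sym_group d) \<Longrightarrow> bij_betw \<sigma> {1..d} {1..d}"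
  by (simp add: sym_group_def permutes_imp_bij)

text \<open>The right action of permutations on words of length \<open>d\<close>; the restriction
  keeps the result extensional.\<close>

definition pcomp :: "nat \<Rightarrow> (nat \<Rightarrow> 'b) \<Rightarrow> perm \<Rightarrow> nat \<Rightarrow> 'b" where
  "pcomp d v \<sigma> = (\<lambda>i\<in>{1..d}. v (\<sigma> i))"

lemma pcomp_closed:
  "\<lbrakk>\<sigma> \<in> carrier (sym_group d); v \<in> {1..d} \<rightarrow>\<^sub>E S\<rbrakk> \<Longrightarrow> pcomp d v \<sigma> \<in> {1..d} \<rightarrow>\<^sub>E S"
  unfolding pcomp_def by (intro restrict_PiE_iff[THEN iffD2] ballI) (metis PiE_mem sym_group_in)

lemma pcomp_pcomp:
  "\<lbrakk>\<sigma> \<in> carrier (sym_group d); \<tau> \<in> carrier (sym_group d)\<rbrakk> \<Longrightarrow> pcomp d (pcomp d v \<sigma>) \<tau> = pcomp d v (\<sigma> \<circ> \<tau>)"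
  unfolding pcomp_def by (rule restrict_ext) (metis comp_apply restrict_apply' sym_group_in)

lemma pcomp_id: "v \<in> {1..d} \<rightarrow>\<^sub>E S \<Longrightarrow> pcomp d v id = v"
  by (auto simp: pcomp_def fun_eq_iff PiE_iff extensional_def)

text \<open>The entry at \<open>i\<close> is read at the position that \<sigma> sends to
  \<open>i\<close>. Linearity in one slot thereby becomes linearity in another.\<close>

lemma pcomp_upd:
  assumes "\<sigma> \<in> carrier (sym_group d)" "i \<in> {1..d}"
  shows "pcomp d (v(i := x)) \<sigma> = (pcomp d v \<sigma>)((inv\<^bsub>sym_group d\<^esub> \<sigma>) i := x)"
  using assms sym_group_in[OF sym_group_inv_closed[OF assms(1)], of i]
  by (auto simp: pcomp_def fun_eq_iff)

locale base =
  fixes k :: "'k ring"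
  assumes k: "cring k"
begin

sublocale k: cring k by (rule k)

lemma self_mod_module: "left_module k (self_mod k)"
  by (rule left_moduleI) (auto simp: k.ring_axioms k.a_ac k.l_distr k.r_distr k.m_ac)

context
  fixes d :: nat and V :: "('k, 'v) module"
  assumes V: "left_module k V"
begin

lemma tpow_module: "left_module k (tpow k d V)"
  unfolding tpow_def by (rule tensor_module[OF k V])

lemma tpow_spans: "spans k (tpow k d V) (tpure k d V ` ({1..d} \<rightarrow>\<^sub>E carrier V))"
  unfolding tpow_def tpure_def by (rule tensor_spans[OF k V])

lemma tpure_closed: "v \<in> {1..d} \<rightarrow>\<^sub>E carrier V \<Longrightarrow> tpure k d V v \<in> carrier (tpow k d V)"
  unfolding tpow_def tpure_def by (rule pure_tensor_closed[OF k V])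

lemma tpure_multilin: "multilin k {1..d} (\<lambda>_. V) (tpow k d V) (tpure k d V)"
  unfolding tpow_def tpure_def by (rule pure_tensor_multilin[OF k V])

lemma tpow_lin_eq:
  assumes "left_module k N" "lin k (tpow k d V) N f" "lin k (tpow k d V) N g"
    and "\<And>v. v \<in> {1..d} \<rightarrow>\<^sub>E carrier V \<Longrightarrow> f (tpure k d V v) = g (tpure k d V v)"
    and "x \<in> carrier (tpow k d V)"
  shows "f x = g x"
  by (rule tensor_lin_eq[OF k V assms(1), of "{1..d}"]) (use assms in \<open>auto simp: tpow_def tpure_def\<close>)

lemma tpow_lift_linmaps:
  "\<lbrakk>left_module k N; multilin k {1..d} (\<lambda>_. V) N g\<rbrakk> \<Longrightarrow>
    tensor_lift k {1..d} (\<lambda>_. V) N g \<in> linmaps k (tpow k d V) N"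
  unfolding tpow_def by (rule tensor_lift_linmaps[OF k V])

lemma tpow_lift_pure:
  "\<lbrakk>left_module k N; multilin k {1..d} (\<lambda>_. V) N g; v \<in> {1..d} \<rightarrow>\<^sub>E carrier V\<rbrakk> \<Longrightarrow>
    tensor_lift k {1..d} (\<lambda>_. V) N g (tpure k d V v) = g v"
  unfolding tpure_def by (rule tensor_lift_pure[OF k V])

lemma multilin_pcomp:
  assumes g: "multilin k {1..d} (\<lambda>_. V) N g" and s: "\<sigma> \<in> carrier (sym_group d)"
  shows "multilin k {1..d} (\<lambda>_. V) N (\<lambda>v. g (pcomp d v \<sigma>))"
  using g s sym_group_in[OF sym_group_inv_closed[OF s]]
  by (simp add: multilin_def pcomp_upd pcomp_closed[OF s])

lemma perm_ract_eq:
  "perm_ract k d V x \<sigma> = tensor_lift k {1..d} (\<lambda>_. V) (tpow k d V) (\<lambda>v. tpure k d V (pcomp d v \<sigma>)) x"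
  by (simp add: perm_ract_def pcomp_def)

lemma perm_ract_lin:
  "\<sigma> \<in> carrier (sym_group d) \<Longrightarrow> lin k (tpow k d V) (tpow k d V) (\<lambda>x. perm_ract k d V x \<sigma>)"
  unfolding perm_ract_eq
  by (rule lin_linmaps[OF tpow_lift_linmaps[OF tpow_module multilin_pcomp[OF tpure_multilin]]])

lemma perm_ract_pure:
  "\<lbrakk>\<sigma> \<in> carrier (sym_group d); v \<in> {1..d} \<rightarrow>\<^sub>E carrier V\<rbrakk> \<Longrightarrow>
    perm_ract k d V (tpure k d V v) \<sigma> = tpure k d V (pcomp d v \<sigma>)"
  unfolding perm_ract_eq
  by (rule tpow_lift_pure[OF tpow_module multilin_pcomp[OF tpure_multilin]])

lemma perm_ract_closed:
  "\<lbrakk>\<sigma> \<in> carrier (sym_group d); x \<in> carrier (tpow k d V)\<rbrakk> \<Longrightarrow> perm_ract k d V x \<sigma> \<in> carrier (tpow k d V)"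
  using lin_closed[OF perm_ract_lin] .

lemma perm_ract_comp:
  assumes "\<sigma> \<in> carrier (sym_group d)" "\<tau> \<in> carrier (sym_group d)" "x \<in> carrier (tpow k d V)"
  shows "perm_ract k d V (perm_ract k d V x \<sigma>) \<tau> = perm_ract k d V x (\<sigma> \<circ> \<tau>)"
  by (rule tpow_lin_eq[OF tpow_module lin_compose[OF perm_ract_lin perm_ract_lin] perm_ract_lin])
    (use assms in \<open>simp_all add: perm_ract_pure pcomp_closed pcomp_pcomp\<close>)

lemma perm_ract_id:
  assumes "x \<in> carrier (tpow k d V)" shows "perm_ract k d V x id = x"
  by (rule tpow_lin_eq[OF tpow_module perm_ract_lin lin_id])
    (use assms in \<open>simp_all add: perm_ract_pure pcomp_id\<close>)

end

subsection \<open>The group algebra\<close>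

lemma kS_simps [simp]:
  "carrier (kS k d) = carrier (free_mod k (carrier (sym_group d)))"
  "\<zero>\<^bsub>kS k d\<^esub> = (\<lambda>_. \<zero>\<^bsub>k\<^esub>)" "a \<oplus>\<^bsub>kS k d\<^esub> b = (\<lambda>\<sigma>. a \<sigma> \<oplus>\<^bsub>k\<^esub> b \<sigma>)"
  "\<one>\<^bsub>kS k d\<^esub> = basis_vec k id"
  by (simp_all add: kS_def Let_def)

lemma kS_mult:
  "\<rho> \<in> carrier (sym_group d) \<Longrightarrow> (a \<otimes>\<^bsub>kS k d\<^esub> b) \<rho> =
    (\<Oplus>\<^bsub>k\<^esub>\<sigma>\<in>carrier (sym_group d). a \<sigma> \<otimes>\<^bsub>k\<^esub> b (inv\<^bsub>sym_group d\<^esub> \<sigma> \<circ> \<rho>))"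
  "\<rho> \<notin> carrier (sym_group d) \<Longrightarrow> (a \<otimes>\<^bsub>kS k d\<^esub> b) \<rho> = \<zero>\<^bsub>k\<^esub>"
  by (simp_all add: kS_def Let_def)

text \<open>The condition of finite support in \<open>free_mod\<close> is automatic, as the
  symmetric group is finite.\<close>

lemma kS_carrier:
  "a \<in> carrier (kS k d) \<longleftrightarrow> (\<forall>\<sigma>\<in>carrier (sym_group d). a \<sigma> \<in> carrier k) \<and>
    (\<forall>\<sigma>. \<sigma> \<notin> carrier (sym_group d) \<longrightarrow> a \<sigma> = \<zero>\<^bsub>k\<^esub>)"
proof -
  have "finite {\<sigma>. a \<sigma> \<noteq> \<zero>\<^bsub>k\<^esub>}" if "\<forall>\<sigma>. \<sigma> \<notin> carrier (sym_group d) \<longrightarrow> a \<sigma> = \<zero>\<^bsub>k\<^esub>"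
    by (rule finite_subset[OF _ sym_group_finite[of d]]) (use that in auto)
  then show ?thesis by (auto simp: free_mod_carrier)
qed

lemma kS_closed: "a \<in> carrier (kS k d) \<Longrightarrow> a \<sigma> \<in> carrier k"
  using free_mod_closed[OF k, of a "carrier (sym_group d)"] by simp

lemma kS_eqI:
  "\<lbrakk>a \<in> carrier (kS k d); b \<in> carrier (kS k d); \<And>\<sigma>. \<sigma> \<in> carrier (sym_group d) \<Longrightarrow> a \<sigma> = b \<sigma>\<rbrakk> \<Longrightarrow> a = b"
  unfolding kS_carrier by (metis ext)

lemma kS_mult_closed:
  assumes "a \<in> carrier (kS k d)" "b \<in> carrier (kS k d)"
  shows "a \<otimes>\<^bsub>kS k d\<^esub> b \<in> carrier (kS k d)"
  unfolding kS_carrier using kS_closed[OF assms(1)] kS_closed[OF assms(2)]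
  by (auto simp: kS_mult intro!: k.finsum_closed)

lemma kS_basis [simp]: "\<sigma> \<in> carrier (sym_group d) \<Longrightarrow> basis_vec k \<sigma> \<in> carrier (kS k d)"
  using basis_vec_closed[OF k] by simp

text \<open>The substitution of \<sigma> \<circ> \<tau> for \<rho> in the convolution. As
  \<open>h\<close> takes values in any module, the same identity yields associativity of the group
  algebra, of its right action on tensor powers and of its left action.\<close>

lemma convolution_sum:
  assumes N: "left_module k N" and h: "\<And>\<sigma>. \<sigma> \<in> carrier (sym_group d) \<Longrightarrow> h \<sigma> \<in> carrier N"
    and a: "a \<in> carrier (kS k d)" and b: "b \<in> carrier (kS k d)"
  shows "(\<Oplus>\<^bsub>N\<^esub>\<rho>\<in>carrier (sym_group d). (a \<otimes>\<^bsub>kS k d\<^esub> b) \<rho> \<odot>\<^bsub>N\<^esub> h \<rho>) =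
    (\<Oplus>\<^bsub>N\<^esub>\<sigma>\<in>carrier (sym_group d). \<Oplus>\<^bsub>N\<^esub>\<tau>\<in>carrier (sym_group d). a \<sigma> \<odot>\<^bsub>N\<^esub> (b \<tau> \<odot>\<^bsub>N\<^esub> h (\<sigma> \<circ> \<tau>)))"
    (is "?L = ?R")
proof -
  let ?G = "carrier (sym_group d)"
  interpret N: left_module k N by fact
  note ac = kS_closed[OF a] and bc = kS_closed[OF b]
  have "?L = (\<Oplus>\<^bsub>N\<^esub>\<rho>\<in>?G. \<Oplus>\<^bsub>N\<^esub>\<sigma>\<in>?G. (a \<sigma> \<otimes>\<^bsub>k\<^esub> b (inv\<^bsub>sym_group d\<^esub> \<sigma> \<circ> \<rho>)) \<odot>\<^bsub>N\<^esub> h \<rho>)"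
    using h ac bc by (intro N.finsum_cong') (auto simp: kS_mult N.finsum_smult intro!: N.finsum_closed)
  also have "\<dots> = (\<Oplus>\<^bsub>N\<^esub>\<sigma>\<in>?G. \<Oplus>\<^bsub>N\<^esub>\<rho>\<in>?G. (a \<sigma> \<otimes>\<^bsub>k\<^esub> b (inv\<^bsub>sym_group d\<^esub> \<sigma> \<circ> \<rho>)) \<odot>\<^bsub>N\<^esub> h \<rho>)"
    using h ac bc by (intro N.finsum_swap) auto
  also have "\<dots> = ?R"
  proof (rule N.finsum_cong')
    fix \<sigma> assume s: "\<sigma> \<in> ?G"
    have "(\<Oplus>\<^bsub>N\<^esub>\<rho>\<in>?G. (a \<sigma> \<otimes>\<^bsub>k\<^esub> b (inv\<^bsub>sym_group d\<^esub> \<sigma> \<circ> \<rho>)) \<odot>\<^bsub>N\<^esub> h \<rho>)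
      = (\<Oplus>\<^bsub>N\<^esub>\<tau>\<in>?G. (a \<sigma> \<otimes>\<^bsub>k\<^esub> b (inv\<^bsub>sym_group d\<^esub> \<sigma> \<circ> (\<sigma> \<circ> \<tau>))) \<odot>\<^bsub>N\<^esub> h (\<sigma> \<circ> \<tau>))"
      using h ac bc s by (intro N.finsum_reindex_bij sym_group_bij_left) auto
    also have "\<dots> = (\<Oplus>\<^bsub>N\<^esub>\<tau>\<in>?G. a \<sigma> \<odot>\<^bsub>N\<^esub> (b \<tau> \<odot>\<^bsub>N\<^esub> h (\<sigma> \<circ> \<tau>)))"
      using h ac bc s by (intro N.finsum_cong') (auto simp: o_assoc N.smult_assoc)
    finally show "(\<Oplus>\<^bsub>N\<^esub>\<rho>\<in>?G. (a \<sigma> \<otimes>\<^bsub>k\<^esub> b (inv\<^bsub>sym_group d\<^esub> \<sigma> \<circ> \<rho>)) \<odot>\<^bsub>N\<^esub> h \<rho>) = \<dots>" .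
  qed (use h ac bc in \<open>auto intro!: N.finsum_closed\<close>)
  finally show ?thesis .
qed

lemma basis_sum:
  assumes N: "left_module k N" and h: "\<And>\<sigma>. \<sigma> \<in> carrier (sym_group d) \<Longrightarrow> h \<sigma> \<in> carrier N"
    and s: "\<rho> \<in> carrier (sym_group d)"
  shows "(\<Oplus>\<^bsub>N\<^esub>\<sigma>\<in>carrier (sym_group d). basis_vec k \<rho> \<sigma> \<odot>\<^bsub>N\<^esub> h \<sigma>) = h \<rho>"
proof -
  interpret N: left_module k N by fact
  have "(\<Oplus>\<^bsub>N\<^esub>\<sigma>\<in>carrier (sym_group d). basis_vec k \<rho> \<sigma> \<odot>\<^bsub>N\<^esub> h \<sigma>) = basis_vec k \<rho> \<rho> \<odot>\<^bsub>N\<^esub> h \<rho>"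
    using h s by (intro N.finsum_single) (auto simp: basis_vec_def)
  then show ?thesis using h[OF s] by (simp add: basis_vec_def N.smult_one)
qed

lemma kS_ring: "ring (kS k d)"
proof -
  let ?G = "carrier (sym_group d)"
  interpret F: left_module k "free_mod k ?G" by (rule free_mod_module[OF k])
  have ag: "abelian_group (kS k d)"
  proof (rule abelian_groupI)
    fix a assume "a \<in> carrier (kS k d)"
    then show "\<exists>b\<in>carrier (kS k d). b \<oplus>\<^bsub>kS k d\<^esub> a = \<zero>\<^bsub>kS k d\<^esub>"
      using F.l_neg[of a] F.a_inv_closed[of a] by auto
  qed (use F.a_closed F.zero_closed F.a_assoc F.a_comm F.l_zero in auto)
  show ?thesis
  proof (rule ringI[OF ag monoidI])
    fix a b c assume a: "a \<in> carrier (kS k d)" and b: "b \<in> carrier (kS k d)" and c: "c \<in> carrier (kS k d)"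
    note cl = kS_closed[OF a] kS_closed[OF b] kS_closed[OF c]
    have sum: "a \<oplus>\<^bsub>kS k d\<^esub> b \<in> carrier (kS k d)" if "a \<in> carrier (kS k d)" "b \<in> carrier (kS k d)" for a b
      using F.a_closed that by simp
    show "(a \<oplus>\<^bsub>kS k d\<^esub> b) \<otimes>\<^bsub>kS k d\<^esub> c = (a \<otimes>\<^bsub>kS k d\<^esub> c) \<oplus>\<^bsub>kS k d\<^esub> (b \<otimes>\<^bsub>kS k d\<^esub> c)"
    proof (rule kS_eqI)
      fix \<rho> assume r: "\<rho> \<in> ?G"
      have "(\<Oplus>\<^bsub>k\<^esub>\<sigma>\<in>?G. (a \<sigma> \<oplus>\<^bsub>k\<^esub> b \<sigma>) \<otimes>\<^bsub>k\<^esub> c (inv\<^bsub>sym_group d\<^esub> \<sigma> \<circ> \<rho>)) =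
        (\<Oplus>\<^bsub>k\<^esub>\<sigma>\<in>?G. a \<sigma> \<otimes>\<^bsub>k\<^esub> c (inv\<^bsub>sym_group d\<^esub> \<sigma> \<circ> \<rho>) \<oplus>\<^bsub>k\<^esub> b \<sigma> \<otimes>\<^bsub>k\<^esub> c (inv\<^bsub>sym_group d\<^esub> \<sigma> \<circ> \<rho>))"
        using cl by (intro k.finsum_cong') (auto simp: k.l_distr)
      also have "\<dots> = (\<Oplus>\<^bsub>k\<^esub>\<sigma>\<in>?G. a \<sigma> \<otimes>\<^bsub>k\<^esub> c (inv\<^bsub>sym_group d\<^esub> \<sigma> \<circ> \<rho>)) \<oplus>\<^bsub>k\<^esub>
          (\<Oplus>\<^bsub>k\<^esub>\<sigma>\<in>?G. b \<sigma> \<otimes>\<^bsub>k\<^esub> c (inv\<^bsub>sym_group d\<^esub> \<sigma> \<circ> \<rho>))"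
        using cl by (intro k.finsum_addf) auto
      finally show "((a \<oplus>\<^bsub>kS k d\<^esub> b) \<otimes>\<^bsub>kS k d\<^esub> c) \<rho> = ((a \<otimes>\<^bsub>kS k d\<^esub> c) \<oplus>\<^bsub>kS k d\<^esub> (b \<otimes>\<^bsub>kS k d\<^esub> c)) \<rho>"
        using r by (simp add: kS_mult)
    qed (intro sum kS_mult_closed a b c)+
    show "c \<otimes>\<^bsub>kS k d\<^esub> (a \<oplus>\<^bsub>kS k d\<^esub> b) = (c \<otimes>\<^bsub>kS k d\<^esub> a) \<oplus>\<^bsub>kS k d\<^esub> (c \<otimes>\<^bsub>kS k d\<^esub> b)"
    proof (rule kS_eqI)
      fix \<rho> assume r: "\<rho> \<in> ?G"
      have "(\<Oplus>\<^bsub>k\<^esub>\<sigma>\<in>?G. c \<sigma> \<otimes>\<^bsub>k\<^esub> (a (inv\<^bsub>sym_group d\<^esub> \<sigma> \<circ> \<rho>) \<oplus>\<^bsub>k\<^esub> b (inv\<^bsub>sym_group d\<^esub> \<sigma> \<circ> \<rho>))) =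
        (\<Oplus>\<^bsub>k\<^esub>\<sigma>\<in>?G. c \<sigma> \<otimes>\<^bsub>k\<^esub> a (inv\<^bsub>sym_group d\<^esub> \<sigma> \<circ> \<rho>) \<oplus>\<^bsub>k\<^esub> c \<sigma> \<otimes>\<^bsub>k\<^esub> b (inv\<^bsub>sym_group d\<^esub> \<sigma> \<circ> \<rho>))"
        using cl by (intro k.finsum_cong') (auto simp: k.r_distr)
      also have "\<dots> = (\<Oplus>\<^bsub>k\<^esub>\<sigma>\<in>?G. c \<sigma> \<otimes>\<^bsub>k\<^esub> a (inv\<^bsub>sym_group d\<^esub> \<sigma> \<circ> \<rho>)) \<oplus>\<^bsub>k\<^esub>
          (\<Oplus>\<^bsub>k\<^esub>\<sigma>\<in>?G. c \<sigma> \<otimes>\<^bsub>k\<^esub> b (inv\<^bsub>sym_group d\<^esub> \<sigma> \<circ> \<rho>))"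
        using cl by (intro k.finsum_addf) auto
      finally show "(c \<otimes>\<^bsub>kS k d\<^esub> (a \<oplus>\<^bsub>kS k d\<^esub> b)) \<rho> = ((c \<otimes>\<^bsub>kS k d\<^esub> a) \<oplus>\<^bsub>kS k d\<^esub> (c \<otimes>\<^bsub>kS k d\<^esub> b)) \<rho>"
        using r by (simp add: kS_mult)
    qed (intro sum kS_mult_closed a b c)+
    show "a \<otimes>\<^bsub>kS k d\<^esub> b \<otimes>\<^bsub>kS k d\<^esub> c = a \<otimes>\<^bsub>kS k d\<^esub> (b \<otimes>\<^bsub>kS k d\<^esub> c)"
    proof (rule kS_eqI)
      fix \<rho> assume r: "\<rho> \<in> ?G"
      have "(a \<otimes>\<^bsub>kS k d\<^esub> b \<otimes>\<^bsub>kS k d\<^esub> c) \<rho> = (\<Oplus>\<^bsub>k\<^esub>\<sigma>\<in>?G. \<Oplus>\<^bsub>k\<^esub>\<tau>\<in>?G.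
          a \<sigma> \<otimes>\<^bsub>k\<^esub> (b \<tau> \<otimes>\<^bsub>k\<^esub> c (inv\<^bsub>sym_group d\<^esub> (\<sigma> \<circ> \<tau>) \<circ> \<rho>)))"
        using convolution_sum[OF self_mod_module _ a b, of "\<lambda>\<sigma>. c (inv\<^bsub>sym_group d\<^esub> \<sigma> \<circ> \<rho>)"] cl r
        by (simp add: kS_mult finsum_self_mod)
      also have "\<dots> = (\<Oplus>\<^bsub>k\<^esub>\<sigma>\<in>?G. a \<sigma> \<otimes>\<^bsub>k\<^esub> (\<Oplus>\<^bsub>k\<^esub>\<tau>\<in>?G.
          b \<tau> \<otimes>\<^bsub>k\<^esub> c (inv\<^bsub>sym_group d\<^esub> \<tau> \<circ> (inv\<^bsub>sym_group d\<^esub> \<sigma> \<circ> \<rho>))))"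
        using cl by (intro k.finsum_cong')
          (auto simp: sym_group_inv_comp o_assoc k.finsum_rdistr intro!: k.finsum_closed k.finsum_cong')
      also have "\<dots> = (a \<otimes>\<^bsub>kS k d\<^esub> (b \<otimes>\<^bsub>kS k d\<^esub> c)) \<rho>"
        using r cl by (auto simp: kS_mult intro!: k.finsum_cong' k.finsum_closed)
      finally show "(a \<otimes>\<^bsub>kS k d\<^esub> b \<otimes>\<^bsub>kS k d\<^esub> c) \<rho> = \<dots>" .
    qed (intro kS_mult_closed a b c)+
    show "\<one>\<^bsub>kS k d\<^esub> \<otimes>\<^bsub>kS k d\<^esub> a = a"
    proof (rule kS_eqI)
      fix \<rho> assume r: "\<rho> \<in> ?G"
      have i: "inv\<^bsub>sym_group d\<^esub> id = id" using monoid.inv_one[OF group.is_monoid[OF sym_group_is_group[of d]]] by simp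
      show "(\<one>\<^bsub>kS k d\<^esub> \<otimes>\<^bsub>kS k d\<^esub> a) \<rho> = a \<rho>"
        using basis_sum[OF self_mod_module _ sym_group_id, of d "\<lambda>\<sigma>. a (inv\<^bsub>sym_group d\<^esub> \<sigma> \<circ> \<rho>)"] r cl i
        by (simp add: kS_mult finsum_self_mod)
    qed (use a kS_mult_closed kS_basis[OF sym_group_id] in auto)
    show "a \<otimes>\<^bsub>kS k d\<^esub> \<one>\<^bsub>kS k d\<^esub> = a"
    proof (rule kS_eqI)
      fix \<rho> assume r: "\<rho> \<in> ?G"
      have "(a \<otimes>\<^bsub>kS k d\<^esub> \<one>\<^bsub>kS k d\<^esub>) \<rho> = (\<Oplus>\<^bsub>k\<^esub>\<sigma>\<in>?G. basis_vec k \<rho> \<sigma> \<otimes>\<^bsub>k\<^esub> a \<sigma>)"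
      proof -
        have "inv\<^bsub>sym_group d\<^esub> \<sigma> \<circ> \<rho> = id \<longleftrightarrow> \<sigma> = \<rho>" if "\<sigma> \<in> ?G" for \<sigma>
          using that r by (metis comp_id o_assoc sym_group_l_inv sym_group_r_inv id_comp)
        then show ?thesis using r cl
          by (auto simp: kS_mult basis_vec_def intro!: k.finsum_cong')
      qed
      then show "(a \<otimes>\<^bsub>kS k d\<^esub> \<one>\<^bsub>kS k d\<^esub>) \<rho> = a \<rho>"
        using basis_sum[OF self_mod_module _ r, of a] cl by (simp add: finsum_self_mod)
    qed (use a kS_mult_closed kS_basis[OF sym_group_id] in auto)
  qed (use kS_mult_closed kS_basis[OF sym_group_id] in auto)
qed

context
  fixes d :: nat and V :: "('k, 'v) module"
  assumes V: "left_module k V"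
begin

interpretation T: left_module k "tpow k d V" by (rule tpow_module[OF V])

lemma kS_ract_lin:
  assumes "a \<in> carrier (kS k d)"
  shows "lin k (tpow k d V) (tpow k d V) (\<lambda>x. kS_ract k d V x a)"
  unfolding kS_ract_def
  by (intro lin_sum lin_scale[OF k] tpow_module V perm_ract_lin kS_closed[OF assms])

lemma kS_ract_closed:
  "\<lbrakk>a \<in> carrier (kS k d); x \<in> carrier (tpow k d V)\<rbrakk> \<Longrightarrow> kS_ract k d V x a \<in> carrier (tpow k d V)"
  by (rule lin_closed[OF kS_ract_lin])

text \<open>The record \<open>kS k d\<close> is a ring without scalars from \<open>k\<close>, so
  linearity in the algebra element is expressed over the free module underlying it.\<close>

lemma kS_ract_lin2:
  assumes x: "x \<in> carrier (tpow k d V)"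
  shows "lin k (free_mod k (carrier (sym_group d))) (tpow k d V) (\<lambda>a. kS_ract k d V x a)"
proof (rule linI)
  note pc = perm_ract_closed[OF V _ x]
  fix a assume a: "a \<in> carrier (free_mod k (carrier (sym_group d)))"
  note ac = free_mod_closed[OF k a]
  show "kS_ract k d V x a \<in> carrier (tpow k d V)" using kS_ract_closed a x by simp
  { fix b assume b: "b \<in> carrier (free_mod k (carrier (sym_group d)))"
    note bc = free_mod_closed[OF k b]
    show "kS_ract k d V x (a \<oplus>\<^bsub>free_mod k (carrier (sym_group d))\<^esub> b) =
        kS_ract k d V x a \<oplus>\<^bsub>tpow k d V\<^esub> kS_ract k d V x b"
      unfolding kS_ract_def using ac bc pc
      by (subst T.finsum_addf[symmetric]) (auto intro!: T.finsum_cong' simp: T.smult_l_distr simp del: T.finsum_addf) }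
  { fix c assume c: "c \<in> carrier k"
    show "kS_ract k d V x (c \<odot>\<^bsub>free_mod k (carrier (sym_group d))\<^esub> a) = c \<odot>\<^bsub>tpow k d V\<^esub> kS_ract k d V x a"
      unfolding kS_ract_def using ac c pc
      by (subst T.smult_finsum) (auto intro!: T.finsum_cong' simp: T.smult_assoc) }
qed

lemma kS_ract_basis:
  "\<lbrakk>x \<in> carrier (tpow k d V); \<sigma> \<in> carrier (sym_group d)\<rbrakk> \<Longrightarrow>
    kS_ract k d V x (basis_vec k \<sigma>) = perm_ract k d V x \<sigma>"
  unfolding kS_ract_def by (rule basis_sum[OF tpow_module[OF V] perm_ract_closed[OF V]])

lemma kS_ract_one: "x \<in> carrier (tpow k d V) \<Longrightarrow> kS_ract k d V x \<one>\<^bsub>kS k d\<^esub> = x"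
  by (simp add: kS_ract_basis perm_ract_id[OF V])

lemma kS_ract_assoc:
  assumes x: "x \<in> carrier (tpow k d V)" and a: "a \<in> carrier (kS k d)" and b: "b \<in> carrier (kS k d)"
  shows "kS_ract k d V (kS_ract k d V x a) b = kS_ract k d V x (a \<otimes>\<^bsub>kS k d\<^esub> b)"
proof -
  let ?G = "carrier (sym_group d)" and ?T = "tpow k d V"
  note pl = perm_ract_lin[OF V]
  note pc = perm_ract_closed[OF V]
  note cl = kS_closed[OF a] kS_closed[OF b] pc x
  have "kS_ract k d V (kS_ract k d V x a) b =
    (\<Oplus>\<^bsub>?T\<^esub>\<tau>\<in>?G. \<Oplus>\<^bsub>?T\<^esub>\<sigma>\<in>?G. a \<sigma> \<odot>\<^bsub>?T\<^esub> (b \<tau> \<odot>\<^bsub>?T\<^esub> perm_ract k d V x (\<sigma> \<circ> \<tau>)))"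
    unfolding kS_ract_def
  proof (rule T.finsum_cong')
    fix \<tau> assume t: "\<tau> \<in> ?G"
    have "perm_ract k d V (\<Oplus>\<^bsub>?T\<^esub>\<sigma>\<in>?G. a \<sigma> \<odot>\<^bsub>?T\<^esub> perm_ract k d V x \<sigma>) \<tau> =
      (\<Oplus>\<^bsub>?T\<^esub>\<sigma>\<in>?G. perm_ract k d V (a \<sigma> \<odot>\<^bsub>?T\<^esub> perm_ract k d V x \<sigma>) \<tau>)"
      using t cl by (intro lin_finsum[OF T.left_module_axioms T.left_module_axioms pl]) auto
    also have "\<dots> = (\<Oplus>\<^bsub>?T\<^esub>\<sigma>\<in>?G. a \<sigma> \<odot>\<^bsub>?T\<^esub> perm_ract k d V x (\<sigma> \<circ> \<tau>))"
      using t cl by (intro T.finsum_cong') (auto simp: lin_smult[OF pl] perm_ract_comp[OF V])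
    finally have *: "perm_ract k d V (\<Oplus>\<^bsub>?T\<^esub>\<sigma>\<in>?G. a \<sigma> \<odot>\<^bsub>?T\<^esub> perm_ract k d V x \<sigma>) \<tau> = \<dots>" .
    show "b \<tau> \<odot>\<^bsub>?T\<^esub> perm_ract k d V (\<Oplus>\<^bsub>?T\<^esub>\<sigma>\<in>?G. a \<sigma> \<odot>\<^bsub>?T\<^esub> perm_ract k d V x \<sigma>) \<tau> =
        (\<Oplus>\<^bsub>?T\<^esub>\<sigma>\<in>?G. a \<sigma> \<odot>\<^bsub>?T\<^esub> (b \<tau> \<odot>\<^bsub>?T\<^esub> perm_ract k d V x (\<sigma> \<circ> \<tau>)))"
      \<comment> \<open>Commutativity of \<open>k\<close> enters here: the coefficients
        \<open>a \<sigma>\<close> and \<open>b \<tau>\<close> arrive in the wrong order.\<close>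
      unfolding * using t cl
      by (subst T.smult_finsum) (auto intro!: T.finsum_cong' simp: T.smult_assoc[symmetric] k.m_comm)
  qed (use cl in \<open>auto intro!: T.finsum_closed\<close>)
  also have "\<dots> = (\<Oplus>\<^bsub>?T\<^esub>\<sigma>\<in>?G. \<Oplus>\<^bsub>?T\<^esub>\<tau>\<in>?G. a \<sigma> \<odot>\<^bsub>?T\<^esub> (b \<tau> \<odot>\<^bsub>?T\<^esub> perm_ract k d V x (\<sigma> \<circ> \<tau>)))"
    using cl by (intro T.finsum_swap) auto
  also have "\<dots> = kS_ract k d V x (a \<otimes>\<^bsub>kS k d\<^esub> b)"
    unfolding kS_ract_def using cl by (intro convolution_sum[symmetric] T.left_module_axioms a b) auto
  finally show ?thesis .
qed

text \<open>Inverses turn the right action by permutations into a left one; their reversal of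
  products is what makes \<open>convolution_sum\<close> match the nested action.\<close>

lemma kS_lact_module:
  "left_module (kS k d) (mk_module (carrier (tpow k d V)) \<zero>\<^bsub>tpow k d V\<^esub> (add (tpow k d V)) (kS_lact k d V))"
proof (rule left_moduleI[OF kS_ring]; unfold mk_module_simps)
  let ?G = "carrier (sym_group d)" and ?T = "tpow k d V"
  note pl = perm_ract_lin[OF V]
  note pc = perm_ract_closed[OF V]
  show lc: "kS_lact k d V a x \<in> carrier ?T" if "a \<in> carrier (kS k d)" "x \<in> carrier ?T" for a x
    unfolding kS_lact_def using kS_closed[OF that(1)] that(2) pc by (intro T.finsum_closed) auto
  fix x assume x: "x \<in> carrier ?T"
  show "kS_lact k d V \<zero>\<^bsub>kS k d\<^esub> x = \<zero>\<^bsub>?T\<^esub>"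
    unfolding kS_lact_def using x pc T.add.finprod_one[of ?G] by (auto intro: trans[OF T.finsum_cong'])
  show "kS_lact k d V \<one>\<^bsub>kS k d\<^esub> x = x"
    using basis_sum[OF T.left_module_axioms _ sym_group_id, of d "\<lambda>\<sigma>. perm_ract k d V x (inv\<^bsub>sym_group d\<^esub> \<sigma>)"]
      x pc monoid.inv_one[OF group.is_monoid[OF sym_group_is_group[of d]]]
    by (simp add: kS_lact_def perm_ract_id[OF V])
  fix a assume a: "a \<in> carrier (kS k d)"
  { fix y assume y: "y \<in> carrier ?T"
    show "kS_lact k d V a (x \<oplus>\<^bsub>?T\<^esub> y) = kS_lact k d V a x \<oplus>\<^bsub>?T\<^esub> kS_lact k d V a y"
      unfolding kS_lact_def using x y pc kS_closed[OF a]
      by (subst T.finsum_addf[symmetric])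
        (auto intro!: T.finsum_cong' simp: T.smult_r_distr lin_add[OF pl] simp del: T.finsum_addf) }
  fix b assume b: "b \<in> carrier (kS k d)"
  note cl = kS_closed[OF a] kS_closed[OF b] pc x
  show "kS_lact k d V (a \<oplus>\<^bsub>kS k d\<^esub> b) x = kS_lact k d V a x \<oplus>\<^bsub>?T\<^esub> kS_lact k d V b x"
    unfolding kS_lact_def using cl
    by (subst T.finsum_addf[symmetric]) (auto intro!: T.finsum_cong' simp: T.smult_l_distr simp del: T.finsum_addf)
  have "kS_lact k d V (a \<otimes>\<^bsub>kS k d\<^esub> b) x = (\<Oplus>\<^bsub>?T\<^esub>\<sigma>\<in>?G. \<Oplus>\<^bsub>?T\<^esub>\<tau>\<in>?G.
     a \<sigma> \<odot>\<^bsub>?T\<^esub> (b \<tau> \<odot>\<^bsub>?T\<^esub> perm_ract k d V x (inv\<^bsub>sym_group d\<^esub> (\<sigma> \<circ> \<tau>))))"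
    unfolding kS_lact_def using cl by (intro convolution_sum T.left_module_axioms a b) auto
  also have "\<dots> = kS_lact k d V a (kS_lact k d V b x)"
    unfolding kS_lact_def[of _ _ _ a]
  proof (rule T.finsum_cong')
    fix \<sigma> assume s: "\<sigma> \<in> ?G"
    have "perm_ract k d V (kS_lact k d V b x) (inv\<^bsub>sym_group d\<^esub> \<sigma>) =
      (\<Oplus>\<^bsub>?T\<^esub>\<tau>\<in>?G. perm_ract k d V (b \<tau> \<odot>\<^bsub>?T\<^esub> perm_ract k d V x (inv\<^bsub>sym_group d\<^esub> \<tau>)) (inv\<^bsub>sym_group d\<^esub> \<sigma>))"
      unfolding kS_lact_def using s cl
      by (intro lin_finsum[OF T.left_module_axioms T.left_module_axioms pl]) auto
    also have "\<dots> = (\<Oplus>\<^bsub>?T\<^esub>\<tau>\<in>?G. b \<tau> \<odot>\<^bsub>?T\<^esub> perm_ract k d V x (inv\<^bsub>sym_group d\<^esub> (\<sigma> \<circ> \<tau>)))"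
      using s cl by (intro T.finsum_cong') (auto simp: lin_smult[OF pl] perm_ract_comp[OF V] sym_group_inv_comp)
    finally show "(\<Oplus>\<^bsub>?T\<^esub>\<tau>\<in>?G. a \<sigma> \<odot>\<^bsub>?T\<^esub> (b \<tau> \<odot>\<^bsub>?T\<^esub> perm_ract k d V x (inv\<^bsub>sym_group d\<^esub> (\<sigma> \<circ> \<tau>)))) =
       a \<sigma> \<odot>\<^bsub>?T\<^esub> perm_ract k d V (kS_lact k d V b x) (inv\<^bsub>sym_group d\<^esub> \<sigma>)"
      using s cl by (subst T.smult_finsum[symmetric]) auto
  qed (use cl lc[OF b x] in auto)
  finally show "kS_lact k d V (a \<otimes>\<^bsub>kS k d\<^esub> b) x = kS_lact k d V a (kS_lact k d V b x)" .
qed (simp_all add: T.a_ac)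

end

text \<open>Morphisms of \<open>GammaP\<close> are only required to commute with permutations;
  linearity extends this to the group algebra.\<close>

lemma kS_ract_equivariant:
  assumes "left_module k V" "left_module k W" "lin k (tpow k d V) (tpow k d W) f"
    and "\<And>\<sigma> x. \<lbrakk>\<sigma> \<in> carrier (sym_group d); x \<in> carrier (tpow k d V)\<rbrakk> \<Longrightarrow>
      f (perm_ract k d V x \<sigma>) = perm_ract k d W (f x) \<sigma>"
    and x: "x \<in> carrier (tpow k d V)" and a: "a \<in> carrier (kS k d)"
  shows "f (kS_ract k d V x a) = kS_ract k d W (f x) a"
proof -
  interpret T: left_module k "tpow k d V" by (rule tpow_module) fact
  interpret U: left_module k "tpow k d W" by (rule tpow_module) fact
  note pc = perm_ract_closed[OF assms(1) _ x]
  have "f (kS_ract k d V x a) =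
    (\<Oplus>\<^bsub>tpow k d W\<^esub>\<sigma>\<in>carrier (sym_group d). f (a \<sigma> \<odot>\<^bsub>tpow k d V\<^esub> perm_ract k d V x \<sigma>))"
    unfolding kS_ract_def using pc kS_closed[OF a]
    by (intro lin_finsum[OF T.left_module_axioms U.left_module_axioms assms(3)]) auto
  also have "\<dots> = kS_ract k d W (f x) a"
    unfolding kS_ract_def
    using pc kS_closed[OF a] lin_closed[OF assms(3) x] perm_ract_closed[OF assms(2)]
    by (intro U.finsum_cong') (auto simp: lin_smult[OF assms(3)] assms(4) x)
  finally show ?thesis .
qed

end

subsection \<open>Direct summands are retracts\<close>

lemma lin_inv:
  assumes "left_module A M" "lin A M N f" "bij_betw f (carrier M) (carrier N)"
  shows "lin A N M (inv_into (carrier M) f)"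
proof -
  interpret M: left_module A M by fact
  let ?g = "inv_into (carrier M) f"
  note b = bij_betw_inv_into_left[OF assms(3)] bij_betw_inv_into_right[OF assms(3)]
  have c: "?g y \<in> carrier M" if "y \<in> carrier N" for y
    using bij_betwE[OF bij_betw_inv_into[OF assms(3)]] that by blast
  show ?thesis
  proof (rule linI)
    fix x y assume "x \<in> carrier N" "y \<in> carrier N"
    then show "?g (x \<oplus>\<^bsub>N\<^esub> y) = ?g x \<oplus>\<^bsub>M\<^esub> ?g y"
      using b(1)[OF M.a_closed[OF c c], of x y] by (simp add: lin_add[OF assms(2)] b c)
  next
    fix a x assume "a \<in> carrier A" "x \<in> carrier N"
    then show "?g (a \<odot>\<^bsub>N\<^esub> x) = a \<odot>\<^bsub>M\<^esub> ?g x"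
      using b(1)[OF M.smult_closed[OF _ c], of a x] by (simp add: lin_smult[OF assms(2)] b c)
  qed (rule c)
qed

lemma dsum2_simps [simp]:
  "carrier (dsum2 M N) = carrier M \<times> carrier N" "\<zero>\<^bsub>dsum2 M N\<^esub> = (\<zero>\<^bsub>M\<^esub>, \<zero>\<^bsub>N\<^esub>)"
  "(x, y) \<oplus>\<^bsub>dsum2 M N\<^esub> (x', y') = (x \<oplus>\<^bsub>M\<^esub> x', y \<oplus>\<^bsub>N\<^esub> y')"
  "a \<odot>\<^bsub>dsum2 M N\<^esub> (x, y) = (a \<odot>\<^bsub>M\<^esub> x, a \<odot>\<^bsub>N\<^esub> y)"
  by (simp_all add: dsum2_def)

lemma lin_fst: "lin A (dsum2 M N) M fst" and lin_snd: "lin A (dsum2 M N) N snd"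
  by (auto simp: lin_def)

lemma lin_inl:
  assumes "left_module A N" shows "lin A M (dsum2 M N) (\<lambda>x. (x, \<zero>\<^bsub>N\<^esub>))"
proof -
  interpret N: left_module A N by fact
  show ?thesis by (rule linI) auto
qed

text \<open>The complement of a retract. Its elements are elements of \<open>N\<close>, so it has
  the carrier type that \<open>summand\<close> prescribes for complements.\<close>

definition ker_mod :: "('r, 'a) module \<Rightarrow> ('r, 'b) module \<Rightarrow> ('a \<Rightarrow> 'b) \<Rightarrow> ('r, 'a) module" where
  "ker_mod N M p = mk_module {x \<in> carrier N. p x = \<zero>\<^bsub>M\<^esub>} \<zero>\<^bsub>N\<^esub> (add N) (smult N)"

lemma ker_mod_module:
  assumes "left_module A N" "left_module A M" "lin A N M p" shows "left_module A (ker_mod N M p)"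
  by (rule left_module_submod[OF assms(1) submod_kernel[OF assms]]) (simp_all add: ker_mod_def)

text \<open>An element \<open>x\<close> splits into \<open>i (p x)\<close> and a remainder that
  \<open>p\<close> kills; the inverse map adds the two parts back together.\<close>

lemma retract_splitting:
  assumes M: "left_module A M" and N: "left_module A N" and i: "lin A M N i" and p: "lin A N M p"
    and pi: "\<And>x. x \<in> carrier M \<Longrightarrow> p (i x) = x"
  shows "(\<lambda>x\<in>carrier N. (p x, x \<ominus>\<^bsub>N\<^esub> i (p x))) \<in> lin_isos A N (dsum2 M (ker_mod N M p))"
proof -
  interpret M: left_module A M by fact
  interpret N: left_module A N by fact
  note cl = lin_closed[OF i] lin_closed[OF p]
  define q where "q x = x \<ominus>\<^bsub>N\<^esub> i (p x)" for x
  have m: "x \<ominus>\<^bsub>N\<^esub> x = \<zero>\<^bsub>N\<^esub>" if "x \<in> carrier N" for x using that by (simp add: N.minus_eq N.r_neg)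
  have q: "lin A N N q"
  proof (rule linI)
    fix x y assume "x \<in> carrier N" "y \<in> carrier N"
    then show "q (x \<oplus>\<^bsub>N\<^esub> y) = q x \<oplus>\<^bsub>N\<^esub> q y"
      using cl by (simp add: q_def lin_add[OF i] lin_add[OF p] N.minus_eq N.minus_add N.a_ac)
  next
    fix a x assume a: "a \<in> carrier A" and x: "x \<in> carrier N"
    have "a \<odot>\<^bsub>N\<^esub> (\<ominus>\<^bsub>N\<^esub> y) = \<ominus>\<^bsub>N\<^esub> (a \<odot>\<^bsub>N\<^esub> y)" if y: "y \<in> carrier N" for y
      using N.smult_r_distr[OF a y, of "\<ominus>\<^bsub>N\<^esub> y"] a y
      by (simp add: N.r_neg) (metis N.a_comm N.a_inv_closed N.minus_equality N.smult_closed)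
    then show "q (a \<odot>\<^bsub>N\<^esub> x) = a \<odot>\<^bsub>N\<^esub> q x"
      using cl a x by (simp add: q_def lin_smult[OF i] lin_smult[OF p] N.minus_eq N.smult_r_distr)
  qed (use cl in \<open>auto simp: q_def\<close>)
  have ker: "p (q x) = \<zero>\<^bsub>M\<^esub>" if "x \<in> carrier N" for x
    using that cl by (simp add: q_def lin_minus[OF N M p] pi) (simp add: M.minus_eq M.r_neg)
  have l: "lin A N (dsum2 M (ker_mod N M p)) (\<lambda>x. (p x, q x))"
    using lin_closed[OF q] ker cl
    by (intro linI) (simp_all add: lin_add[OF p] lin_smult[OF p] lin_add[OF q] lin_smult[OF q] ker_mod_def)
  have "bij_betw (\<lambda>x. (p x, q x)) (carrier N) (carrier (dsum2 M (ker_mod N M p)))"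
  proof (rule bij_betw_byWitness[where f'="\<lambda>(m, z). i m \<oplus>\<^bsub>N\<^esub> z"])
    show "\<forall>x\<in>carrier N. (case (p x, q x) of (m, z) \<Rightarrow> i m \<oplus>\<^bsub>N\<^esub> z) = x"
      using cl by (simp add: q_def N.minus_eq N.a_lcomm N.r_neg)
    show "\<forall>z\<in>carrier (dsum2 M (ker_mod N M p)). (p (case z of (m, z) \<Rightarrow> i m \<oplus>\<^bsub>N\<^esub> z),
        q (case z of (m, z) \<Rightarrow> i m \<oplus>\<^bsub>N\<^esub> z)) = z"
      using cl by (auto simp: q_def ker_mod_def lin_add[OF p] pi N.minus_eq N.a_ac N.r_neg N.r_neg1 N.r_neg2)
    show "(\<lambda>(m, z). i m \<oplus>\<^bsub>N\<^esub> z) ` carrier (dsum2 M (ker_mod N M p)) \<subseteq> carrier N"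
      using cl by (auto simp: ker_mod_def)
    show "(\<lambda>x. (p x, q x)) ` carrier N \<subseteq> carrier (dsum2 M (ker_mod N M p))"
      by (rule image_subsetI) (rule lin_closed[OF l])
  qed
  then show ?thesis
    using l unfolding q_def by (simp add: lin_isos_def restrict_linmaps_iff[OF N] cong: bij_betw_cong)
qed

text \<open>Together with \<open>summandD\<close> this replaces direct summands by retracts, which
  functors preserve without any reference to a complement.\<close>

lemma summandI:
  assumes "left_module A M" "left_module A N" "lin A M N i" "lin A N M p"
    and "\<And>x. x \<in> carrier M \<Longrightarrow> p (i x) = x"
  shows "summand A M N"
  unfolding summand_def
  using retract_splitting[OF assms] ker_mod_module[OF assms(2,1,4)] by blast

lemma summandD:
  fixes M :: "('r, 'a) module" and N :: "('r, 'b) module"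
  assumes "left_module A N" "summand A M N"
  obtains i p where "lin A M N i" "lin A N M p" "\<And>x. x \<in> carrier M \<Longrightarrow> p (i x) = x"
proof -
  obtain M' :: "('r, 'b) module" and f where M': "left_module A M'" and f: "f \<in> lin_isos A N (dsum2 M M')"
    using assms(2) unfolding summand_def ex_in_conv[symmetric] by blast
  interpret M': left_module A M' by fact
  have fl: "lin A N (dsum2 M M') f" and fb: "bij_betw f (carrier N) (carrier (dsum2 M M'))"
    using f by (auto simp: lin_isos_def linmaps_iff)
  show ?thesis
  proof (rule that)
    show "lin A M N (\<lambda>x. inv_into (carrier N) f (x, \<zero>\<^bsub>M'\<^esub>))"
      by (rule lin_compose[OF lin_inl[OF M'] lin_inv[OF assms(1) fl fb]])
    show "lin A N M (\<lambda>x. fst (f x))"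
      by (rule lin_compose[OF fl lin_fst])
    show "fst (f (inv_into (carrier N) f (x, \<zero>\<^bsub>M'\<^esub>))) = x" if "x \<in> carrier M" for x
      using bij_betw_inv_into_right[OF fb, of "(x, \<zero>\<^bsub>M'\<^esub>)"] that by simp
  qed
qed

lemma sym_group_cancel:
  assumes "\<sigma> \<in> carrier (sym_group d)"
  shows "\<sigma> \<circ> (inv\<^bsub>sym_group d\<^esub> \<sigma> \<circ> f) = f" "inv\<^bsub>sym_group d\<^esub> \<sigma> \<circ> (\<sigma> \<circ> f) = f"
  using assms by (simp_all add: o_assoc)

context base
begin

subsection \<open>Coordinates on tensor powers\<close>

lemma lin_eval: "lin k (free_mod k X) (self_mod k) (\<lambda>f. f i)"
  by (rule linI) (auto simp: free_mod_closed[OF k])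

lemma free_mod_finite_carrier:
  "finite X \<Longrightarrow> f \<in> carrier (free_mod k X) \<longleftrightarrow> (\<forall>x\<in>X. f x \<in> carrier k) \<and> (\<forall>x. x \<notin> X \<longrightarrow> f x = \<zero>\<^bsub>k\<^esub>)"
  unfolding free_mod_carrier by (auto intro: finite_subset[of _ X])

context
  fixes d :: nat and V :: "('k, 'v) module" and L :: "'l set" and lam :: "'l \<Rightarrow> 'v \<Rightarrow> 'k"
  assumes V: "left_module k V" and L: "finite L" and lams: "\<forall>l\<in>L. lin k V (self_mod k) (lam l)"
begin

lemmas lam = bspec[OF lams]

text \<open>\<open>coord x i\<close> is the value at \<open>x\<close> of the tensor product of the
  functionals \<open>lam (i 1)\<close>, ..., \<open>lam (i d)\<close>. All words are treated by one
  linear map into a free module, hence the value zero off the words.\<close>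

definition coord :: "('k, 'v) tens \<Rightarrow> (nat \<Rightarrow> 'l) \<Rightarrow> 'k" where
  "coord = tensor_lift k {1..d} (\<lambda>_. V) (free_mod k ({1..d} \<rightarrow>\<^sub>E L))
     (\<lambda>v i. if i \<in> {1..d} \<rightarrow>\<^sub>E L then \<Otimes>\<^bsub>k\<^esub>j\<in>{1..d}. lam (i j) (v j) else \<zero>\<^bsub>k\<^esub>)"

lemma lam_closed: "\<lbrakk>l \<in> L; x \<in> carrier V\<rbrakk> \<Longrightarrow> lam l x \<in> carrier k"
  using lin_closed[OF lam] by simp

lemma coord_prod_closed:
  "\<lbrakk>i \<in> {1..d} \<rightarrow>\<^sub>E L; v \<in> {1..d} \<rightarrow>\<^sub>E carrier V; J \<subseteq> {1..d}\<rbrakk> \<Longrightarrow> (\<Otimes>\<^bsub>k\<^esub>j\<in>J. lam (i j) (v j)) \<in> carrier k"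
  by (intro k.finprod_closed) (auto simp: PiE_iff subset_iff intro!: lam_closed)

text \<open>Only the factor at position \<open>j\<close> sees \<open>x\<close>; multilinearity of
  the product is then linearity of that factor.\<close>

lemma coord_prod_upd:
  assumes "i \<in> {1..d} \<rightarrow>\<^sub>E L" "v \<in> {1..d} \<rightarrow>\<^sub>E carrier V" "j \<in> {1..d}" "x \<in> carrier V"
  shows "(\<Otimes>\<^bsub>k\<^esub>j'\<in>{1..d}. lam (i j') ((v(j := x)) j')) =
    lam (i j) x \<otimes>\<^bsub>k\<^esub> (\<Otimes>\<^bsub>k\<^esub>j'\<in>{1..d} - {j}. lam (i j') (v j'))"
proof -
  have c: "\<And>j'. j' \<in> {1..d} \<Longrightarrow> lam (i j') (v j') \<in> carrier k"
    using assms by (auto simp: PiE_iff intro!: lam_closed)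
  have "(\<Otimes>\<^bsub>k\<^esub>j'\<in>insert j ({1..d} - {j}). lam (i j') ((v(j := x)) j')) =
    lam (i j) x \<otimes>\<^bsub>k\<^esub> (\<Otimes>\<^bsub>k\<^esub>j'\<in>{1..d} - {j}. lam (i j') ((v(j := x)) j'))"
    using c assms by (subst k.finprod_insert) (auto simp: PiE_iff intro!: lam_closed)
  moreover have "(\<Otimes>\<^bsub>k\<^esub>j'\<in>{1..d} - {j}. lam (i j') ((v(j := x)) j')) = (\<Otimes>\<^bsub>k\<^esub>j'\<in>{1..d} - {j}. lam (i j') (v j'))"
    using c by (intro k.finprod_cong') auto
  ultimately show ?thesis using assms(3) by (simp add: insert_absorb)
qed

lemma coord_multilin:
  "multilin k {1..d} (\<lambda>_. V) (free_mod k ({1..d} \<rightarrow>\<^sub>E L))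
     (\<lambda>v i. if i \<in> {1..d} \<rightarrow>\<^sub>E L then \<Otimes>\<^bsub>k\<^esub>j\<in>{1..d}. lam (i j) (v j) else \<zero>\<^bsub>k\<^esub>)"
  unfolding multilin_def
proof (intro conjI ballI)
  let ?g = "\<lambda>v i. if i \<in> {1..d} \<rightarrow>\<^sub>E L then \<Otimes>\<^bsub>k\<^esub>j\<in>{1..d}. lam (i j) (v j) else \<zero>\<^bsub>k\<^esub>"
  have fin: "finite ({1..d} \<rightarrow>\<^sub>E L)" using L by (simp add: finite_PiE)
  interpret V: left_module k V by (rule V)
  show gc: "?g v \<in> carrier (free_mod k ({1..d} \<rightarrow>\<^sub>E L))" if "v \<in> {1..d} \<rightarrow>\<^sub>E carrier V" for v
    using that coord_prod_closed by (auto simp: free_mod_finite_carrier[OF fin] simp del: PiE_iff)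
  fix v j assume v: "v \<in> {1..d} \<rightarrow>\<^sub>E carrier V" and j: "j \<in> {1..d}"
  have cp: "(\<Otimes>\<^bsub>k\<^esub>j'\<in>{1..d} - {j}. lam (i j') (v j')) \<in> carrier k" if "i \<in> {1..d} \<rightarrow>\<^sub>E L" for i
    by (rule coord_prod_closed[OF that v]) auto
  have ij: "i j \<in> L" if "i \<in> {1..d} \<rightarrow>\<^sub>E L" for i using that j by auto
  show "lin k V (free_mod k ({1..d} \<rightarrow>\<^sub>E L)) (\<lambda>x. ?g (v(j := x)))"
  proof (rule linI)
    fix x y assume x: "x \<in> carrier V" and y: "y \<in> carrier V"
    have "(\<Otimes>\<^bsub>k\<^esub>j'\<in>{1..d}. lam (i j') ((v(j := x \<oplus>\<^bsub>V\<^esub> y)) j')) =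
      (\<Otimes>\<^bsub>k\<^esub>j'\<in>{1..d}. lam (i j') ((v(j := x)) j')) \<oplus>\<^bsub>k\<^esub> (\<Otimes>\<^bsub>k\<^esub>j'\<in>{1..d}. lam (i j') ((v(j := y)) j'))"
      if i: "i \<in> {1..d} \<rightarrow>\<^sub>E L" for i
      using lin_add[OF lam[OF ij[OF i]] x y] cp[OF i] lam_closed[OF ij[OF i]] x y
      by (simp only: coord_prod_upd[OF i v j] V.a_closed self_mod_simps k.l_distr)
    then show "?g (v(j := x \<oplus>\<^bsub>V\<^esub> y)) = ?g (v(j := x)) \<oplus>\<^bsub>free_mod k ({1..d} \<rightarrow>\<^sub>E L)\<^esub> ?g (v(j := y))"
      by (simp only: free_mod_simps) (rule ext, simp)
  next
    fix c x assume c: "c \<in> carrier k" and x: "x \<in> carrier V"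
    have "(\<Otimes>\<^bsub>k\<^esub>j'\<in>{1..d}. lam (i j') ((v(j := c \<odot>\<^bsub>V\<^esub> x)) j')) =
      c \<otimes>\<^bsub>k\<^esub> (\<Otimes>\<^bsub>k\<^esub>j'\<in>{1..d}. lam (i j') ((v(j := x)) j'))"
      if i: "i \<in> {1..d} \<rightarrow>\<^sub>E L" for i
      using lin_smult[OF lam[OF ij[OF i]] c x] cp[OF i] lam_closed[OF ij[OF i]] x c
      by (simp only: coord_prod_upd[OF i v j] V.smult_closed self_mod_simps k.m_assoc)
    then show "?g (v(j := c \<odot>\<^bsub>V\<^esub> x)) = c \<odot>\<^bsub>free_mod k ({1..d} \<rightarrow>\<^sub>E L)\<^esub> ?g (v(j := x))"
      using c by (simp only: free_mod_simps) (rule ext, simp)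
  qed (use v j in \<open>intro gc PiE_upd\<close>)
qed

lemma coord_lin: "lin k (tpow k d V) (free_mod k ({1..d} \<rightarrow>\<^sub>E L)) coord"
  unfolding coord_def by (rule lin_linmaps[OF tpow_lift_linmaps[OF V free_mod_module[OF k] coord_multilin]])

lemma coord_pure:
  "\<lbrakk>v \<in> {1..d} \<rightarrow>\<^sub>E carrier V; i \<in> {1..d} \<rightarrow>\<^sub>E L\<rbrakk> \<Longrightarrow>
    coord (tpure k d V v) i = (\<Otimes>\<^bsub>k\<^esub>j\<in>{1..d}. lam (i j) (v j))"
  unfolding coord_def by (subst tpow_lift_pure[OF V free_mod_module[OF k] coord_multilin]) simp_all

lemma coord_closed: "x \<in> carrier (tpow k d V) \<Longrightarrow> coord x i \<in> carrier k"
  using free_mod_closed[OF k lin_closed[OF coord_lin]] by blast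

text \<open>Reindexing the product along \<tau> moves the permutation from the vectors to the
  functionals, where it appears inverted.\<close>

lemma coord_perm:
  assumes t: "\<tau> \<in> carrier (sym_group d)" and x: "x \<in> carrier (tpow k d V)" and i: "i \<in> {1..d} \<rightarrow>\<^sub>E L"
  shows "coord (perm_ract k d V x \<tau>) i = coord x (pcomp d i (inv\<^bsub>sym_group d\<^esub> \<tau>))"
proof (rule tpow_lin_eq[OF V self_mod_module _ _ _ x])
  show "lin k (tpow k d V) (self_mod k) (\<lambda>x. coord (perm_ract k d V x \<tau>) i)"
    by (rule lin_compose[OF lin_compose[OF perm_ract_lin[OF V t] coord_lin] lin_eval])
  show "lin k (tpow k d V) (self_mod k) (\<lambda>x. coord x (pcomp d i (inv\<^bsub>sym_group d\<^esub> \<tau>)))"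
    by (rule lin_compose[OF coord_lin lin_eval])
  fix v assume v: "v \<in> {1..d} \<rightarrow>\<^sub>E carrier V"
  have "(\<Otimes>\<^bsub>k\<^esub>j\<in>{1..d}. lam (pcomp d i (inv\<^bsub>sym_group d\<^esub> \<tau>) j) (v j)) =
    (\<Otimes>\<^bsub>k\<^esub>j\<in>\<tau> ` {1..d}. lam (pcomp d i (inv\<^bsub>sym_group d\<^esub> \<tau>) j) (v j))"
    using sym_group_bij[OF t] by (simp add: bij_betw_def)
  also have "\<dots> = (\<Otimes>\<^bsub>k\<^esub>j\<in>{1..d}. lam (pcomp d i (inv\<^bsub>sym_group d\<^esub> \<tau>) (\<tau> j)) (v (\<tau> j)))"
  proof (rule k.finprod_reindex)
    show "(\<lambda>j. lam (pcomp d i (inv\<^bsub>sym_group d\<^esub> \<tau>) j) (v j)) \<in> \<tau> ` {1..d} \<rightarrow> carrier k"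
      using sym_group_bij[OF t] v pcomp_closed[OF sym_group_inv_closed[OF t] i]
      by (auto simp: bij_betw_def PiE_iff intro!: lam_closed)
  qed (use sym_group_bij[OF t] in \<open>simp add: bij_betw_def\<close>)
  also have "\<dots> = (\<Otimes>\<^bsub>k\<^esub>j\<in>{1..d}. lam (i j) (pcomp d v \<tau> j))"
  proof (rule k.finprod_cong')
    show "(\<lambda>j. lam (i j) (pcomp d v \<tau> j)) \<in> {1..d} \<rightarrow> carrier k"
      using i pcomp_closed[OF t v] by (auto simp: PiE_iff intro!: lam_closed)
    show "lam (pcomp d i (inv\<^bsub>sym_group d\<^esub> \<tau>) (\<tau> j)) (v (\<tau> j)) = lam (i j) (pcomp d v \<tau> j)" if "j \<in> {1..d}" for j
      using that sym_group_in[OF t, of j] t by (simp add: pcomp_def)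
  qed simp
  finally show "coord (perm_ract k d V (tpure k d V v) \<tau>) i = coord (tpure k d V v) (pcomp d i (inv\<^bsub>sym_group d\<^esub> \<tau>))"
    using v i t by (simp add: perm_ract_pure[OF V] coord_pure pcomp_closed)
qed

text \<open>Where two words differ, one factor of the product is zero.\<close>

lemma coord_basis:
  assumes e: "\<And>l. l \<in> L \<Longrightarrow> e l \<in> carrier V"
    and dual: "\<And>l m. \<lbrakk>l \<in> L; m \<in> L\<rbrakk> \<Longrightarrow> lam l (e m) = (if l = m then \<one>\<^bsub>k\<^esub> else \<zero>\<^bsub>k\<^esub>)"
    and i: "i \<in> {1..d} \<rightarrow>\<^sub>E L" and i': "i' \<in> {1..d} \<rightarrow>\<^sub>E L"
  shows "coord (tpure k d V (\<lambda>j\<in>{1..d}. e (i j))) i' = basis_vec k i i'"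
proof -
  have v: "(\<lambda>j\<in>{1..d}. e (i j)) \<in> {1..d} \<rightarrow>\<^sub>E carrier V" using i e by auto
  show ?thesis
  proof (cases "i' = i")
    case True
    have "(\<Otimes>\<^bsub>k\<^esub>j\<in>{1..d}. lam (i j) ((\<lambda>j\<in>{1..d}. e (i j)) j)) = \<one>\<^bsub>k\<^esub>"
      using i dual by (intro k.finprod_one_eqI) (auto simp: PiE_iff)
    then show ?thesis using True i by (simp add: coord_pure[OF v] basis_vec_def)
  next
    case False
    then obtain j where j: "j \<in> {1..d}" "i' j \<noteq> i j" using i i' by (metis PiE_ext)
    have "(\<Otimes>\<^bsub>k\<^esub>j'\<in>{1..d}. lam (i' j') (((\<lambda>j\<in>{1..d}. e (i j))(j := e (i j))) j')) = \<zero>\<^bsub>k\<^esub>"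
      using i i' j e dual[of "i' j" "i j"] coord_prod_closed[OF i' v]
      by (subst coord_prod_upd[OF i' v j(1)]) (auto simp: PiE_iff)
    \<comment> \<open>The update inserts the value that is already there. It only brings the product
      into the shape of \<open>coord_prod_upd\<close>, whose split-off factor is zero.\<close>
    moreover have "(\<lambda>j\<in>{1..d}. e (i j))(j := e (i j)) = (\<lambda>j\<in>{1..d}. e (i j))" using j by auto
    ultimately show ?thesis using False by (simp add: coord_pure[OF v i'] basis_vec_def)
  qed
qed

end

subsection \<open>The regular module as a retract of a tensor power\<close>

text \<open>The map \<pi> commutes with the right action and sends \<open>u\<close> to the unit, so
  it is a left inverse of \<open>a \<mapsto> u a\<close>. The translates of \<open>u\<close> belong
  to pairwise different words, which is what allows \<pi> to read off the coefficients of
  \<open>a\<close>.\<close>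

lemma regular_retract:
  fixes V :: "('k, 'v) module" and d :: nat
  assumes V: "left_module k V" and lam: "\<And>l. l \<in> {1..d} \<Longrightarrow> lin k V (self_mod k) (lam l)"
    and e: "\<And>l. l \<in> {1..d} \<Longrightarrow> e l \<in> carrier V"
    and dual: "\<And>l m. \<lbrakk>l \<in> {1..d}; m \<in> {1..d}\<rbrakk> \<Longrightarrow> lam l (e m) = (if l = m then \<one>\<^bsub>k\<^esub> else \<zero>\<^bsub>k\<^esub>)"
  obtains u \<pi> where "u \<in> carrier (tpow k d V)" "lin k (tpow k d V) (free_mod k (carrier (sym_group d))) \<pi>"
    "\<pi> u = \<one>\<^bsub>kS k d\<^esub>"
    "\<And>x a. \<lbrakk>x \<in> carrier (tpow k d V); a \<in> carrier (kS k d)\<rbrakk> \<Longrightarrow> \<pi> (kS_ract k d V x a) = \<pi> x \<otimes>\<^bsub>kS k d\<^esub> a"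
proof -
  let ?G = "carrier (sym_group d)" and ?T = "tpow k d V"
  interpret T: left_module k ?T by (rule tpow_module[OF V])
  define C where "C = coord d V {1..d} lam"
  have lams: "\<forall>l\<in>{1..d}. lin k V (self_mod k) (lam l)" using lam by blast
  note C_lin = coord_lin[where L="{1..d}" and lam=lam and d=d, OF V finite_atLeastAtMost lams, folded C_def]
  note C_closed = coord_closed[where L="{1..d}" and lam=lam and d=d, OF V finite_atLeastAtMost lams, folded C_def]
  note C_perm = coord_perm[where L="{1..d}" and lam=lam and d=d, OF V finite_atLeastAtMost lams, folded C_def]
  \<comment> \<open>The word 1, 2, ..., d, so that \<open>u\<close> is the tensor of
    \<open>e 1\<close>, ..., \<open>e d\<close>.\<close>
  define \<iota> where "\<iota> = (\<lambda>i\<in>{1..d}. i)"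
  have io: "\<iota> \<in> {1..d} \<rightarrow>\<^sub>E {1..d}" by (simp add: \<iota>_def)
  define u where "u = tpure k d V (\<lambda>j\<in>{1..d}. e (\<iota> j))"
  \<comment> \<open>The value at \<sigma> is the coordinate at the word of the translate of
    \<open>u\<close> by \<sigma>.\<close>
  define \<pi> where "\<pi> x \<sigma> = (if \<sigma> \<in> ?G then C x (pcomp d \<iota> \<sigma>) else \<zero>\<^bsub>k\<^esub>)" for x \<sigma>
  have u: "u \<in> carrier ?T" unfolding u_def using e io by (intro tpure_closed V) (auto simp: PiE_iff)
  have \<pi>c: "\<pi> x \<in> carrier (kS k d)" if "x \<in> carrier ?T" for x
    using C_closed[OF that] unfolding kS_carrier by (simp add: \<pi>_def)
  have \<pi>: "lin k ?T (free_mod k ?G) \<pi>"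
  proof (rule linI)
    fix x y assume x: "x \<in> carrier ?T" and y: "y \<in> carrier ?T"
    show "\<pi> (x \<oplus>\<^bsub>?T\<^esub> y) = \<pi> x \<oplus>\<^bsub>free_mod k ?G\<^esub> \<pi> y"
      using lin_add[OF C_lin x y] by (simp add: \<pi>_def fun_eq_iff)
  next
    fix c x assume c: "c \<in> carrier k" and x: "x \<in> carrier ?T"
    show "\<pi> (c \<odot>\<^bsub>?T\<^esub> x) = c \<odot>\<^bsub>free_mod k ?G\<^esub> \<pi> x"
      using lin_smult[OF C_lin c x] c by (simp add: \<pi>_def fun_eq_iff)
  qed (use \<pi>c in simp)
  have "\<pi> u = \<one>\<^bsub>kS k d\<^esub>"
  proof (rule kS_eqI[OF \<pi>c[OF u]])
    fix \<sigma> assume s: "\<sigma> \<in> ?G"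
    have "pcomp d \<iota> \<sigma> = \<iota> \<longleftrightarrow> \<sigma> = id"
    proof
      assume a: "pcomp d \<iota> \<sigma> = \<iota>"
      show "\<sigma> = id"
      proof
        fix j show "\<sigma> j = id j"
        proof (cases "j \<in> {1..d}")
          case True then show ?thesis using fun_cong[OF a, of j] sym_group_in[OF s, of j] by (simp add: pcomp_def \<iota>_def)
        next
          case False then show ?thesis using s by (auto simp: sym_group_def permutes_def)
        qed
      qed
    qed (use pcomp_id[OF io] in simp)
    moreover have "C u (pcomp d \<iota> \<sigma>) = basis_vec k \<iota> (pcomp d \<iota> \<sigma>)"
      unfolding u_def C_def
      by (rule coord_basis[where L="{1..d}" and lam=lam, OF V finite_atLeastAtMost lams e dual io pcomp_closed[OF s io]])
    ultimately show "\<pi> u \<sigma> = \<one>\<^bsub>kS k d\<^esub> \<sigma>" using s by (simp add: \<pi>_def basis_vec_def)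
  qed (use kS_basis[OF sym_group_id] in simp)
  moreover have "\<pi> (kS_ract k d V x a) = \<pi> x \<otimes>\<^bsub>kS k d\<^esub> a"
    if x: "x \<in> carrier ?T" and a: "a \<in> carrier (kS k d)" for x a
  proof (rule kS_eqI)
    note cl = perm_ract_closed[OF V _ x] kS_closed[OF a] C_closed
    fix \<rho> assume r: "\<rho> \<in> ?G"
    have ev: "lin k ?T (self_mod k) (\<lambda>x. C x (pcomp d \<iota> \<rho>))"
      by (rule lin_compose[OF C_lin lin_eval])
    have "\<pi> (kS_ract k d V x a) \<rho> = (\<Oplus>\<^bsub>k\<^esub>\<tau>\<in>?G. C (a \<tau> \<odot>\<^bsub>?T\<^esub> perm_ract k d V x \<tau>) (pcomp d \<iota> \<rho>))"
      using lin_finsum[OF T.left_module_axioms self_mod_module ev, of ?G "\<lambda>\<tau>. a \<tau> \<odot>\<^bsub>?T\<^esub> perm_ract k d V x \<tau>"] cl r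
      by (simp add: \<pi>_def kS_ract_def finsum_self_mod)
    also have "\<dots> = (\<Oplus>\<^bsub>k\<^esub>\<tau>\<in>?G. a \<tau> \<otimes>\<^bsub>k\<^esub> C x (pcomp d \<iota> (\<rho> \<circ> inv\<^bsub>sym_group d\<^esub> \<tau>)))"
      using cl r x by (intro k.finsum_cong')
        (auto simp: lin_smult[OF ev, unfolded self_mod_simps] C_perm pcomp_closed[OF r io] pcomp_pcomp)
    \<comment> \<open>Taking \<open>inv \<sigma> \<circ> \<rho>\<close> as the new summation index
      gives the sum the form of a convolution.\<close>
    also have "\<dots> = (\<Oplus>\<^bsub>k\<^esub>\<sigma>\<in>?G. a (inv\<^bsub>sym_group d\<^esub> \<sigma> \<circ> \<rho>) \<otimes>\<^bsub>k\<^esub> C x (pcomp d \<iota> (\<rho> \<circ> inv\<^bsub>sym_group d\<^esub> (inv\<^bsub>sym_group d\<^esub> \<sigma> \<circ> \<rho>))))"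
    proof (rule k.finsum_reindex_bij)
      show "bij_betw (\<lambda>\<sigma>. inv\<^bsub>sym_group d\<^esub> \<sigma> \<circ> \<rho>) ?G ?G"
        by (rule bij_betw_byWitness[where f'="\<lambda>\<tau>. \<rho> \<circ> inv\<^bsub>sym_group d\<^esub> \<tau>"])
          (use r in \<open>auto simp: sym_group_inv_comp comp_assoc sym_group_cancel\<close>)
    qed (use cl r x in auto)
    also have "\<dots> = (\<Oplus>\<^bsub>k\<^esub>\<sigma>\<in>?G. \<pi> x \<sigma> \<otimes>\<^bsub>k\<^esub> a (inv\<^bsub>sym_group d\<^esub> \<sigma> \<circ> \<rho>))"
      using cl r x by (intro k.finsum_cong') (auto simp: \<pi>_def sym_group_inv_comp sym_group_cancel k.m_comm)
    also have "\<dots> = (\<pi> x \<otimes>\<^bsub>kS k d\<^esub> a) \<rho>" using r by (simp add: kS_mult)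
    finally show "\<pi> (kS_ract k d V x a) \<rho> = (\<pi> x \<otimes>\<^bsub>kS k d\<^esub> a) \<rho>" .
  qed (use x a \<pi>c kS_ract_closed[OF V] kS_mult_closed in auto)
  ultimately show ?thesis using that u \<pi> by blast
qed

text \<open>Copies a module structure to the image of a map injective on the carrier; it moves the
  free module of rank \<open>d\<close> into the type \<open>'v\<close>.\<close>

definition transport :: "('r, 'a) module \<Rightarrow> ('a \<Rightarrow> 'b) \<Rightarrow> ('r, 'b) module" where
  "transport M b = (let g = inv_into (carrier M) b in mk_module (b ` carrier M) (b \<zero>\<^bsub>M\<^esub>)
     (\<lambda>x y. b (g x \<oplus>\<^bsub>M\<^esub> g y)) (\<lambda>a x. b (a \<odot>\<^bsub>M\<^esub> g x)))"

lemma transport: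
  assumes "left_module A M" "inj_on b (carrier M)"
  shows transport_module: "left_module A (transport M b)"
    and transport_lin: "lin A M (transport M b) b"
    and transport_bij: "bij_betw b (carrier M) (carrier (transport M b))"
proof -
  interpret M: left_module A M by fact
  show "left_module A (transport M b)"
    by (rule left_moduleI) (auto simp: transport_def Let_def assms(2) M.R.ring_axioms M.a_ac
      M.smult_l_distr M.smult_r_distr M.smult_assoc M.smult_one)
  show "lin A M (transport M b) b"
    by (rule linI) (auto simp: transport_def Let_def assms(2))
  show "bij_betw b (carrier M) (carrier (transport M b))"
    using assms(2) by (simp add: bij_betw_def transport_def Let_def)
qed

text \<open>A vector of length \<open>d\<close> is encoded by the list of its entries and then by
  \<open>c\<close>. The injection is needed a second time, because \<open>projective\<close> asks
  for a basis indexed by elements of \<open>'v\<close>.\<close>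

lemma free_object:
  fixes c :: "'k list \<Rightarrow> 'v" and d :: nat
  assumes c: "inj_on c (lists (carrier k))"
  obtains E :: "('k, 'v) module" and e lam where "E \<in> fg_projectives k"
    "\<And>l. l \<in> {1..d} \<Longrightarrow> lin k E (self_mod k) (lam l)" "\<And>l. l \<in> {1..d} \<Longrightarrow> e l \<in> carrier E"
    "\<And>l m. \<lbrakk>l \<in> {1..d}; m \<in> {1..d}\<rbrakk> \<Longrightarrow> lam l (e m) = (if l = m then \<one>\<^bsub>k\<^esub> else \<zero>\<^bsub>k\<^esub>)"
proof -
  let ?F = "free_mod k {1..d}"
  note F = free_mod_module[OF k, of "{1..d}"]
  define b where "b f = c (map f [1..<Suc d])" for f
  have inj: "inj_on b (carrier ?F)"
  proof (rule inj_onI)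
    fix f g assume f: "f \<in> carrier ?F" and g: "g \<in> carrier ?F" and "b f = b g"
    then have "map f [1..<Suc d] = map g [1..<Suc d]"
      unfolding b_def using free_mod_closed[OF k f] free_mod_closed[OF k g]
      by (intro inj_onD[OF c]) auto
    then have "\<forall>x\<in>{1..d}. f x = g x" by (simp add: atLeastLessThanSuc_atLeastAtMost del: upt_Suc)
    then show "f = g" using f g unfolding free_mod_carrier by (metis ext)
  qed
  define E where "E = transport ?F b"
  note E = transport_module[OF F inj, folded E_def] and bl = transport_lin[OF F inj, folded E_def]
    and bb = transport_bij[OF F inj, folded E_def]
  define g where "g = inv_into (carrier ?F) b"
  have gl: "lin k E ?F g" unfolding g_def by (rule lin_inv[OF F bl bb])
  have gb: "g (b f) = f" if "f \<in> carrier ?F" for f unfolding g_def using inj that by simp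
  have bg: "b (g y) = y" if "y \<in> carrier E" for y
    unfolding g_def by (rule bij_betw_inv_into_right[OF bb that])
  have "E \<in> fg_projectives k"
    unfolding fg_projectives_def mem_Collect_eq
  proof (intro conjI)
    show "module k E" using E left_module_iff_module[OF k] by blast
    have sp: "spans k E (b ` basis_vec k ` {1..d})"
      by (rule spans_image[OF F E bl _ spans_free_mod[OF k]]) (use bb in \<open>simp add: bij_betw_def\<close>)
    show "\<exists>S. finite S \<and> S \<subseteq> carrier E \<and> mspan k E S = carrier E"
    proof (intro exI conjI)
      show s: "b ` basis_vec k ` {1..d} \<subseteq> carrier E" using sp by (simp add: spans_def)
      show "mspan k E (b ` basis_vec k ` {1..d}) = carrier E"
        using mspan_eq_carrier_iff[OF k E s] sp by simp
    qed simp
    \<comment> \<open>Names in \<open>'v\<close> for the \<open>d\<close> basis vectors. Lists of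
      zeros of different lengths are distinct even over the zero ring, where \<open>E\<close> itself
      has a single element.\<close>
    define u :: "nat \<Rightarrow> 'v" where "u j = c (replicate j \<zero>\<^bsub>k\<^esub>)" for j
    have u: "u i = u j \<longleftrightarrow> i = j" for i j
    proof
      assume "u i = u j"
      then have "replicate i \<zero>\<^bsub>k\<^esub> = replicate j \<zero>\<^bsub>k\<^esub>"
        unfolding u_def by (intro inj_onD[OF c]) auto
      then show "i = j" by (metis length_replicate)
    qed simp
    let ?X = "u ` {1..d}"
    define w where "w = inv_into {1..d} u"
    have w: "w (u j) = j" if "j \<in> {1..d}" for j
      unfolding w_def using that u by (intro inv_into_f_f inj_onI) auto
    note FX = free_mod_module[OF k, of ?X]
    show "projective k E"
      unfolding projective_def
    proof (rule exI[of _ ?X], rule summandI[OF E FX])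
      have "lin k ?F (free_mod k ?X) (\<lambda>f x. if x \<in> ?X then f (w x) else \<zero>\<^bsub>k\<^esub>)"
      proof (rule linI)
        fix f assume f: "f \<in> carrier ?F"
        have "finite {x. (if x \<in> ?X then f (w x) else \<zero>\<^bsub>k\<^esub>) \<noteq> \<zero>\<^bsub>k\<^esub>}"
          by (rule finite_subset[of _ ?X]) auto
        then show "(\<lambda>x. if x \<in> ?X then f (w x) else \<zero>\<^bsub>k\<^esub>) \<in> carrier (free_mod k ?X)"
          using free_mod_closed[OF k f] by (simp add: free_mod_carrier)
      qed (auto simp: fun_eq_iff)
      from lin_compose[OF gl this]
      show "lin k E (free_mod k ?X) (\<lambda>y x. if x \<in> ?X then g y (w x) else \<zero>\<^bsub>k\<^esub>)" .
      have "lin k (free_mod k ?X) ?F (\<lambda>f j. if j \<in> {1..d} then f (u j) else \<zero>\<^bsub>k\<^esub>)"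
      proof (rule linI)
        fix f assume f: "f \<in> carrier (free_mod k ?X)"
        have "finite {j. (if j \<in> {1..d} then f (u j) else \<zero>\<^bsub>k\<^esub>) \<noteq> \<zero>\<^bsub>k\<^esub>}"
          by (rule finite_subset[of _ "{1..d}"]) auto
        then show "(\<lambda>j. if j \<in> {1..d} then f (u j) else \<zero>\<^bsub>k\<^esub>) \<in> carrier ?F"
          using free_mod_closed[OF k f] by (simp add: free_mod_carrier)
      qed (auto simp: fun_eq_iff)
      from lin_compose[OF this bl]
      show "lin k (free_mod k ?X) E (\<lambda>f. b (\<lambda>j. if j \<in> {1..d} then f (u j) else \<zero>\<^bsub>k\<^esub>))" .
      fix y assume y: "y \<in> carrier E"
      have "(\<lambda>j. if j \<in> {1..d} then (if u j \<in> ?X then g y (w (u j)) else \<zero>\<^bsub>k\<^esub>) else \<zero>\<^bsub>k\<^esub>) = g y"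
        using lin_closed[OF gl y] w by (auto simp: free_mod_carrier)
      then show "b (\<lambda>j. if j \<in> {1..d} then (if u j \<in> ?X then g y (w (u j)) else \<zero>\<^bsub>k\<^esub>) else \<zero>\<^bsub>k\<^esub>) = y"
        using bg[OF y] by simp
    qed
  qed
  moreover have "lin k E (self_mod k) (\<lambda>y. g y l)" for l
    by (rule lin_compose[OF gl]) (rule linI, auto simp: free_mod_closed[OF k])
  moreover have "b (basis_vec k l) \<in> carrier E" if "l \<in> {1..d}" for l
    using lin_closed[OF bl] basis_vec_closed[OF k that] by blast
  moreover have "g (b (basis_vec k m)) l = (if l = m then \<one>\<^bsub>k\<^esub> else \<zero>\<^bsub>k\<^esub>)" if "m \<in> {1..d}" for l m
    using gb[OF basis_vec_closed[OF k that]] by (simp add: basis_vec_def)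
  ultimately show ?thesis by (intro that[of E "\<lambda>l y. g y l" "\<lambda>l. b (basis_vec k l)"]) auto
qed

end

section \<open>Natural transformations and strict polynomial functors\<close>

lemma LMod_simps [simp]:
  "Ob (LMod A) = {M. left_module A M}" "Hom (LMod A) = linmaps A" "Id (LMod A) M = (\<lambda>x\<in>carrier M. x)"
  "Comp (LMod A) M g f = compose (carrier M) g f"
  by (simp_all add: LMod_def)

lemma nat_transI:
  assumes "\<eta> \<in> extensional (Ob C)" "\<And>X. X \<in> Ob C \<Longrightarrow> \<eta> X \<in> linmaps A (fob F X) (fob G X)"
    and "\<And>X Y f x. \<lbrakk>X \<in> Ob C; Y \<in> Ob C; f \<in> Hom C X Y; x \<in> carrier (fob F X)\<rbrakk> \<Longrightarrow>
      \<eta> Y (fmor F X Y f x) = fmor G X Y f (\<eta> X x)"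
  shows "\<eta> \<in> nat_trans A C F G"
  using assms by (simp add: nat_trans_def)

lemma nat_trans_linmaps: "\<lbrakk>\<eta> \<in> nat_trans A C F G; X \<in> Ob C\<rbrakk> \<Longrightarrow> \<eta> X \<in> linmaps A (fob F X) (fob G X)"
  and nat_trans_natural: "\<lbrakk>\<eta> \<in> nat_trans A C F G; X \<in> Ob C; Y \<in> Ob C; f \<in> Hom C X Y; x \<in> carrier (fob F X)\<rbrakk> \<Longrightarrow>
      \<eta> Y (fmor F X Y f x) = fmor G X Y f (\<eta> X x)"
  and nat_trans_extensional: "\<eta> \<in> nat_trans A C F G \<Longrightarrow> \<eta> \<in> extensional (Ob C)"
  by (simp_all add: nat_trans_def)

lemma nat_trans_lin: "\<lbrakk>\<eta> \<in> nat_trans A C F G; X \<in> Ob C\<rbrakk> \<Longrightarrow> lin A (fob F X) (fob G X) (\<eta> X)"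
  by (rule lin_linmaps[OF nat_trans_linmaps])

lemma nat_trans_closed: "\<lbrakk>\<eta> \<in> nat_trans A C F G; X \<in> Ob C; x \<in> carrier (fob F X)\<rbrakk> \<Longrightarrow> \<eta> X x \<in> carrier (fob G X)"
  by (rule lin_closed[OF nat_trans_lin])

lemma nat_trans_eqI:
  assumes "\<eta> \<in> nat_trans A C F G" "\<eta>' \<in> nat_trans A C F G'"
    and "\<And>X x. \<lbrakk>X \<in> Ob C; x \<in> carrier (fob F X)\<rbrakk> \<Longrightarrow> \<eta> X x = \<eta>' X x"
  shows "\<eta> = \<eta>'"
proof (rule extensionalityI[OF nat_trans_extensional[OF assms(1)] nat_trans_extensional[OF assms(2)]])
  fix X assume "X \<in> Ob C"
  then show "\<eta> X = \<eta>' X"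
    by (intro linmaps_eqI[OF nat_trans_linmaps[OF assms(1)] nat_trans_linmaps[OF assms(2)]] assms(3))
qed

lemma vcomp_apply: "\<lbrakk>X \<in> Ob C; x \<in> carrier (fob F X)\<rbrakk> \<Longrightarrow> vcomp C F \<beta> \<alpha> X x = \<beta> X (\<alpha> X x)"
  by (simp add: vcomp_def compose_def)

lemma functor_LMod:
  assumes "is_functor C (LMod A) F"
  shows functor_LMod_module: "X \<in> Ob C \<Longrightarrow> left_module A (fob F X)"
    and functor_LMod_linmaps: "\<lbrakk>X \<in> Ob C; Y \<in> Ob C; f \<in> Hom C X Y\<rbrakk> \<Longrightarrow> fmor F X Y f \<in> linmaps A (fob F X) (fob F Y)"
    and functor_LMod_id: "\<lbrakk>X \<in> Ob C; x \<in> carrier (fob F X)\<rbrakk> \<Longrightarrow> fmor F X X (Id C X) x = x"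
    and functor_LMod_comp: "\<lbrakk>X \<in> Ob C; Y \<in> Ob C; Z \<in> Ob C; f \<in> Hom C X Y; g \<in> Hom C Y Z; x \<in> carrier (fob F X)\<rbrakk> \<Longrightarrow>
      fmor F X Z (Comp C X g f) x = fmor F Y Z g (fmor F X Y f x)"
  using assms by (simp_all add: is_functor_def compose_def)

text \<open>The functor laws are equations between extensional maps and can be checked on elements,
  once identities and composites are known to be morphisms.\<close>

lemma functor_LModI:
  assumes "\<And>X. X \<in> Ob C \<Longrightarrow> left_module A (fob F X)"
    and l: "\<And>X Y f. \<lbrakk>X \<in> Ob C; Y \<in> Ob C; f \<in> Hom C X Y\<rbrakk> \<Longrightarrow> fmor F X Y f \<in> linmaps A (fob F X) (fob F Y)"
    and i: "\<And>X x. \<lbrakk>X \<in> Ob C; x \<in> carrier (fob F X)\<rbrakk> \<Longrightarrow> fmor F X X (Id C X) x = x"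
    and c: "\<And>X Y Z f g x. \<lbrakk>X \<in> Ob C; Y \<in> Ob C; Z \<in> Ob C; f \<in> Hom C X Y; g \<in> Hom C Y Z; x \<in> carrier (fob F X)\<rbrakk> \<Longrightarrow>
      fmor F X Z (Comp C X g f) x = fmor F Y Z g (fmor F X Y f x)"
    and Id: "\<And>X. X \<in> Ob C \<Longrightarrow> Id C X \<in> Hom C X X"
    and Comp: "\<And>X Y Z f g. \<lbrakk>X \<in> Ob C; Y \<in> Ob C; Z \<in> Ob C; f \<in> Hom C X Y; g \<in> Hom C Y Z\<rbrakk> \<Longrightarrow> Comp C X g f \<in> Hom C X Z"
  shows "is_functor C (LMod A) F"
  unfolding is_functor_def
proof (intro conjI ballI)
  fix X assume X: "X \<in> Ob C"
  show "fmor F X X (Id C X) = Id (LMod A) (fob F X)"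
    unfolding LMod_simps using i[OF X] l[OF X X Id[OF X]]
    by (intro extensionalityI[of _ "carrier (fob F X)"]) (auto simp: linmaps_iff)
  fix Y Z f g assume Y: "Y \<in> Ob C" and Z: "Z \<in> Ob C" and f: "f \<in> Hom C X Y" and g: "g \<in> Hom C Y Z"
  show "fmor F X Z (Comp C X g f) = Comp (LMod A) (fob F X) (fmor F Y Z g) (fmor F X Y f)"
    unfolding LMod_simps using c[OF X Y Z f g] l[OF X Z Comp[OF X Y Z f g]]
    by (intro extensionalityI[of _ "carrier (fob F X)"]) (auto simp: linmaps_iff compose_def)
qed (use assms in auto)

lemma vcomp_nat_trans:
  assumes F: "is_functor C (LMod A) F" and a: "\<alpha> \<in> nat_trans A C F G" and b: "\<beta> \<in> nat_trans A C G H"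
  shows "vcomp C F \<beta> \<alpha> \<in> nat_trans A C F H"
proof (rule nat_transI)
  fix X assume X: "X \<in> Ob C"
  show "vcomp C F \<beta> \<alpha> X \<in> linmaps A (fob F X) (fob H X)"
    using lin_compose[OF nat_trans_lin[OF a X] nat_trans_lin[OF b X]] X
    by (simp add: vcomp_def compose_def restrict_linmaps_iff[OF functor_LMod_module[OF F X]])
next
  fix X Y f x assume a': "X \<in> Ob C" "Y \<in> Ob C" "f \<in> Hom C X Y" "x \<in> carrier (fob F X)"
  show "vcomp C F \<beta> \<alpha> Y (fmor F X Y f x) = fmor H X Y f (vcomp C F \<beta> \<alpha> X x)"
    using a' linmaps_closed[OF functor_LMod_linmaps[OF F]] nat_trans_closed[OF a]
    by (simp add: vcomp_apply nat_trans_natural[OF a] nat_trans_natural[OF b])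
qed (simp add: vcomp_def)

section \<open>The category \<open>GammaP\<close> and linear functors on it\<close>

context base
begin

lemma GammaP_simps [simp]:
  "Ob (GammaP k d) = fg_projectives k" "Id (GammaP k d) V = (\<lambda>x\<in>carrier (tpow k d V). x)"
  "Comp (GammaP k d) V g f = compose (carrier (tpow k d V)) g f"
  by (simp_all add: GammaP_def)

lemma fg_proj_module: "V \<in> fg_projectives k \<Longrightarrow> left_module k V"
  using left_module_iff_module[OF k] by (auto simp: fg_projectives_def)

lemmas fg_tpow_module = tpow_module[OF fg_proj_module]

lemma GammaP_Hom: "f \<in> Hom (GammaP k d) V W \<longleftrightarrow> f \<in> linmaps k (tpow k d V) (tpow k d W) \<and>
   (\<forall>\<sigma>\<in>carrier (sym_group d). \<forall>x\<in>carrier (tpow k d V).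
          f (perm_ract k d V x \<sigma>) = perm_ract k d W (f x) \<sigma>)"
  by (simp add: GammaP_def)

lemma GammaP_Hom_lin: "f \<in> Hom (GammaP k d) V W \<Longrightarrow> lin k (tpow k d V) (tpow k d W) f"
  by (simp add: GammaP_Hom linmaps_iff)

lemma GammaP_Hom_closed: "\<lbrakk>f \<in> Hom (GammaP k d) V W; x \<in> carrier (tpow k d V)\<rbrakk> \<Longrightarrow> f x \<in> carrier (tpow k d W)"
  by (rule lin_closed[OF GammaP_Hom_lin])

lemma GammaP_Hom_ract:
  assumes "V \<in> fg_projectives k" "W \<in> fg_projectives k" "f \<in> Hom (GammaP k d) V W"
    "x \<in> carrier (tpow k d V)" "a \<in> carrier (kS k d)"
  shows "f (kS_ract k d V x a) = kS_ract k d W (f x) a"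
  using kS_ract_equivariant[OF fg_proj_module[OF assms(1)] fg_proj_module[OF assms(2)] GammaP_Hom_lin[OF assms(3)]]
    assms(3-) by (simp add: GammaP_Hom)

lemma GammaP_HomI:
  assumes V: "V \<in> fg_projectives k" and f: "lin k (tpow k d V) (tpow k d W) f"
    and eq: "\<And>\<sigma> x. \<lbrakk>\<sigma> \<in> carrier (sym_group d); x \<in> carrier (tpow k d V)\<rbrakk> \<Longrightarrow>
      f (perm_ract k d V x \<sigma>) = perm_ract k d W (f x) \<sigma>"
  shows "restrict f (carrier (tpow k d V)) \<in> Hom (GammaP k d) V W"
  using f eq perm_ract_closed[OF fg_proj_module[OF V]]
  by (simp add: GammaP_Hom restrict_linmaps_iff[OF fg_tpow_module[OF V]])

lemma GammaP_Id: "V \<in> fg_projectives k \<Longrightarrow> (\<lambda>x\<in>carrier (tpow k d V). x) \<in> Hom (GammaP k d) V V"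
  by (rule GammaP_HomI) (auto intro: lin_id)

lemma GammaP_Comp:
  assumes "V \<in> fg_projectives k" "W \<in> fg_projectives k" "f \<in> Hom (GammaP k d) V W" "g \<in> Hom (GammaP k d) W Z"
  shows "compose (carrier (tpow k d V)) g f \<in> Hom (GammaP k d) V Z"
  unfolding compose_def
proof (rule GammaP_HomI[OF assms(1)])
  show "lin k (tpow k d V) (tpow k d Z) (\<lambda>x. g (f x))"
    by (rule lin_compose[OF GammaP_Hom_lin[OF assms(3)] GammaP_Hom_lin[OF assms(4)]])
qed (use assms(3,4) GammaP_Hom_closed[OF assms(3)] in \<open>simp add: GammaP_Hom\<close>)

lemma GammaP_plus:
  assumes V: "V \<in> fg_projectives k" and W: "W \<in> fg_projectives k"
    and f: "f \<in> Hom (GammaP k d) V W" and g: "g \<in> Hom (GammaP k d) V W"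
  shows "(\<lambda>t\<in>carrier (tpow k d V). f t \<oplus>\<^bsub>tpow k d W\<^esub> g t) \<in> Hom (GammaP k d) V W"
proof (rule GammaP_HomI[OF V lin_plus[OF fg_tpow_module[OF W] GammaP_Hom_lin[OF f] GammaP_Hom_lin[OF g]]])
  fix \<sigma> x assume "\<sigma> \<in> carrier (sym_group d)" "x \<in> carrier (tpow k d V)"
  then show "f (perm_ract k d V x \<sigma>) \<oplus>\<^bsub>tpow k d W\<^esub> g (perm_ract k d V x \<sigma>) =
      perm_ract k d W (f x \<oplus>\<^bsub>tpow k d W\<^esub> g x) \<sigma>"
    using f g lin_add[OF perm_ract_lin[OF fg_proj_module[OF W]]] GammaP_Hom_closed[OF f] GammaP_Hom_closed[OF g]
    by (simp add: GammaP_Hom)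
qed

lemma GammaP_scale:
  assumes V: "V \<in> fg_projectives k" and W: "W \<in> fg_projectives k"
    and f: "f \<in> Hom (GammaP k d) V W" and c: "c \<in> carrier k"
  shows "(\<lambda>t\<in>carrier (tpow k d V). c \<odot>\<^bsub>tpow k d W\<^esub> f t) \<in> Hom (GammaP k d) V W"
proof (rule GammaP_HomI[OF V lin_scale[OF k fg_tpow_module[OF W] GammaP_Hom_lin[OF f] c]])
  fix \<sigma> x assume "\<sigma> \<in> carrier (sym_group d)" "x \<in> carrier (tpow k d V)"
  then show "c \<odot>\<^bsub>tpow k d W\<^esub> f (perm_ract k d V x \<sigma>) = perm_ract k d W (c \<odot>\<^bsub>tpow k d W\<^esub> f x) \<sigma>"
    using f c lin_smult[OF perm_ract_lin[OF fg_proj_module[OF W]]] GammaP_Hom_closed[OF f]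
    by (simp add: GammaP_Hom)
qed

lemma Rep_simps [simp]:
  "Hom (Rep k d) = nat_trans k (GammaP k d)"
  "Id (Rep k d) F = (\<lambda>V\<in>fg_projectives k. \<lambda>x\<in>carrier (fob F V). x)"
  "Comp (Rep k d) = vcomp (GammaP k d)"
  by (simp_all add: Rep_def)

context
  fixes F :: "('k, 'v, 'w) spf" and d :: nat
  assumes F: "F \<in> Ob (Rep k d)"
begin

lemma Rep_functor: "is_functor (GammaP k d) (LMod k) F"
  using F by (simp add: Rep_def)

lemma Rep_module: "V \<in> fg_projectives k \<Longrightarrow> left_module k (fob F V)"
  using functor_LMod_module[OF Rep_functor] by simp

lemma Rep_linmaps:
  "\<lbrakk>V \<in> fg_projectives k; W \<in> fg_projectives k; f \<in> Hom (GammaP k d) V W\<rbrakk> \<Longrightarrow>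
    fmor F V W f \<in> linmaps k (fob F V) (fob F W)"
  using functor_LMod_linmaps[OF Rep_functor] by simp

lemmas Rep_lin = lin_linmaps[OF Rep_linmaps]
lemmas Rep_closed = lin_closed[OF Rep_lin]

lemma Rep_id:
  "\<lbrakk>V \<in> fg_projectives k; x \<in> carrier (fob F V)\<rbrakk> \<Longrightarrow> fmor F V V (\<lambda>x\<in>carrier (tpow k d V). x) x = x"
  using functor_LMod_id[OF Rep_functor, of V x] by simp

lemma Rep_comp:
  "\<lbrakk>V \<in> fg_projectives k; W \<in> fg_projectives k; Z \<in> fg_projectives k; f \<in> Hom (GammaP k d) V W;
    g \<in> Hom (GammaP k d) W Z; x \<in> carrier (fob F V)\<rbrakk> \<Longrightarrow>
    fmor F V Z (compose (carrier (tpow k d V)) g f) x = fmor F W Z g (fmor F V W f x)"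
  using functor_LMod_comp[OF Rep_functor, of V W Z f g x] by simp

lemma Rep_plus:
  "\<lbrakk>V \<in> fg_projectives k; W \<in> fg_projectives k; f \<in> Hom (GammaP k d) V W; g \<in> Hom (GammaP k d) V W;
    x \<in> carrier (fob F V)\<rbrakk> \<Longrightarrow>
    fmor F V W (\<lambda>t\<in>carrier (tpow k d V). f t \<oplus>\<^bsub>tpow k d W\<^esub> g t) x = fmor F V W f x \<oplus>\<^bsub>fob F W\<^esub> fmor F V W g x"
  and Rep_scale:
  "\<lbrakk>V \<in> fg_projectives k; W \<in> fg_projectives k; f \<in> Hom (GammaP k d) V W; c \<in> carrier k;
    x \<in> carrier (fob F V)\<rbrakk> \<Longrightarrow>
    fmor F V W (\<lambda>t\<in>carrier (tpow k d V). c \<odot>\<^bsub>tpow k d W\<^esub> f t) x = c \<odot>\<^bsub>fob F W\<^esub> fmor F V W f x"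
  using F by (simp_all add: Rep_def spf_linear_def)

end

lemma Rep_ObI:
  assumes "\<And>V. V \<in> fg_projectives k \<Longrightarrow> left_module k (fob F V)"
    and "\<And>V W f. \<lbrakk>V \<in> fg_projectives k; W \<in> fg_projectives k; f \<in> Hom (GammaP k d) V W\<rbrakk> \<Longrightarrow>
      fmor F V W f \<in> linmaps k (fob F V) (fob F W)"
    and "\<And>V x. \<lbrakk>V \<in> fg_projectives k; x \<in> carrier (fob F V)\<rbrakk> \<Longrightarrow>
      fmor F V V (\<lambda>x\<in>carrier (tpow k d V). x) x = x"
    and "\<And>V W Z f g x. \<lbrakk>V \<in> fg_projectives k; W \<in> fg_projectives k; Z \<in> fg_projectives k;
      f \<in> Hom (GammaP k d) V W; g \<in> Hom (GammaP k d) W Z; x \<in> carrier (fob F V)\<rbrakk> \<Longrightarrow>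
      fmor F V Z (compose (carrier (tpow k d V)) g f) x = fmor F W Z g (fmor F V W f x)"
    and "\<And>V W f g x. \<lbrakk>V \<in> fg_projectives k; W \<in> fg_projectives k; f \<in> Hom (GammaP k d) V W;
      g \<in> Hom (GammaP k d) V W; x \<in> carrier (fob F V)\<rbrakk> \<Longrightarrow>
      fmor F V W (\<lambda>t\<in>carrier (tpow k d V). f t \<oplus>\<^bsub>tpow k d W\<^esub> g t) x = fmor F V W f x \<oplus>\<^bsub>fob F W\<^esub> fmor F V W g x"
    and "\<And>V W f c x. \<lbrakk>V \<in> fg_projectives k; W \<in> fg_projectives k; f \<in> Hom (GammaP k d) V W;
      c \<in> carrier k; x \<in> carrier (fob F V)\<rbrakk> \<Longrightarrow>
      fmor F V W (\<lambda>t\<in>carrier (tpow k d V). c \<odot>\<^bsub>tpow k d W\<^esub> f t) x = c \<odot>\<^bsub>fob F W\<^esub> fmor F V W f x"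
  shows "F \<in> Ob (Rep k d)"
proof -
  have "is_functor (GammaP k d) (LMod k) F"
    by (rule functor_LModI) (use assms in \<open>auto simp: GammaP_Id GammaP_Comp\<close>)
  then show ?thesis using assms(5,6) by (simp add: Rep_def spf_linear_def)
qed

subsection \<open>The functor \<open>G\<^sub>\<otimes>\<close>\<close>

text \<open>The value of \<open>G\<^sub>\<otimes>(N)\<close> at \<open>V\<close>; \<open>PT\<close>
  below gives its pure tensors.\<close>

abbreviation BT where "BT d N V \<equiv> btensor k (kS k d) (tpow k d V) (kS_ract k d V) N"
abbreviation PT where "PT d N V \<equiv> pure_btensor k (kS k d) (tpow k d V) (kS_ract k d V) N"

context
  fixes d :: nat and N :: "(perm \<Rightarrow> 'k, 'a) module" and V :: "('k, 'v) module"
  assumes N: "left_module (kS k d) N" and V: "V \<in> fg_projectives k"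
begin

lemma BT_hyps: "cring k" "left_module k (tpow k d V)" "left_module (kS k d) N"
  "\<forall>x\<in>carrier (tpow k d V). \<forall>a\<in>carrier (kS k d). kS_ract k d V x a \<in> carrier (tpow k d V)"
  using k N fg_tpow_module[OF V] kS_ract_closed[OF fg_proj_module[OF V]] by blast+

lemmas BT_module = btensor_module[OF BT_hyps]
lemmas PT_closed = pure_btensor_closed[OF BT_hyps]
lemmas BT_lin_eq = btensor_lin_eq[OF BT_hyps]
lemmas BT_lift_linmaps = btensor_lift_linmaps[OF BT_hyps]
lemmas BT_lift_pure = btensor_lift_pure[OF BT_hyps]

lemma PT_lin: "y \<in> carrier N \<Longrightarrow> lin k (tpow k d V) (BT d N V) (\<lambda>x. PT d N V x y)"
  and PT_add: "\<lbrakk>x \<in> carrier (tpow k d V); y \<in> carrier N; y' \<in> carrier N\<rbrakk> \<Longrightarrow>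
    PT d N V x (y \<oplus>\<^bsub>N\<^esub> y') = PT d N V x y \<oplus>\<^bsub>BT d N V\<^esub> PT d N V x y'"
  and PT_balanced: "\<lbrakk>x \<in> carrier (tpow k d V); y \<in> carrier N; a \<in> carrier (kS k d)\<rbrakk> \<Longrightarrow>
    PT d N V (kS_ract k d V x a) y = PT d N V x (a \<odot>\<^bsub>N\<^esub> y)"
  using pure_btensor_balanced[OF BT_hyps] unfolding balanced_def by blast+

end

lemma Gtensor_ob_simps [simp]:
  "fob (Gtensor_ob k d N) V = BT d N V"
  "fmor (Gtensor_ob k d N) V W f = btensor_lift k (kS k d) (tpow k d V) (kS_ract k d V) N (BT d N W)
    (\<lambda>x y. PT d N W (f x) y)"
  by (simp_all add: Gtensor_ob_def)

text \<open>An equivariant \<open>f\<close> commutes with the whole group algebra, so tensoring it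
  with the identity of \<open>N\<close> respects balance.\<close>

lemma Gtensor_ob_lift:
  assumes N: "left_module (kS k d) N" and V: "V \<in> fg_projectives k" and W: "W \<in> fg_projectives k"
    and f: "f \<in> Hom (GammaP k d) V W"
  shows Gtensor_ob_linmaps: "fmor (Gtensor_ob k d N) V W f \<in> linmaps k (BT d N V) (BT d N W)"
    and Gtensor_ob_pure: "\<lbrakk>x \<in> carrier (tpow k d V); y \<in> carrier N\<rbrakk> \<Longrightarrow>
      fmor (Gtensor_ob k d N) V W f (PT d N V x y) = PT d N W (f x) y"
proof -
  have b: "balanced k (kS k d) (tpow k d V) (kS_ract k d V) N (BT d N W) (\<lambda>x y. PT d N W (f x) y)"
    unfolding balanced_def
    using lin_compose[OF GammaP_Hom_lin[OF f] PT_lin[OF N W]] PT_add[OF N W] PT_balanced[OF N W]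
      GammaP_Hom_closed[OF f] GammaP_Hom_ract[OF V W f] by auto
  show "fmor (Gtensor_ob k d N) V W f \<in> linmaps k (BT d N V) (BT d N W)"
    unfolding Gtensor_ob_simps by (rule BT_lift_linmaps[OF N V BT_module[OF N W] b])
  show "fmor (Gtensor_ob k d N) V W f (PT d N V x y) = PT d N W (f x) y"
    if "x \<in> carrier (tpow k d V)" "y \<in> carrier N"
    unfolding Gtensor_ob_simps by (rule BT_lift_pure[OF N V BT_module[OF N W] b that])
qed

declare Gtensor_ob_simps(2) [simp del]

text \<open>Each functor law, and linearity on hom-sets, compares two linear maps out of a tensor
  product, so pure tensors suffice.\<close>

lemma Gtensor_ob_Rep:
  fixes N :: "(perm \<Rightarrow> 'k, 'a) module"
  assumes N: "left_module (kS k d) N"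
  shows "(Gtensor_ob k d N :: ('k, 'v, _) spf) \<in> Ob (Rep k d)"
proof (rule Rep_ObI)
  let ?F = "Gtensor_ob k d N :: ('k, 'v, _) spf"
  note L = Gtensor_ob_linmaps[OF N] and P = Gtensor_ob_pure[OF N]
  note ll = lin_linmaps[OF L]
  fix V :: "('k, 'v) module" assume V: "V \<in> fg_projectives k"
  note eq = BT_lin_eq[OF N V]
  show "left_module k (fob ?F V)" using BT_module[OF N V] by simp
  { fix x assume x: "x \<in> carrier (fob ?F V)"
    show "fmor ?F V V (\<lambda>x\<in>carrier (tpow k d V). x) x = x"
      by (rule eq[OF BT_module[OF N V] ll[OF V V GammaP_Id[OF V]] lin_id])
        (use x in \<open>simp_all add: P[OF V V GammaP_Id[OF V]]\<close>) }
  fix W :: "('k, 'v) module" assume W: "W \<in> fg_projectives k"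
  fix f assume f: "f \<in> Hom (GammaP k d) V W"
  show "fmor ?F V W f \<in> linmaps k (fob ?F V) (fob ?F W)" using L[OF V W f] by simp
  { fix Z :: "('k, 'v) module" and g x
    assume Z: "Z \<in> fg_projectives k" and g: "g \<in> Hom (GammaP k d) W Z" and x: "x \<in> carrier (fob ?F V)"
    note gf = GammaP_Comp[OF V W f g]
    show "fmor ?F V Z (compose (carrier (tpow k d V)) g f) x = fmor ?F W Z g (fmor ?F V W f x)"
      by (rule eq[OF BT_module[OF N Z] ll[OF V Z gf] lin_compose[OF ll[OF V W f] ll[OF W Z g]]])
        (use x in \<open>simp_all add: P[OF V Z gf, unfolded compose_def] P[OF V W f] P[OF W Z g] GammaP_Hom_closed[OF f] compose_def\<close>) }
  { fix g x assume g: "g \<in> Hom (GammaP k d) V W" and x: "x \<in> carrier (fob ?F V)"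
    note fg = GammaP_plus[OF V W f g]
    show "fmor ?F V W (\<lambda>t\<in>carrier (tpow k d V). f t \<oplus>\<^bsub>tpow k d W\<^esub> g t) x =
        fmor ?F V W f x \<oplus>\<^bsub>fob ?F W\<^esub> fmor ?F V W g x"
      unfolding Gtensor_ob_simps(1)
      by (rule eq[OF BT_module[OF N W] ll[OF V W fg] lin_plus[OF BT_module[OF N W] ll[OF V W f] ll[OF V W g]]])
        (use x in \<open>simp_all add: P[OF V W fg] P[OF V W f] P[OF V W g] GammaP_Hom_closed[OF f]
          GammaP_Hom_closed[OF g] lin_add[OF PT_lin[OF N W]]\<close>) }
  { fix c x assume c: "c \<in> carrier k" and x: "x \<in> carrier (fob ?F V)"
    note cf = GammaP_scale[OF V W f c]
    show "fmor ?F V W (\<lambda>t\<in>carrier (tpow k d V). c \<odot>\<^bsub>tpow k d W\<^esub> f t) x = c \<odot>\<^bsub>fob ?F W\<^esub> fmor ?F V W f x"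
      unfolding Gtensor_ob_simps(1)
      by (rule eq[OF BT_module[OF N W] ll[OF V W cf] lin_scale[OF k BT_module[OF N W] ll[OF V W f] c]])
        (use x c in \<open>simp_all add: P[OF V W cf] P[OF V W f] GammaP_Hom_closed[OF f] lin_smult[OF PT_lin[OF N W]]\<close>) }
qed

text \<open>Unlike \<open>fmor (Gtensor k d)\<close>, this also acts on maps between modules with different carrier types.\<close>

definition Gmap :: "nat \<Rightarrow> (perm \<Rightarrow> 'k, 'a) module \<Rightarrow> (perm \<Rightarrow> 'k, 'b) module \<Rightarrow> ('a \<Rightarrow> 'b) \<Rightarrow>
    ('k, 'v, (('k, 'v) tens \<times> 'a \<Rightarrow> 'k) set, (('k, 'v) tens \<times> 'b \<Rightarrow> 'k) set) spf_hom" where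
  "Gmap d N N' g = (\<lambda>V\<in>fg_projectives k.
       btensor_lift k (kS k d) (tpow k d V) (kS_ract k d V) N (BT d N' V) (\<lambda>x y. PT d N' V x (g y)))"

context
  fixes d :: nat and N :: "(perm \<Rightarrow> 'k, 'a) module" and N' :: "(perm \<Rightarrow> 'k, 'b) module" and g
  assumes N: "left_module (kS k d) N" and N': "left_module (kS k d) N'" and g: "lin (kS k d) N N' g"
begin

lemma Gmap_balanced:
  assumes V: "V \<in> fg_projectives k"
  shows "balanced k (kS k d) (tpow k d V) (kS_ract k d V) N (BT d N' V) (\<lambda>x y. PT d N' V x (g y))"
  unfolding balanced_def
  using PT_lin[OF N' V] PT_add[OF N' V] PT_balanced[OF N' V] lin_closed[OF g] lin_add[OF g] lin_smult[OF g]
  by auto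

lemma Gmap_linmaps: "V \<in> fg_projectives k \<Longrightarrow> Gmap d N N' g V \<in> linmaps k (BT d N V) (BT d N' V)"
  by (simp add: Gmap_def) (rule BT_lift_linmaps[OF N _ BT_module[OF N'] Gmap_balanced])

lemmas Gmap_lin = lin_linmaps[OF Gmap_linmaps]

lemma Gmap_pure:
  "\<lbrakk>V \<in> fg_projectives k; x \<in> carrier (tpow k d V); y \<in> carrier N\<rbrakk> \<Longrightarrow>
    Gmap d N N' g V (PT d N V x y) = PT d N' V x (g y)"
  by (simp add: Gmap_def) (rule BT_lift_pure[OF N _ BT_module[OF N'] Gmap_balanced])

lemma Gmap_nat_trans: "Gmap d N N' g \<in> nat_trans k (GammaP k d) (Gtensor_ob k d N) (Gtensor_ob k d N')"
proof (rule nat_transI)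
  fix V W f x assume "V \<in> Ob (GammaP k d)" "W \<in> Ob (GammaP k d)" and f: "f \<in> Hom (GammaP k d) V W"
    and x: "x \<in> carrier (fob (Gtensor_ob k d N) V)"
  then have V: "V \<in> fg_projectives k" and W: "W \<in> fg_projectives k" by simp_all
  show "Gmap d N N' g W (fmor (Gtensor_ob k d N) V W f x) = fmor (Gtensor_ob k d N') V W f (Gmap d N N' g V x)"
    by (rule BT_lin_eq[OF N V BT_module[OF N' W]
        lin_compose[OF lin_linmaps[OF Gtensor_ob_linmaps[OF N V W f]] Gmap_lin[OF W]]
        lin_compose[OF Gmap_lin[OF V] lin_linmaps[OF Gtensor_ob_linmaps[OF N' V W f]]]])
      (use x in \<open>simp_all add: Gmap_pure V W Gtensor_ob_pure[OF N V W f] Gtensor_ob_pure[OF N' V W f]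
        GammaP_Hom_closed[OF f] lin_closed[OF g]\<close>)
qed (auto simp: Gmap_linmaps, simp add: Gmap_def)

end

lemma Gmap_id:
  assumes N: "left_module (kS k d) N" and V: "V \<in> fg_projectives k" and g: "\<And>y. y \<in> carrier N \<Longrightarrow> g y = y"
    and x: "x \<in> carrier (BT d N V)"
  shows "Gmap d N N g V x = x"
proof -
  have gl: "lin (kS k d) N N g" using lin_cong[OF N, of g "\<lambda>x. x" N] g lin_id by blast
  show ?thesis
    by (rule BT_lin_eq[OF N V BT_module[OF N V] Gmap_lin[OF N N gl V] lin_id])
      (use x in \<open>simp_all add: Gmap_pure[OF N N gl V] g\<close>)
qed

text \<open>\<open>gh\<close> has to agree with the composite only on the carrier, which covers both
  the extensional \<open>compose\<close> and plain composition.\<close>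

lemma Gmap_comp:
  assumes N: "left_module (kS k d) N" and N': "left_module (kS k d) N'" and N'': "left_module (kS k d) N''"
    and g: "lin (kS k d) N N' g" and h: "lin (kS k d) N' N'' h"
    and gh: "\<And>y. y \<in> carrier N \<Longrightarrow> gh y = h (g y)"
    and V: "V \<in> fg_projectives k" and x: "x \<in> carrier (BT d N V)"
  shows "Gmap d N N'' gh V x = Gmap d N' N'' h V (Gmap d N N' g V x)"
proof -
  have l: "lin (kS k d) N N'' gh"
    using lin_cong[OF N, of gh "\<lambda>y. h (g y)" N''] gh lin_compose[OF g h] by blast
  show ?thesis
    by (rule BT_lin_eq[OF N V BT_module[OF N'' V] Gmap_lin[OF N N'' l V]
        lin_compose[OF Gmap_lin[OF N N' g V] Gmap_lin[OF N' N'' h V]]])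
      (use x in \<open>simp_all add: Gmap_pure[OF N N'' l V] Gmap_pure[OF N N' g V] Gmap_pure[OF N' N'' h V] gh lin_closed[OF g]\<close>)
qed

end

context base
begin

subsection \<open>The Schur functor\<close>

lemma Gamma_omega_simps [simp]:
  "fob (Gamma_omega k d) V = tpow k d V" "fmor (Gamma_omega k d) V W f = f"
  by (simp_all add: Gamma_omega_def)

lemma Gamma_omega_Rep: "Gamma_omega k d \<in> Ob (Rep k d)"
  by (rule Rep_ObI) (auto simp: fg_tpow_module GammaP_Hom compose_def)

lemma Schur_ob_simps [simp]:
  fixes F :: "('k, 'v, 'w) spf"
  shows "carrier (Schur_ob k d F) = nat_trans k (GammaP k d) (Gamma_omega k d) F"
    "\<zero>\<^bsub>Schur_ob k d F\<^esub> = (\<lambda>V\<in>fg_projectives k. \<lambda>x\<in>carrier (tpow k d V). \<zero>\<^bsub>fob F V\<^esub>)"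
    "\<phi> \<oplus>\<^bsub>Schur_ob k d F\<^esub> \<psi> = (\<lambda>V\<in>fg_projectives k. \<lambda>x\<in>carrier (tpow k d V). \<phi> V x \<oplus>\<^bsub>fob F V\<^esub> \<psi> V x)"
    "a \<odot>\<^bsub>Schur_ob k d F\<^esub> \<phi> = (\<lambda>V\<in>fg_projectives k. \<lambda>x\<in>carrier (tpow k d V). \<phi> V (kS_ract k d V x a))"
  by (simp_all add: Schur_ob_def)

text \<open>The laws of addition hold pointwise in \<open>fob F V\<close>. Precomposition turns the
  right action into a left one: acting by \<open>b\<close> and then by \<open>a\<close> sends
  \<open>x\<close> to the value of \<phi> at \<open>(x a) b\<close>.\<close>

lemma Schur_ob_module:
  fixes F :: "('k, 'v, 'w) spf"
  assumes F: "F \<in> Ob (Rep k d)"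
  shows "left_module (kS k d) (Schur_ob k d F)"
proof (rule left_moduleI[OF kS_ring])
  let ?S = "Schur_ob k d F"
  have eqI: "\<phi> = \<psi>" if "\<phi> \<in> carrier ?S" "\<psi> \<in> carrier ?S"
    "\<And>V x. \<lbrakk>V \<in> fg_projectives k; x \<in> carrier (tpow k d V)\<rbrakk> \<Longrightarrow> \<phi> V x = \<psi> V x" for \<phi> \<psi>
    using that by (intro nat_trans_eqI) auto
  \<comment> \<open>Pointwise linear maps that are natural become an element after restriction to
    the carriers; every operation of the module is shown to be closed in this way.\<close>
  have sI: "(\<lambda>V\<in>fg_projectives k. restrict (\<phi> V) (carrier (tpow k d V))) \<in> carrier ?S"
    if l: "\<And>V. V \<in> fg_projectives k \<Longrightarrow> lin k (tpow k d V) (fob F V) (\<phi> V)"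
      and n: "\<And>V W f x. \<lbrakk>V \<in> fg_projectives k; W \<in> fg_projectives k; f \<in> Hom (GammaP k d) V W;
        x \<in> carrier (tpow k d V)\<rbrakk> \<Longrightarrow> \<phi> W (f x) = fmor F V W f (\<phi> V x)" for \<phi>
    unfolding Schur_ob_simps(1)
  proof (rule nat_transI)
    fix V W :: "('k, 'v) module" and f x
    assume "V \<in> Ob (GammaP k d)" "W \<in> Ob (GammaP k d)" and f: "f \<in> Hom (GammaP k d) V W"
      and "x \<in> carrier (fob (Gamma_omega k d) V)"
    then show "(\<lambda>V\<in>fg_projectives k. restrict (\<phi> V) (carrier (tpow k d V))) W (fmor (Gamma_omega k d) V W f x) =
        fmor F V W f ((\<lambda>V\<in>fg_projectives k. restrict (\<phi> V) (carrier (tpow k d V))) V x)"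
      using n[of V W f x] GammaP_Hom_closed[OF f, of x] by simp
  qed (use l in \<open>auto simp: restrict_linmaps_iff[OF fg_tpow_module]\<close>)
  have lin: "lin k (tpow k d V) (fob F V) (\<phi> V)" if "\<phi> \<in> carrier ?S" "V \<in> fg_projectives k" for \<phi> V
    using nat_trans_lin[of \<phi> k "GammaP k d" "Gamma_omega k d" F V] that by simp
  note cl = lin_closed[OF lin]
  have nat: "\<phi> W (f x) = fmor F V W f (\<phi> V x)" if "\<phi> \<in> carrier ?S" "V \<in> fg_projectives k"
    "W \<in> fg_projectives k" "f \<in> Hom (GammaP k d) V W" "x \<in> carrier (tpow k d V)" for \<phi> V W f x
    using nat_trans_natural[of \<phi> k "GammaP k d" "Gamma_omega k d" F V W f x] that by simp
  note M = Rep_module[OF F]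
  note Fl = Rep_lin[OF F]
  note rc = kS_ract_closed[OF fg_proj_module]
  have ap: "(\<phi> \<oplus>\<^bsub>?S\<^esub> \<psi>) V x = \<phi> V x \<oplus>\<^bsub>fob F V\<^esub> \<psi> V x" "(a \<odot>\<^bsub>?S\<^esub> \<phi>) V x = \<phi> V (kS_ract k d V x a)"
    "\<zero>\<^bsub>?S\<^esub> V x = \<zero>\<^bsub>fob F V\<^esub>"
    if "V \<in> fg_projectives k" "x \<in> carrier (tpow k d V)" for \<phi> \<psi> a V x
    using that by simp_all
  show add: "\<phi> \<oplus>\<^bsub>?S\<^esub> \<psi> \<in> carrier ?S" if p: "\<phi> \<in> carrier ?S" and q: "\<psi> \<in> carrier ?S" for \<phi> \<psi>
    unfolding Schur_ob_simps(3)
  proof (rule sI)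
    fix V :: "('k, 'v) module" assume V: "V \<in> fg_projectives k"
    show "lin k (tpow k d V) (fob F V) (\<lambda>x. \<phi> V x \<oplus>\<^bsub>fob F V\<^esub> \<psi> V x)"
      by (rule lin_plus[OF M[OF V] lin[OF p V] lin[OF q V]])
    fix W :: "('k, 'v) module" and f x assume W: "W \<in> fg_projectives k" and f: "f \<in> Hom (GammaP k d) V W"
      and x: "x \<in> carrier (tpow k d V)"
    show "\<phi> W (f x) \<oplus>\<^bsub>fob F W\<^esub> \<psi> W (f x) = fmor F V W f (\<phi> V x \<oplus>\<^bsub>fob F V\<^esub> \<psi> V x)"
      using nat[OF p V W f x] nat[OF q V W f x] lin_add[OF Fl[OF V W f] cl[OF p V x] cl[OF q V x]] by simp
  qed
  show zero: "\<zero>\<^bsub>?S\<^esub> \<in> carrier ?S"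
    unfolding Schur_ob_simps(2)
    by (rule sI) (simp_all add: lin_const_zero M lin_zero[OF M M Fl])
  show act: "a \<odot>\<^bsub>?S\<^esub> \<phi> \<in> carrier ?S" if a: "a \<in> carrier (kS k d)" and p: "\<phi> \<in> carrier ?S" for a \<phi>
    unfolding Schur_ob_simps(4)
  proof (rule sI)
    fix V :: "('k, 'v) module" assume V: "V \<in> fg_projectives k"
    show "lin k (tpow k d V) (fob F V) (\<lambda>x. \<phi> V (kS_ract k d V x a))"
      by (rule lin_compose[OF kS_ract_lin[OF fg_proj_module[OF V] a] lin[OF p V]])
    fix W :: "('k, 'v) module" and f x assume W: "W \<in> fg_projectives k" and f: "f \<in> Hom (GammaP k d) V W"
      and x: "x \<in> carrier (tpow k d V)"
    show "\<phi> W (kS_ract k d W (f x) a) = fmor F V W f (\<phi> V (kS_ract k d V x a))"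
      using nat[OF p V W f rc[OF V a x]] GammaP_Hom_ract[OF V W f x a] by simp
  qed
  { fix \<phi> assume p: "\<phi> \<in> carrier ?S"
    show "\<zero>\<^bsub>?S\<^esub> \<oplus>\<^bsub>?S\<^esub> \<phi> = \<phi>"
    proof (rule eqI[OF add[OF zero p] p])
      fix V :: "('k, 'v) module" and x assume V: "V \<in> fg_projectives k" and x: "x \<in> carrier (tpow k d V)"
      interpret FV: left_module k "fob F V" by (rule M[OF V])
      show "(\<zero>\<^bsub>?S\<^esub> \<oplus>\<^bsub>?S\<^esub> \<phi>) V x = \<phi> V x" using cl[OF p V x] by (simp only: ap V x FV.l_zero)
    qed
    show "\<one>\<^bsub>kS k d\<^esub> \<odot>\<^bsub>?S\<^esub> \<phi> = \<phi>"
    proof (rule eqI[OF act[OF _ p] p])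
      show "\<one>\<^bsub>kS k d\<^esub> \<in> carrier (kS k d)" by (rule ring.ring_simprules(6)[OF kS_ring])
    qed (simp only: ap kS_ract_one[OF fg_proj_module])
    show "\<zero>\<^bsub>kS k d\<^esub> \<odot>\<^bsub>?S\<^esub> \<phi> = \<zero>\<^bsub>?S\<^esub>"
    proof (rule eqI[OF act[OF _ p] zero])
      show "\<zero>\<^bsub>kS k d\<^esub> \<in> carrier (kS k d)" by (rule ring.ring_simprules(2)[OF kS_ring])
      fix V :: "('k, 'v) module" and x assume V: "V \<in> fg_projectives k" and x: "x \<in> carrier (tpow k d V)"
      have "kS_ract k d V x \<zero>\<^bsub>kS k d\<^esub> = \<zero>\<^bsub>tpow k d V\<^esub>"
        using lin_zero[OF free_mod_module[OF k] fg_tpow_module[OF V] kS_ract_lin2[OF fg_proj_module[OF V] x]] by simp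
      then show "(\<zero>\<^bsub>kS k d\<^esub> \<odot>\<^bsub>?S\<^esub> \<phi>) V x = \<zero>\<^bsub>?S\<^esub> V x"
        using lin_zero[OF fg_tpow_module[OF V] M[OF V] lin[OF p V]] by (simp only: ap V x)
    qed
    fix a assume a: "a \<in> carrier (kS k d)"
    { fix b assume b: "b \<in> carrier (kS k d)"
      have ab: "a \<oplus>\<^bsub>kS k d\<^esub> b \<in> carrier (kS k d)" "a \<otimes>\<^bsub>kS k d\<^esub> b \<in> carrier (kS k d)"
        using ring.ring_simprules(1,5)[OF kS_ring] a b by blast+
      show "(a \<oplus>\<^bsub>kS k d\<^esub> b) \<odot>\<^bsub>?S\<^esub> \<phi> = a \<odot>\<^bsub>?S\<^esub> \<phi> \<oplus>\<^bsub>?S\<^esub> b \<odot>\<^bsub>?S\<^esub> \<phi>"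
      proof (rule eqI[OF act[OF ab(1) p] add[OF act[OF a p] act[OF b p]]])
        fix V :: "('k, 'v) module" and x assume V: "V \<in> fg_projectives k" and x: "x \<in> carrier (tpow k d V)"
        have "kS_ract k d V x (a \<oplus>\<^bsub>kS k d\<^esub> b) = kS_ract k d V x a \<oplus>\<^bsub>tpow k d V\<^esub> kS_ract k d V x b"
          using lin_add[OF kS_ract_lin2[OF fg_proj_module[OF V] x], of a b] a b by simp
        then show "((a \<oplus>\<^bsub>kS k d\<^esub> b) \<odot>\<^bsub>?S\<^esub> \<phi>) V x = (a \<odot>\<^bsub>?S\<^esub> \<phi> \<oplus>\<^bsub>?S\<^esub> b \<odot>\<^bsub>?S\<^esub> \<phi>) V x"
          using lin_add[OF lin[OF p V] rc[OF V a x] rc[OF V b x]] by (simp only: ap V x)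
      qed
      show "(a \<otimes>\<^bsub>kS k d\<^esub> b) \<odot>\<^bsub>?S\<^esub> \<phi> = a \<odot>\<^bsub>?S\<^esub> (b \<odot>\<^bsub>?S\<^esub> \<phi>)"
        by (rule eqI[OF act[OF ab(2) p] act[OF a act[OF b p]]])
          (simp only: ap rc[OF _ a] kS_ract_assoc[OF fg_proj_module _ a b]) }
    fix \<psi> assume q: "\<psi> \<in> carrier ?S"
    show "a \<odot>\<^bsub>?S\<^esub> (\<phi> \<oplus>\<^bsub>?S\<^esub> \<psi>) = a \<odot>\<^bsub>?S\<^esub> \<phi> \<oplus>\<^bsub>?S\<^esub> a \<odot>\<^bsub>?S\<^esub> \<psi>"
      by (rule eqI[OF act[OF a add[OF p q]] add[OF act[OF a p] act[OF a q]]]) (simp only: ap rc[OF _ a]) }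
  { fix \<phi> \<psi> assume p: "\<phi> \<in> carrier ?S" and q: "\<psi> \<in> carrier ?S"
    show "\<phi> \<oplus>\<^bsub>?S\<^esub> \<psi> = \<psi> \<oplus>\<^bsub>?S\<^esub> \<phi>"
    proof (rule eqI[OF add[OF p q] add[OF q p]])
      fix V :: "('k, 'v) module" and x assume V: "V \<in> fg_projectives k" and x: "x \<in> carrier (tpow k d V)"
      interpret FV: left_module k "fob F V" by (rule M[OF V])
      show "(\<phi> \<oplus>\<^bsub>?S\<^esub> \<psi>) V x = (\<psi> \<oplus>\<^bsub>?S\<^esub> \<phi>) V x"
        using cl[OF p V x] cl[OF q V x] by (simp only: ap V x FV.a_comm)
    qed
    fix \<chi> assume r: "\<chi> \<in> carrier ?S"
    show "\<phi> \<oplus>\<^bsub>?S\<^esub> \<psi> \<oplus>\<^bsub>?S\<^esub> \<chi> = \<phi> \<oplus>\<^bsub>?S\<^esub> (\<psi> \<oplus>\<^bsub>?S\<^esub> \<chi>)"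
    proof (rule eqI[OF add[OF add[OF p q] r] add[OF p add[OF q r]]])
      fix V :: "('k, 'v) module" and x assume V: "V \<in> fg_projectives k" and x: "x \<in> carrier (tpow k d V)"
      interpret FV: left_module k "fob F V" by (rule M[OF V])
      show "(\<phi> \<oplus>\<^bsub>?S\<^esub> \<psi> \<oplus>\<^bsub>?S\<^esub> \<chi>) V x = (\<phi> \<oplus>\<^bsub>?S\<^esub> (\<psi> \<oplus>\<^bsub>?S\<^esub> \<chi>)) V x"
        using cl[OF p V x] cl[OF q V x] cl[OF r V x] by (simp only: ap V x FV.a_assoc)
    qed }
qed

text \<open>Unlike \<open>fmor (Schur k d)\<close>, this also acts on morphisms between functors with different value types.\<close>

abbreviation Smap where "Smap d \<alpha> \<equiv> vcomp (GammaP k d) (Gamma_omega k d) \<alpha>"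

lemmas Smap_closed = vcomp_nat_trans[OF Rep_functor[OF Gamma_omega_Rep]]

lemma Smap_apply:
  "\<lbrakk>V \<in> fg_projectives k; x \<in> carrier (tpow k d V)\<rbrakk> \<Longrightarrow> Smap d \<alpha> \<phi> V x = \<alpha> V (\<phi> V x)"
  by (simp add: vcomp_apply)

lemma nat_trans_omega:
  assumes "\<phi> \<in> nat_trans k (GammaP k d) (Gamma_omega k d) F" "V \<in> fg_projectives k"
  shows nat_trans_omega_lin: "lin k (tpow k d V) (fob F V) (\<phi> V)"
    and nat_trans_omega_closed: "x \<in> carrier (tpow k d V) \<Longrightarrow> \<phi> V x \<in> carrier (fob F V)"
  using nat_trans_lin[OF assms(1), of V] nat_trans_closed[OF assms(1), of V x] assms(2) by simp_all

lemma nat_trans_omega_eqI: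
  assumes "\<phi> \<in> nat_trans k (GammaP k d) (Gamma_omega k d) F" "\<psi> \<in> nat_trans k (GammaP k d) (Gamma_omega k d) F"
    "\<And>V x. \<lbrakk>V \<in> fg_projectives k; x \<in> carrier (tpow k d V)\<rbrakk> \<Longrightarrow> \<phi> V x = \<psi> V x"
  shows "\<phi> = \<psi>"
  by (rule nat_trans_eqI[OF assms(1,2)]) (use assms(3) in auto)

lemma Smap_lin:
  fixes F :: "('k, 'v, 'w) spf" and F' :: "('k, 'v, 'x) spf"
  assumes F: "F \<in> Ob (Rep k d)" and F': "F' \<in> Ob (Rep k d)" and a: "\<alpha> \<in> nat_trans k (GammaP k d) F F'"
  shows "lin (kS k d) (Schur_ob k d F) (Schur_ob k d F') (Smap d \<alpha>)"
proof (rule linI)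
  interpret S: left_module "kS k d" "Schur_ob k d F" by (rule Schur_ob_module[OF F])
  interpret S': left_module "kS k d" "Schur_ob k d F'" by (rule Schur_ob_module[OF F'])
  note al = nat_trans_lin[OF a, unfolded GammaP_simps]
  have cl: "Smap d \<alpha> \<phi> \<in> carrier (Schur_ob k d F')" if "\<phi> \<in> carrier (Schur_ob k d F)" for \<phi>
    using Smap_closed[OF _ a] that by simp
  { fix \<phi> assume p: "\<phi> \<in> carrier (Schur_ob k d F)"
    show "Smap d \<alpha> \<phi> \<in> carrier (Schur_ob k d F')" by (rule cl[OF p])
    { fix \<psi> assume q: "\<psi> \<in> carrier (Schur_ob k d F)"
      show "Smap d \<alpha> (\<phi> \<oplus>\<^bsub>Schur_ob k d F\<^esub> \<psi>) = Smap d \<alpha> \<phi> \<oplus>\<^bsub>Schur_ob k d F'\<^esub> Smap d \<alpha> \<psi>"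
        by (rule nat_trans_omega_eqI[OF cl[OF S.a_closed[OF p q], unfolded Schur_ob_simps(1)]
              S'.a_closed[OF cl[OF p] cl[OF q], unfolded Schur_ob_simps(1)]])
          (use p q in \<open>simp add: Smap_apply lin_add[OF al] nat_trans_omega_closed\<close>) }
    fix a assume "a \<in> carrier (kS k d)"
    then show "Smap d \<alpha> (a \<odot>\<^bsub>Schur_ob k d F\<^esub> \<phi>) = a \<odot>\<^bsub>Schur_ob k d F'\<^esub> Smap d \<alpha> \<phi>"
      by (intro nat_trans_omega_eqI[OF cl[OF S.smult_closed[OF _ p], unfolded Schur_ob_simps(1)]
              S'.smult_closed[OF _ cl[OF p], unfolded Schur_ob_simps(1)]])
        (use p in \<open>simp_all add: Smap_apply kS_ract_closed[OF fg_proj_module]\<close>) }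
qed

subsection \<open>The unit\<close>

text \<open>Restriction of scalars along the map from \<open>k\<close> to the group algebra. Lifts
  out of \<open>btensor\<close> need a target over \<open>k\<close>, and \<open>N\<close> itself
  occurs as such a target.\<close>

definition res :: "nat \<Rightarrow> (perm \<Rightarrow> 'k, 'a) module \<Rightarrow> ('k, 'a) module" where
  "res d N = mk_module (carrier N) \<zero>\<^bsub>N\<^esub> (add N) (\<lambda>c x. (\<lambda>\<sigma>. c \<otimes>\<^bsub>k\<^esub> \<one>\<^bsub>kS k d\<^esub> \<sigma>) \<odot>\<^bsub>N\<^esub> x)"

lemma kS_scale_closed: "\<lbrakk>c \<in> carrier k; a \<in> carrier (kS k d)\<rbrakk> \<Longrightarrow> (\<lambda>\<sigma>. c \<otimes>\<^bsub>k\<^esub> a \<sigma>) \<in> carrier (kS k d)"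
  unfolding kS_carrier by auto

lemma kS_scale_mult:
  assumes c: "c \<in> carrier k" and a: "a \<in> carrier (kS k d)" and b: "b \<in> carrier (kS k d)"
  shows "(\<lambda>\<sigma>. c \<otimes>\<^bsub>k\<^esub> a \<sigma>) \<otimes>\<^bsub>kS k d\<^esub> b = (\<lambda>\<sigma>. c \<otimes>\<^bsub>k\<^esub> (a \<otimes>\<^bsub>kS k d\<^esub> b) \<sigma>)"
proof (rule kS_eqI)
  fix \<rho> assume "\<rho> \<in> carrier (sym_group d)"
  then show "((\<lambda>\<sigma>. c \<otimes>\<^bsub>k\<^esub> a \<sigma>) \<otimes>\<^bsub>kS k d\<^esub> b) \<rho> = c \<otimes>\<^bsub>k\<^esub> (a \<otimes>\<^bsub>kS k d\<^esub> b) \<rho>"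
    using c kS_closed[OF a] kS_closed[OF b]
    by (simp add: kS_mult k.m_assoc) (subst k.finsum_rdistr, auto)
qed (intro kS_mult_closed kS_scale_closed c a b)+

lemma res_module:
  assumes N: "left_module (kS k d) N" shows "left_module k (res d N)"
proof -
  interpret N: left_module "kS k d" N by fact
  note sc = kS_scale_closed[OF _ N.R.one_closed]
  show ?thesis
  proof (rule left_moduleI; (unfold res_def mk_module_simps)?)
    fix a b x assume a: "a \<in> carrier k" and b: "b \<in> carrier k" and x: "x \<in> carrier N"
    have 1: "\<one>\<^bsub>kS k d\<^esub> \<sigma> \<in> carrier k" for \<sigma> by (rule kS_closed[OF N.R.one_closed])
    have "(\<lambda>\<sigma>. (a \<oplus>\<^bsub>k\<^esub> b) \<otimes>\<^bsub>k\<^esub> \<one>\<^bsub>kS k d\<^esub> \<sigma>) =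
      (\<lambda>\<sigma>. a \<otimes>\<^bsub>k\<^esub> \<one>\<^bsub>kS k d\<^esub> \<sigma>) \<oplus>\<^bsub>kS k d\<^esub> (\<lambda>\<sigma>. b \<otimes>\<^bsub>k\<^esub> \<one>\<^bsub>kS k d\<^esub> \<sigma>)"
      using a b 1 by (simp add: k.l_distr)
    then show "(\<lambda>\<sigma>. (a \<oplus>\<^bsub>k\<^esub> b) \<otimes>\<^bsub>k\<^esub> \<one>\<^bsub>kS k d\<^esub> \<sigma>) \<odot>\<^bsub>N\<^esub> x =
        (\<lambda>\<sigma>. a \<otimes>\<^bsub>k\<^esub> \<one>\<^bsub>kS k d\<^esub> \<sigma>) \<odot>\<^bsub>N\<^esub> x \<oplus>\<^bsub>N\<^esub> (\<lambda>\<sigma>. b \<otimes>\<^bsub>k\<^esub> \<one>\<^bsub>kS k d\<^esub> \<sigma>) \<odot>\<^bsub>N\<^esub> x"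
      using N.smult_l_distr[OF sc[OF a] sc[OF b] x] by (simp only:)
    have "(\<lambda>\<sigma>. (a \<otimes>\<^bsub>k\<^esub> b) \<otimes>\<^bsub>k\<^esub> \<one>\<^bsub>kS k d\<^esub> \<sigma>) =
      (\<lambda>\<sigma>. a \<otimes>\<^bsub>k\<^esub> \<one>\<^bsub>kS k d\<^esub> \<sigma>) \<otimes>\<^bsub>kS k d\<^esub> (\<lambda>\<sigma>. b \<otimes>\<^bsub>k\<^esub> \<one>\<^bsub>kS k d\<^esub> \<sigma>)"
      unfolding kS_scale_mult[OF a N.R.one_closed sc[OF b]] N.R.l_one[OF sc[OF b]]
      using a b 1 by (simp add: k.m_assoc)
    then show "(\<lambda>\<sigma>. a \<otimes>\<^bsub>k\<^esub> b \<otimes>\<^bsub>k\<^esub> \<one>\<^bsub>kS k d\<^esub> \<sigma>) \<odot>\<^bsub>N\<^esub> x =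
        (\<lambda>\<sigma>. a \<otimes>\<^bsub>k\<^esub> \<one>\<^bsub>kS k d\<^esub> \<sigma>) \<odot>\<^bsub>N\<^esub> ((\<lambda>\<sigma>. b \<otimes>\<^bsub>k\<^esub> \<one>\<^bsub>kS k d\<^esub> \<sigma>) \<odot>\<^bsub>N\<^esub> x)"
      using N.smult_assoc[OF sc[OF a] sc[OF b] x] by (simp only:)
  next
    fix x assume x: "x \<in> carrier N"
    have 1: "\<one>\<^bsub>kS k d\<^esub> \<sigma> \<in> carrier k" for \<sigma> by (rule kS_closed[OF N.R.one_closed])
    have "(\<lambda>\<sigma>. \<zero>\<^bsub>k\<^esub> \<otimes>\<^bsub>k\<^esub> \<one>\<^bsub>kS k d\<^esub> \<sigma>) = \<zero>\<^bsub>kS k d\<^esub>" using 1 by simp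
    then show "(\<lambda>\<sigma>. \<zero>\<^bsub>k\<^esub> \<otimes>\<^bsub>k\<^esub> \<one>\<^bsub>kS k d\<^esub> \<sigma>) \<odot>\<^bsub>N\<^esub> x = \<zero>\<^bsub>N\<^esub>" using N.smult_l_null[OF x] by (simp only:)
    have "(\<lambda>\<sigma>. \<one>\<^bsub>k\<^esub> \<otimes>\<^bsub>k\<^esub> \<one>\<^bsub>kS k d\<^esub> \<sigma>) = \<one>\<^bsub>kS k d\<^esub>" using 1 by simp
    then show "(\<lambda>\<sigma>. \<one>\<^bsub>k\<^esub> \<otimes>\<^bsub>k\<^esub> \<one>\<^bsub>kS k d\<^esub> \<sigma>) \<odot>\<^bsub>N\<^esub> x = x" using N.smult_one[OF x] by (simp only:)
  qed (use N.smult_closed[OF sc] N.smult_r_distr[OF sc] in \<open>auto simp: k.ring_axioms N.a_ac simp del: kS_simps(4)\<close>)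
qed

definition unit :: "nat \<Rightarrow> (perm \<Rightarrow> 'k, 'a) module \<Rightarrow> 'a \<Rightarrow>
    ('k, 'v, ('k, 'v) tens, (('k, 'v) tens \<times> 'a \<Rightarrow> 'k) set) spf_hom" where
  "unit d N y = (\<lambda>V\<in>fg_projectives k. \<lambda>x\<in>carrier (tpow k d V). PT d N V x y)"

context
  fixes d :: nat and N :: "(perm \<Rightarrow> 'k, 'a) module"
  assumes N: "left_module (kS k d) N"
begin

interpretation N: left_module "kS k d" N by (rule N)

lemma unit_apply:
  "\<lbrakk>V \<in> fg_projectives k; x \<in> carrier (tpow k d V)\<rbrakk> \<Longrightarrow> unit d N y V x = PT d N V x y"
  by (simp add: unit_def)

lemma unit_closed: "y \<in> carrier N \<Longrightarrow> unit d N y \<in> carrier (Schur_ob k d (Gtensor_ob k d N))"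
  unfolding Schur_ob_simps
  by (rule nat_transI)
    (auto simp: unit_def restrict_linmaps_iff[OF fg_tpow_module] PT_lin[OF N] Gtensor_ob_pure[OF N]
      GammaP_Hom_closed)

lemma unit_lin: "lin (kS k d) N (Schur_ob k d (Gtensor_ob k d N)) (unit d N)"
proof (rule linI)
  let ?S = "Schur_ob k d (Gtensor_ob k d N)"
  interpret S: left_module "kS k d" ?S by (rule Schur_ob_module[OF Gtensor_ob_Rep[OF N]])
  note uc = unit_closed
  note sS = Schur_ob_simps(1)
  { fix x y assume x: "x \<in> carrier N" and y: "y \<in> carrier N"
    show "unit d N (x \<oplus>\<^bsub>N\<^esub> y) = unit d N x \<oplus>\<^bsub>?S\<^esub> unit d N y"
      by (rule nat_trans_omega_eqI[OF uc[OF N.a_closed[OF x y], unfolded sS] S.a_closed[OF uc[OF x] uc[OF y], unfolded sS]])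
        (use x y in \<open>simp add: unit_apply PT_add[OF N]\<close>) }
  fix a x assume a: "a \<in> carrier (kS k d)" and x: "x \<in> carrier N"
  show "unit d N (a \<odot>\<^bsub>N\<^esub> x) = a \<odot>\<^bsub>?S\<^esub> unit d N x"
    by (rule nat_trans_omega_eqI[OF uc[OF N.smult_closed[OF a x], unfolded sS] S.smult_closed[OF a uc[OF x], unfolded sS]])
      (use a x in \<open>simp add: unit_apply PT_balanced[OF N] kS_ract_closed[OF fg_proj_module]\<close>)
qed (rule unit_closed)

text \<open>For \<open>t \<in> V\<^sup>\<otimes>\<^sup>d\<close> the map \<open>x \<mapsto> t \<pi>(x)\<close> is a morphism in \<open>\<Gamma>\<^sup>dP\<^sub>k\<close> taking \<open>u\<close> to \<open>t\<close>; by naturality a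
  transformation \<open>\<phi>\<close> is therefore determined by \<open>\<phi>(u)\<close>.\<close>

lemma unit_bij:
  fixes E :: "('k, 'v) module"
  assumes E: "E \<in> fg_projectives k" and u: "u \<in> carrier (tpow k d E)"
    and \<pi>: "lin k (tpow k d E) (free_mod k (carrier (sym_group d))) \<pi>" and \<pi>u: "\<pi> u = \<one>\<^bsub>kS k d\<^esub>"
    and \<pi>a: "\<And>x a. \<lbrakk>x \<in> carrier (tpow k d E); a \<in> carrier (kS k d)\<rbrakk> \<Longrightarrow> \<pi> (kS_ract k d E x a) = \<pi> x \<otimes>\<^bsub>kS k d\<^esub> a"
  shows "bij_betw (unit d N :: 'a \<Rightarrow> ('k, 'v, _, _) spf_hom) (carrier N) (carrier (Schur_ob k d (Gtensor_ob k d N)))"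
proof -
  let ?G = "Gtensor_ob k d N"
  have \<pi>c: "\<pi> x \<in> carrier (kS k d)" if "x \<in> carrier (tpow k d E)" for x
    using lin_closed[OF \<pi> that] by simp
  have rN: "carrier (res d N) = carrier N" "add (res d N) = add N"
    "\<And>c x. c \<odot>\<^bsub>res d N\<^esub> x = (\<lambda>\<sigma>. c \<otimes>\<^bsub>k\<^esub> \<one>\<^bsub>kS k d\<^esub> \<sigma>) \<odot>\<^bsub>N\<^esub> x"
    by (simp_all add: res_def)
  \<comment> \<open>The assignment of \<open>\<pi> x \<odot> y\<close> to the pair \<open>x\<close>,
    \<open>y\<close> is balanced exactly because \<pi> commutes with the right action.\<close>
  have bal: "balanced k (kS k d) (tpow k d E) (kS_ract k d E) N (res d N) (\<lambda>x y. \<pi> x \<odot>\<^bsub>N\<^esub> y)"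
    unfolding balanced_def
  proof (intro conjI ballI linI; (unfold rN)?)
    fix x x' y assume x: "x \<in> carrier (tpow k d E)" and x': "x' \<in> carrier (tpow k d E)" and y: "y \<in> carrier N"
    show "\<pi> (x \<oplus>\<^bsub>tpow k d E\<^esub> x') \<odot>\<^bsub>N\<^esub> y = \<pi> x \<odot>\<^bsub>N\<^esub> y \<oplus>\<^bsub>N\<^esub> \<pi> x' \<odot>\<^bsub>N\<^esub> y"
      using N.smult_l_distr[OF \<pi>c[OF x] \<pi>c[OF x'] y] lin_add[OF \<pi> x x'] by simp
  next
    fix c x y assume x: "x \<in> carrier (tpow k d E)" and c: "c \<in> carrier k" and y: "y \<in> carrier N"
    have "\<pi> (c \<odot>\<^bsub>tpow k d E\<^esub> x) = (\<lambda>\<sigma>. c \<otimes>\<^bsub>k\<^esub> \<one>\<^bsub>kS k d\<^esub> \<sigma>) \<otimes>\<^bsub>kS k d\<^esub> \<pi> x"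
      unfolding kS_scale_mult[OF c N.R.one_closed \<pi>c[OF x]] N.R.l_one[OF \<pi>c[OF x]]
      using lin_smult[OF \<pi> c x] by simp
    then show "\<pi> (c \<odot>\<^bsub>tpow k d E\<^esub> x) \<odot>\<^bsub>N\<^esub> y = (\<lambda>\<sigma>. c \<otimes>\<^bsub>k\<^esub> \<one>\<^bsub>kS k d\<^esub> \<sigma>) \<odot>\<^bsub>N\<^esub> (\<pi> x \<odot>\<^bsub>N\<^esub> y)"
      using N.smult_assoc[OF kS_scale_closed[OF c N.R.one_closed] \<pi>c[OF x] y] by (simp only:)
  next
    fix x a y assume x: "x \<in> carrier (tpow k d E)" and a: "a \<in> carrier (kS k d)" and y: "y \<in> carrier N"
    show "\<pi> (kS_ract k d E x a) \<odot>\<^bsub>N\<^esub> y = \<pi> x \<odot>\<^bsub>N\<^esub> (a \<odot>\<^bsub>N\<^esub> y)"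
      using N.smult_assoc[OF \<pi>c[OF x] a y] \<pi>a[OF x a] by (simp only:)
  qed (use N.smult_r_distr[OF \<pi>c] N.smult_closed[OF \<pi>c] in auto)
  \<comment> \<open>The inverse of the unit is evaluation at \<open>u\<close> followed by
    \<open>r\<close>, which sends the tensor of \<open>u\<close> and \<open>y\<close> to
    \<open>y\<close>.\<close>
  define r where "r = btensor_lift k (kS k d) (tpow k d E) (kS_ract k d E) N (res d N) (\<lambda>x y. \<pi> x \<odot>\<^bsub>N\<^esub> y)"
  have r: "lin k (BT d N E) (res d N) r"
    unfolding r_def by (rule lin_linmaps[OF BT_lift_linmaps[OF N E res_module[OF N] bal]])
  have rp: "r (PT d N E x y) = \<pi> x \<odot>\<^bsub>N\<^esub> y" if "x \<in> carrier (tpow k d E)" "y \<in> carrier N" for x y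
    unfolding r_def by (rule BT_lift_pure[OF N E res_module[OF N] bal that])
  have rc: "r z \<in> carrier N" if "z \<in> carrier (BT d N E)" for z using lin_closed[OF r that] by (simp add: rN)
  have surj: "unit d N (r (\<phi> E u)) = \<phi>" if p: "\<phi> \<in> carrier (Schur_ob k d ?G)" for \<phi> :: "('k, 'v, _, _) spf_hom"
  proof (rule nat_trans_omega_eqI)
    have z: "\<phi> E u \<in> carrier (BT d N E)"
      using nat_trans_omega_closed[of \<phi> d ?G E u] p E u by simp
    show "unit d N (r (\<phi> E u)) \<in> nat_trans k (GammaP k d) (Gamma_omega k d) ?G"
      using unit_closed[OF rc[OF z]] by simp
    show p': "\<phi> \<in> nat_trans k (GammaP k d) (Gamma_omega k d) ?G" using p by simp
    fix V :: "('k, 'v) module" and t assume V: "V \<in> fg_projectives k" and t: "t \<in> carrier (tpow k d V)"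
    note V' = fg_proj_module[OF V]
    define f where "f = (\<lambda>x\<in>carrier (tpow k d E). kS_ract k d V t (\<pi> x))"
    have f: "f \<in> Hom (GammaP k d) E V"
      unfolding f_def
    proof (rule GammaP_HomI[OF E])
      show "lin k (tpow k d E) (tpow k d V) (\<lambda>x. kS_ract k d V t (\<pi> x))"
        by (rule lin_compose[OF \<pi> kS_ract_lin2[OF V' t]])
      fix \<sigma> x assume s: "\<sigma> \<in> carrier (sym_group d)" and x: "x \<in> carrier (tpow k d E)"
      have b: "basis_vec k \<sigma> \<in> carrier (kS k d)" using s by (rule kS_basis)
      show "kS_ract k d V t (\<pi> (perm_ract k d E x \<sigma>)) = perm_ract k d V (kS_ract k d V t (\<pi> x)) \<sigma>"
        using kS_ract_assoc[OF V' t \<pi>c[OF x] b] \<pi>a[OF x b] kS_ract_basis[OF fg_proj_module[OF E] x s]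
          kS_ract_basis[OF V' kS_ract_closed[OF V' \<pi>c[OF x] t] s] by simp
    qed
    \<comment> \<open>Both sides are linear in \<open>w\<close>. On the tensor of \<open>x\<close>
      and \<open>y\<close> the algebra element \<open>\<pi> x\<close> moves across the tensor sign,
      from \<open>t\<close> to \<open>y\<close>.\<close>
    have "fmor ?G E V f w = PT d N V t (r w)" if "w \<in> carrier (BT d N E)" for w
    proof (rule BT_lin_eq[OF N E BT_module[OF N V] lin_linmaps[OF Gtensor_ob_linmaps[OF N E V f]] _ _ that])
      have "lin k (res d N) (BT d N V) (\<lambda>y. PT d N V t y)"
      proof (rule linI; (unfold rN)?)
        fix c y assume c: "c \<in> carrier k" and y: "y \<in> carrier N"
        have "PT d N V t ((\<lambda>\<sigma>. c \<otimes>\<^bsub>k\<^esub> \<one>\<^bsub>kS k d\<^esub> \<sigma>) \<odot>\<^bsub>N\<^esub> y) =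
          PT d N V (kS_ract k d V t (\<lambda>\<sigma>. c \<otimes>\<^bsub>k\<^esub> \<one>\<^bsub>kS k d\<^esub> \<sigma>)) y"
          by (rule PT_balanced[OF N V t y kS_scale_closed[OF c N.R.one_closed], symmetric])
        also have "kS_ract k d V t (\<lambda>\<sigma>. c \<otimes>\<^bsub>k\<^esub> \<one>\<^bsub>kS k d\<^esub> \<sigma>) = c \<odot>\<^bsub>tpow k d V\<^esub> t"
          using lin_smult[OF kS_ract_lin2[OF V' t] c, of "\<one>\<^bsub>kS k d\<^esub>"] N.R.one_closed kS_ract_one[OF V' t] by simp
        also have "PT d N V (c \<odot>\<^bsub>tpow k d V\<^esub> t) y = c \<odot>\<^bsub>BT d N V\<^esub> PT d N V t y"
          by (rule lin_smult[OF PT_lin[OF N V y] c t])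
        finally show "PT d N V t ((\<lambda>\<sigma>. c \<otimes>\<^bsub>k\<^esub> \<one>\<^bsub>kS k d\<^esub> \<sigma>) \<odot>\<^bsub>N\<^esub> y) = \<dots>" .
      qed (use PT_closed[OF N V t] PT_add[OF N V t] in auto)
      then show "lin k (BT d N E) (BT d N V) (\<lambda>w. PT d N V t (r w))" by (rule lin_compose[OF r])
      fix x y assume x: "x \<in> carrier (tpow k d E)" and y: "y \<in> carrier N"
      show "fmor ?G E V f (PT d N E x y) = PT d N V t (r (PT d N E x y))"
        using PT_balanced[OF N V t y \<pi>c[OF x]]
        by (simp add: Gtensor_ob_pure[OF N E V f x y] rp[OF x y]) (simp add: f_def x)
    qed
    from this[OF z] have "PT d N V t (r (\<phi> E u)) = fmor ?G E V f (\<phi> E u)" by simp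
    also have "\<dots> = \<phi> V (f u)"
      using nat_trans_natural[OF p', of E V f u] E V f u by simp
    also have "f u = t" using u \<pi>u kS_ract_one[OF V' t] by (simp add: f_def)
    finally show "unit d N (r (\<phi> E u)) V t = \<phi> V t" using unit_apply[OF V t] by simp
  qed
  show ?thesis
  proof (rule bij_betw_byWitness[where f'="\<lambda>\<phi>. r (\<phi> E u)"])
    show "\<forall>y\<in>carrier N. r (unit d N y E u) = y"
      using u E rp \<pi>u N.smult_one by (simp add: unit_apply del: kS_simps(4))
    show "(\<lambda>\<phi>. r (\<phi> E u)) ` carrier (Schur_ob k d ?G) \<subseteq> carrier N"
      using nat_trans_omega_closed[of _ d ?G E u] E u rc by auto
  qed (use surj unit_closed in auto)
qed

end

subsection \<open>The counit\<close>

text \<open>Evaluation of transformations. It is balanced by the very definition of the action on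
  \<open>Schur_ob\<close>, as precomposition with the right action.\<close>

definition counit :: "nat \<Rightarrow> ('k, 'v, 'w) spf \<Rightarrow>
    ('k, 'v, (('k, 'v) tens \<times> ('k, 'v, ('k, 'v) tens, 'w) spf_hom \<Rightarrow> 'k) set, 'w) spf_hom" where
  "counit d F = (\<lambda>V\<in>fg_projectives k. btensor_lift k (kS k d) (tpow k d V) (kS_ract k d V)
     (Schur_ob k d F) (fob F V) (\<lambda>x \<phi>. \<phi> V x))"

context
  fixes d :: nat and F :: "('k, 'v, 'w) spf"
  assumes F: "F \<in> Ob (Rep k d)"
begin

lemma counit_balanced:
  assumes V: "V \<in> fg_projectives k"
  shows "balanced k (kS k d) (tpow k d V) (kS_ract k d V) (Schur_ob k d F) (fob F V) (\<lambda>x \<phi>. \<phi> V x)"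
  unfolding balanced_def using V nat_trans_omega_lin[of _ d F V] by auto

lemma counit_linmaps:
  "V \<in> fg_projectives k \<Longrightarrow> counit d F V \<in> linmaps k (BT d (Schur_ob k d F) V) (fob F V)"
  by (simp add: counit_def) (rule BT_lift_linmaps[OF Schur_ob_module[OF F] _ Rep_module[OF F] counit_balanced])

lemmas counit_lin = lin_linmaps[OF counit_linmaps]

lemma counit_pure:
  "\<lbrakk>V \<in> fg_projectives k; x \<in> carrier (tpow k d V); \<phi> \<in> carrier (Schur_ob k d F)\<rbrakk> \<Longrightarrow>
    counit d F V (PT d (Schur_ob k d F) V x \<phi>) = \<phi> V x"
  by (simp add: counit_def del: Schur_ob_simps(1))
    (rule BT_lift_pure[OF Schur_ob_module[OF F] _ Rep_module[OF F] counit_balanced])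

lemma counit_nat_trans: "counit d F \<in> nat_trans k (GammaP k d) (Gtensor_ob k d (Schur_ob k d F)) F"
proof (rule nat_transI)
  note S = Schur_ob_module[OF F]
  fix V W :: "('k, 'v) module" and f x
  assume "V \<in> Ob (GammaP k d)" "W \<in> Ob (GammaP k d)" and f: "f \<in> Hom (GammaP k d) V W"
    and x: "x \<in> carrier (fob (Gtensor_ob k d (Schur_ob k d F)) V)"
  then have V: "V \<in> fg_projectives k" and W: "W \<in> fg_projectives k" by simp_all
  show "counit d F W (fmor (Gtensor_ob k d (Schur_ob k d F)) V W f x) = fmor F V W f (counit d F V x)"
  proof (rule BT_lin_eq[OF S V Rep_module[OF F W]
        lin_compose[OF lin_linmaps[OF Gtensor_ob_linmaps[OF S V W f]] counit_lin[OF W]]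
        lin_compose[OF counit_lin[OF V] Rep_lin[OF F V W f]]])
    fix t \<phi> assume t: "t \<in> carrier (tpow k d V)" and p: "\<phi> \<in> carrier (Schur_ob k d F)"
    show "counit d F W (fmor (Gtensor_ob k d (Schur_ob k d F)) V W f (PT d (Schur_ob k d F) V t \<phi>)) =
        fmor F V W f (counit d F V (PT d (Schur_ob k d F) V t \<phi>))"
      unfolding Gtensor_ob_pure[OF S V W f t p] counit_pure[OF V t p] counit_pure[OF W GammaP_Hom_closed[OF f t] p]
      using nat_trans_natural[of \<phi> k "GammaP k d" "Gamma_omega k d" F V W f t] p V W f t by simp
  qed (use x in simp)
qed (auto simp: counit_linmaps, simp add: counit_def)

end

lemma counit_natural:
  fixes F :: "('k, 'v, 'w) spf" and F' :: "('k, 'v, 'x) spf"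
  assumes F: "F \<in> Ob (Rep k d)" and F': "F' \<in> Ob (Rep k d)" and a: "\<alpha> \<in> nat_trans k (GammaP k d) F F'"
    and V: "V \<in> fg_projectives k" and z: "z \<in> carrier (BT d (Schur_ob k d F) V)"
  shows "counit d F' V (Gmap d (Schur_ob k d F) (Schur_ob k d F') (Smap d \<alpha>) V z) = \<alpha> V (counit d F V z)"
proof (rule BT_lin_eq[OF Schur_ob_module[OF F] V Rep_module[OF F' V] _ _ _ z])
  note G = Schur_ob_module[OF F] Schur_ob_module[OF F'] Smap_lin[OF F F' a]
  have al: "lin k (fob F V) (fob F' V) (\<alpha> V)" using nat_trans_lin[OF a, of V] V by simp
  show "lin k (BT d (Schur_ob k d F) V) (fob F' V)
      (\<lambda>z. counit d F' V (Gmap d (Schur_ob k d F) (Schur_ob k d F') (Smap d \<alpha>) V z))"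
    by (rule lin_compose[OF Gmap_lin[OF G V] counit_lin[OF F' V]])
  show "lin k (BT d (Schur_ob k d F) V) (fob F' V) (\<lambda>z. \<alpha> V (counit d F V z))"
    by (rule lin_compose[OF counit_lin[OF F V] al])
  fix x \<phi> assume x: "x \<in> carrier (tpow k d V)" and p: "\<phi> \<in> carrier (Schur_ob k d F)"
  show "counit d F' V (Gmap d (Schur_ob k d F) (Schur_ob k d F') (Smap d \<alpha>) V (PT d (Schur_ob k d F) V x \<phi>)) =
      \<alpha> V (counit d F V (PT d (Schur_ob k d F) V x \<phi>))"
    unfolding Gmap_pure[OF G V x p] counit_pure[OF F V x p] counit_pure[OF F' V x lin_closed[OF G(3) p]]
    by (rule Smap_apply[OF V x])
qed

text \<open>One of the two triangle identities of the adjunction; on a pure tensor it evaluates the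
  transformation attached to \<open>y\<close> at \<open>x\<close>.\<close>

lemma counit_unit:
  assumes N: "left_module (kS k d) N" and V: "V \<in> fg_projectives k" and z: "z \<in> carrier (BT d N V)"
  shows "counit d (Gtensor_ob k d N) V (Gmap d N (Schur_ob k d (Gtensor_ob k d N)) (unit d N) V z) = z"
proof (rule BT_lin_eq[OF N V BT_module[OF N V] _ lin_id _ z])
  note F = Gtensor_ob_Rep[OF N]
  note G = N Schur_ob_module[OF F] unit_lin[OF N]
  show "lin k (BT d N V) (BT d N V)
      (\<lambda>z. counit d (Gtensor_ob k d N) V (Gmap d N (Schur_ob k d (Gtensor_ob k d N)) (unit d N) V z))"
    using lin_compose[OF Gmap_lin[OF G V] counit_lin[OF F V]] by simp
  fix x y assume x: "x \<in> carrier (tpow k d V)" and y: "y \<in> carrier N"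
  show "counit d (Gtensor_ob k d N) V (Gmap d N (Schur_ob k d (Gtensor_ob k d N)) (unit d N) V (PT d N V x y)) =
      PT d N V x y"
    unfolding Gmap_pure[OF G V x y] counit_pure[OF F V x unit_closed[OF N y]] by (rule unit_apply[OF N V x])
qed

text \<open>The counit is invertible on \<open>G\<^sub>\<otimes>(P)\<close> by the triangle identity, since the unit is invertible; being natural, it is
  invertible on all retracts of such functors.\<close>

lemma counit_iso:
  fixes F :: "('k, 'v, 'w) spf" and P :: "(perm \<Rightarrow> 'k, 'b) module"
  assumes F: "F \<in> Ob (Rep k d)" and P: "left_module (kS k d) P"
    and ub: "bij_betw (unit d P :: 'b \<Rightarrow> ('k, 'v, _, _) spf_hom) (carrier P) (carrier (Schur_ob k d (Gtensor_ob k d P)))"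
    and i: "i \<in> nat_trans k (GammaP k d) F (Gtensor_ob k d P)"
    and p: "p \<in> nat_trans k (GammaP k d) (Gtensor_ob k d P) F"
    and pi: "\<And>V x. \<lbrakk>V \<in> fg_projectives k; x \<in> carrier (fob F V)\<rbrakk> \<Longrightarrow> p V (i V x) = x"
  shows "counit d F \<in> nat_isos k (GammaP k d) (Gtensor_ob k d (Schur_ob k d F)) F"
  unfolding nat_isos_def mem_Collect_eq
proof (intro conjI ballI counit_nat_trans[OF F])
  fix V :: "('k, 'v) module" assume "V \<in> Ob (GammaP k d)"
  then have V: "V \<in> fg_projectives k" by simp
  let ?GP = "Gtensor_ob k d P"
  let ?S = "Schur_ob k d F" and ?SG = "Schur_ob k d (Gtensor_ob k d P :: ('k, 'v, _) spf)"
  note GP = Gtensor_ob_Rep[OF P]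
  note S = Schur_ob_module[OF F] and SG = Schur_ob_module[OF GP]
  note Sp = Smap_lin[OF GP F p] and Si = Smap_lin[OF F GP i]
  note ul = unit_lin[OF P]
  note Gp = Gmap_lin[OF SG S Sp V] and Gi = Gmap_lin[OF S SG Si V] and Gu = Gmap_lin[OF P SG ul V]
  have ic: "i V x \<in> carrier (BT d P V)" if "x \<in> carrier (fob F V)" for x
    using nat_trans_closed[OF i, of V x] V that by simp
  \<comment> \<open>The inverse of the counit: go to \<open>G\<^sub>\<otimes>(P)\<close> by
    \<open>i\<close>, apply the unit of \<open>P\<close> there, and return by
    \<open>p\<close>.\<close>
  define j where "j x = Gmap d ?SG ?S (Smap d p) V (Gmap d P ?SG (unit d P) V (i V x))" for x
  have jc: "j x \<in> carrier (BT d ?S V)" if "x \<in> carrier (fob F V)" for x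
    unfolding j_def by (intro lin_closed[OF Gp] lin_closed[OF Gu] ic that)
  have 1: "counit d F V (j x) = x" if x: "x \<in> carrier (fob F V)" for x
    unfolding j_def counit_natural[OF GP F p V lin_closed[OF Gu ic[OF x]]] counit_unit[OF P V ic[OF x]]
    by (rule pi[OF V x])
  have 2: "j (counit d F V z) = z" if z: "z \<in> carrier (BT d ?S V)" for z
  proof -
    \<comment> \<open>For the other composite \<open>z\<close> is moved to the retract's ambient
      functor. There the unit of \<open>P\<close> is invertible, so the triangle identity makes the
      counit its inverse, and naturality brings the result back.\<close>
    define w where "w = Gmap d ?S ?SG (Smap d i) V z"
    have w: "w \<in> carrier (BT d ?SG V)" unfolding w_def by (rule lin_closed[OF Gi z])
    define v where "v = inv_into (carrier P) (unit d P :: 'b \<Rightarrow> ('k, 'v, _, _) spf_hom)"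
    have vl: "lin (kS k d) ?SG P v" unfolding v_def by (rule lin_inv[OF P ul ub])
    define w' where "w' = Gmap d ?SG P v V w"
    have w': "w' \<in> carrier (BT d P V)" unfolding w'_def by (rule lin_closed[OF Gmap_lin[OF SG P vl V] w])
    have uv: "unit d P (v y) = y" if "y \<in> carrier ?SG" for y
      unfolding v_def by (rule bij_betw_inv_into_right[OF ub that])
    have ww': "Gmap d P ?SG (unit d P) V w' = w"
      unfolding w'_def using Gmap_comp[OF SG P SG vl ul _ V w, of "\<lambda>y. y"] Gmap_id[OF SG V _ w, of "\<lambda>y. y"] uv by simp
    have "i V (counit d F V z) = counit d ?GP V w"
      unfolding w_def by (rule counit_natural[OF F GP i V z, symmetric])
    also have "\<dots> = w'" using counit_unit[OF P V w'] ww' by simp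
    finally have "j (counit d F V z) = Gmap d ?SG ?S (Smap d p) V w" by (simp add: j_def ww')
    also have "\<dots> = Gmap d ?S ?S (\<lambda>\<phi>. Smap d p (Smap d i \<phi>)) V z"
      unfolding w_def by (rule Gmap_comp[OF S SG S Si Sp _ V z, symmetric]) simp
    also have "\<dots> = z"
    proof (rule Gmap_id[OF S V _ z])
      fix \<phi> assume ph: "\<phi> \<in> carrier ?S"
      show "Smap d p (Smap d i \<phi>) = \<phi>"
      proof (rule nat_trans_omega_eqI)
        show "Smap d p (Smap d i \<phi>) \<in> nat_trans k (GammaP k d) (Gamma_omega k d) F"
          using lin_closed[OF Sp lin_closed[OF Si ph]] by simp
        show "\<phi> \<in> nat_trans k (GammaP k d) (Gamma_omega k d) F" using ph by simp
        then show "Smap d p (Smap d i \<phi>) W x = \<phi> W x" if "W \<in> fg_projectives k" "x \<in> carrier (tpow k d W)" for W x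
          using that by (simp add: Smap_apply pi nat_trans_omega_closed)
      qed
    qed
    finally show ?thesis .
  qed
  have "bij_betw (counit d F V) (carrier (BT d ?S V)) (carrier (fob F V))"
    by (rule bij_betw_byWitness[where f'=j]) (use 1 2 jc lin_closed[OF counit_lin[OF F V]] in auto)
  then show "counit d F V \<in> lin_isos k (fob (Gtensor_ob k d ?S) V) (fob F V)"
    using counit_linmaps[OF F V] by (simp add: lin_isos_def)
qed

end

section \<open>Products of symmetric powers\<close>

text \<open>The positions \<open>1..d\<close> are cut into consecutive blocks, block
  \<open>l\<close> having length \<open>\<mu> l\<close>. Its positions are
  \<open>off \<mu> l + 1\<close> up to \<open>off \<mu> l + \<mu> l\<close>.\<close>

definition off :: "(nat \<Rightarrow> nat) \<Rightarrow> nat \<Rightarrow> nat" where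
  "off \<mu> l = (\<Sum>i=1..<l. \<mu> i)"

definition inblk :: "(nat \<Rightarrow> nat) \<Rightarrow> nat \<Rightarrow> nat \<Rightarrow> bool" where
  "inblk \<mu> l p \<longleftrightarrow> off \<mu> l < p \<and> p \<le> off \<mu> l + \<mu> l"

definition blk :: "(nat \<Rightarrow> nat) \<Rightarrow> nat \<Rightarrow> (nat \<Rightarrow> 'b) \<Rightarrow> nat \<Rightarrow> 'b" where
  "blk \<mu> l v = (\<lambda>j\<in>{1..\<mu> l}. v (off \<mu> l + j))"

text \<open>Replacing one block lets symmetry inside that block be stated with a permutation of
  \<open>\<mu> l\<close> letters, without extending it to all \<open>d\<close> positions.\<close>

definition put :: "(nat \<Rightarrow> nat) \<Rightarrow> nat \<Rightarrow> (nat \<Rightarrow> 'b) \<Rightarrow> (nat \<Rightarrow> 'b) \<Rightarrow> nat \<Rightarrow> 'b" where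
  "put \<mu> l w v = (\<lambda>p. if inblk \<mu> l p then w (p - off \<mu> l) else v p)"

text \<open>The block containing \<open>p\<close>. Minimality passes over empty blocks, and the
  bound \<open>1 \<le> l\<close> excludes the index 0, which numbers no block.\<close>

definition idx :: "(nat \<Rightarrow> nat) \<Rightarrow> nat \<Rightarrow> nat" where
  "idx \<mu> p = (LEAST l. 1 \<le> l \<and> p \<le> off \<mu> l + \<mu> l)"

lemma off_1 [simp]: "off \<mu> 1 = 0" by (simp add: off_def)

lemma off_Suc: "1 \<le> l \<Longrightarrow> off \<mu> (Suc l) = off \<mu> l + \<mu> l"
  by (simp add: off_def sum.atLeastLessThan_Suc)

lemma off_less: assumes "1 \<le> l" "l < l'" shows "off \<mu> l + \<mu> l \<le> off \<mu> l'"
proof -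
  have "off \<mu> (Suc l) \<le> off \<mu> l'" unfolding off_def by (rule sum_mono2) (use assms in auto)
  then show ?thesis using assms off_Suc by simp
qed

lemma inblk_unique: "\<lbrakk>inblk \<mu> l p; inblk \<mu> l' p; 1 \<le> l; 1 \<le> l'\<rbrakk> \<Longrightarrow> l = l'"
  using off_less[of l l' \<mu>] off_less[of l' l \<mu>] by (cases l l' rule: linorder_cases) (auto simp: inblk_def)

context
  fixes n d :: nat and \<mu> :: "nat \<Rightarrow> nat"
  assumes sum_mu: "(\<Sum>l=1..n. \<mu> l) = d"
begin

lemma off_end: "off \<mu> (Suc n) = d"
  using sum_mu by (simp add: off_def atLeastLessThanSuc_atLeastAtMost)

lemma off_le: "l \<in> {1..n} \<Longrightarrow> off \<mu> l + \<mu> l \<le> d"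
  using off_less[of l "Suc n" \<mu>] off_end by simp

lemma idx: assumes "p \<in> {1..d}" shows "idx \<mu> p \<in> {1..n}" "inblk \<mu> (idx \<mu> p) p"
proof -
  have n: "1 \<le> n" using assms off_end by (cases n) (auto simp: off_def)
  have ex: "1 \<le> n \<and> p \<le> off \<mu> n + \<mu> n" using assms off_end off_Suc[OF n] n by simp
  have I: "1 \<le> idx \<mu> p \<and> p \<le> off \<mu> (idx \<mu> p) + \<mu> (idx \<mu> p)"
    unfolding idx_def by (rule LeastI) (rule ex)
  have "idx \<mu> p \<le> n" unfolding idx_def by (rule Least_le) (rule ex)
  then show "idx \<mu> p \<in> {1..n}" using I by simp
  have "off \<mu> (idx \<mu> p) < p"
  proof (cases "idx \<mu> p = 1")
    case True then show ?thesis using assms by simp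
  next
    case False
    then obtain l where l: "idx \<mu> p = Suc l" "1 \<le> l" using I by (cases "idx \<mu> p") auto
    \<comment> \<open>By minimality the preceding block ends before \<open>p\<close>, and its end is
      the offset of the present block.\<close>
    then have "\<not> (1 \<le> l \<and> p \<le> off \<mu> l + \<mu> l)"
      using not_less_Least[of l "\<lambda>l. 1 \<le> l \<and> p \<le> off \<mu> l + \<mu> l"] unfolding idx_def by simp
    then show ?thesis using l off_Suc[OF l(2)] by simp
  qed
  then show "inblk \<mu> (idx \<mu> p) p" using I by (simp add: inblk_def)
qed

lemma inblk_in: "\<lbrakk>l \<in> {1..n}; inblk \<mu> l p\<rbrakk> \<Longrightarrow> p \<in> {1..d}"
  using off_le[of l] by (auto simp: inblk_def)

lemma idx_eq: "\<lbrakk>l \<in> {1..n}; inblk \<mu> l p\<rbrakk> \<Longrightarrow> idx \<mu> p = l"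
  using inblk_unique[of \<mu> "idx \<mu> p" p l] idx[OF inblk_in] by simp

lemma inblk_off: "j \<in> {1..\<mu> l} \<Longrightarrow> inblk \<mu> l (off \<mu> l + j)"
  by (auto simp: inblk_def)

lemma off_in: "\<lbrakk>l \<in> {1..n}; j \<in> {1..\<mu> l}\<rbrakk> \<Longrightarrow> off \<mu> l + j \<in> {1..d}"
  by (rule inblk_in[OF _ inblk_off])

lemma blk_closed: "\<lbrakk>l \<in> {1..n}; v \<in> {1..d} \<rightarrow>\<^sub>E S\<rbrakk> \<Longrightarrow> blk \<mu> l v \<in> {1..\<mu> l} \<rightarrow>\<^sub>E S"
  unfolding blk_def using off_in[of l] by (auto simp del: atLeastAtMost_iff)

lemma put_closed:
  assumes "l \<in> {1..n}" "w \<in> {1..\<mu> l} \<rightarrow>\<^sub>E S" "v \<in> {1..d} \<rightarrow>\<^sub>E S"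
  shows "put \<mu> l w v \<in> {1..d} \<rightarrow>\<^sub>E S"
proof (rule PiE_I)
  fix p assume p: "p \<in> {1..d}"
  show "put \<mu> l w v p \<in> S"
  proof (cases "inblk \<mu> l p")
    case True
    then have "p - off \<mu> l \<in> {1..\<mu> l}" by (auto simp: inblk_def)
    then show ?thesis using True assms(2) by (auto simp: put_def simp del: atLeastAtMost_iff)
  qed (use p assms(3) in \<open>auto simp: put_def simp del: atLeastAtMost_iff\<close>)
next
  fix p assume "p \<notin> {1..d}"
  then have "\<not> inblk \<mu> l p" using inblk_in[OF assms(1)] by blast
  then show "put \<mu> l w v p = undefined"
    using \<open>p \<notin> {1..d}\<close> assms(3) unfolding put_def PiE_iff extensional_def by simp
qed

lemma put_upd: "j \<in> {1..\<mu> l} \<Longrightarrow> put \<mu> l (w(j := x)) v = (put \<mu> l w v)(off \<mu> l + j := x)"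
  by (auto simp: put_def inblk_def fun_eq_iff)

lemma put_upd_out: "\<not> inblk \<mu> l p \<Longrightarrow> put \<mu> l w (v(p := x)) = (put \<mu> l w v)(p := x)"
  by (auto simp: put_def fun_eq_iff)

lemma put_commute: "\<lbrakk>l \<noteq> l'; 1 \<le> l; 1 \<le> l'\<rbrakk> \<Longrightarrow> put \<mu> l w (put \<mu> l' w' v) = put \<mu> l' w' (put \<mu> l w v)"
  using inblk_unique[of \<mu> l _ l'] by (auto simp: put_def fun_eq_iff)

lemma blk_upd: "\<lbrakk>j \<in> {1..\<mu> l}\<rbrakk> \<Longrightarrow> blk \<mu> l (v(off \<mu> l + j := x)) = (blk \<mu> l v)(j := x)"
  by (auto simp: blk_def fun_eq_iff)

lemma blk_upd_out: "\<not> inblk \<mu> l p \<Longrightarrow> blk \<mu> l (v(p := x)) = blk \<mu> l v"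
  by (auto simp: blk_def fun_eq_iff inblk_def)

text \<open>The Young subgroup as the stabilizer of the block function and not as a product of
  symmetric groups; this is also the stabilizer of the weakly increasing word
  \<open>word0\<close>.\<close>

definition young :: "perm set" where
  "young = {\<tau> \<in> carrier (sym_group d). \<forall>p\<in>{1..d}. idx \<mu> (\<tau> p) = idx \<mu> p}"

text \<open>An element of the Young subgroup maps block \<open>l\<close> injectively into itself,
  hence onto itself; shifted by the offset it is \<sigma>. The truncated subtraction loses nothing
  because images stay beyond the offset.\<close>

lemma young_blk:
  assumes \<tau>: "\<tau> \<in> young" and l: "l \<in> {1..n}"
  obtains \<sigma> where "\<sigma> \<in> carrier (sym_group (\<mu> l))" "\<And>v. blk \<mu> l (pcomp d v \<tau>) = pcomp (\<mu> l) (blk \<mu> l v) \<sigma>"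
proof
  let ?\<sigma> = "\<lambda>j. if j \<in> {1..\<mu> l} then \<tau> (off \<mu> l + j) - off \<mu> l else j"
  have t: "\<tau> \<in> carrier (sym_group d)" and ti: "\<And>p. p \<in> {1..d} \<Longrightarrow> idx \<mu> (\<tau> p) = idx \<mu> p"
    using \<tau> by (auto simp: young_def)
  have in_b: "inblk \<mu> l (\<tau> (off \<mu> l + j))" if "j \<in> {1..\<mu> l}" for j
    using idx(2)[of "\<tau> (off \<mu> l + j)"] sym_group_in[OF t] off_in[OF l that] ti[OF off_in[OF l that]]
      idx_eq[OF l inblk_off[OF that]] by simp
  have inj: "inj \<tau>" using t by (auto simp: sym_group_def permutes_inj)
  have "?\<sigma> permutes {1..\<mu> l}"
  proof (rule bij_imp_permutes)
    have 1: "inj_on ?\<sigma> {1..\<mu> l}"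
    proof (rule inj_onI)
      fix i j assume i: "i \<in> {1..\<mu> l}" and j: "j \<in> {1..\<mu> l}" and "?\<sigma> i = ?\<sigma> j"
      then have "\<tau> (off \<mu> l + i) - off \<mu> l = \<tau> (off \<mu> l + j) - off \<mu> l" using i j by simp
      then have "\<tau> (off \<mu> l + i) = \<tau> (off \<mu> l + j)"
        using in_b[OF i] in_b[OF j] unfolding inblk_def by linarith
      from injD[OF inj this] show "i = j" by simp
    qed
    have "?\<sigma> ` {1..\<mu> l} \<subseteq> {1..\<mu> l}" using in_b by (force simp: inblk_def)
    then show "bij_betw ?\<sigma> {1..\<mu> l} {1..\<mu> l}"
      using endo_inj_surj[OF finite_atLeastAtMost _ 1] 1 unfolding bij_betw_def by blast
  qed auto
  then show "?\<sigma> \<in> carrier (sym_group (\<mu> l))" by (simp add: sym_group_def)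
  show "blk \<mu> l (pcomp d v \<tau>) = pcomp (\<mu> l) (blk \<mu> l v) ?\<sigma>" for v
  proof
    fix j show "blk \<mu> l (pcomp d v \<tau>) j = pcomp (\<mu> l) (blk \<mu> l v) ?\<sigma> j"
    proof (cases "j \<in> {1..\<mu> l}")
      case True
      then have "\<tau> (off \<mu> l + j) - off \<mu> l \<in> {1..\<mu> l}" "off \<mu> l \<le> \<tau> (off \<mu> l + j)"
        using in_b[OF True] by (auto simp: inblk_def)
      then show ?thesis using True off_in[OF l True] by (simp add: blk_def pcomp_def)
    qed (simp add: blk_def pcomp_def del: atLeastAtMost_iff)
  qed
qed

text \<open>A permutation of one block extends by the identity outside it. In this way invariance
  under the Young subgroup implies symmetry inside each block, the form used for lifting.\<close>

lemma put_young:
  assumes \<sigma>: "\<sigma> \<in> carrier (sym_group (\<mu> l))" and l: "l \<in> {1..n}"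
  obtains \<tau> where "\<tau> \<in> young"
    "\<And>w v S. \<lbrakk>w \<in> {1..\<mu> l} \<rightarrow>\<^sub>E S; v \<in> {1..d} \<rightarrow>\<^sub>E S\<rbrakk> \<Longrightarrow> put \<mu> l (pcomp (\<mu> l) w \<sigma>) v = pcomp d (put \<mu> l w v) \<tau>"
proof
  let ?\<tau> = "\<lambda>p. if inblk \<mu> l p then off \<mu> l + \<sigma> (p - off \<mu> l) else p"
  have in1: "p - off \<mu> l \<in> {1..\<mu> l}" if "inblk \<mu> l p" for p using that by (auto simp: inblk_def)
  have in_b: "inblk \<mu> l (?\<tau> p)" if "inblk \<mu> l p" for p
    using that inblk_off[of "\<sigma> (p - off \<mu> l)" l] sym_group_in[OF \<sigma>, of "p - off \<mu> l"] in1[OF that] by simp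
  have inj: "inj \<sigma>" using \<sigma> by (auto simp: sym_group_def permutes_inj)
  have "?\<tau> permutes {1..d}"
  proof (rule bij_imp_permutes)
    have 1: "inj_on ?\<tau> {1..d}"
    proof (rule inj_onI)
      fix p q assume "?\<tau> p = ?\<tau> q"
      then show "p = q" using in_b[of p] in_b[of q] injD[OF inj, of "p - off \<mu> l" "q - off \<mu> l"]
        by (auto simp: inblk_def split: if_splits)
    qed
    have "?\<tau> ` {1..d} \<subseteq> {1..d}" using in_b inblk_in[OF l] by (auto simp del: atLeastAtMost_iff)
    then show "bij_betw ?\<tau> {1..d} {1..d}"
      using endo_inj_surj[OF finite_atLeastAtMost _ 1] 1 unfolding bij_betw_def by blast
  qed (use inblk_in[OF l] in auto)
  then have t: "?\<tau> \<in> carrier (sym_group d)" by (simp add: sym_group_def)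
  then show "?\<tau> \<in> young" using in_b idx_eq[OF l] by (auto simp: young_def)
  fix w v :: "nat \<Rightarrow> 'x" and S assume w: "w \<in> {1..\<mu> l} \<rightarrow>\<^sub>E S" and v: "v \<in> {1..d} \<rightarrow>\<^sub>E S"
  show "put \<mu> l (pcomp (\<mu> l) w \<sigma>) v = pcomp d (put \<mu> l w v) ?\<tau>"
  proof
    fix p show "put \<mu> l (pcomp (\<mu> l) w \<sigma>) v p = pcomp d (put \<mu> l w v) ?\<tau> p"
    proof (cases "inblk \<mu> l p")
      case True
      then show ?thesis using in1[OF True] in_b[OF True] inblk_in[OF l True]
        by (simp add: put_def pcomp_def)
    next
      case False
      then show ?thesis using v by (auto simp: put_def pcomp_def PiE_iff extensional_def)
    qed
  qed
qed

end

context base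
begin

subsection \<open>Symmetric powers\<close>

context
  fixes e :: nat and V :: "('k, 'v) module"
  assumes V: "left_module k V"
begin

interpretation T: left_module k "tpow k e V" by (rule tpow_module[OF V])

lemma sym_rel_gens: "{perm_ract k e V x \<sigma> \<ominus>\<^bsub>tpow k e V\<^esub> x | x \<sigma>.
        x \<in> carrier (tpow k e V) \<and> \<sigma> \<in> carrier (sym_group e)} \<subseteq> carrier (tpow k e V)"
  using perm_ract_closed[OF V] by auto

lemma sym_rel_submod: "submod k (tpow k e V) (sym_rel k e V)"
  unfolding sym_rel_def by (rule mspan_submod[OF k T.left_module_axioms sym_rel_gens])

lemma sym_pow_module: "left_module k (sym_pow k e V)"
  unfolding sym_pow_def by (rule mquot_module[OF k T.left_module_axioms sym_rel_submod])

lemma sym_proj_lin: "lin k (tpow k e V) (sym_pow k e V) (\<lambda>x. sym_rel k e V +>\<^bsub>tpow k e V\<^esub> x)"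
  unfolding sym_pow_def by (rule mquot_proj_lin[OF k T.left_module_axioms sym_rel_submod])

lemma sym_pow_spans: "spans k (sym_pow k e V) (sym_prod k e V ` ({1..e} \<rightarrow>\<^sub>E carrier V))"
proof -
  have "spans k (sym_pow k e V) ((\<lambda>x. sym_rel k e V +>\<^bsub>tpow k e V\<^esub> x) ` tpure k e V ` ({1..e} \<rightarrow>\<^sub>E carrier V))"
    by (rule spans_image[OF T.left_module_axioms sym_pow_module sym_proj_lin _ tpow_spans[OF V]])
      (simp add: sym_pow_def mquot_carrier[OF k T.left_module_axioms sym_rel_submod])
  then show ?thesis by (simp add: image_image sym_prod_def)
qed

lemma sym_prod_closed: "v \<in> {1..e} \<rightarrow>\<^sub>E carrier V \<Longrightarrow> sym_prod k e V v \<in> carrier (sym_pow k e V)"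
  using sym_pow_spans unfolding spans_def by blast

lemma sym_prod_perm:
  assumes "v \<in> {1..e} \<rightarrow>\<^sub>E carrier V" "\<sigma> \<in> carrier (sym_group e)"
  shows "sym_prod k e V (pcomp e v \<sigma>) = sym_prod k e V v"
proof -
  have "perm_ract k e V (tpure k e V v) \<sigma> \<ominus>\<^bsub>tpow k e V\<^esub> tpure k e V v \<in> sym_rel k e V"
    unfolding sym_rel_def using assms tpure_closed[OF V assms(1)] by (intro mspan_superset[THEN subsetD]) blast
  then show ?thesis
    using assms tpure_closed[OF V assms(1)] perm_ract_closed[OF V assms(2)]
    by (simp add: sym_prod_def mquot_coset_eq_iff[OF k T.left_module_axioms sym_rel_submod]
      perm_ract_pure[OF V, symmetric])
qed

text \<open>Symmetry on pure tensors extends by linearity to all tensors, so the induced map kills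
  the generators of \<open>sym_rel\<close>.\<close>

lemma sym_lift:
  assumes Q: "left_module k Q" and g: "multilin k {1..e} (\<lambda>_. V) Q g"
    and sym: "\<And>v \<sigma>. \<lbrakk>v \<in> {1..e} \<rightarrow>\<^sub>E carrier V; \<sigma> \<in> carrier (sym_group e)\<rbrakk> \<Longrightarrow> g (pcomp e v \<sigma>) = g v"
  shows "\<exists>h. lin k (sym_pow k e V) Q h \<and> (\<forall>v\<in>{1..e} \<rightarrow>\<^sub>E carrier V. h (sym_prod k e V v) = g v)"
proof -
  interpret Q: left_module k Q by (rule Q)
  define t where "t = tensor_lift k {1..e} (\<lambda>_. V) Q g"
  have t: "lin k (tpow k e V) Q t" unfolding t_def by (rule lin_linmaps[OF tpow_lift_linmaps[OF V Q g]])
  have tp: "t (tpure k e V v) = g v" if "v \<in> {1..e} \<rightarrow>\<^sub>E carrier V" for v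
    unfolding t_def by (rule tpow_lift_pure[OF V Q g that])
  have ts: "t (perm_ract k e V x \<sigma>) = t x" if s: "\<sigma> \<in> carrier (sym_group e)" and x: "x \<in> carrier (tpow k e V)" for x \<sigma>
    by (rule tpow_lin_eq[OF V Q lin_compose[OF perm_ract_lin[OF V s] t] t _ x])
      (use s in \<open>simp add: perm_ract_pure[OF V] tp pcomp_closed sym\<close>)
  have "sym_rel k e V \<subseteq> {x \<in> carrier (tpow k e V). t x = \<zero>\<^bsub>Q\<^esub>}"
    unfolding sym_rel_def
  proof (rule mspan_least[OF k T.left_module_axioms submod_kernel[OF T.left_module_axioms Q t]])
    show "{perm_ract k e V x \<sigma> \<ominus>\<^bsub>tpow k e V\<^esub> x |x \<sigma>. x \<in> carrier (tpow k e V) \<and> \<sigma> \<in> carrier (sym_group e)}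
      \<subseteq> {x \<in> carrier (tpow k e V). t x = \<zero>\<^bsub>Q\<^esub>}"
    proof (clarify, intro CollectI conjI)
      fix x \<sigma> assume x: "x \<in> carrier (tpow k e V)" and s: "\<sigma> \<in> carrier (sym_group e)"
      note xs = perm_ract_closed[OF V s x]
      show "perm_ract k e V x \<sigma> \<ominus>\<^bsub>tpow k e V\<^esub> x \<in> carrier (tpow k e V)" using xs x by simp
      show "t (perm_ract k e V x \<sigma> \<ominus>\<^bsub>tpow k e V\<^esub> x) = \<zero>\<^bsub>Q\<^esub>"
        using lin_minus[OF T.left_module_axioms Q t xs x] ts[OF s x] lin_closed[OF t x] Q.minus_eq_zero_iff by simp
    qed
  qed
  then obtain h where "lin k (sym_pow k e V) Q h"
      "\<And>x. x \<in> carrier (tpow k e V) \<Longrightarrow> h (sym_rel k e V +>\<^bsub>tpow k e V\<^esub> x) = t x"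
    using mquot_lift[OF k T.left_module_axioms sym_rel_submod Q t] unfolding sym_pow_def by blast
  then show ?thesis using tp tpure_closed[OF V] by (auto simp: sym_prod_def simp del: PiE_iff)
qed

lemma sym_prod_multilin: "multilin k {1..e} (\<lambda>_. V) (sym_pow k e V) (sym_prod k e V)"
  unfolding multilin_def sym_prod_def
proof (intro conjI ballI)
  fix v assume v: "v \<in> {1..e} \<rightarrow>\<^sub>E carrier V"
  show "sym_rel k e V +>\<^bsub>tpow k e V\<^esub> tpure k e V v \<in> carrier (sym_pow k e V)"
    by (rule lin_closed[OF sym_proj_lin tpure_closed[OF V v]])
  fix i assume "i \<in> {1..e}"
  then show "lin k V (sym_pow k e V) (\<lambda>x. sym_rel k e V +>\<^bsub>tpow k e V\<^esub> tpure k e V (v(i := x)))"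
    using tpure_multilin[OF V, of e] v
    by (intro lin_compose[OF _ sym_proj_lin]) (simp add: multilin_def)
qed

text \<open>For fixed parameters, both sides of each linearity equation are linear in
  \<open>t\<close>, so it is enough to know them at symmetric products. This recovers linear
  dependence on parameters for maps that were merely chosen.\<close>

lemma sym_param_lin:
  assumes X: "left_module k X" and Q: "left_module k Q"
    and L: "\<And>x. x \<in> carrier X \<Longrightarrow> lin k (sym_pow k e V) Q (L x)"
    and p: "\<And>w. w \<in> {1..e} \<rightarrow>\<^sub>E carrier V \<Longrightarrow> lin k X Q (\<lambda>x. L x (sym_prod k e V w))"
    and t: "t \<in> carrier (sym_pow k e V)"
  shows "lin k X Q (\<lambda>x. L x t)"
proof (rule linI)
  interpret X: left_module k X by (rule X)
  fix x assume x: "x \<in> carrier X"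
  show "L x t \<in> carrier Q" by (rule lin_closed[OF L[OF x] t])
  { fix y assume y: "y \<in> carrier X"
    show "L (x \<oplus>\<^bsub>X\<^esub> y) t = L x t \<oplus>\<^bsub>Q\<^esub> L y t"
      by (rule lin_eq_on_spans[OF sym_pow_module Q L[OF X.a_closed[OF x y]] lin_plus[OF Q L[OF x] L[OF y]] sym_pow_spans _ t])
        (use lin_add[OF p x y] in auto) }
  fix a assume a: "a \<in> carrier k"
  show "L (a \<odot>\<^bsub>X\<^esub> x) t = a \<odot>\<^bsub>Q\<^esub> L x t"
    by (rule lin_eq_on_spans[OF sym_pow_module Q L[OF X.smult_closed[OF a x]] lin_scale[OF k Q L[OF x] a] sym_pow_spans _ t])
      (use lin_smult[OF p a x] in auto)
qed

end

subsection \<open>The universal property of \<open>S\<^sup>\<mu>\<close>\<close>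

context
  fixes n d :: nat and \<mu> :: "nat \<Rightarrow> nat" and V :: "('k, 'v) module"
  assumes sum_mu: "(\<Sum>l=1..n. \<mu> l) = d" and V: "left_module k V"
begin

abbreviation (input) "Sy l \<equiv> sym_pow k (\<mu> l) V"
abbreviation (input) "SS \<equiv> \<Pi>\<^sub>E l\<in>{1..n}. carrier (Sy l)"
abbreviation (input) "WW \<equiv> {1..d} \<rightarrow>\<^sub>E carrier V"

lemma S_ob_module: "left_module k (S_ob k n \<mu> V)"
  unfolding S_ob_def by (rule tensor_module[OF k sym_pow_module[OF V]])

text \<open>The factors of \<open>S\<^sup>\<mu>\<close> are replaced one at a time: after \<open>m\<close> steps the map depends linearly on elements of the
  first \<open>m\<close> symmetric powers and multilinearly on the vectors in the remaining blocks.\<close>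

definition partial_lift :: "nat \<Rightarrow> ('k, 'b) module \<Rightarrow> ((nat \<Rightarrow> 'v) \<Rightarrow> 'b) \<Rightarrow>
    ((nat \<Rightarrow> ('k, 'v) tens set) \<Rightarrow> (nat \<Rightarrow> 'v) \<Rightarrow> 'b) \<Rightarrow> bool" where
  "partial_lift m Q g P \<longleftrightarrow> (\<forall>s\<in>SS. \<forall>v\<in>WW. P s v \<in> carrier Q) \<and>
    (\<forall>s\<in>SS. \<forall>v\<in>WW. \<forall>p\<in>{1..d}. off \<mu> (Suc m) < p \<longrightarrow> lin k V Q (\<lambda>x. P s (v(p := x)))) \<and>
    (\<forall>s\<in>SS. \<forall>v\<in>WW. \<forall>l\<in>{1..m}. lin k (Sy l) Q (\<lambda>x. P (s(l := x)) v)) \<and>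
    (\<forall>s\<in>SS. \<forall>v\<in>WW. \<forall>l\<in>{1..n}. m < l \<longrightarrow> (\<forall>\<sigma>\<in>carrier (sym_group (\<mu> l)). \<forall>w\<in>{1..\<mu> l} \<rightarrow>\<^sub>E carrier V.
       P s (put \<mu> l (pcomp (\<mu> l) w \<sigma>) v) = P s (put \<mu> l w v))) \<and>
    (\<forall>s\<in>SS. \<forall>v\<in>WW. \<forall>u\<in>WW. (\<forall>l\<in>{1..m}. s l = sym_prod k (\<mu> l) V (blk \<mu> l u)) \<longrightarrow>
       P s v = g (\<lambda>p. if p \<in> {1..d} \<and> p \<le> off \<mu> (Suc m) then u p else v p))"

lemma partial_liftD:
  assumes "partial_lift m Q g P" "s \<in> SS" "v \<in> WW"
  shows partial_lift_closed: "P s v \<in> carrier Q"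
    and partial_lift_lin: "\<lbrakk>p \<in> {1..d}; off \<mu> (Suc m) < p\<rbrakk> \<Longrightarrow> lin k V Q (\<lambda>x. P s (v(p := x)))"
    and partial_lift_lin_sym: "l \<in> {1..m} \<Longrightarrow> lin k (Sy l) Q (\<lambda>x. P (s(l := x)) v)"
    and partial_lift_sym: "\<lbrakk>l \<in> {1..n}; m < l; \<sigma> \<in> carrier (sym_group (\<mu> l)); w \<in> {1..\<mu> l} \<rightarrow>\<^sub>E carrier V\<rbrakk> \<Longrightarrow>
      P s (put \<mu> l (pcomp (\<mu> l) w \<sigma>) v) = P s (put \<mu> l w v)"
    and partial_lift_eq: "\<lbrakk>u \<in> WW; \<And>l. l \<in> {1..m} \<Longrightarrow> s l = sym_prod k (\<mu> l) V (blk \<mu> l u)\<rbrakk> \<Longrightarrow>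
       P s v = g (\<lambda>p. if p \<in> {1..d} \<and> p \<le> off \<mu> (Suc m) then u p else v p)"
  using assms unfolding partial_lift_def by blast+

text \<open>Induction on the number of blocks already replaced. Each step applies the universal
  property of one symmetric power with all other arguments fixed, then has to restore linearity and
  symmetry in those other arguments.\<close>

lemma partial_lift_ex:
  assumes Q: "left_module k Q" and g: "multilin k {1..d} (\<lambda>_. V) Q g"
    and sym: "\<And>l \<sigma> w v. \<lbrakk>l \<in> {1..n}; \<sigma> \<in> carrier (sym_group (\<mu> l)); w \<in> {1..\<mu> l} \<rightarrow>\<^sub>E carrier V; v \<in> WW\<rbrakk> \<Longrightarrow>
      g (put \<mu> l (pcomp (\<mu> l) w \<sigma>) v) = g (put \<mu> l w v)"
    and "m \<le> n"
  shows "\<exists>P. partial_lift m Q g P"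
  using \<open>m \<le> n\<close>
proof (induction m)
  case 0
  have "off \<mu> (Suc 0) = 0" using off_1[of \<mu>] by (simp add: One_nat_def)
  then have *: "(\<lambda>p. if p \<in> {1..d} \<and> p \<le> off \<mu> (Suc 0) then u p else v p) = v" for u v :: "nat \<Rightarrow> 'v"
    by (auto simp: fun_eq_iff)
  show ?case
    unfolding partial_lift_def
  proof (intro exI[of _ "\<lambda>s. g"] conjI ballI impI)
    fix v p assume "v \<in> WW" "p \<in> {1..d}"
    then show "lin k V Q (\<lambda>x. g (v(p := x)))"
      using g unfolding multilin_def by blast
  next
    fix v assume "v \<in> WW"
    then show "g v \<in> carrier Q" using g unfolding multilin_def by blast
  qed (use sym * in auto)
next
  case (Suc m)
  let ?b = "Suc m"
  have b: "?b \<in> {1..n}" "1 \<le> ?b" using Suc.prems by auto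
  note sm = sum_mu
  interpret V: left_module k V by (rule V)
  have Sy: "left_module k (Sy l)" for l by (rule sym_pow_module[OF V])
  obtain P where P: "partial_lift m Q g P" using Suc.IH Suc.prems by auto
  note A = partial_lift_closed[OF P] and B = partial_lift_lin[OF P] and C = partial_lift_lin_sym[OF P]
    and D = partial_lift_sym[OF P] and E = partial_lift_eq[OF P]
  \<comment> \<open>\<open>R s v h\<close> says that \<open>h\<close> is the linear map on the
    symmetric power of the new block which extends \<open>P\<close> in the vectors of that
    block.\<close>
  define R where "R s v h \<longleftrightarrow> lin k (Sy ?b) Q h \<and>
      (\<forall>w\<in>{1..\<mu> ?b} \<rightarrow>\<^sub>E carrier V. h (sym_prod k (\<mu> ?b) V w) = P s (put \<mu> ?b w v))" for s v h
  have ex: "\<exists>h. R s v h" if s: "s \<in> SS" and v: "v \<in> WW" for s v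
    unfolding R_def
    proof (rule sym_lift[OF V Q])
      show "multilin k {1..\<mu> ?b} (\<lambda>_. V) Q (\<lambda>w. P s (put \<mu> ?b w v))"
        unfolding multilin_def
      proof (intro conjI ballI)
        fix w assume w: "w \<in> {1..\<mu> ?b} \<rightarrow>\<^sub>E carrier V"
        note pw = put_closed[OF sm b(1) w v]
        show "P s (put \<mu> ?b w v) \<in> carrier Q" by (rule A[OF s pw])
        fix j assume j: "j \<in> {1..\<mu> ?b}"
        show "lin k V Q (\<lambda>x. P s (put \<mu> ?b (w(j := x)) v))"
          unfolding put_upd[OF sm j] by (rule B[OF s pw off_in[OF sm b(1) j]]) (use j in auto)
      qed
    qed (use D[OF s v b(1)] in auto)
  define L where "L s v = (SOME h. R s v h)" for s v
  have "R s v (L s v)" if "s \<in> SS" "v \<in> WW" for s v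
    unfolding L_def using ex[OF that] by (rule someI_ex)
  then have L: "\<And>s v. \<lbrakk>s \<in> SS; v \<in> WW\<rbrakk> \<Longrightarrow> lin k (Sy ?b) Q (L s v)"
    and Lp: "\<And>s v w. \<lbrakk>s \<in> SS; v \<in> WW; w \<in> {1..\<mu> ?b} \<rightarrow>\<^sub>E carrier V\<rbrakk> \<Longrightarrow>
      L s v (sym_prod k (\<mu> ?b) V w) = P s (put \<mu> ?b w v)"
    unfolding R_def by blast+
  \<comment> \<open>Entry \<open>?b\<close> of \<open>s\<close> becomes the argument of the chosen
    map, so the choice must not depend on it. Resetting that entry makes the map the same for all
    its values.\<close>
  define r where "r s = s(?b := \<zero>\<^bsub>Sy ?b\<^esub>)" for s
  have r: "r s \<in> SS" if "s \<in> SS" for s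
  proof -
    interpret Sb: left_module k "Sy ?b" by (rule Sy)
    show ?thesis unfolding r_def using that b by (intro PiE_upd) auto
  qed
  have sb: "s ?b \<in> carrier (Sy ?b)" if "s \<in> SS" for s using that b by (auto simp del: atLeastAtMost_iff)
  define P' where "P' s v = L (r s) v (s ?b)" for s v
  show ?case
    unfolding partial_lift_def
  proof (intro exI[of _ P'] conjI ballI impI)
    fix s v assume s: "s \<in> SS" and v: "v \<in> WW"
    show "P' s v \<in> carrier Q" unfolding P'_def by (rule lin_closed[OF L[OF r[OF s] v] sb[OF s]])
    { fix p assume p: "p \<in> {1..d}" and op: "off \<mu> (Suc ?b) < p"
      have nb: "\<not> inblk \<mu> ?b p" using op off_Suc[OF b(2), of \<mu>] by (auto simp: inblk_def)
      have op': "off \<mu> (Suc m) < p" using op off_Suc[OF b(2), of \<mu>] by auto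
      have vp: "v(p := x) \<in> WW" if "x \<in> carrier V" for x using v p that by (intro PiE_upd)
      show "lin k V Q (\<lambda>x. P' s (v(p := x)))"
        unfolding P'_def
      \<comment> \<open>How the chosen map depends on \<open>x\<close> is known only on symmetric
        products, where it is given by \<open>P\<close>; that is enough.\<close>
      proof (rule sym_param_lin[OF V V Q L[OF r[OF s] vp] _ sb[OF s]])
        fix w assume w: "w \<in> {1..\<mu> ?b} \<rightarrow>\<^sub>E carrier V"
        have "lin k V Q (\<lambda>x. P (r s) ((put \<mu> ?b w v)(p := x)))"
          by (rule B[OF r[OF s] put_closed[OF sm b(1) w v] p op'])
        moreover have "L (r s) (v(p := x)) (sym_prod k (\<mu> ?b) V w) = P (r s) ((put \<mu> ?b w v)(p := x))"
          if "x \<in> carrier V" for x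
          using Lp[OF r[OF s] vp[OF that] w] unfolding put_upd_out[OF sm nb] .
        ultimately show "lin k V Q (\<lambda>x. L (r s) (v(p := x)) (sym_prod k (\<mu> ?b) V w))"
          using lin_cong[OF V, of "\<lambda>x. L (r s) (v(p := x)) (sym_prod k (\<mu> ?b) V w)"
            "\<lambda>x. P (r s) ((put \<mu> ?b w v)(p := x))" Q] by blast
      qed }
    { fix l assume l: "l \<in> {1..?b}"
      show "lin k (Sy l) Q (\<lambda>x. P' (s(l := x)) v)"
      proof (cases "l = ?b")
        case True
        have "P' (s(?b := x)) v = L (r s) v x" for x by (simp add: P'_def r_def)
        then show ?thesis using True L[OF r[OF s] v] by simp
      next
        case False
        then have lm: "l \<in> {1..m}" and ln: "l \<in> {1..n}" using l b by auto
        have *: "P' (s(l := x)) v = L ((r s)(l := x)) v (s ?b)" for x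
          using False by (simp add: P'_def r_def fun_upd_twist)
        have rl: "(r s)(l := x) \<in> SS" if "x \<in> carrier (Sy l)" for x using r[OF s] ln that by (intro PiE_upd)
        show ?thesis
          unfolding *
        proof (rule sym_param_lin[OF V Sy Q L[OF rl v] _ sb[OF s]])
          fix w assume w: "w \<in> {1..\<mu> ?b} \<rightarrow>\<^sub>E carrier V"
          have "lin k (Sy l) Q (\<lambda>x. P ((r s)(l := x)) (put \<mu> ?b w v))"
            by (rule C[OF r[OF s] put_closed[OF sm b(1) w v] lm])
          then show "lin k (Sy l) Q (\<lambda>x. L ((r s)(l := x)) v (sym_prod k (\<mu> ?b) V w))"
            using lin_cong[OF Sy, of l "\<lambda>x. L ((r s)(l := x)) v (sym_prod k (\<mu> ?b) V w)"
              "\<lambda>x. P ((r s)(l := x)) (put \<mu> ?b w v)" Q] Lp[OF rl v w] by blast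
        qed
      qed }
    { fix l \<sigma> w assume l: "l \<in> {1..n}" and bl: "?b < l" and \<sigma>: "\<sigma> \<in> carrier (sym_group (\<mu> l))"
        and w: "w \<in> {1..\<mu> l} \<rightarrow>\<^sub>E carrier V"
      have ml: "m < l" using bl by simp
      note w\<sigma> = pcomp_closed[OF \<sigma> w]
      show "P' s (put \<mu> l (pcomp (\<mu> l) w \<sigma>) v) = P' s (put \<mu> l w v)"
        unfolding P'_def
      proof (rule lin_eq_on_spans[OF Sy Q L[OF r[OF s] put_closed[OF sm l w\<sigma> v]] L[OF r[OF s] put_closed[OF sm l w v]]
            sym_pow_spans[OF V] _ sb[OF s]])
        fix t assume "t \<in> sym_prod k (\<mu> ?b) V ` ({1..\<mu> ?b} \<rightarrow>\<^sub>E carrier V)"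
        then obtain w' where w': "w' \<in> {1..\<mu> ?b} \<rightarrow>\<^sub>E carrier V" and t: "t = sym_prod k (\<mu> ?b) V w'" by blast
        \<comment> \<open>Replacing the vectors of two different blocks commutes, so the symmetry of
          \<open>P\<close> in a later block passes to the new map.\<close>
        have c: "put \<mu> ?b w' (put \<mu> l y v) = put \<mu> l y (put \<mu> ?b w' v)" for y
          using bl by (intro put_commute[OF sm]) auto
        show "L (r s) (put \<mu> l (pcomp (\<mu> l) w \<sigma>) v) t = L (r s) (put \<mu> l w v) t"
          unfolding t Lp[OF r[OF s] put_closed[OF sm l w\<sigma> v] w'] Lp[OF r[OF s] put_closed[OF sm l w v] w'] c
          by (rule D[OF r[OF s] put_closed[OF sm b(1) w' v] l ml \<sigma> w])
      qed }
    { fix u assume u: "u \<in> WW" and su: "\<forall>l\<in>{1..?b}. s l = sym_prod k (\<mu> l) V (blk \<mu> l u)"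
      note bu = blk_closed[OF sm b(1) u]
      have "P' s v = P (r s) (put \<mu> ?b (blk \<mu> ?b u) v)"
        unfolding P'_def using su Lp[OF r[OF s] v bu] by simp
      also have "\<dots> = g (\<lambda>p. if p \<in> {1..d} \<and> p \<le> off \<mu> (Suc m) then u p else put \<mu> ?b (blk \<mu> ?b u) v p)"
        by (rule E[OF r[OF s] put_closed[OF sm b(1) bu v] u]) (use su in \<open>auto simp: r_def\<close>)
      \<comment> \<open>The new block lies exactly between the two offsets, so filling it from
        \<open>u\<close> extends the range taken from \<open>u\<close> by one block.\<close>
      also have "(\<lambda>p. if p \<in> {1..d} \<and> p \<le> off \<mu> (Suc m) then u p else put \<mu> ?b (blk \<mu> ?b u) v p) =
        (\<lambda>p. if p \<in> {1..d} \<and> p \<le> off \<mu> (Suc ?b) then u p else v p)"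
      proof
        fix p
        show "(if p \<in> {1..d} \<and> p \<le> off \<mu> (Suc m) then u p else put \<mu> ?b (blk \<mu> ?b u) v p) =
          (if p \<in> {1..d} \<and> p \<le> off \<mu> (Suc ?b) then u p else v p)"
          using off_Suc[OF b(2), of \<mu>] inblk_in[OF sm b(1), of p]
          by (cases "inblk \<mu> ?b p") (auto simp: put_def blk_def inblk_def)
      qed
      finally show "P' s v = g (\<lambda>p. if p \<in> {1..d} \<and> p \<le> off \<mu> (Suc ?b) then u p else v p)" . }
  qed
qed

definition sprods :: "(nat \<Rightarrow> 'v) \<Rightarrow> nat \<Rightarrow> ('k, 'v) tens set" where
  "sprods v = (\<lambda>l\<in>{1..n}. sym_prod k (\<mu> l) V (blk \<mu> l v))"

lemma sprods_closed: "v \<in> WW \<Longrightarrow> sprods v \<in> SS"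
  unfolding sprods_def using sym_prod_closed[OF V blk_closed[OF sum_mu]] by (auto simp del: PiE_iff atLeastAtMost_iff)

lemma S_proj_eq: "S_proj k n d \<mu> V =
  tensor_lift k {1..d} (\<lambda>_. V) (S_ob k n \<mu> V) (\<lambda>v. pure_tensor k {1..n} (\<lambda>l. Sy l) (sprods v))"
  by (simp add: S_proj_def sprods_def blk_def off_def)

text \<open>A position lies in exactly one block. Varying its vector changes one slot of one
  symmetric product and leaves the other factors alone.\<close>

lemma S_proj_multilin:
  "multilin k {1..d} (\<lambda>_. V) (S_ob k n \<mu> V) (\<lambda>v. pure_tensor k {1..n} (\<lambda>l. Sy l) (sprods v))"
  unfolding multilin_def
proof (intro conjI ballI)
  note pm = pure_tensor_multilin[OF k, of "{1..n}" "\<lambda>l. Sy l", OF sym_pow_module[OF V], folded S_ob_def]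
  fix v assume v: "v \<in> WW"
  show "pure_tensor k {1..n} (\<lambda>l. Sy l) (sprods v) \<in> carrier (S_ob k n \<mu> V)"
    using pm sprods_closed[OF v] unfolding multilin_def by blast
  fix p assume p: "p \<in> {1..d}"
  define l where "l = idx \<mu> p"
  define j where "j = p - off \<mu> l"
  have l: "l \<in> {1..n}" and ib: "inblk \<mu> l p" using idx[OF sum_mu p] by (simp_all add: l_def)
  have j: "j \<in> {1..\<mu> l}" and pj: "p = off \<mu> l + j" using ib by (auto simp: j_def inblk_def)
  have *: "sprods (v(p := x)) = (sprods v)(l := sym_prod k (\<mu> l) V ((blk \<mu> l v)(j := x)))" for x
  proof
    fix l'
    show "sprods (v(p := x)) l' = ((sprods v)(l := sym_prod k (\<mu> l) V ((blk \<mu> l v)(j := x)))) l'"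
    proof (cases "l' = l")
      case True then show ?thesis using l pj blk_upd[OF sum_mu j, of v x] by (simp add: sprods_def)
    next
      case False
      have "\<not> inblk \<mu> l' p" if "l' \<in> {1..n}" using False inblk_unique[of \<mu> l p l'] ib that l by auto
      then show ?thesis using False blk_upd_out[OF sum_mu, of l' p v x] by (simp add: sprods_def)
    qed
  qed
  have 1: "lin k V (Sy l) (\<lambda>x. sym_prod k (\<mu> l) V ((blk \<mu> l v)(j := x)))"
    using sym_prod_multilin[OF V, of "\<mu> l"] blk_closed[OF sum_mu l v] j unfolding multilin_def by blast
  have 2: "lin k (Sy l) (S_ob k n \<mu> V) (\<lambda>y. pure_tensor k {1..n} (\<lambda>l. Sy l) ((sprods v)(l := y)))"
    using pm sprods_closed[OF v] l unfolding multilin_def by blast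
  show "lin k V (S_ob k n \<mu> V) (\<lambda>x. pure_tensor k {1..n} (\<lambda>l. Sy l) (sprods (v(p := x))))"
    unfolding * by (rule lin_compose[OF 1 2])
qed

lemma S_proj_lin: "lin k (tpow k d V) (S_ob k n \<mu> V) (S_proj k n d \<mu> V)"
  unfolding S_proj_eq by (rule lin_linmaps[OF tpow_lift_linmaps[OF V S_ob_module S_proj_multilin]])

lemma S_proj_pure: "v \<in> WW \<Longrightarrow> S_proj k n d \<mu> V (tpure k d V v) = pure_tensor k {1..n} (\<lambda>l. Sy l) (sprods v)"
  unfolding S_proj_eq by (rule tpow_lift_pure[OF V S_ob_module S_proj_multilin])

text \<open>Inside each block the permutation only reorders the factors of a symmetric
  product.\<close>

lemma S_proj_young:
  assumes \<tau>: "\<tau> \<in> young d \<mu>" and x: "x \<in> carrier (tpow k d V)"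
  shows "S_proj k n d \<mu> V (perm_ract k d V x \<tau>) = S_proj k n d \<mu> V x"
proof -
  have t: "\<tau> \<in> carrier (sym_group d)" using \<tau> by (simp add: young_def[OF sum_mu])
  show ?thesis
  proof (rule tpow_lin_eq[OF V S_ob_module lin_compose[OF perm_ract_lin[OF V t] S_proj_lin] S_proj_lin _ x])
    fix v assume v: "v \<in> WW"
    have "sprods (pcomp d v \<tau>) = sprods v"
      unfolding sprods_def
    proof (rule restrict_ext)
      fix l assume l: "l \<in> {1..n}"
      obtain \<sigma> where "\<sigma> \<in> carrier (sym_group (\<mu> l))" "\<And>v :: nat \<Rightarrow> 'v. blk \<mu> l (pcomp d v \<tau>) = pcomp (\<mu> l) (blk \<mu> l v) \<sigma>"
        using young_blk[OF sum_mu \<tau> l] by blast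
      then show "sym_prod k (\<mu> l) V (blk \<mu> l (pcomp d v \<tau>)) = sym_prod k (\<mu> l) V (blk \<mu> l v)"
        using sym_prod_perm[OF V blk_closed[OF sum_mu l v]] by simp
    qed
    then show "S_proj k n d \<mu> V (perm_ract k d V (tpure k d V v) \<tau>) = S_proj k n d \<mu> V (tpure k d V v)"
      using v by (simp add: perm_ract_pure[OF V t v] S_proj_pure pcomp_closed[OF t v])
  qed
qed

text \<open>Induction on the number of leading factors that are arbitrary, the later ones being
  symmetric products. When all factors are products, their words are concatenated.\<close>

lemma S_proj_surj: "S_proj k n d \<mu> V ` carrier (tpow k d V) = carrier (S_ob k n \<mu> V)"
proof -
  let ?H = "S_proj k n d \<mu> V ` carrier (tpow k d V)"
  let ?p = "pure_tensor k {1..n} (\<lambda>l. Sy l)"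
  have Sy: "left_module k (Sy l)" for l by (rule sym_pow_module[OF V])
  note pm = pure_tensor_multilin[OF k, of "{1..n}" "\<lambda>l. Sy l", OF Sy, folded S_ob_def]
  have H: "submod k (S_ob k n \<mu> V) ?H"
    by (rule submod_image[OF tpow_module[OF V] S_ob_module S_proj_lin])
  have "?p s \<in> ?H" if "m \<le> n" "s \<in> SS"
    "\<And>l. \<lbrakk>l \<in> {1..n}; m < l\<rbrakk> \<Longrightarrow> s l \<in> sym_prod k (\<mu> l) V ` ({1..\<mu> l} \<rightarrow>\<^sub>E carrier V)" for m s
    using that
  proof (induction m arbitrary: s)
    case 0
    have "\<exists>w. w \<in> {1..\<mu> l} \<rightarrow>\<^sub>E carrier V \<and> s l = sym_prod k (\<mu> l) V w" if "l \<in> {1..n}" for l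
    proof -
      have "0 < l" using that by simp
      then show ?thesis using 0(3)[OF that] by blast
    qed
    then obtain w where w: "\<And>l. l \<in> {1..n} \<Longrightarrow> w l \<in> {1..\<mu> l} \<rightarrow>\<^sub>E carrier V"
      "\<And>l. l \<in> {1..n} \<Longrightarrow> s l = sym_prod k (\<mu> l) V (w l)" by metis
    \<comment> \<open>The concatenation of the words \<open>w l\<close>, placed block by
      block.\<close>
    define v where "v = (\<lambda>p\<in>{1..d}. w (idx \<mu> p) (p - off \<mu> (idx \<mu> p)))"
    have v: "v \<in> WW"
      unfolding v_def
    proof (rule restrict_PiE_iff[THEN iffD2], rule ballI)
      fix p assume p: "p \<in> {1..d}"
      have "p - off \<mu> (idx \<mu> p) \<in> {1..\<mu> (idx \<mu> p)}" using idx(2)[OF sum_mu p] by (auto simp: inblk_def)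
      then show "w (idx \<mu> p) (p - off \<mu> (idx \<mu> p)) \<in> carrier V" using w(1)[OF idx(1)[OF sum_mu p]] by blast
    qed
    have bv: "blk \<mu> l v = w l" if l: "l \<in> {1..n}" for l
    proof
      fix j show "blk \<mu> l v j = w l j"
      proof (cases "j \<in> {1..\<mu> l}")
        case True
        then show ?thesis using off_in[OF sum_mu l True] idx_eq[OF sum_mu l inblk_off[OF sum_mu True]]
          by (simp add: blk_def v_def)
      next
        case False
        then show ?thesis using PiE_arb[OF w(1)[OF l] False] by (simp add: blk_def del: atLeastAtMost_iff)
      qed
    qed
    have "sprods v = s"
    proof
      fix l show "sprods v l = s l"
        using bv[of l] w(2)[of l] 0(2) by (cases "l \<in> {1..n}") (auto simp: sprods_def PiE_iff extensional_def)
    qed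
    then have "?p s = S_proj k n d \<mu> V (tpure k d V v)" using S_proj_pure[OF v] by simp
    then show ?case using tpure_closed[OF V v] by blast
  next
    case (Suc m)
    let ?b = "Suc m"
    have b: "?b \<in> {1..n}" using Suc.prems by simp
    have l: "lin k (Sy ?b) (S_ob k n \<mu> V) (\<lambda>t. ?p (s(?b := t)))"
      using pm Suc.prems(2) b unfolding multilin_def by blast
    \<comment> \<open>With the other factors fixed, the admissible entries at \<open>?b\<close> form
      a submodule, and it contains the symmetric products by the induction hypothesis.\<close>
    have "s ?b \<in> {t \<in> carrier (Sy ?b). ?p (s(?b := t)) \<in> ?H}"
    proof (rule spans_submod[OF sym_pow_spans[OF V] submod_vimage[OF Sy S_ob_module l H]])
      show "sym_prod k (\<mu> ?b) V ` ({1..\<mu> ?b} \<rightarrow>\<^sub>E carrier V) \<subseteq> {t \<in> carrier (Sy ?b). ?p (s(?b := t)) \<in> ?H}"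
      proof (rule subsetI, rule CollectI, rule conjI)
        fix t assume t: "t \<in> sym_prod k (\<mu> ?b) V ` ({1..\<mu> ?b} \<rightarrow>\<^sub>E carrier V)"
        then show tc: "t \<in> carrier (Sy ?b)" using sym_prod_closed[OF V] by blast
        show "?p (s(?b := t)) \<in> ?H"
        proof (rule Suc.IH)
          show "s(?b := t) \<in> SS" using Suc.prems(2) b tc by (intro PiE_upd)
          show "(s(?b := t)) l \<in> sym_prod k (\<mu> l) V ` ({1..\<mu> l} \<rightarrow>\<^sub>E carrier V)" if "l \<in> {1..n}" "m < l" for l
            using Suc.prems(3)[OF that(1)] that(2) t by (cases "l = ?b") auto
        qed (use Suc.prems in simp)
      qed
      show "s ?b \<in> carrier (Sy ?b)" using Suc.prems(2) b by blast
    qed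
    then show ?case by simp
  qed
  from this[of n] have "?p ` SS \<subseteq> ?H" by auto
  then show ?thesis
    using tensor_spans[OF k, of "{1..n}" "\<lambda>l. Sy l", OF Sy, folded S_ob_def] H unfolding spans_def by blast
qed

text \<open>The universal property of the coinvariants of the tensor power under the Young subgroup,
  obtained from the partial lift in which all blocks are replaced.\<close>

lemma S_lift:
  assumes Q: "left_module k Q" and g: "multilin k {1..d} (\<lambda>_. V) Q g"
    and sym: "\<And>v \<tau>. \<lbrakk>v \<in> WW; \<tau> \<in> young d \<mu>\<rbrakk> \<Longrightarrow> g (pcomp d v \<tau>) = g v"
  obtains h where "lin k (S_ob k n \<mu> V) Q h" "\<And>v. v \<in> WW \<Longrightarrow> h (S_proj k n d \<mu> V (tpure k d V v)) = g v"
proof -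
  interpret V: left_module k V by (rule V)
  have sym': "g (put \<mu> l (pcomp (\<mu> l) w \<sigma>) v) = g (put \<mu> l w v)"
    if l: "l \<in> {1..n}" and s: "\<sigma> \<in> carrier (sym_group (\<mu> l))" and w: "w \<in> {1..\<mu> l} \<rightarrow>\<^sub>E carrier V" and v: "v \<in> WW" for l \<sigma> w v
  proof -
    obtain \<tau> where "\<tau> \<in> young d \<mu>" "put \<mu> l (pcomp (\<mu> l) w \<sigma>) v = pcomp d (put \<mu> l w v) \<tau>"
      using put_young[OF sum_mu s l] w v by metis
    then show ?thesis using sym[OF put_closed[OF sum_mu l w v]] by simp
  qed
  obtain P where P: "partial_lift n Q g P" using partial_lift_ex[OF Q g sym' order_refl] by blast
  note A = partial_lift_closed[OF P] and C = partial_lift_lin_sym[OF P] and E = partial_lift_eq[OF P]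
  \<comment> \<open>After the last block every vector is determined by the symmetric factors;
    \<open>v0\<close> merely fills the vector argument of \<open>P\<close>.\<close>
  define v0 where "v0 = (\<lambda>p\<in>{1..d}. \<zero>\<^bsub>V\<^esub>)"
  have v0: "v0 \<in> WW" by (simp add: v0_def)
  have m: "multilin k {1..n} (\<lambda>l. Sy l) Q (\<lambda>s. P s v0)"
    unfolding multilin_def using A C v0 by blast
  obtain h where h: "lin k (S_ob k n \<mu> V) Q h" "\<And>s. s \<in> SS \<Longrightarrow> h (pure_tensor k {1..n} (\<lambda>l. Sy l) s) = P s v0"
    using tensor_lift_ex[OF k sym_pow_module[OF V] Q m] unfolding S_ob_def by blast
  show ?thesis
  proof (rule that[OF h(1)])
    fix v assume v: "v \<in> WW"
    have "h (S_proj k n d \<mu> V (tpure k d V v)) = P (sprods v) v0"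
      using S_proj_pure[OF v] h(2)[OF sprods_closed[OF v]] by simp
    also have "\<dots> = g (\<lambda>p. if p \<in> {1..d} \<and> p \<le> off \<mu> (Suc n) then v p else v0 p)"
      by (rule E[OF sprods_closed[OF v] v0 v]) (simp add: sprods_def)
    also have "(\<lambda>p. if p \<in> {1..d} \<and> p \<le> off \<mu> (Suc n) then v p else v0 p) = v"
      using v by (auto simp: off_end[OF sum_mu] v0_def PiE_iff extensional_def)
    finally show "h (S_proj k n d \<mu> V (tpure k d V v)) = g v" .
  qed
qed

end

lemma S_fun_simps [simp]: "fob (S_fun k n d \<mu>) V = S_ob k n \<mu> V"
  by (simp add: S_fun_def)

text \<open>The description defining \<open>S_fun\<close> on morphisms is proper: a map exists
  because \<open>f\<close> commutes with the Young subgroup, and it is unique because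
  \<open>S_proj\<close> is onto.\<close>

lemma S_fun_fmor:
  assumes sum_mu: "(\<Sum>l=1..n. \<mu> l) = d" and V: "V \<in> fg_projectives k" and W: "W \<in> fg_projectives k"
    and f: "f \<in> Hom (GammaP k d) V W"
  shows S_fun_linmaps: "fmor (S_fun k n d \<mu>) V W f \<in> linmaps k (S_ob k n \<mu> V) (S_ob k n \<mu> W)"
    and S_fun_proj: "x \<in> carrier (tpow k d V) \<Longrightarrow>
      fmor (S_fun k n d \<mu>) V W f (S_proj k n d \<mu> V x) = S_proj k n d \<mu> W (f x)"
proof -
  note mV = fg_proj_module[OF V] and mW = fg_proj_module[OF W]
  note SV = S_ob_module[OF sum_mu mV] and SW = S_ob_module[OF sum_mu mW]
  note pV = S_proj_lin[OF sum_mu mV] and pW = S_proj_lin[OF sum_mu mW]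
  note fl = GammaP_Hom_lin[OF f]
  have g: "multilin k {1..d} (\<lambda>_. V) (S_ob k n \<mu> W) (\<lambda>v. S_proj k n d \<mu> W (f (tpure k d V v)))"
    using tpure_multilin[OF mV, of d] lin_compose[OF _ lin_compose[OF fl pW]] lin_closed[OF lin_compose[OF fl pW]]
    unfolding multilin_def by blast
  obtain h where h: "lin k (S_ob k n \<mu> V) (S_ob k n \<mu> W) h"
    "\<And>v. v \<in> {1..d} \<rightarrow>\<^sub>E carrier V \<Longrightarrow> h (S_proj k n d \<mu> V (tpure k d V v)) = S_proj k n d \<mu> W (f (tpure k d V v))"
  proof (rule S_lift[OF sum_mu mV SW g])
    fix v \<tau> assume v: "v \<in> {1..d} \<rightarrow>\<^sub>E carrier V" and \<tau>: "\<tau> \<in> young d \<mu>"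
    have t: "\<tau> \<in> carrier (sym_group d)" using \<tau> by (simp add: young_def[OF sum_mu])
    have "f (tpure k d V (pcomp d v \<tau>)) = perm_ract k d W (f (tpure k d V v)) \<tau>"
      using f t tpure_closed[OF mV v] perm_ract_pure[OF mV t v] by (metis GammaP_Hom)
    then show "S_proj k n d \<mu> W (f (tpure k d V (pcomp d v \<tau>))) = S_proj k n d \<mu> W (f (tpure k d V v))"
      using S_proj_young[OF sum_mu mW \<tau> GammaP_Hom_closed[OF f tpure_closed[OF mV v]]] by simp
  qed blast
  have hx: "h (S_proj k n d \<mu> V x) = S_proj k n d \<mu> W (f x)" if x: "x \<in> carrier (tpow k d V)" for x
    by (rule tpow_lin_eq[OF mV SW lin_compose[OF pV h(1)] lin_compose[OF fl pW] h(2) x])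
  let ?Q = "\<lambda>h. h \<in> linmaps k (S_ob k n \<mu> V) (S_ob k n \<mu> W) \<and>
       (\<forall>x\<in>carrier (tpow k d V). h (S_proj k n d \<mu> V x) = S_proj k n d \<mu> W (f x))"
  have "\<exists>!h. ?Q h"
  proof (rule ex1I[of _ "restrict h (carrier (S_ob k n \<mu> V))"])
    show *: "?Q (restrict h (carrier (S_ob k n \<mu> V)))"
      using h(1) hx lin_closed[OF pV] by (simp add: restrict_linmaps_iff[OF SV])
    fix h' assume h': "?Q h'"
    show "h' = restrict h (carrier (S_ob k n \<mu> V))"
    proof (rule linmaps_eqI[OF conjunct1[OF h'] conjunct1[OF *]])
      fix z assume "z \<in> carrier (S_ob k n \<mu> V)"
      then obtain x where "x \<in> carrier (tpow k d V)" "z = S_proj k n d \<mu> V x"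
        using S_proj_surj[OF sum_mu mV] by blast
      then show "h' z = restrict h (carrier (S_ob k n \<mu> V)) z"
        using conjunct2[OF h'] conjunct2[OF *] by simp
    qed
  qed
  from theI'[OF this] show "fmor (S_fun k n d \<mu>) V W f \<in> linmaps k (S_ob k n \<mu> V) (S_ob k n \<mu> W)"
    "x \<in> carrier (tpow k d V) \<Longrightarrow> fmor (S_fun k n d \<mu>) V W f (S_proj k n d \<mu> V x) = S_proj k n d \<mu> W (f x)"
    by (simp_all add: S_fun_def)
qed

text \<open>Every element of \<open>S_ob\<close> is an image under \<open>S_proj\<close>, where the
  induced map is given by \<open>f\<close>; the laws are read off there.\<close>

lemma S_fun_Rep:
  assumes sum_mu: "(\<Sum>l=1..n. \<mu> l) = d"
  shows "(S_fun k n d \<mu> :: ('k, 'v, _) spf) \<in> Ob (Rep k d)"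
proof (rule Rep_ObI)
  let ?S = "S_fun k n d \<mu> :: ('k, 'v, _) spf"
  let ?p = "S_proj k n d \<mu>"
  note P = S_fun_proj[OF sum_mu]
  fix V :: "('k, 'v) module" assume V: "V \<in> fg_projectives k"
  show "left_module k (fob ?S V)" using S_ob_module[OF sum_mu fg_proj_module[OF V]] by simp
  have surj: "\<exists>t\<in>carrier (tpow k d V). x = ?p V t" if "x \<in> carrier (fob ?S V)" for x
    using S_proj_surj[OF sum_mu fg_proj_module[OF V]] that by auto
  { fix x assume "x \<in> carrier (fob ?S V)"
    then show "fmor ?S V V (\<lambda>x\<in>carrier (tpow k d V). x) x = x"
      using surj[of x] P[OF V V GammaP_Id[OF V]] by auto }
  fix W :: "('k, 'v) module" assume W: "W \<in> fg_projectives k"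
  note pl = S_proj_lin[OF sum_mu fg_proj_module[OF W]]
  fix f assume f: "f \<in> Hom (GammaP k d) V W"
  show "fmor ?S V W f \<in> linmaps k (fob ?S V) (fob ?S W)" using S_fun_linmaps[OF sum_mu V W f] by simp
  { fix Z :: "('k, 'v) module" and g x
    assume Z: "Z \<in> fg_projectives k" and g: "g \<in> Hom (GammaP k d) W Z" and "x \<in> carrier (fob ?S V)"
    then obtain t where t: "t \<in> carrier (tpow k d V)" "x = ?p V t" using surj by blast
    show "fmor ?S V Z (compose (carrier (tpow k d V)) g f) x = fmor ?S W Z g (fmor ?S V W f x)"
      unfolding t(2) P[OF V Z GammaP_Comp[OF V W f g] t(1)] P[OF V W f t(1)] P[OF W Z g GammaP_Hom_closed[OF f t(1)]]
      using t(1) by (simp add: compose_def) }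
  { fix g x assume g: "g \<in> Hom (GammaP k d) V W" and "x \<in> carrier (fob ?S V)"
    then obtain t where t: "t \<in> carrier (tpow k d V)" "x = ?p V t" using surj by blast
    show "fmor ?S V W (\<lambda>t\<in>carrier (tpow k d V). f t \<oplus>\<^bsub>tpow k d W\<^esub> g t) x =
        fmor ?S V W f x \<oplus>\<^bsub>fob ?S W\<^esub> fmor ?S V W g x"
      unfolding t(2) P[OF V W GammaP_plus[OF V W f g] t(1)] P[OF V W f t(1)] P[OF V W g t(1)]
      using t(1) lin_add[OF pl GammaP_Hom_closed[OF f t(1)] GammaP_Hom_closed[OF g t(1)]] by simp }
  { fix c x assume c: "c \<in> carrier k" and "x \<in> carrier (fob ?S V)"
    then obtain t where t: "t \<in> carrier (tpow k d V)" "x = ?p V t" using surj by blast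
    show "fmor ?S V W (\<lambda>t\<in>carrier (tpow k d V). c \<odot>\<^bsub>tpow k d W\<^esub> f t) x = c \<odot>\<^bsub>fob ?S W\<^esub> fmor ?S V W f x"
      unfolding t(2) P[OF V W GammaP_scale[OF V W f c] t(1)] P[OF V W f t(1)]
      using t(1) lin_smult[OF pl c GammaP_Hom_closed[OF f t(1)]] by simp }
qed

end

section \<open>The isomorphism between \<open>G\<^sub>\<otimes>(M\<^sup>\<mu>)\<close> and \<open>S\<^sup>\<mu>\<close>\<close>

context base
begin

context
  fixes n d :: nat and \<mu> :: "nat \<Rightarrow> nat"
  assumes sum_mu: "(\<Sum>l=1..n. \<mu> l) = d"
begin

abbreviation (input) "EE \<equiv> free_mod k {1..n}"
abbreviation (input) "TE \<equiv> tpow k d EE"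

lemma EE: "left_module k EE" by (rule free_mod_module[OF k])

interpretation T: left_module k TE by (rule tpow_module[OF EE])

section \<open>Words, their single orbit, and the basis of the permutation module\<close>

definition ebas :: "(nat \<Rightarrow> nat) \<Rightarrow> ('k, nat \<Rightarrow> 'k) tens" where
  "ebas i = tpure k d EE (\<lambda>j\<in>{1..d}. basis_vec k (i j))"

definition words :: "(nat \<Rightarrow> nat) set" where
  "words = {i \<in> {1..d} \<rightarrow>\<^sub>E {1..n}. \<forall>l\<in>{1..n}. card {j \<in> {1..d}. i j = l} = \<mu> l}"

text \<open>The weakly increasing word, with letter \<open>l\<close> throughout block
  \<open>l\<close>. It serves as base point of the orbit of words.\<close>

definition word0 :: "nat \<Rightarrow> nat" where
  "word0 = (\<lambda>p\<in>{1..d}. idx \<mu> p)"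

lemma words_finite: "finite words"
  unfolding words_def by (rule finite_subset[of _ "{1..d} \<rightarrow>\<^sub>E {1..n}"]) (auto intro: finite_PiE)

lemma words_PiE: "i \<in> words \<Longrightarrow> i \<in> {1..d} \<rightarrow>\<^sub>E {1..n}"
  by (simp add: words_def)

lemma word0: "word0 \<in> words"
  unfolding words_def
proof (intro CollectI conjI ballI)
  show "word0 \<in> {1..d} \<rightarrow>\<^sub>E {1..n}" unfolding word0_def using idx(1)[OF sum_mu] by (simp del: atLeastAtMost_iff)
  fix l assume l: "l \<in> {1..n}"
  have "{j \<in> {1..d}. word0 j = l} = {off \<mu> l <.. off \<mu> l + \<mu> l}"
  proof (rule Set.set_eqI)
    fix p
    show "p \<in> {j \<in> {1..d}. word0 j = l} \<longleftrightarrow> p \<in> {off \<mu> l <.. off \<mu> l + \<mu> l}"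
      using idx(2)[OF sum_mu, of p] idx_eq[OF sum_mu l, of p] inblk_in[OF sum_mu l, of p]
      by (auto simp: word0_def inblk_def)
  qed
  then show "card {j \<in> {1..d}. word0 j = l} = \<mu> l" by simp
qed

lemma words_pcomp:
  assumes i: "i \<in> words" and s: "\<sigma> \<in> carrier (sym_group d)"
  shows "pcomp d i \<sigma> \<in> words"
  unfolding words_def
proof (intro CollectI conjI ballI)
  show "pcomp d i \<sigma> \<in> {1..d} \<rightarrow>\<^sub>E {1..n}" by (rule pcomp_closed[OF s words_PiE[OF i]])
  fix l assume l: "l \<in> {1..n}"
  have "bij_betw \<sigma> {j \<in> {1..d}. pcomp d i \<sigma> j = l} {j \<in> {1..d}. i j = l}"
    by (rule bij_betw_byWitness[where f'="inv\<^bsub>sym_group d\<^esub> \<sigma>"])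
      (use s sym_group_in[OF s] sym_group_in[OF sym_group_inv_closed[OF s]] in \<open>auto simp: pcomp_def simp del: atLeastAtMost_iff\<close>)
  then show "card {j \<in> {1..d}. pcomp d i \<sigma> j = l} = \<mu> l"
    using i l bij_betw_same_card by (fastforce simp: words_def)
qed

text \<open>Transitivity: words with the same letter counts have the same multiset of letters, and
  then a permutation of positions relates them.\<close>

lemma words_perm:
  assumes i: "i \<in> words"
  shows "\<exists>\<sigma>. \<sigma> \<in> carrier (sym_group d) \<and> pcomp d i \<sigma> = word0"
proof -
  have "image_mset word0 (mset_set {1..d}) = image_mset i (mset_set {1..d})"
  proof (rule multiset_eqI)
    fix l
    have c: "count (image_mset w (mset_set {1..d})) l = card {j \<in> {1..d}. w j = l}" for w :: "nat \<Rightarrow> nat"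
    proof -
      have "{1..d} \<inter> {x. w x = l} = {j \<in> {1..d}. w j = l}" by (rule Set.set_eqI) simp
      then show ?thesis by (simp add: count_image_mset vimage_def Int_commute)
    qed
    show "count (image_mset word0 (mset_set {1..d})) l = count (image_mset i (mset_set {1..d})) l"
    proof (cases "l \<in> {1..n}")
      case True then show ?thesis using i word0 unfolding c by (simp add: words_def)
    next
      case False
      have e: "{j \<in> {1..d}. w j = l} = {}" if "w \<in> words" for w
        using PiE_mem[OF words_PiE[OF that]] False by (auto simp del: atLeastAtMost_iff)
      show ?thesis unfolding c e[OF i] e[OF word0] ..
    qed
  qed
  then obtain p where p: "p permutes {1..d}" "\<forall>x\<in>{1..d}. word0 x = i (p x)"
    using image_mset_eq_implies_permutes[OF finite_atLeastAtMost] by metis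
  have "pcomp d i p = word0"
    using p(2) by (auto simp: pcomp_def word0_def)
  then show ?thesis using p(1) by (auto simp: sym_group_def)
qed

text \<open>A chosen permutation leading from \<open>i\<close> to the base word. It is determined
  only up to the Young subgroup, which \<open>S_proj\<close> does not see.\<close>

definition wperm :: "(nat \<Rightarrow> nat) \<Rightarrow> perm" where
  "wperm i = (SOME \<sigma>. \<sigma> \<in> carrier (sym_group d) \<and> pcomp d i \<sigma> = word0)"

lemma wperm: assumes "i \<in> words"
  shows "wperm i \<in> carrier (sym_group d)" "pcomp d i (wperm i) = word0"
  using someI_ex[OF words_perm[OF assms]] by (simp_all add: wperm_def)

lemma young_iff:
  assumes "\<tau> \<in> carrier (sym_group d)" shows "\<tau> \<in> young d \<mu> \<longleftrightarrow> pcomp d word0 \<tau> = word0"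
proof -
  have "pcomp d word0 \<tau> = word0 \<longleftrightarrow> (\<forall>p\<in>{1..d}. pcomp d word0 \<tau> p = word0 p)"
    by (auto simp: fun_eq_iff pcomp_def word0_def)
  also have "\<dots> \<longleftrightarrow> (\<forall>p\<in>{1..d}. idx \<mu> (\<tau> p) = idx \<mu> p)"
    using sym_group_in[OF assms] by (auto simp: pcomp_def word0_def simp del: atLeastAtMost_iff)
  finally show ?thesis using assms by (simp add: young_def[OF sum_mu])
qed

lemma ebas_closed: "i \<in> {1..d} \<rightarrow>\<^sub>E {1..n} \<Longrightarrow> ebas i \<in> carrier TE"
  unfolding ebas_def using basis_vec_closed[OF k, of _ "{1..n}"]
  by (intro tpure_closed[OF EE]) (auto simp del: atLeastAtMost_iff)

lemma ebas_perm:
  assumes "i \<in> {1..d} \<rightarrow>\<^sub>E {1..n}" "\<sigma> \<in> carrier (sym_group d)"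
  shows "perm_ract k d EE (ebas i) \<sigma> = ebas (pcomp d i \<sigma>)"
proof -
  have v: "(\<lambda>j\<in>{1..d}. basis_vec k (i j)) \<in> {1..d} \<rightarrow>\<^sub>E carrier EE"
    using assms(1) basis_vec_closed[OF k, of _ "{1..n}"] by (auto simp del: atLeastAtMost_iff)
  have "pcomp d (\<lambda>j\<in>{1..d}. basis_vec k (i j)) \<sigma> = (\<lambda>j\<in>{1..d}. basis_vec k (pcomp d i \<sigma> j))"
    unfolding pcomp_def by (rule restrict_ext) (use sym_group_in[OF assms(2)] in \<open>simp del: atLeastAtMost_iff\<close>)
  then show ?thesis unfolding ebas_def perm_ract_pure[OF EE assms(2) v] by simp
qed

text \<open>The definition admits index functions with any values outside \<open>{1..d}\<close>;
  restricting them gives extensional words and the same tensors.\<close>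

lemma M_mod_carrier: "carrier (M_mod k n d \<mu>) = mspan k TE (ebas ` words)"
proof -
  have "{tpure k d EE (\<lambda>j\<in>{1..d}. basis_vec k (i j)) | i.
          i \<in> {1..d} \<rightarrow> {1..n} \<and> (\<forall>l\<in>{1..n}. card {j \<in> {1..d}. i j = l} = \<mu> l)} = ebas ` words" (is "?L = _")
  proof (intro Set.set_eqI iffI)
    fix x assume "x \<in> ?L"
    then obtain i where i: "i \<in> {1..d} \<rightarrow> {1..n}" "\<forall>l\<in>{1..n}. card {j \<in> {1..d}. i j = l} = \<mu> l"
      and x: "x = tpure k d EE (\<lambda>j\<in>{1..d}. basis_vec k (i j))" by blast
    have "{j \<in> {1..d}. restrict i {1..d} j = l} = {j \<in> {1..d}. i j = l}" for l
      by (rule Set.set_eqI) auto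
    then have "restrict i {1..d} \<in> words" using i by (simp add: words_def)
    moreover have "x = ebas (restrict i {1..d})"
      unfolding x ebas_def by (intro arg_cong[where f="tpure k d EE"] restrict_ext) simp
    ultimately show "x \<in> ebas ` words" by blast
  next
    fix x assume "x \<in> ebas ` words"
    then show "x \<in> ?L" unfolding ebas_def words_def by (auto simp: PiE_def)
  qed
  then show ?thesis by (simp add: M_mod_def Let_def)
qed

lemma M_mod_simps [simp]: "\<zero>\<^bsub>M_mod k n d \<mu>\<^esub> = \<zero>\<^bsub>TE\<^esub>" "add (M_mod k n d \<mu>) = add TE"
  "smult (M_mod k n d \<mu>) = kS_lact k d EE"
  by (simp_all add: M_mod_def Let_def)

lemma ebas_words_subset: "ebas ` words \<subseteq> carrier TE"
  using ebas_closed[OF words_PiE] by blast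

lemma M_mod_submod: "submod k TE (carrier (M_mod k n d \<mu>))"
  unfolding M_mod_carrier by (rule mspan_submod[OF k T.left_module_axioms ebas_words_subset])

lemma M_mod_sub: "x \<in> carrier (M_mod k n d \<mu>) \<Longrightarrow> x \<in> carrier TE"
  using M_mod_submod by (auto simp: submod_def)

lemma ebas_M: "i \<in> words \<Longrightarrow> ebas i \<in> carrier (M_mod k n d \<mu>)"
  unfolding M_mod_carrier using mspan_superset[of "ebas ` words" k TE] by blast

lemma M_mod_perm:
  assumes x: "x \<in> carrier (M_mod k n d \<mu>)" and s: "\<sigma> \<in> carrier (sym_group d)"
  shows "perm_ract k d EE x \<sigma> \<in> carrier (M_mod k n d \<mu>)"
proof -
  have "mspan k TE (ebas ` words) \<subseteq> {x \<in> carrier TE. perm_ract k d EE x \<sigma> \<in> carrier (M_mod k n d \<mu>)}"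
  proof (rule mspan_least[OF k T.left_module_axioms submod_vimage[OF T.left_module_axioms T.left_module_axioms
        perm_ract_lin[OF EE s] M_mod_submod]])
    show "ebas ` words \<subseteq> {x \<in> carrier TE. perm_ract k d EE x \<sigma> \<in> carrier (M_mod k n d \<mu>)}"
    proof (rule subsetI, rule CollectI)
      fix y assume "y \<in> ebas ` words"
      then obtain i where i: "i \<in> words" "y = ebas i" by blast
      show "y \<in> carrier TE \<and> perm_ract k d EE y \<sigma> \<in> carrier (M_mod k n d \<mu>)"
        unfolding i(2) ebas_perm[OF words_PiE[OF i(1)] s]
        using ebas_closed[OF words_PiE[OF i(1)]] ebas_M[OF words_pcomp[OF i(1) s]] by blast
    qed
  qed
  then show ?thesis using x unfolding M_mod_carrier by blast
qed

lemma M_mod_module: "left_module (kS k d) (M_mod k n d \<mu>)"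
proof (rule left_module_submod[OF kS_lact_module[OF EE, of d]])
  let ?L = "mk_module (carrier TE) \<zero>\<^bsub>TE\<^esub> (add TE) (kS_lact k d EE)"
  show "submod (kS k d) ?L (carrier (M_mod k n d \<mu>))"
    unfolding submod_def
  proof (intro conjI ballI)
    fix a x assume a: "a \<in> carrier (kS k d)" and x: "x \<in> carrier (M_mod k n d \<mu>)"
    have "kS_lact k d EE a x \<in> carrier (M_mod k n d \<mu>)"
      unfolding kS_lact_def
    proof (rule T.submod_finsum[OF M_mod_submod])
      fix \<sigma> assume "\<sigma> \<in> carrier (sym_group d)"
      then show "a \<sigma> \<odot>\<^bsub>TE\<^esub> perm_ract k d EE x (inv\<^bsub>sym_group d\<^esub> \<sigma>) \<in> carrier (M_mod k n d \<mu>)"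
        using M_mod_perm[OF x] kS_closed[OF a] M_mod_submod unfolding submod_def by simp
    qed
    then show "a \<odot>\<^bsub>?L\<^esub> x \<in> carrier (M_mod k n d \<mu>)" by simp
  qed (use M_mod_submod in \<open>auto simp: submod_def\<close>)
qed simp_all

text \<open>\<open>M_mod\<close> with the scalars of the ambient tensor power. Over \<open>k\<close>
  it is generated by the basis tensors, so linear maps on it can be compared word by word.\<close>

definition Mk :: "('k, ('k, nat \<Rightarrow> 'k) tens) module" where
  "Mk = mk_module (carrier (M_mod k n d \<mu>)) \<zero>\<^bsub>TE\<^esub> (add TE) (smult TE)"

lemma Mk_simps [simp]: "carrier Mk = carrier (M_mod k n d \<mu>)" "\<zero>\<^bsub>Mk\<^esub> = \<zero>\<^bsub>TE\<^esub>" "add Mk = add TE" "smult Mk = smult TE"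
  by (simp_all add: Mk_def)

lemma Mk_module: "left_module k Mk"
  by (rule left_module_submod[OF T.left_module_axioms M_mod_submod]) simp_all

lemma Mk_spans: "spans k Mk (ebas ` words)"
  by (rule spans_mspan[OF k T.left_module_axioms ebas_words_subset]) (simp_all add: M_mod_carrier)

lemma kS_lact_basis:
  "\<lbrakk>x \<in> carrier TE; \<sigma> \<in> carrier (sym_group d)\<rbrakk> \<Longrightarrow>
    kS_lact k d EE (basis_vec k \<sigma>) x = perm_ract k d EE x (inv\<^bsub>sym_group d\<^esub> \<sigma>)"
  unfolding kS_lact_def using perm_ract_closed[OF EE]
  by (intro basis_sum[OF T.left_module_axioms, of d "\<lambda>\<sigma>. perm_ract k d EE x (inv\<^bsub>sym_group d\<^esub> \<sigma>)"]) auto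

lemma kS_lact_scale:
  assumes c: "c \<in> carrier k" and x: "x \<in> carrier TE"
  shows "kS_lact k d EE (\<lambda>\<sigma>. c \<otimes>\<^bsub>k\<^esub> basis_vec k id \<sigma>) x = c \<odot>\<^bsub>TE\<^esub> x"
proof -
  note pc = perm_ract_closed[OF EE _ x]
  have b: "basis_vec k id \<sigma> \<in> carrier k" for \<sigma> :: perm by (rule kS_closed[OF kS_basis[OF sym_group_id[of d]]])
  have "kS_lact k d EE (\<lambda>\<sigma>. c \<otimes>\<^bsub>k\<^esub> basis_vec k id \<sigma>) x = c \<odot>\<^bsub>TE\<^esub> kS_lact k d EE (basis_vec k id) x"
    unfolding kS_lact_def using c pc b
    by (subst T.smult_finsum) (auto intro!: T.finsum_cong' simp: T.smult_assoc)
  also have "kS_lact k d EE (basis_vec k id) x = x"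
    using kS_lact_basis[OF x sym_group_id] monoid.inv_one[OF group.is_monoid[OF sym_group_is_group[of d]]]
    by (simp add: perm_ract_id[OF EE x])
  finally show ?thesis .
qed

section \<open>The comparison of tensor product and symmetric powers at a fixed
  \<open>V\<close>\<close>

context
  fixes V :: "('k, 'v) module"
  assumes V: "V \<in> fg_projectives k"
begin

abbreviation (input) "GM \<equiv> BT d (M_mod k n d \<mu>) V"
abbreviation (input) "PM \<equiv> PT d (M_mod k n d \<mu>) V"
abbreviation (input) "Sp \<equiv> S_proj k n d \<mu> V"
abbreviation (input) "TV \<equiv> tpow k d V"
abbreviation (input) "SV \<equiv> S_ob k n \<mu> V"

lemmas V' = fg_proj_module[OF V]
lemmas GM_module = BT_module[OF M_mod_module V]
lemmas SV_module = S_ob_module[OF sum_mu V']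

text \<open>Balance gives only additivity in the second argument. A scalar is moved across the
  tensor sign as a multiple of the unit of the group algebra.\<close>

lemma PM_lin2: assumes x: "x \<in> carrier TV" shows "lin k Mk GM (\<lambda>m. PM x m)"
proof (rule linI)
  fix m assume "m \<in> carrier Mk"
  then have m: "m \<in> carrier (M_mod k n d \<mu>)" by simp
  show "PM x m \<in> carrier GM" by (rule PT_closed[OF M_mod_module V x m])
  { fix m' assume "m' \<in> carrier Mk"
    then show "PM x (m \<oplus>\<^bsub>Mk\<^esub> m') = PM x m \<oplus>\<^bsub>GM\<^esub> PM x m'"
      using PT_add[OF M_mod_module V x m, of m'] by simp }
  fix c assume c: "c \<in> carrier k"
  let ?c = "\<lambda>\<sigma>. c \<otimes>\<^bsub>k\<^esub> basis_vec k id \<sigma>"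
  have cc: "?c \<in> carrier (kS k d)" by (rule kS_scale_closed[OF c kS_basis[OF sym_group_id]])
  have "PM x (kS_lact k d EE ?c m) = PM (kS_ract k d V x ?c) m"
    using PT_balanced[OF M_mod_module V x m cc] by simp
  also have "kS_ract k d V x ?c = c \<odot>\<^bsub>TV\<^esub> x"
    using lin_smult[OF kS_ract_lin2[OF V' x] c, of "basis_vec k id"] kS_basis[OF sym_group_id[of d]]
      kS_ract_one[OF V' x] by simp
  also have "PM (c \<odot>\<^bsub>TV\<^esub> x) m = c \<odot>\<^bsub>GM\<^esub> PM x m" by (rule lin_smult[OF PT_lin[OF M_mod_module V m] c x])
  finally show "PM x (c \<odot>\<^bsub>Mk\<^esub> m) = c \<odot>\<^bsub>GM\<^esub> PM x m"
    unfolding Mk_simps kS_lact_scale[OF c M_mod_sub[OF m]] .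
qed

lemma PM_perm:
  assumes x: "x \<in> carrier TV" and m: "m \<in> carrier (M_mod k n d \<mu>)" and s: "\<sigma> \<in> carrier (sym_group d)"
  shows "PM (perm_ract k d V x \<sigma>) m = PM x (perm_ract k d EE m (inv\<^bsub>sym_group d\<^esub> \<sigma>))"
  using PT_balanced[OF M_mod_module V x m kS_basis[OF s]] kS_ract_basis[OF V' x s] kS_lact_basis[OF M_mod_sub[OF m] s]
  by simp

text \<open>Each basis tensor is a translate of the base one, and the translating permutation can be
  moved to the left factor.\<close>

lemma PM_word:
  assumes x: "x \<in> carrier TV" and i: "i \<in> words"
  shows "PM x (ebas i) = PM (perm_ract k d V x (wperm i)) (ebas word0)"
proof -
  note w = wperm[OF i]
  have "perm_ract k d EE (ebas word0) (inv\<^bsub>sym_group d\<^esub> (wperm i)) = ebas (pcomp d word0 (inv\<^bsub>sym_group d\<^esub> (wperm i)))"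
    by (rule ebas_perm[OF words_PiE[OF word0] sym_group_inv_closed[OF w(1)]])
  also have "pcomp d word0 (inv\<^bsub>sym_group d\<^esub> (wperm i)) = i"
    using w pcomp_pcomp[OF w(1) sym_group_inv_closed[OF w(1)], of i] pcomp_id[OF words_PiE[OF i]] by simp
  finally show ?thesis using PM_perm[OF x ebas_M[OF word0] w(1)] by simp
qed

text \<open>The Young subgroup fixes the base tensor, so tensoring with it is invariant under the
  subgroup and descends to \<open>S_ob\<close>.\<close>

lemma S_to_GM:
  obtains h where "lin k SV GM h" "\<And>x. x \<in> carrier TV \<Longrightarrow> h (Sp x) = PM x (ebas word0)"
proof -
  note e = ebas_M[OF word0]
  have g: "multilin k {1..d} (\<lambda>_. V) GM (\<lambda>v. PM (tpure k d V v) (ebas word0))"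
    using tpure_multilin[OF V', of d] lin_compose[OF _ PT_lin[OF M_mod_module V e]]
      lin_closed[OF PT_lin[OF M_mod_module V e]] unfolding multilin_def by blast
  obtain h where h: "lin k SV GM h"
    "\<And>v. v \<in> {1..d} \<rightarrow>\<^sub>E carrier V \<Longrightarrow> h (Sp (tpure k d V v)) = PM (tpure k d V v) (ebas word0)"
  proof (rule S_lift[OF sum_mu V' GM_module g])
    fix v \<tau> assume v: "v \<in> {1..d} \<rightarrow>\<^sub>E carrier V" and \<tau>: "\<tau> \<in> young d \<mu>"
    have t: "\<tau> \<in> carrier (sym_group d)" using \<tau> by (simp add: young_def[OF sum_mu])
    have "pcomp d word0 (inv\<^bsub>sym_group d\<^esub> \<tau>) = pcomp d (pcomp d word0 \<tau>) (inv\<^bsub>sym_group d\<^esub> \<tau>)"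
      using young_iff[OF t] \<tau> by simp
    also have "\<dots> = word0"
      using pcomp_pcomp[OF t sym_group_inv_closed[OF t], of word0] t pcomp_id[OF words_PiE[OF word0]] by simp
    finally have "perm_ract k d EE (ebas word0) (inv\<^bsub>sym_group d\<^esub> \<tau>) = ebas word0"
      using ebas_perm[OF words_PiE[OF word0] sym_group_inv_closed[OF t]] by simp
    then show "PM (tpure k d V (pcomp d v \<tau>)) (ebas word0) = PM (tpure k d V v) (ebas word0)"
      using PM_perm[OF tpure_closed[OF V' v] e t] perm_ract_pure[OF V' t v] by simp
  qed blast
  have "h (Sp x) = PM x (ebas word0)" if "x \<in> carrier TV" for x
    by (rule tpow_lin_eq[OF V' GM_module lin_compose[OF S_proj_lin[OF sum_mu V'] h(1)] PT_lin[OF M_mod_module V e] h(2) that])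
  then show ?thesis using that h(1) by blast
qed

text \<open>Two permutations leading from \<open>i\<close> to the base word differ by an element of
  its stabilizer. Hence the choice in \<open>wperm\<close> does not matter after projection.\<close>

lemma S_proj_coset:
  assumes x: "x \<in> carrier TV" and r: "\<rho> \<in> carrier (sym_group d)" and r': "\<rho>' \<in> carrier (sym_group d)"
    and "pcomp d i \<rho> = word0" "pcomp d i \<rho>' = word0"
  shows "Sp (perm_ract k d V x \<rho>) = Sp (perm_ract k d V x \<rho>')"
proof -
  let ?\<kappa> = "inv\<^bsub>sym_group d\<^esub> \<rho> \<circ> \<rho>'"
  have kc: "?\<kappa> \<in> carrier (sym_group d)" using r r' by simp
  have "pcomp d word0 ?\<kappa> = pcomp d i (\<rho> \<circ> ?\<kappa>)" using pcomp_pcomp[OF r kc, of i] assms(4) by simp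
  also have "\<dots> = word0" using sym_group_cancel(1)[OF r, of \<rho>'] assms(5) by simp
  finally have "?\<kappa> \<in> young d \<mu>" using young_iff[OF kc] by simp
  from S_proj_young[OF sum_mu V' this perm_ract_closed[OF V' r x]] show ?thesis
    using perm_ract_comp[OF V' r kc x] sym_group_cancel(1)[OF r, of \<rho>'] by simp
qed

definition coordE :: "('k, nat \<Rightarrow> 'k) tens \<Rightarrow> (nat \<Rightarrow> nat) \<Rightarrow> 'k" where
  "coordE = coord d EE {1..n} (\<lambda>l f. f l)"

lemma coordE_hyps: "left_module k EE" "finite {1..n}" "\<forall>l\<in>{1..n}. lin k EE (self_mod k) (\<lambda>f. f l)"
  using EE lin_eval by auto

lemmas coordE_lin = coord_lin[OF coordE_hyps, of d, folded coordE_def]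
lemmas coordE_perm = coord_perm[OF coordE_hyps, where d=d, folded coordE_def]

lemma coordE_closed: "x \<in> carrier TE \<Longrightarrow> coordE x i \<in> carrier k"
  using free_mod_closed[OF k lin_closed[OF coordE_lin]] by blast

lemma coordE_ebas:
  assumes "i \<in> {1..d} \<rightarrow>\<^sub>E {1..n}" "i' \<in> {1..d} \<rightarrow>\<^sub>E {1..n}"
  shows "coordE (ebas i) i' = basis_vec k i i'"
  unfolding coordE_def ebas_def
proof (rule coord_basis[OF coordE_hyps _ _ assms])
  show "basis_vec k l \<in> carrier EE" if "l \<in> {1..n}" for l by (rule basis_vec_closed[OF k that])
qed (simp add: basis_vec_def)

text \<open>The inverse comparison on a pair: expand \<open>m\<close> in the basis tensors and send
  the tensor of \<open>x\<close> and \<open>ebas i\<close> to the class of \<open>x\<close> acted on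
  by \<open>wperm i\<close>. Coordinates make this visibly linear in \<open>m\<close>.\<close>

definition theta0 :: "('k, 'v) tens \<Rightarrow> ('k, nat \<Rightarrow> 'k) tens \<Rightarrow> ('k, 'v) stens" where
  "theta0 x m = (\<Oplus>\<^bsub>SV\<^esub>i\<in>words. coordE m i \<odot>\<^bsub>SV\<^esub> Sp (perm_ract k d V x (wperm i)))"

lemma Sp_closed: "x \<in> carrier TV \<Longrightarrow> Sp x \<in> carrier SV"
  by (rule lin_closed[OF S_proj_lin[OF sum_mu V']])

lemma theta0_lin1: "m \<in> carrier TE \<Longrightarrow> lin k TV SV (\<lambda>x. theta0 x m)"
  unfolding theta0_def
  by (intro lin_sum[OF SV_module] lin_scale[OF k SV_module]
      lin_compose[OF perm_ract_lin[OF V' wperm(1)] S_proj_lin[OF sum_mu V']] coordE_closed)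

lemma theta0_lin2: assumes x: "x \<in> carrier TV" shows "lin k TE SV (\<lambda>m. theta0 x m)"
  unfolding theta0_def
proof (rule lin_sum[OF SV_module])
  fix i assume i: "i \<in> words"
  interpret S: left_module k SV by (rule SV_module)
  have c: "Sp (perm_ract k d V x (wperm i)) \<in> carrier SV"
    by (rule Sp_closed[OF perm_ract_closed[OF V' wperm(1)[OF i] x]])
  note ev = lin_compose[OF coordE_lin lin_eval]
  show "lin k TE SV (\<lambda>m. coordE m i \<odot>\<^bsub>SV\<^esub> Sp (perm_ract k d V x (wperm i)))"
    by (rule linI) (use c coordE_closed in \<open>simp_all add: lin_add[OF ev, unfolded self_mod_simps]
      lin_smult[OF ev, unfolded self_mod_simps] S.smult_l_distr S.smult_assoc\<close>)
qed

text \<open>Reindexing the words by \<tau> matches the coefficients. The remaining discrepancy is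
  between two permutations that lead from the same word to the base word.\<close>

lemma theta0_perm:
  assumes x: "x \<in> carrier TV" and m: "m \<in> carrier TE" and t: "\<tau> \<in> carrier (sym_group d)"
  shows "theta0 (perm_ract k d V x \<tau>) m = theta0 x (perm_ract k d EE m (inv\<^bsub>sym_group d\<^esub> \<tau>))"
proof -
  interpret S: left_module k SV by (rule SV_module)
  note ti = sym_group_inv_closed[OF t]
  have c: "Sp (perm_ract k d V x (wperm i)) \<in> carrier SV" if "i \<in> words" for i
    by (rule Sp_closed[OF perm_ract_closed[OF V' wperm(1)[OF that] x]])
  have "theta0 x (perm_ract k d EE m (inv\<^bsub>sym_group d\<^esub> \<tau>)) =
    (\<Oplus>\<^bsub>SV\<^esub>i\<in>words. coordE m (pcomp d i \<tau>) \<odot>\<^bsub>SV\<^esub> Sp (perm_ract k d V x (wperm i)))"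
    unfolding theta0_def
    by (rule S.finsum_cong') (use c coordE_closed[OF m] coordE_perm[OF ti m words_PiE] t in auto)
  also have "\<dots> = (\<Oplus>\<^bsub>SV\<^esub>j\<in>words. coordE m (pcomp d (pcomp d j (inv\<^bsub>sym_group d\<^esub> \<tau>)) \<tau>) \<odot>\<^bsub>SV\<^esub>
      Sp (perm_ract k d V x (wperm (pcomp d j (inv\<^bsub>sym_group d\<^esub> \<tau>)))))"
  proof (rule S.finsum_reindex_bij)
    show "bij_betw (\<lambda>j. pcomp d j (inv\<^bsub>sym_group d\<^esub> \<tau>)) words words"
      by (rule bij_betw_byWitness[where f'="\<lambda>j. pcomp d j \<tau>"])
        (use t ti words_pcomp pcomp_id[OF words_PiE] in \<open>auto simp: pcomp_pcomp\<close>)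
  qed (use c coordE_closed[OF m] in auto)
  also have "\<dots> = theta0 (perm_ract k d V x \<tau>) m"
    unfolding theta0_def
  proof (rule S.finsum_cong')
    fix j assume j: "j \<in> words"
    let ?j = "pcomp d j (inv\<^bsub>sym_group d\<^esub> \<tau>)"
    note j' = words_pcomp[OF j ti]
    have 1: "pcomp d ?j \<tau> = j" using pcomp_pcomp[OF ti t, of j] t pcomp_id[OF words_PiE[OF j]] by simp
    \<comment> \<open>This makes \<open>\<tau> \<circ> wperm j\<close> a competitor of
      \<open>wperm ?j\<close>, to which \<open>S_proj_coset\<close> applies.\<close>
    have 2: "pcomp d ?j (\<tau> \<circ> wperm j) = word0"
      using pcomp_pcomp[OF t wperm(1)[OF j], of ?j] 1 wperm(2)[OF j] by simp
    have "Sp (perm_ract k d V (perm_ract k d V x \<tau>) (wperm j)) = Sp (perm_ract k d V x (wperm ?j))"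
      using S_proj_coset[OF x sym_group_comp[OF t wperm(1)[OF j]] wperm(1)[OF j'] 2 wperm(2)[OF j']]
        perm_ract_comp[OF V' t wperm(1)[OF j] x] by simp
    then show "coordE m (pcomp d ?j \<tau>) \<odot>\<^bsub>SV\<^esub> Sp (perm_ract k d V x (wperm ?j)) =
      coordE m j \<odot>\<^bsub>SV\<^esub> Sp (perm_ract k d V (perm_ract k d V x \<tau>) (wperm j))"
      using 1 by simp
  qed (use Sp_closed[OF perm_ract_closed[OF V' wperm(1) perm_ract_closed[OF V' t x]]] coordE_closed[OF m] in auto)
  finally show ?thesis by simp
qed

text \<open>Linearity in each argument reduces the action of \<open>a\<close> to that of single
  permutations.\<close>

lemma theta0_balanced: "balanced k (kS k d) TV (kS_ract k d V) (M_mod k n d \<mu>) SV theta0"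
  unfolding balanced_def
proof (intro conjI ballI)
  interpret S: left_module k SV by (rule SV_module)
  interpret TV: left_module k TV by (rule tpow_module[OF V'])
  fix x a m assume x: "x \<in> carrier TV" and a: "a \<in> carrier (kS k d)" and m: "m \<in> carrier (M_mod k n d \<mu>)"
  note mT = M_mod_sub[OF m] and ac = kS_closed[OF a]
  note l1 = theta0_lin1[OF mT] and l2 = theta0_lin2[OF x]
  have "theta0 (kS_ract k d V x a) m = (\<Oplus>\<^bsub>SV\<^esub>\<tau>\<in>carrier (sym_group d). theta0 (a \<tau> \<odot>\<^bsub>TV\<^esub> perm_ract k d V x \<tau>) m)"
    unfolding kS_ract_def
    by (rule lin_finsum[OF TV.left_module_axioms SV_module l1]) (use ac perm_ract_closed[OF V' _ x] in auto)
  also have "\<dots> = (\<Oplus>\<^bsub>SV\<^esub>\<tau>\<in>carrier (sym_group d).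
      theta0 x (a \<tau> \<odot>\<^bsub>TE\<^esub> perm_ract k d EE m (inv\<^bsub>sym_group d\<^esub> \<tau>)))"
    by (rule S.finsum_cong')
      (use ac perm_ract_closed[OF V' _ x] perm_ract_closed[OF EE _ mT] lin_closed[OF l2] theta0_perm[OF x mT]
        in \<open>auto simp: lin_smult[OF l1] lin_smult[OF l2]\<close>)
  also have "\<dots> = theta0 x (kS_lact k d EE a m)"
    unfolding kS_lact_def
    by (rule lin_finsum[OF T.left_module_axioms SV_module l2, symmetric]) (use ac perm_ract_closed[OF EE _ mT] in auto)
  finally show "theta0 (kS_ract k d V x a) m = theta0 x (a \<odot>\<^bsub>M_mod k n d \<mu>\<^esub> m)" by simp
qed (use theta0_lin1 M_mod_sub lin_add[OF theta0_lin2] in auto)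

lemma theta0_word0: assumes x: "x \<in> carrier TV" shows "theta0 x (ebas word0) = Sp x"
proof -
  interpret S: left_module k SV by (rule SV_module)
  have c: "Sp (perm_ract k d V x (wperm i)) \<in> carrier SV" if "i \<in> words" for i
    by (rule Sp_closed[OF perm_ract_closed[OF V' wperm(1)[OF that] x]])
  have "theta0 x (ebas word0) = coordE (ebas word0) word0 \<odot>\<^bsub>SV\<^esub> Sp (perm_ract k d V x (wperm word0))"
    unfolding theta0_def
  proof (rule S.finsum_single[OF words_finite word0])
    fix i assume i: "i \<in> words"
    show "coordE (ebas word0) i \<odot>\<^bsub>SV\<^esub> Sp (perm_ract k d V x (wperm i)) \<in> carrier SV"
      using coordE_closed[OF ebas_closed[OF words_PiE[OF word0]]] c[OF i] by simp
    assume "i \<noteq> word0"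
    then show "coordE (ebas word0) i \<odot>\<^bsub>SV\<^esub> Sp (perm_ract k d V x (wperm i)) = \<zero>\<^bsub>SV\<^esub>"
      using c[OF i] by (simp add: coordE_ebas[OF words_PiE[OF word0] words_PiE[OF i]] basis_vec_def)
  qed
  also have "\<dots> = Sp (perm_ract k d V x (wperm word0))"
    using c[OF word0] by (simp add: coordE_ebas[OF words_PiE[OF word0] words_PiE[OF word0]] basis_vec_def S.smult_one)
  also have "\<dots> = Sp (perm_ract k d V x id)"
    by (rule S_proj_coset[OF x wperm(1)[OF word0] sym_group_id wperm(2)[OF word0] pcomp_id[OF words_PiE[OF word0]]])
  finally show ?thesis using perm_ract_id[OF V' x] by simp
qed

text \<open>Both maps are determined by exchanging the tensor of \<open>x\<close> and the base
  tensor with the class of \<open>x\<close>. As \<open>S_proj\<close> is onto, every element of the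
  tensor product is then a single pure tensor of this kind.\<close>

lemma GM_S_iso:
  obtains \<theta> h where "lin k GM SV \<theta>" "lin k SV GM h" "\<And>x. x \<in> carrier TV \<Longrightarrow> \<theta> (PM x (ebas word0)) = Sp x"
    "\<And>x. x \<in> carrier TV \<Longrightarrow> h (Sp x) = PM x (ebas word0)"
    "\<And>z. z \<in> carrier GM \<Longrightarrow> \<exists>x\<in>carrier TV. z = PM x (ebas word0)"
proof -
  obtain h where h: "lin k SV GM h" "\<And>x. x \<in> carrier TV \<Longrightarrow> h (Sp x) = PM x (ebas word0)"
    using S_to_GM by blast
  define \<theta> where "\<theta> = btensor_lift k (kS k d) TV (kS_ract k d V) (M_mod k n d \<mu>) SV theta0"
  have \<theta>: "lin k GM SV \<theta>"
    unfolding \<theta>_def by (rule lin_linmaps[OF BT_lift_linmaps[OF M_mod_module V SV_module theta0_balanced]])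
  have \<theta>p: "\<theta> (PM x m) = theta0 x m" if "x \<in> carrier TV" "m \<in> carrier (M_mod k n d \<mu>)" for x m
    unfolding \<theta>_def by (rule BT_lift_pure[OF M_mod_module V SV_module theta0_balanced that])
  have \<theta>e: "\<theta> (PM x (ebas word0)) = Sp x" if "x \<in> carrier TV" for x
    using \<theta>p[OF that ebas_M[OF word0]] theta0_word0[OF that] by simp
  have h\<theta>: "h (\<theta> z) = z" if "z \<in> carrier GM" for z
  proof (rule BT_lin_eq[OF M_mod_module V GM_module lin_compose[OF \<theta> h(1)] lin_id _ that])
    fix x m assume x: "x \<in> carrier TV" and m: "m \<in> carrier (M_mod k n d \<mu>)"
    show "h (\<theta> (PM x m)) = PM x m"
    proof (rule lin_eq_on_spans[OF Mk_module GM_module lin_compose[OF PM_lin2[OF x] lin_compose[OF \<theta> h(1)]]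
          PM_lin2[OF x] Mk_spans])
      fix s assume "s \<in> ebas ` words"
      then obtain i where i: "i \<in> words" "s = ebas i" by blast
      show "h (\<theta> (PM x s)) = PM x s"
        unfolding i(2) PM_word[OF x i(1)]
        using \<theta>e h(2) perm_ract_closed[OF V' wperm(1)[OF i(1)] x] by simp
    qed (use m in simp)
  qed
  have "\<exists>x\<in>carrier TV. z = PM x (ebas word0)" if z: "z \<in> carrier GM" for z
  proof -
    obtain x where "x \<in> carrier TV" "\<theta> z = Sp x"
      using lin_closed[OF \<theta> z] S_proj_surj[OF sum_mu V'] by blast
    then show ?thesis using h(2) h\<theta>[OF z] by metis
  qed
  then show ?thesis using that \<theta> h \<theta>e by blast
qed

end

text \<open>Naturality costs nothing: at each \<open>V\<close> the isomorphism is fixed on tensors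
  with the base tensor and on classes of \<open>x\<close>, and both functors move these by replacing
  \<open>x\<close> with \<open>f x\<close>.\<close>

theorem GM_S_nat_iso:
  obtains \<theta> h where
    "\<theta> \<in> nat_trans k (GammaP k d) (Gtensor_ob k d (M_mod k n d \<mu>) :: ('k, 'v, _) spf) (S_fun k n d \<mu>)"
    "h \<in> nat_trans k (GammaP k d) (S_fun k n d \<mu>) (Gtensor_ob k d (M_mod k n d \<mu>) :: ('k, 'v, _) spf)"
    "\<And>V z. \<lbrakk>V \<in> fg_projectives k; z \<in> carrier (BT d (M_mod k n d \<mu>) V)\<rbrakk> \<Longrightarrow> h V (\<theta> V z) = z"
    "\<And>V s. \<lbrakk>V \<in> fg_projectives k; s \<in> carrier (S_ob k n \<mu> V)\<rbrakk> \<Longrightarrow> \<theta> V (h V s) = s"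
proof -
  let ?M = "M_mod k n d \<mu>" and ?e = "ebas word0"
  let ?G = "Gtensor_ob k d ?M :: ('k, 'v, _) spf" and ?S = "S_fun k n d \<mu> :: ('k, 'v, _) spf"
  note M = M_mod_module
  \<comment> \<open>All properties are gathered in one relation, so that a single choice for each
    \<open>V\<close> yields both directions at once.\<close>
  define R where "R V p \<longleftrightarrow>
    lin k (BT d ?M V) (S_ob k n \<mu> V) (fst p) \<and> lin k (S_ob k n \<mu> V) (BT d ?M V) (snd p) \<and>
    (\<forall>x\<in>carrier (tpow k d V). fst p (PT d ?M V x ?e) = S_proj k n d \<mu> V x) \<and>
    (\<forall>x\<in>carrier (tpow k d V). snd p (S_proj k n d \<mu> V x) = PT d ?M V x ?e) \<and>
    (\<forall>z\<in>carrier (BT d ?M V). \<exists>x\<in>carrier (tpow k d V). z = PT d ?M V x ?e)" for V :: "('k, 'v) module" and p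
  define \<theta> where "\<theta> V = fst (SOME p. R V p)" for V
  define h where "h V = snd (SOME p. R V p)" for V
  have "\<exists>p. R V p" if V: "V \<in> fg_projectives k" for V
  proof -
    obtain a b where "lin k (BT d ?M V) (S_ob k n \<mu> V) a" "lin k (S_ob k n \<mu> V) (BT d ?M V) b"
      "\<And>x. x \<in> carrier (tpow k d V) \<Longrightarrow> a (PT d ?M V x ?e) = S_proj k n d \<mu> V x"
      "\<And>x. x \<in> carrier (tpow k d V) \<Longrightarrow> b (S_proj k n d \<mu> V x) = PT d ?M V x ?e"
      "\<And>z. z \<in> carrier (BT d ?M V) \<Longrightarrow> \<exists>x\<in>carrier (tpow k d V). z = PT d ?M V x ?e"
      using GM_S_iso[OF V] by blast
    then have "R V (a, b)" by (simp add: R_def)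
    then show ?thesis by blast
  qed
  then have R: "R V (\<theta> V, h V)" if "V \<in> fg_projectives k" for V
    unfolding \<theta>_def h_def using someI_ex[of "R V"] that by simp
  define \<theta>' where "\<theta>' = (\<lambda>V\<in>fg_projectives k. restrict (\<theta> V) (carrier (BT d ?M V)))"
  define h' where "h' = (\<lambda>V\<in>fg_projectives k. restrict (h V) (carrier (S_ob k n \<mu> V)))"
  have lt: "lin k (BT d ?M V) (S_ob k n \<mu> V) (\<theta> V)" and lh: "lin k (S_ob k n \<mu> V) (BT d ?M V) (h V)"
    and t: "\<And>x. x \<in> carrier (tpow k d V) \<Longrightarrow> \<theta> V (PT d ?M V x ?e) = S_proj k n d \<mu> V x"
    and hp: "\<And>x. x \<in> carrier (tpow k d V) \<Longrightarrow> h V (S_proj k n d \<mu> V x) = PT d ?M V x ?e"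
    and ex: "\<And>z. z \<in> carrier (BT d ?M V) \<Longrightarrow> \<exists>x\<in>carrier (tpow k d V). z = PT d ?M V x ?e"
    if "V \<in> fg_projectives k" for V :: "('k, 'v) module"
    using R[OF that] by (simp_all add: R_def)
  have exS: "\<exists>x\<in>carrier (tpow k d V). s = S_proj k n d \<mu> V x"
    if "V \<in> fg_projectives k" "s \<in> carrier (S_ob k n \<mu> V)" for V :: "('k, 'v) module" and s
    using S_proj_surj[OF sum_mu fg_proj_module[OF that(1)]] that(2) by blast
  have PTc: "PT d ?M V x ?e \<in> carrier (BT d ?M V)" and Sc: "S_proj k n d \<mu> V x \<in> carrier (S_ob k n \<mu> V)"
    if "V \<in> fg_projectives k" "x \<in> carrier (tpow k d V)" for V :: "('k, 'v) module" and x
    using PT_closed[OF M that(1,2) ebas_M[OF word0]] Sp_closed[OF that] by blast+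
  show ?thesis
  proof
    show "\<theta>' \<in> nat_trans k (GammaP k d) ?G ?S"
    proof (rule nat_transI)
      fix V W :: "('k, 'v) module" and f z assume "V \<in> Ob (GammaP k d)" "W \<in> Ob (GammaP k d)"
        and f: "f \<in> Hom (GammaP k d) V W" and z: "z \<in> carrier (fob ?G V)"
      then have V: "V \<in> fg_projectives k" and W: "W \<in> fg_projectives k" by simp_all
      obtain x where x: "x \<in> carrier (tpow k d V)" "z = PT d ?M V x ?e" using ex[OF V] z by auto
      show "\<theta>' W (fmor ?G V W f z) = fmor ?S V W f (\<theta>' V z)"
        using V W x PTc[OF V x(1)] PTc[OF W GammaP_Hom_closed[OF f x(1)]] t[OF V x(1)] t[OF W GammaP_Hom_closed[OF f x(1)]]
        by (simp add: \<theta>'_def Gtensor_ob_pure[OF M V W f x(1) ebas_M[OF word0]] S_fun_proj[OF sum_mu V W f])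
    qed (use lt in \<open>auto simp: \<theta>'_def restrict_linmaps_iff[OF BT_module[OF M]]\<close>)
    show "h' \<in> nat_trans k (GammaP k d) ?S ?G"
    proof (rule nat_transI)
      fix V W :: "('k, 'v) module" and f z assume "V \<in> Ob (GammaP k d)" "W \<in> Ob (GammaP k d)"
        and f: "f \<in> Hom (GammaP k d) V W" and z: "z \<in> carrier (fob ?S V)"
      then have V: "V \<in> fg_projectives k" and W: "W \<in> fg_projectives k" by simp_all
      obtain x where x: "x \<in> carrier (tpow k d V)" "z = S_proj k n d \<mu> V x" using exS[OF V] z by auto
      show "h' W (fmor ?S V W f z) = fmor ?G V W f (h' V z)"
        using V W x Sc[OF V x(1)] Sc[OF W GammaP_Hom_closed[OF f x(1)]] hp[OF V x(1)] hp[OF W GammaP_Hom_closed[OF f x(1)]]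
        by (simp add: h'_def Gtensor_ob_pure[OF M V W f x(1) ebas_M[OF word0]] S_fun_proj[OF sum_mu V W f])
    qed (use lh in \<open>auto simp: h'_def restrict_linmaps_iff[OF S_ob_module[OF sum_mu fg_proj_module]]\<close>)
  next
    fix V :: "('k, 'v) module" and z assume V: "V \<in> fg_projectives k" and z: "z \<in> carrier (BT d ?M V)"
    obtain x where x: "x \<in> carrier (tpow k d V)" "z = PT d ?M V x ?e" using ex[OF V z] by blast
    show "h' V (\<theta>' V z) = z" using V z lin_closed[OF lt[OF V] z] t[OF V x(1)] hp[OF V x(1)] x(2)
      by (simp add: h'_def \<theta>'_def)
  next
    fix V :: "('k, 'v) module" and s assume V: "V \<in> fg_projectives k" and s: "s \<in> carrier (S_ob k n \<mu> V)"
    obtain x where x: "x \<in> carrier (tpow k d V)" "s = S_proj k n d \<mu> V x" using exS[OF V s] by blast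
    show "\<theta>' V (h' V s) = s" using V s lin_closed[OF lh[OF V] s] t[OF V x(1)] hp[OF V x(1)] x(2)
      by (simp add: h'_def \<theta>'_def)
  qed
qed

end

end

section \<open>Direct sums and direct summands of functors\<close>

lemma dsum_simps [simp]:
  "carrier (dsum I M) = (\<Pi>\<^sub>E i\<in>I. carrier (M i))" "\<zero>\<^bsub>dsum I M\<^esub> = (\<lambda>i\<in>I. \<zero>\<^bsub>M i\<^esub>)"
  "x \<oplus>\<^bsub>dsum I M\<^esub> y = (\<lambda>i\<in>I. x i \<oplus>\<^bsub>M i\<^esub> y i)" "a \<odot>\<^bsub>dsum I M\<^esub> x = (\<lambda>i\<in>I. a \<odot>\<^bsub>M i\<^esub> x i)"
  by (simp_all add: dsum_def)

lemma lin_dsum_proj: "j \<in> I \<Longrightarrow> lin A (dsum I M) (M j) (\<lambda>x. x j)"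
  by (rule linI) auto

lemma lin_into_dsum:
  assumes "\<And>j. j \<in> I \<Longrightarrow> lin A X (M j) (f j)"
  shows "lin A X (dsum I M) (\<lambda>x. \<lambda>j\<in>I. f j x)"
  by (rule linI)
    (auto intro!: restrict_ext lin_closed[OF assms] simp: lin_add[OF assms] lin_smult[OF assms])

context
  fixes A :: "'r ring" and I :: "'i set" and M :: "'i \<Rightarrow> ('r, 'a) module"
  assumes A: "ring A" and M: "\<forall>i\<in>I. left_module A (M i)"
begin

lemma dsum_module: "left_module A (dsum I M)"
proof (rule left_moduleI[OF A])
  have Mi: "i \<in> I \<Longrightarrow> abelian_group (M i)" for i using M by (auto simp: left_module_def)
  note r = abelian_groupE[OF Mi]
  note L = bspec[OF M]
  note s = left_module.smult_closed[OF L] left_module.smult_l_distr[OF L] left_module.smult_r_distr[OF L]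
    left_module.smult_assoc[OF L] left_module.smult_one[OF L] left_module.smult_l_null[OF L]
  fix x assume x: "x \<in> carrier (dsum I M)"
  have xi: "x i \<in> carrier (M i)" if "i \<in> I" for i using x that by auto
  have xe: "restrict x I = x" using x by (simp add: PiE_restrict)
  show "\<zero>\<^bsub>dsum I M\<^esub> \<oplus>\<^bsub>dsum I M\<^esub> x = x"
    unfolding dsum_simps by (subst (2) xe[symmetric]) (rule restrict_ext, simp add: r(5) xi)
  show "\<zero>\<^bsub>A\<^esub> \<odot>\<^bsub>dsum I M\<^esub> x = \<zero>\<^bsub>dsum I M\<^esub>"
    unfolding dsum_simps by (rule restrict_ext) (simp add: s(6) xi)
  show "\<one>\<^bsub>A\<^esub> \<odot>\<^bsub>dsum I M\<^esub> x = x"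
    unfolding dsum_simps by (subst (2) xe[symmetric]) (rule restrict_ext, simp add: s(5) xi)
  fix a assume a: "a \<in> carrier A"
  show "a \<odot>\<^bsub>dsum I M\<^esub> x \<in> carrier (dsum I M)"
    unfolding dsum_simps by (rule restrict_PiE_iff[THEN iffD2]) (simp add: s(1) xi a)
  { fix b assume b: "b \<in> carrier A"
    show "(a \<oplus>\<^bsub>A\<^esub> b) \<odot>\<^bsub>dsum I M\<^esub> x = a \<odot>\<^bsub>dsum I M\<^esub> x \<oplus>\<^bsub>dsum I M\<^esub> b \<odot>\<^bsub>dsum I M\<^esub> x"
      unfolding dsum_simps by (rule restrict_ext) (simp add: s(2) xi a b)
    show "(a \<otimes>\<^bsub>A\<^esub> b) \<odot>\<^bsub>dsum I M\<^esub> x = a \<odot>\<^bsub>dsum I M\<^esub> (b \<odot>\<^bsub>dsum I M\<^esub> x)"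
      unfolding dsum_simps by (rule restrict_ext) (simp add: s(4) xi a b) }
  fix y assume y: "y \<in> carrier (dsum I M)"
  have yi: "y i \<in> carrier (M i)" if "i \<in> I" for i using y that by auto
  show "a \<odot>\<^bsub>dsum I M\<^esub> (x \<oplus>\<^bsub>dsum I M\<^esub> y) = a \<odot>\<^bsub>dsum I M\<^esub> x \<oplus>\<^bsub>dsum I M\<^esub> a \<odot>\<^bsub>dsum I M\<^esub> y"
    unfolding dsum_simps by (rule restrict_ext) (simp add: s(3) xi yi a)
next
  have Mi: "i \<in> I \<Longrightarrow> abelian_group (M i)" for i using M by (auto simp: left_module_def)
  note r = abelian_groupE[OF Mi]
  fix x y assume x: "x \<in> carrier (dsum I M)" and y: "y \<in> carrier (dsum I M)"
  have xi: "x i \<in> carrier (M i)" "y i \<in> carrier (M i)" if "i \<in> I" for i using x y that by auto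
  show "x \<oplus>\<^bsub>dsum I M\<^esub> y \<in> carrier (dsum I M)"
    unfolding dsum_simps by (rule restrict_PiE_iff[THEN iffD2]) (simp add: r(1) xi)
  show "x \<oplus>\<^bsub>dsum I M\<^esub> y = y \<oplus>\<^bsub>dsum I M\<^esub> x"
    unfolding dsum_simps by (rule restrict_ext) (rule r(4), simp_all add: xi)
  fix z assume z: "z \<in> carrier (dsum I M)"
  have zi: "z i \<in> carrier (M i)" if "i \<in> I" for i using z that by auto
  show "x \<oplus>\<^bsub>dsum I M\<^esub> y \<oplus>\<^bsub>dsum I M\<^esub> z = x \<oplus>\<^bsub>dsum I M\<^esub> (y \<oplus>\<^bsub>dsum I M\<^esub> z)"
    unfolding dsum_simps by (rule restrict_ext) (simp add: r(3) xi zi)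
next
  show "\<zero>\<^bsub>dsum I M\<^esub> \<in> carrier (dsum I M)"
    unfolding dsum_simps using M
    by (intro restrict_PiE_iff[THEN iffD2] ballI) (auto simp: left_module_def intro: abelian_groupE(2))
qed

definition dinj :: "'i \<Rightarrow> 'a \<Rightarrow> 'i \<Rightarrow> 'a" where
  "dinj j y = (\<lambda>i\<in>I. if i = j then y else \<zero>\<^bsub>M i\<^esub>)"

lemma dinj_apply: "i \<in> I \<Longrightarrow> dinj j y i = (if i = j then y else \<zero>\<^bsub>M i\<^esub>)"
  by (simp add: dinj_def)

lemma lin_dinj: assumes j: "j \<in> I" shows "lin A (M j) (dsum I M) (dinj j)"
  unfolding dinj_def
proof (rule lin_into_dsum)
  fix i assume i: "i \<in> I"
  show "lin A (M j) (M i) (\<lambda>x. if i = j then x else \<zero>\<^bsub>M i\<^esub>)"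
    using lin_id[of A "M j"] lin_const_zero[OF bspec[OF M i], of "M j"] by (cases "i = j") simp_all
qed

lemma dsum_decompose:
  assumes fin: "finite I" and y: "y \<in> carrier (dsum I M)"
  shows "(\<Oplus>\<^bsub>dsum I M\<^esub>j\<in>I. dinj j (y j)) = y"
proof -
  interpret D: left_module A "dsum I M" by (rule dsum_module)
  have yc: "y j \<in> carrier (M j)" if "j \<in> I" for j using y that by auto
  have c: "dinj j (y j) \<in> carrier (dsum I M)" if "j \<in> I" for j
    by (rule lin_closed[OF lin_dinj[OF that] yc[OF that]])
  have "(\<Oplus>\<^bsub>dsum I M\<^esub>j\<in>I. dinj j (y j)) \<in> (\<Pi>\<^sub>E i\<in>I. carrier (M i))"
    using D.finsum_closed[of "\<lambda>j. dinj j (y j)" I] c by simp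
  then show ?thesis
  proof (rule PiE_ext)
    show "y \<in> (\<Pi>\<^sub>E i\<in>I. carrier (M i))" using y by simp
    fix i assume i: "i \<in> I"
    interpret Mi: left_module A "M i" using M i by blast
    have "(\<Oplus>\<^bsub>dsum I M\<^esub>j\<in>I. dinj j (y j)) i = (\<Oplus>\<^bsub>M i\<^esub>j\<in>I. dinj j (y j) i)"
      by (rule lin_finsum[OF dsum_module Mi.left_module_axioms lin_dsum_proj[OF i] c])
    also have "\<dots> = dinj i (y i) i"
      by (rule Mi.finsum_single[OF fin i]) (use i yc in \<open>auto simp: dinj_apply\<close>)
    finally show "(\<Oplus>\<^bsub>dsum I M\<^esub>j\<in>I. dinj j (y j)) i = y i" using i by (simp add: dinj_apply)
  qed
qed

end

context base
begin

text \<open>\<open>Schur\<close> restricts its maps to the carrier, so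
  \<open>G\<^sub>\<otimes>\<close> meets restricted and unrestricted versions of the same
  map.\<close>

lemma Gmap_cong:
  assumes N: "left_module (kS k d) N" and N': "left_module (kS k d) N'" and g: "lin (kS k d) N N' g"
    and gh: "\<And>y. y \<in> carrier N \<Longrightarrow> h y = g y" and V: "V \<in> fg_projectives k" and x: "x \<in> carrier (BT d N V)"
  shows "Gmap d N N' h V x = Gmap d N N' g V x"
proof -
  have hl: "lin (kS k d) N N' h" using lin_cong[OF N, of h g N'] gh g by blast
  show ?thesis
    by (rule BT_lin_eq[OF N V BT_module[OF N' V] Gmap_lin[OF N N' hl V] Gmap_lin[OF N N' g V]])
      (use x in \<open>simp_all add: Gmap_pure[OF N N' hl V] Gmap_pure[OF N N' g V] gh\<close>)
qed

lemma PT_zero: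
  assumes N: "left_module (kS k d) N" and V: "V \<in> fg_projectives k" and x: "x \<in> carrier (tpow k d V)"
  shows "PT d N V x \<zero>\<^bsub>N\<^esub> = \<zero>\<^bsub>BT d N V\<^esub>"
proof -
  interpret N: left_module "kS k d" N by (rule N)
  interpret B: left_module k "BT d N V" by (rule BT_module[OF N V])
  show ?thesis
    using PT_add[OF N V x N.zero_closed N.zero_closed] PT_closed[OF N V x N.zero_closed] by simp
qed

lemma PT_finsum:
  assumes N: "left_module (kS k d) N" and V: "V \<in> fg_projectives k" and x: "x \<in> carrier (tpow k d V)"
    and "finite J" "\<And>j. j \<in> J \<Longrightarrow> y j \<in> carrier N"
  shows "PT d N V x (\<Oplus>\<^bsub>N\<^esub>j\<in>J. y j) = (\<Oplus>\<^bsub>BT d N V\<^esub>j\<in>J. PT d N V x (y j))"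
proof -
  interpret N: left_module "kS k d" N by (rule N)
  interpret B: left_module k "BT d N V" by (rule BT_module[OF N V])
  show ?thesis
    using assms(4,5)
  proof (induction J)
    case (insert j J)
    then have "PT d N V x (y j \<oplus>\<^bsub>N\<^esub> (\<Oplus>\<^bsub>N\<^esub>j\<in>J. y j)) =
        PT d N V x (y j) \<oplus>\<^bsub>BT d N V\<^esub> PT d N V x (\<Oplus>\<^bsub>N\<^esub>j\<in>J. y j)"
      by (intro PT_add[OF N V x] N.finsum_closed) auto
    then show ?case
      using insert PT_closed[OF N V x] by (subst N.finsum_insert) auto
  qed (simp add: PT_zero[OF N V x])
qed

section \<open>Direct sums of functors and their compatibility with
  \<open>G\<^sub>\<otimes>\<close>\<close>

lemma spf_dsum_simps [simp]:
  "fob (spf_dsum I F) V = dsum I (\<lambda>i. fob (F i) V)"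
  "fmor (spf_dsum I F) V W f = (\<lambda>x\<in>(\<Pi>\<^sub>E i\<in>I. carrier (fob (F i) V)). \<lambda>i\<in>I. fmor (F i) V W f (x i))"
  by (simp_all add: spf_dsum_def)

lemma spf_dsum_Rep:
  fixes F :: "'i \<Rightarrow> ('k, 'v, 'w) spf"
  assumes F: "\<And>i. i \<in> I \<Longrightarrow> F i \<in> Ob (Rep k d)"
  shows "spf_dsum I F \<in> Ob (Rep k d)"
proof (rule Rep_ObI)
  let ?D = "spf_dsum I F"
  fix V :: "('k, 'v) module" assume V: "V \<in> fg_projectives k"
  have DM: "left_module k (dsum I (\<lambda>i. fob (F i) V))"
    using Rep_module[OF F V] by (intro dsum_module k.ring_axioms) blast
  then show "left_module k (fob ?D V)" by simp
  have ext: "restrict x I = x" if "x \<in> carrier (fob ?D V)" for x using that by (simp add: PiE_restrict)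
  have xi: "x i \<in> carrier (fob (F i) V)" if "x \<in> carrier (fob ?D V)" "i \<in> I" for x i using that by auto
  have ap: "fmor ?D V W f x = (\<lambda>i\<in>I. fmor (F i) V W f (x i))" if "x \<in> carrier (fob ?D V)" for W f x
    using that by simp
  { fix x assume x: "x \<in> carrier (fob ?D V)"
    show "fmor ?D V V (\<lambda>x\<in>carrier (tpow k d V). x) x = x"
      unfolding ap[OF x] by (subst (2) ext[OF x, symmetric]) (rule restrict_ext, rule Rep_id[OF F V xi[OF x]]) }
  fix W :: "('k, 'v) module" and f assume W: "W \<in> fg_projectives k" and f: "f \<in> Hom (GammaP k d) V W"
  have "lin k (dsum I (\<lambda>i. fob (F i) V)) (dsum I (\<lambda>i. fob (F i) W)) (\<lambda>x. \<lambda>i\<in>I. fmor (F i) V W f (x i))"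
  proof (rule lin_into_dsum)
    fix i assume i: "i \<in> I"
    show "lin k (dsum I (\<lambda>i. fob (F i) V)) (fob (F i) W) (\<lambda>x. fmor (F i) V W f (x i))"
      by (rule lin_compose[where f="\<lambda>x. x i", OF lin_dsum_proj[where M="\<lambda>i. fob (F i) V", OF i] Rep_lin[OF F[OF i] V W f]])
  qed
  then show l: "fmor ?D V W f \<in> linmaps k (fob ?D V) (fob ?D W)"
    by (simp add: restrict_linmaps_iff[OF DM, unfolded dsum_simps])
  { fix Z :: "('k, 'v) module" and g x assume Z: "Z \<in> fg_projectives k" and g: "g \<in> Hom (GammaP k d) W Z"
      and x: "x \<in> carrier (fob ?D V)"
    have c: "(\<lambda>i\<in>I. fmor (F i) V W f (x i)) \<in> (\<Pi>\<^sub>E i\<in>I. carrier (fob (F i) W))"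
      using linmaps_closed[OF l x] unfolding ap[OF x] by simp
    show "fmor ?D V Z (compose (carrier (tpow k d V)) g f) x = fmor ?D W Z g (fmor ?D V W f x)"
      unfolding ap[OF x] spf_dsum_simps(2)[of I F W Z g] restrict_apply'[OF c]
      by (rule restrict_ext) (simp add: Rep_comp[OF F V W Z f g xi[OF x]]) }
  { fix g x assume g: "g \<in> Hom (GammaP k d) V W" and x: "x \<in> carrier (fob ?D V)"
    show "fmor ?D V W (\<lambda>t\<in>carrier (tpow k d V). f t \<oplus>\<^bsub>tpow k d W\<^esub> g t) x =
        fmor ?D V W f x \<oplus>\<^bsub>fob ?D W\<^esub> fmor ?D V W g x"
      unfolding ap[OF x] spf_dsum_simps(1) dsum_simps
      by (rule restrict_ext) (simp add: Rep_plus[OF F V W f g xi[OF x]]) }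
  { fix c x assume c: "c \<in> carrier k" and x: "x \<in> carrier (fob ?D V)"
    show "fmor ?D V W (\<lambda>t\<in>carrier (tpow k d V). c \<odot>\<^bsub>tpow k d W\<^esub> f t) x = c \<odot>\<^bsub>fob ?D W\<^esub> fmor ?D V W f x"
      unfolding ap[OF x] spf_dsum_simps(1) dsum_simps
      by (rule restrict_ext) (simp add: Rep_scale[OF F V W f c xi[OF x]]) }
qed

text \<open>\<open>G\<^sub>\<otimes>\<close> respects the equations between injections and
  projections that characterize a finite direct sum. The isomorphisms of the single summands are
  built in, since the functors \<open>F j\<close> have values of a different type.\<close>

lemma G_dsum_iso:
  fixes N :: "'i \<Rightarrow> (perm \<Rightarrow> 'k, 'a) module" and F :: "'i \<Rightarrow> ('k, 'v, 'w) spf"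
  assumes fin: "finite I" and N: "\<And>j. j \<in> I \<Longrightarrow> left_module (kS k d) (N j)"
    and F: "\<And>j. j \<in> I \<Longrightarrow> F j \<in> Ob (Rep k d)"
    and \<theta>: "\<And>j. j \<in> I \<Longrightarrow> \<theta> j \<in> nat_trans k (GammaP k d) (Gtensor_ob k d (N j)) (F j)"
    and h: "\<And>j. j \<in> I \<Longrightarrow> h j \<in> nat_trans k (GammaP k d) (F j) (Gtensor_ob k d (N j))"
    and h\<theta>: "\<And>j V z. \<lbrakk>j \<in> I; V \<in> fg_projectives k; z \<in> carrier (BT d (N j) V)\<rbrakk> \<Longrightarrow> h j V (\<theta> j V z) = z"
    and \<theta>h: "\<And>j V s. \<lbrakk>j \<in> I; V \<in> fg_projectives k; s \<in> carrier (fob (F j) V)\<rbrakk> \<Longrightarrow> \<theta> j V (h j V s) = s"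
  obtains a b where
    "a \<in> nat_trans k (GammaP k d) (Gtensor_ob k d (dsum I N)) (spf_dsum I F)"
    "b \<in> nat_trans k (GammaP k d) (spf_dsum I F) (Gtensor_ob k d (dsum I N))"
    "\<And>V z. \<lbrakk>V \<in> fg_projectives k; z \<in> carrier (BT d (dsum I N) V)\<rbrakk> \<Longrightarrow> b V (a V z) = z"
    "\<And>V s. \<lbrakk>V \<in> fg_projectives k; s \<in> carrier (fob (spf_dsum I F) V)\<rbrakk> \<Longrightarrow> a V (b V s) = s"
proof -
  let ?P = "dsum I N" and ?D = "spf_dsum I F"
  let ?GP = "Gtensor_ob k d ?P :: ('k, 'v, _) spf"
  have N': "\<forall>j\<in>I. left_module (kS k d) (N j)" using N by blast
  note P = dsum_module[OF kS_ring N']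
  note Dr = spf_dsum_Rep[where I=I and F=F and d=d, OF F]
  note pr = lin_dsum_proj[where M=N and A="kS k d"]
  note inj = lin_dinj[OF kS_ring N']
  let ?in = "dinj I N"
  let ?pr = "\<lambda>j y. y j"
  note Gpr = Gmap_lin[OF P N pr] and Gin = Gmap_lin[OF N P inj]
  have tl: "lin k (BT d (N j) V) (fob (F j) V) (\<theta> j V)" and hl: "lin k (fob (F j) V) (BT d (N j) V) (h j V)"
    if "j \<in> I" "V \<in> fg_projectives k" for j V
    using nat_trans_lin[OF \<theta>[OF that(1)], of V] nat_trans_lin[OF h[OF that(1)], of V] that(2) by simp_all
  \<comment> \<open>Components are obtained by projecting before applying \<theta>; conversely
    \<open>b0\<close> applies \<open>h\<close> to each component, injects, and adds up.\<close>
  define a0 where "a0 V z = (\<lambda>j\<in>I. \<theta> j V (Gmap d ?P (N j) (?pr j) V z))" for V z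
  define b0 where "b0 V s = (\<Oplus>\<^bsub>BT d ?P V\<^esub>j\<in>I. Gmap d (N j) ?P (?in j) V (h j V (s j)))" for V s
  define a where "a = (\<lambda>V\<in>fg_projectives k. restrict (a0 V) (carrier (BT d ?P V)))"
  define b where "b = (\<lambda>V\<in>fg_projectives k. restrict (b0 V) (carrier (dsum I (\<lambda>j. fob (F j) V))))"
  have al: "lin k (BT d ?P V) (dsum I (\<lambda>j. fob (F j) V)) (a0 V)" if V: "V \<in> fg_projectives k" for V
    unfolding a0_def by (rule lin_into_dsum) (rule lin_compose[OF Gpr tl], (assumption | rule V)+)
  have bl: "lin k (dsum I (\<lambda>j. fob (F j) V)) (BT d ?P V) (b0 V)" if V: "V \<in> fg_projectives k" for V
    unfolding b0_def
  proof (rule lin_sum[OF BT_module[OF P V]])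
    fix j assume j: "j \<in> I"
    show "lin k (dsum I (\<lambda>j. fob (F j) V)) (BT d ?P V) (\<lambda>s. Gmap d (N j) ?P (?in j) V (h j V (s j)))"
      by (rule lin_compose[where f="\<lambda>s. s j", OF lin_dsum_proj[where M="\<lambda>j. fob (F j) V", OF j]
          lin_compose[OF hl[OF j V] Gin[OF j j V]]])
  qed
  have DM: "left_module k (dsum I (\<lambda>j. fob (F j) V))" if V: "V \<in> fg_projectives k" for V
    using Rep_module[OF Dr V] by simp
  have hc: "Gmap d (N j) ?P (?in j) V (h j V (s j)) \<in> carrier (BT d ?P V)" "h j V (s j) \<in> carrier (BT d (N j) V)"
    if V: "V \<in> fg_projectives k" and s: "s \<in> carrier (dsum I (\<lambda>j. fob (F j) V))" and j: "j \<in> I" for V s j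
  proof -
    show *: "h j V (s j) \<in> carrier (BT d (N j) V)" by (rule lin_closed[OF hl[OF j V]]) (use s j in auto)
    show "Gmap d (N j) ?P (?in j) V (h j V (s j)) \<in> carrier (BT d ?P V)"
      by (rule lin_closed[OF Gin[OF j j V] *])
  qed
  show ?thesis
  proof
    show "a \<in> nat_trans k (GammaP k d) ?GP ?D"
    proof (rule nat_transI)
      fix V W :: "('k, 'v) module" and f z assume "V \<in> Ob (GammaP k d)" "W \<in> Ob (GammaP k d)"
        and f: "f \<in> Hom (GammaP k d) V W" and "z \<in> carrier (fob ?GP V)"
      then have V: "V \<in> fg_projectives k" and W: "W \<in> fg_projectives k" and z: "z \<in> carrier (BT d ?P V)" by simp_all
      have fz: "fmor ?GP V W f z \<in> carrier (BT d ?P W)"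
        by (rule linmaps_closed[OF Gtensor_ob_linmaps[OF P V W f] z])
      have az: "a0 V z \<in> carrier (dsum I (\<lambda>j. fob (F j) V))" by (rule lin_closed[OF al[OF V] z])
      have "a0 W (fmor ?GP V W f z) = (\<lambda>j\<in>I. fmor (F j) V W f (a0 V z j))"
        unfolding a0_def
      proof (rule restrict_ext)
        fix j assume j: "j \<in> I"
        have gz: "Gmap d ?P (N j) (?pr j) V z \<in> carrier (BT d (N j) V)" by (rule lin_closed[OF Gpr[OF j j V] z])
        have "Gmap d ?P (N j) (?pr j) W (fmor ?GP V W f z) =
            fmor (Gtensor_ob k d (N j)) V W f (Gmap d ?P (N j) (?pr j) V z)"
          using nat_trans_natural[OF Gmap_nat_trans[OF P N[OF j] pr[OF j]], of V W f z] V W f z by simp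
        then show "\<theta> j W (Gmap d ?P (N j) (?pr j) W (fmor ?GP V W f z)) =
            fmor (F j) V W f ((\<lambda>j\<in>I. \<theta> j V (Gmap d ?P (N j) (?pr j) V z)) j)"
          using nat_trans_natural[OF \<theta>[OF j], of V W f "Gmap d ?P (N j) (?pr j) V z"] V W f gz j by simp
      qed
      then show "a W (fmor ?GP V W f z) = fmor ?D V W f (a V z)"
        using V W z fz az by (simp add: a_def)
    qed (use al in \<open>auto simp: a_def restrict_linmaps_iff[OF BT_module[OF P]]\<close>)
    show "b \<in> nat_trans k (GammaP k d) ?D ?GP"
    proof (rule nat_transI)
      fix V W :: "('k, 'v) module" and f s assume "V \<in> Ob (GammaP k d)" "W \<in> Ob (GammaP k d)"
        and f: "f \<in> Hom (GammaP k d) V W" and s: "s \<in> carrier (fob ?D V)"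
      then have V: "V \<in> fg_projectives k" and W: "W \<in> fg_projectives k"
        and s': "s \<in> carrier (dsum I (\<lambda>j. fob (F j) V))" by simp_all
      interpret BW: left_module k "BT d ?P W" by (rule BT_module[OF P W])
      have fs: "fmor ?D V W f s \<in> carrier (dsum I (\<lambda>j. fob (F j) W))"
        using Rep_closed[OF Dr V W f s] by simp
      have sj: "s j \<in> carrier (fob (F j) V)" if "j \<in> I" for j using s' that by auto
      have "b0 W (fmor ?D V W f s) = (\<Oplus>\<^bsub>BT d ?P W\<^esub>j\<in>I. fmor ?GP V W f (Gmap d (N j) ?P (?in j) V (h j V (s j))))"
        unfolding b0_def
      proof (rule BW.finsum_cong')
        fix j assume j: "j \<in> I"
        have "fmor ?D V W f s j = fmor (F j) V W f (s j)" using s' j by simp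
        then have "h j W (fmor ?D V W f s j) = fmor (Gtensor_ob k d (N j)) V W f (h j V (s j))"
          using nat_trans_natural[OF h[OF j], of V W f "s j"] V W f sj[OF j] by simp
        then show "Gmap d (N j) ?P (?in j) W (h j W (fmor ?D V W f s j)) =
            fmor ?GP V W f (Gmap d (N j) ?P (?in j) V (h j V (s j)))"
          using nat_trans_natural[OF Gmap_nat_trans[OF N[OF j] P inj[OF j]], of V W f "h j V (s j)"]
            V W f hc(2)[OF V s' j] by simp
      qed (use linmaps_closed[OF Gtensor_ob_linmaps[OF P V W f] hc(1)[OF V s']] in auto)
      also have "\<dots> = fmor ?GP V W f (b0 V s)"
        unfolding b0_def
        by (rule lin_finsum[OF BT_module[OF P V] BT_module[OF P W] lin_linmaps[OF Gtensor_ob_linmaps[OF P V W f]]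
              hc(1)[OF V s'], symmetric])
      finally show "b W (fmor ?D V W f s) = fmor ?GP V W f (b V s)"
        using V W s' fs by (simp add: b_def)
    qed (use bl in \<open>auto simp: b_def restrict_linmaps_iff[OF DM, unfolded dsum_simps]\<close>)
  next
    fix V :: "('k, 'v) module" and z assume V: "V \<in> fg_projectives k" and z: "z \<in> carrier (BT d ?P V)"
    interpret BV: left_module k "BT d ?P V" by (rule BT_module[OF P V])
    have "b0 V (a0 V z) = (\<Oplus>\<^bsub>BT d ?P V\<^esub>j\<in>I. Gmap d ?P ?P (\<lambda>y. ?in j (y j)) V z)"
      unfolding b0_def
    proof (rule BV.finsum_cong')
      fix j assume j: "j \<in> I"
      have gz: "Gmap d ?P (N j) (?pr j) V z \<in> carrier (BT d (N j) V)" by (rule lin_closed[OF Gpr[OF j j V] z])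
      have "Gmap d ?P ?P (\<lambda>y. ?in j (y j)) V z = Gmap d (N j) ?P (?in j) V (Gmap d ?P (N j) (?pr j) V z)"
        by (rule Gmap_comp[OF P N[OF j] P pr[OF j] inj[OF j] refl V z])
      then show "Gmap d (N j) ?P (?in j) V (h j V (a0 V z j)) = Gmap d ?P ?P (\<lambda>y. ?in j (y j)) V z"
        using h\<theta>[OF j V gz] j by (simp add: a0_def)
    qed (use lin_closed[OF Gmap_lin[OF P P lin_compose[OF pr inj] V] z] in auto)
    \<comment> \<open>The projections followed by the injections add up to the identity of
      \<open>?P\<close>, and pure tensors are additive in the second argument.\<close>
    also have "\<dots> = z"
    proof (rule BT_lin_eq[OF P V BT_module[OF P V] _ lin_id _ z])
      show "lin k (BT d ?P V) (BT d ?P V) (\<lambda>z. \<Oplus>\<^bsub>BT d ?P V\<^esub>j\<in>I. Gmap d ?P ?P (\<lambda>y. ?in j (y j)) V z)"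
        by (rule lin_sum[OF BT_module[OF P V] Gmap_lin[OF P P lin_compose[OF pr inj] V]])
      fix x y assume x: "x \<in> carrier (tpow k d V)" and y: "y \<in> carrier ?P"
      have ic: "?in j (y j) \<in> carrier ?P" if "j \<in> I" for j
        by (rule lin_closed[OF lin_compose[OF pr[OF that] inj[OF that]] y])
      have "(\<Oplus>\<^bsub>BT d ?P V\<^esub>j\<in>I. Gmap d ?P ?P (\<lambda>y. ?in j (y j)) V (PT d ?P V x y)) =
          (\<Oplus>\<^bsub>BT d ?P V\<^esub>j\<in>I. PT d ?P V x (?in j (y j)))"
        by (rule BV.finsum_cong')
          (use Gmap_pure[OF P P lin_compose[OF pr inj] V x y] PT_closed[OF P V x ic] in auto)
      also have "\<dots> = PT d ?P V x (\<Oplus>\<^bsub>?P\<^esub>j\<in>I. ?in j (y j))"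
        by (rule PT_finsum[OF P V x fin ic, symmetric])
      also have "(\<Oplus>\<^bsub>?P\<^esub>j\<in>I. ?in j (y j)) = y" by (rule dsum_decompose[OF kS_ring N' fin y])
      finally show "(\<Oplus>\<^bsub>BT d ?P V\<^esub>j\<in>I. Gmap d ?P ?P (\<lambda>y. ?in j (y j)) V (PT d ?P V x y)) = PT d ?P V x y" .
    qed
    finally show "b V (a V z) = z"
      using V z lin_closed[OF al[OF V] z] by (simp add: a_def b_def)
  next
    fix V :: "('k, 'v) module" and s assume V: "V \<in> fg_projectives k" and "s \<in> carrier (fob ?D V)"
    then have s: "s \<in> carrier (dsum I (\<lambda>j. fob (F j) V))" by simp
    have sj: "s j \<in> carrier (fob (F j) V)" if "j \<in> I" for j using s that by auto
    have bs: "b0 V s \<in> carrier (BT d ?P V)" by (rule lin_closed[OF bl[OF V] s])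
    have "a0 V (b0 V s) = s"
    proof (rule PiE_ext)
      show "a0 V (b0 V s) \<in> (\<Pi>\<^sub>E j\<in>I. carrier (fob (F j) V))" using lin_closed[OF al[OF V] bs] by simp
      show "s \<in> (\<Pi>\<^sub>E j\<in>I. carrier (fob (F j) V))" using s by simp
      fix i assume i: "i \<in> I"
      interpret Bi: left_module k "BT d (N i) V" by (rule BT_module[OF N[OF i] V])
      \<comment> \<open>Injecting at \<open>j\<close> and projecting at \<open>i\<close> gives the
        identity or zero, and \<open>G\<^sub>\<otimes>\<close> preserves both.\<close>
      have t: "Gmap d ?P (N i) (?pr i) V (Gmap d (N j) ?P (?in j) V (h j V (s j))) =
          (if j = i then h i V (s i) else \<zero>\<^bsub>BT d (N i) V\<^esub>)" if j: "j \<in> I" for j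
      proof -
        note w = hc(2)[OF V s j]
        have "Gmap d ?P (N i) (?pr i) V (Gmap d (N j) ?P (?in j) V (h j V (s j))) =
          Gmap d (N j) (N i) (\<lambda>y. ?in j y i) V (h j V (s j))"
          by (rule Gmap_comp[OF N[OF j] P N[OF i] inj[OF j] pr[OF i] refl V w, symmetric])
        also have "\<dots> = (if j = i then h i V (s i) else \<zero>\<^bsub>BT d (N i) V\<^esub>)"
        proof (cases "j = i")
          case True
          then show ?thesis using Gmap_id[OF N[OF i] V _ hc(2)[OF V s i], of "\<lambda>y. ?in i y i"] i
            by (simp add: dinj_apply[OF kS_ring N'])
        next
          case False
          have "Gmap d (N j) (N i) (\<lambda>y. ?in j y i) V (h j V (s j)) = \<zero>\<^bsub>BT d (N i) V\<^esub>"
          proof (rule BT_lin_eq[OF N[OF j] V BT_module[OF N[OF i] V] Gmap_lin[OF N[OF j] N[OF i] lin_compose[OF inj[OF j] pr[OF i]] V]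
                lin_const_zero[OF BT_module[OF N[OF i] V]] _ w])
            fix x y assume x: "x \<in> carrier (tpow k d V)" and y: "y \<in> carrier (N j)"
            show "Gmap d (N j) (N i) (\<lambda>y. ?in j y i) V (PT d (N j) V x y) = \<zero>\<^bsub>BT d (N i) V\<^esub>"
              using False i PT_zero[OF N[OF i] V x] Gmap_pure[OF N[OF j] N[OF i] lin_compose[OF inj[OF j] pr[OF i]] V x y]
              by (simp add: dinj_apply[OF kS_ring N'])
          qed
          then show ?thesis using False by simp
        qed
        finally show ?thesis .
      qed
      have "Gmap d ?P (N i) (?pr i) V (b0 V s) =
        (\<Oplus>\<^bsub>BT d (N i) V\<^esub>j\<in>I. Gmap d ?P (N i) (?pr i) V (Gmap d (N j) ?P (?in j) V (h j V (s j))))"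
        unfolding b0_def by (rule lin_finsum[OF BT_module[OF P V] BT_module[OF N[OF i] V] Gpr[OF i i V] hc(1)[OF V s]])
      also have "\<dots> = Gmap d ?P (N i) (?pr i) V (Gmap d (N i) ?P (?in i) V (h i V (s i)))"
        by (rule Bi.finsum_single[OF fin i]) (use t hc(2)[OF V s] in \<open>auto split: if_splits\<close>)
      also have "\<dots> = h i V (s i)" using t[OF i] by simp
      finally show "a0 V (b0 V s) i = s i" using i \<theta>h[OF i V sj[OF i]] by (simp add: a0_def)
    qed
    then show "a V (b V s) = s" using V s bs by (simp add: a_def b_def)
  qed
qed

section \<open>Direct summands of functors as retracts\<close>

lemma spf_dsum2_simps [simp]:
  "fob (spf_dsum2 F G) V = dsum2 (fob F V) (fob G V)"
  "fmor (spf_dsum2 F G) V W f = (\<lambda>(x, y)\<in>carrier (fob F V) \<times> carrier (fob G V). (fmor F V W f x, fmor G V W f y))"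
  by (simp_all add: spf_dsum2_def)

lemma spf_summandD:
  fixes F :: "('k, 'v, 'a) spf" and G :: "('k, 'v, 'b) spf"
  assumes G: "G \<in> Ob (Rep k d)" and F: "F \<in> Ob (Rep k d)" and "spf_summand k d F G"
  obtains i p where "i \<in> nat_trans k (GammaP k d) F G" "p \<in> nat_trans k (GammaP k d) G F"
    "\<And>V x. \<lbrakk>V \<in> fg_projectives k; x \<in> carrier (fob F V)\<rbrakk> \<Longrightarrow> p V (i V x) = x"
proof -
  obtain F' :: "('k, 'v, 'b) spf" and \<delta> where F': "F' \<in> Ob (Rep k d)"
    and \<delta>: "\<delta> \<in> nat_isos k (GammaP k d) G (spf_dsum2 F F')"
    using assms(3) unfolding spf_summand_def ex_in_conv[symmetric] by blast
  have dn: "\<delta> \<in> nat_trans k (GammaP k d) G (spf_dsum2 F F')" using \<delta> by (simp add: nat_isos_def)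
  have dl: "lin k (fob G V) (dsum2 (fob F V) (fob F' V)) (\<delta> V)"
    and db: "bij_betw (\<delta> V) (carrier (fob G V)) (carrier (dsum2 (fob F V) (fob F' V)))"
    if "V \<in> fg_projectives k" for V
    using \<delta> that by (auto simp: nat_isos_def lin_isos_def linmaps_iff)
  define i0 where "i0 V x = inv_into (carrier (fob G V)) (\<delta> V) (x, \<zero>\<^bsub>fob F' V\<^esub>)" for V x
  define i where "i = (\<lambda>V\<in>fg_projectives k. restrict (i0 V) (carrier (fob F V)))"
  define p where "p = (\<lambda>V\<in>fg_projectives k. restrict (\<lambda>y. fst (\<delta> V y)) (carrier (fob G V)))"
  have il: "lin k (fob F V) (fob G V) (i0 V)" if V: "V \<in> fg_projectives k" for V
    unfolding i0_def
    by (rule lin_compose[OF lin_inl[OF Rep_module[OF F' V]] lin_inv[OF Rep_module[OF G V] dl[OF V] db[OF V]]])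
  have \<delta>i: "\<delta> V (i0 V x) = (x, \<zero>\<^bsub>fob F' V\<^esub>)" if V: "V \<in> fg_projectives k" and x: "x \<in> carrier (fob F V)" for V x
  proof -
    interpret FV: left_module k "fob F' V" by (rule Rep_module[OF F' V])
    show ?thesis unfolding i0_def by (rule bij_betw_inv_into_right[OF db[OF V]]) (use x in simp)
  qed
  have nat: "\<delta> W (fmor G V W f y) = (fmor F V W f (fst (\<delta> V y)), fmor F' V W f (snd (\<delta> V y)))"
    if "V \<in> fg_projectives k" "W \<in> fg_projectives k" "f \<in> Hom (GammaP k d) V W" "y \<in> carrier (fob G V)" for V W f y
    using nat_trans_natural[OF dn, of V W f y] lin_closed[OF dl[OF that(1)] that(4)] that by (auto simp: split_beta mem_Times_iff)
  show ?thesis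
  proof
    show "i \<in> nat_trans k (GammaP k d) F G"
    proof (rule nat_transI)
      fix V W :: "('k, 'v) module" and f x assume "V \<in> Ob (GammaP k d)" "W \<in> Ob (GammaP k d)"
        and f: "f \<in> Hom (GammaP k d) V W" and x: "x \<in> carrier (fob F V)"
      then have V: "V \<in> fg_projectives k" and W: "W \<in> fg_projectives k" by simp_all
      note fx = Rep_closed[OF F V W f x] and ix = lin_closed[OF il[OF V] x]
      \<comment> \<open>Naturality of the injection is tested after the bijection
        \<open>\<delta> W\<close>; the second components agree because \<open>F'\<close> preserves
        zero.\<close>
      have "\<delta> W (i0 W (fmor F V W f x)) = \<delta> W (fmor G V W f (i0 V x))"
        unfolding \<delta>i[OF W fx] nat[OF V W f ix] \<delta>i[OF V x] fst_conv snd_conv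
        using lin_zero[OF Rep_module[OF F' V] Rep_module[OF F' W] Rep_lin[OF F' V W f]] by simp
      then have "i0 W (fmor F V W f x) = fmor G V W f (i0 V x)"
        using bij_betw_imp_inj_on[OF db[OF W]] lin_closed[OF il[OF W] fx] Rep_closed[OF G V W f ix]
        by (auto dest: inj_onD)
      then show "i W (fmor F V W f x) = fmor G V W f (i V x)" using V W x fx by (simp add: i_def)
    qed (use il in \<open>auto simp: i_def restrict_linmaps_iff[OF Rep_module[OF F]]\<close>)
    show "p \<in> nat_trans k (GammaP k d) G F"
    proof (rule nat_transI)
      fix V W :: "('k, 'v) module" and f x assume "V \<in> Ob (GammaP k d)" "W \<in> Ob (GammaP k d)"
        and f: "f \<in> Hom (GammaP k d) V W" and x: "x \<in> carrier (fob G V)"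
      then have V: "V \<in> fg_projectives k" and W: "W \<in> fg_projectives k" by simp_all
      show "p W (fmor G V W f x) = fmor F V W f (p V x)"
        using V W x Rep_closed[OF G V W f x] nat[OF V W f x] by (simp add: p_def)
    qed (use lin_compose[OF dl lin_fst] in \<open>auto simp: p_def restrict_linmaps_iff[OF Rep_module[OF G]]\<close>)
    show "p V (i V x) = x" if "V \<in> fg_projectives k" "x \<in> carrier (fob F V)" for V x
      using that \<delta>i[OF that] lin_closed[OF il[OF that(1)] that(2)] by (simp add: i_def p_def)
  qed
qed

text \<open>The complement is the pointwise kernel of \<open>p\<close>, which naturality of
  \<open>p\<close> makes a subfunctor of \<open>G\<close>. The pointwise splittings are natural
  because both \<open>i\<close> and \<open>p\<close> are.\<close>

lemma spf_summandI:
  fixes F :: "('k, 'v, 'a) spf" and G :: "('k, 'v, 'b) spf"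
  assumes G: "G \<in> Ob (Rep k d)" and F: "F \<in> Ob (Rep k d)"
    and i: "i \<in> nat_trans k (GammaP k d) F G" and p: "p \<in> nat_trans k (GammaP k d) G F"
    and pi: "\<And>V x. \<lbrakk>V \<in> fg_projectives k; x \<in> carrier (fob F V)\<rbrakk> \<Longrightarrow> p V (i V x) = x"
  shows "spf_summand k d F G"
proof -
  let ?K = "\<lambda>V. ker_mod (fob G V) (fob F V) (p V)"
  define F' :: "('k, 'v, 'b) spf" where "F' = \<lparr>fob = ?K, fmor = (\<lambda>V W f. restrict (fmor G V W f) (carrier (?K V)))\<rparr>"
  have il: "lin k (fob F V) (fob G V) (i V)" and pl: "lin k (fob G V) (fob F V) (p V)" if "V \<in> fg_projectives k" for V
    using nat_trans_lin[OF i] nat_trans_lin[OF p] that by simp_all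
  have ni: "i W (fmor F V W f x) = fmor G V W f (i V x)"
    if "V \<in> fg_projectives k" "W \<in> fg_projectives k" "f \<in> Hom (GammaP k d) V W" "x \<in> carrier (fob F V)" for V W f x
    using nat_trans_natural[OF i, of V W f x] that by simp
  have np: "p W (fmor G V W f x) = fmor F V W f (p V x)"
    if "V \<in> fg_projectives k" "W \<in> fg_projectives k" "f \<in> Hom (GammaP k d) V W" "x \<in> carrier (fob G V)" for V W f x
    using nat_trans_natural[OF p, of V W f x] that by simp
  have K: "left_module k (?K V)" if V: "V \<in> fg_projectives k" for V
    by (rule ker_mod_module[OF Rep_module[OF G V] Rep_module[OF F V] pl[OF V]])
  have Kc: "x \<in> carrier (?K V) \<longleftrightarrow> x \<in> carrier (fob G V) \<and> p V x = \<zero>\<^bsub>fob F V\<^esub>"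
    and Ka: "add (?K V) = add (fob G V)" and Ks: "smult (?K V) = smult (fob G V)" for V x
    by (simp_all add: ker_mod_def)
  have Kf: "fmor G V W f x \<in> carrier (?K W)" if V: "V \<in> fg_projectives k" and W: "W \<in> fg_projectives k"
    and f: "f \<in> Hom (GammaP k d) V W" and x: "x \<in> carrier (?K V)" for V W f x
    using x np[OF V W f] Rep_closed[OF G V W f] lin_zero[OF Rep_module[OF F V] Rep_module[OF F W] Rep_lin[OF F V W f]]
    by (simp add: Kc)
  have F'_simps: "fob F' V = ?K V" "fmor F' V W f = restrict (fmor G V W f) (carrier (?K V))" for V W f
    by (simp_all add: F'_def)
  have F'R: "F' \<in> Ob (Rep k d)"
  proof (rule Rep_ObI; unfold F'_simps)
    fix V W :: "('k, 'v) module" and f assume V: "V \<in> fg_projectives k" and W: "W \<in> fg_projectives k"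
      and f: "f \<in> Hom (GammaP k d) V W"
    have "lin k (?K V) (?K W) (fmor G V W f)"
      by (rule linI) (use Kf[OF V W f] lin_add[OF Rep_lin[OF G V W f]] lin_smult[OF Rep_lin[OF G V W f]] Kc Ka Ks in auto)
    then show "restrict (fmor G V W f) (carrier (?K V)) \<in> linmaps k (?K V) (?K W)"
      using restrict_linmaps_iff[OF K[OF V]] by blast
  next
    fix V x assume "V \<in> fg_projectives k" "x \<in> carrier (?K V)"
    then show "restrict (fmor G V V (\<lambda>x\<in>carrier (tpow k d V). x)) (carrier (?K V)) x = x"
      using Rep_id[OF G, of V x] by (simp add: Kc)
  next
    fix V W Z f g x assume V: "V \<in> fg_projectives k" and W: "W \<in> fg_projectives k" and Z: "Z \<in> fg_projectives k"
      and f: "f \<in> Hom (GammaP k d) V W" and g: "g \<in> Hom (GammaP k d) W Z" and x: "x \<in> carrier (?K V)"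
    then show "restrict (fmor G V Z (compose (carrier (tpow k d V)) g f)) (carrier (?K V)) x =
       restrict (fmor G W Z g) (carrier (?K W)) (restrict (fmor G V W f) (carrier (?K V)) x)"
      using Rep_comp[OF G V W Z f g, of x] Kf[OF V W f x] by (simp add: Kc)
  next
    fix V W f g x assume "V \<in> fg_projectives k" "W \<in> fg_projectives k"
      "f \<in> Hom (GammaP k d) V W" "g \<in> Hom (GammaP k d) V W" "x \<in> carrier (?K V)"
    then show "restrict (fmor G V W (\<lambda>t\<in>carrier (tpow k d V). f t \<oplus>\<^bsub>tpow k d W\<^esub> g t)) (carrier (?K V)) x =
       restrict (fmor G V W f) (carrier (?K V)) x \<oplus>\<^bsub>?K W\<^esub> restrict (fmor G V W g) (carrier (?K V)) x"
      using Rep_plus[OF G, of V W f g x] by (simp add: Kc Ka)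
  next
    fix V W f c x assume "V \<in> fg_projectives k" "W \<in> fg_projectives k"
      "f \<in> Hom (GammaP k d) V W" "c \<in> carrier k" "x \<in> carrier (?K V)"
    then show "restrict (fmor G V W (\<lambda>t\<in>carrier (tpow k d V). c \<odot>\<^bsub>tpow k d W\<^esub> f t)) (carrier (?K V)) x =
       c \<odot>\<^bsub>?K W\<^esub> restrict (fmor G V W f) (carrier (?K V)) x"
      using Rep_scale[OF G, of V W f c x] by (simp add: Kc Ks)
  qed (rule K)
  define \<delta> where "\<delta> = (\<lambda>V\<in>fg_projectives k. \<lambda>x\<in>carrier (fob G V). (p V x, x \<ominus>\<^bsub>fob G V\<^esub> i V (p V x)))"
  have di: "\<delta> V \<in> lin_isos k (fob G V) (dsum2 (fob F V) (fob F' V))" if V: "V \<in> fg_projectives k" for V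
    using retract_splitting[OF Rep_module[OF F V] Rep_module[OF G V] il[OF V] pl[OF V] pi[OF V]] V
    by (simp add: \<delta>_def F'_simps)
  have "\<delta> \<in> nat_trans k (GammaP k d) G (spf_dsum2 F F')"
  proof (rule nat_transI)
    fix V W :: "('k, 'v) module" and f x assume "V \<in> Ob (GammaP k d)" "W \<in> Ob (GammaP k d)"
      and f: "f \<in> Hom (GammaP k d) V W" and x: "x \<in> carrier (fob G V)"
    then have V: "V \<in> fg_projectives k" and W: "W \<in> fg_projectives k" by simp_all
    note fx = Rep_closed[OF G V W f x] and px = lin_closed[OF pl[OF V] x]
    note ipx = lin_closed[OF il[OF V] px]
    have "\<delta> V x \<in> carrier (fob F V) \<times> carrier (fob F' V)"
      using di[OF V] x by (auto simp: lin_isos_def dest!: linmaps_closed)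
    then have k: "(p V x, x \<ominus>\<^bsub>fob G V\<^esub> i V (p V x)) \<in> carrier (fob F V) \<times> carrier (?K V)"
      using V x by (simp add: \<delta>_def F'_simps)
    have "fmor G V W f x \<ominus>\<^bsub>fob G W\<^esub> i W (p W (fmor G V W f x)) = fmor G V W f (x \<ominus>\<^bsub>fob G V\<^esub> i V (p V x))"
      unfolding np[OF V W f x] ni[OF V W f px]
      by (rule lin_minus[OF Rep_module[OF G V] Rep_module[OF G W] Rep_lin[OF G V W f] x ipx, symmetric])
    then show "\<delta> W (fmor G V W f x) = fmor (spf_dsum2 F F') V W f (\<delta> V x)"
      using V W x fx k np[OF V W f x] by (simp add: \<delta>_def F'_simps)
  qed (use di in \<open>auto simp: \<delta>_def lin_isos_def\<close>)
  then have "\<delta> \<in> nat_isos k (GammaP k d) G (spf_dsum2 F F')" using di by (simp add: nat_isos_def)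
  then show ?thesis unfolding spf_summand_def using F'R by blast
qed

end

section \<open>The equivalence\<close>

lemma full_subcat_simps [simp]:
  "Ob (full_subcat C S) = S" "Hom (full_subcat C S) = Hom C" "Id (full_subcat C S) = Id C"
  "Comp (full_subcat C S) = Comp C"
  by (simp_all add: full_subcat_def)

context base
begin

lemma Gtensor_simps [simp]:
  "fob (Gtensor k d) N = Gtensor_ob k d N" "fmor (Gtensor k d) N N' g = Gmap d N N' g"
  by (simp_all add: Gtensor_def Gmap_def)

lemma Schur_simps [simp]:
  "fob (Schur k d) F = Schur_ob k d F"
  "fmor (Schur k d) F F' \<alpha> = (\<lambda>\<phi>\<in>carrier (Schur_ob k d F). Smap d \<alpha> \<phi>)"
  by (simp_all add: Schur_def)

abbreviation Msum :: "nat \<Rightarrow> nat \<Rightarrow> nat \<Rightarrow> (nat \<Rightarrow> nat \<Rightarrow> nat) \<Rightarrow> (perm \<Rightarrow> 'k, nat \<Rightarrow> ('k, nat \<Rightarrow> 'k) tens) module" where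
  "Msum n d m \<mu> \<equiv> dsum {..<m} (\<lambda>j. M_mod k n d (\<mu> j))"

abbreviation Ssum :: "nat \<Rightarrow> nat \<Rightarrow> nat \<Rightarrow> (nat \<Rightarrow> nat \<Rightarrow> nat) \<Rightarrow> ('k, 'v, nat \<Rightarrow> ('k, 'v) stens) spf" where
  "Ssum n d m \<mu> \<equiv> spf_dsum {..<m} (\<lambda>j. S_fun k n d (\<mu> j))"

lemma composition_sum: "\<mu> \<in> compositions n d \<Longrightarrow> (\<Sum>l=1..n. \<mu> l) = d"
  by (simp add: compositions_def)

context
  fixes n d m :: nat and \<mu> :: "nat \<Rightarrow> nat \<Rightarrow> nat"
  assumes comps: "\<forall>j<m. \<mu> j \<in> compositions n d"
begin

lemma sum_comp: "j < m \<Longrightarrow> (\<Sum>l=1..n. \<mu> j l) = d"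
  using comps composition_sum by blast

lemma Msum_module: "left_module (kS k d) (Msum n d m \<mu>)"
  by (rule dsum_module[OF kS_ring]) (use M_mod_module[OF sum_comp] in blast)

lemma Ssum_Rep: "Ssum n d m \<mu> \<in> Ob (Rep k d)"
  by (rule spf_dsum_Rep) (use S_fun_Rep[OF sum_comp] in blast)

lemma G_Msum_iso:
  obtains a b where
    "a \<in> nat_trans k (GammaP k d) (Gtensor_ob k d (Msum n d m \<mu>)) (Ssum n d m \<mu> :: ('k, 'v, _) spf)"
    "b \<in> nat_trans k (GammaP k d) (Ssum n d m \<mu> :: ('k, 'v, _) spf) (Gtensor_ob k d (Msum n d m \<mu>))"
    "\<And>V z. \<lbrakk>V \<in> fg_projectives k; z \<in> carrier (BT d (Msum n d m \<mu>) V)\<rbrakk> \<Longrightarrow> b V (a V z) = z"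
    "\<And>V s. \<lbrakk>V \<in> fg_projectives k; s \<in> carrier (fob (Ssum n d m \<mu>) V)\<rbrakk> \<Longrightarrow> a V (b V s) = s"
proof -
  define R where "R j p \<longleftrightarrow>
    fst p \<in> nat_trans k (GammaP k d) (Gtensor_ob k d (M_mod k n d (\<mu> j))) (S_fun k n d (\<mu> j) :: ('k, 'v, _) spf) \<and>
    snd p \<in> nat_trans k (GammaP k d) (S_fun k n d (\<mu> j)) (Gtensor_ob k d (M_mod k n d (\<mu> j))) \<and>
    (\<forall>V\<in>fg_projectives k. \<forall>z\<in>carrier (BT d (M_mod k n d (\<mu> j)) V). snd p V (fst p V z) = z) \<and>
    (\<forall>V\<in>fg_projectives k. \<forall>s\<in>carrier (S_ob k n (\<mu> j) V). fst p V (snd p V s) = s)" for j p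
  define \<theta> where "\<theta> j = fst (SOME p. R j p)" for j
  define h where "h j = snd (SOME p. R j p)" for j
  have R: "R j (\<theta> j, h j)" if j: "j < m" for j
  proof -
    obtain t s where
      "t \<in> nat_trans k (GammaP k d) (Gtensor_ob k d (M_mod k n d (\<mu> j))) (S_fun k n d (\<mu> j) :: ('k, 'v, _) spf)"
      "s \<in> nat_trans k (GammaP k d) (S_fun k n d (\<mu> j)) (Gtensor_ob k d (M_mod k n d (\<mu> j)) :: ('k, 'v, _) spf)"
      "\<And>V z. \<lbrakk>V \<in> fg_projectives k; z \<in> carrier (BT d (M_mod k n d (\<mu> j)) V)\<rbrakk> \<Longrightarrow> s V (t V z) = z"
      "\<And>V y. \<lbrakk>V \<in> fg_projectives k; y \<in> carrier (S_ob k n (\<mu> j) V)\<rbrakk> \<Longrightarrow> t V (s V y) = y"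
      using GM_S_nat_iso[OF sum_comp[OF j]] by blast
    then have "R j (t, s)" by (simp add: R_def)
    then show ?thesis unfolding \<theta>_def h_def using someI_ex[of "R j"] by auto
  qed
  show ?thesis
  proof (rule G_dsum_iso[where I="{..<m}" and N="\<lambda>j. M_mod k n d (\<mu> j)" and
        F="\<lambda>j. S_fun k n d (\<mu> j) :: ('k, 'v, _) spf" and d=d and \<theta>=\<theta> and h=h])
    show "left_module (kS k d) (M_mod k n d (\<mu> j))" if "j \<in> {..<m}" for j
      using M_mod_module[OF sum_comp] that by simp
    show "S_fun k n d (\<mu> j) \<in> Ob (Rep k d)" if "j \<in> {..<m}" for j using S_fun_Rep[OF sum_comp] that by simp
  qed (use R that in \<open>auto simp: R_def\<close>)
qed

end

lemma add_S_simps [simp]: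
  "Hom (add_S k n d) = nat_trans k (GammaP k d)"
  "Id (add_S k n d) F = (\<lambda>V\<in>fg_projectives k. \<lambda>x\<in>carrier (fob F V). x)"
  "Comp (add_S k n d) = vcomp (GammaP k d)"
  by (simp_all add: add_S_def)

lemma add_M_simps [simp]:
  "Hom (add_M k n d) = linmaps (kS k d)" "Id (add_M k n d) N = (\<lambda>x\<in>carrier N. x)"
  "Comp (add_M k n d) N g f = compose (carrier N) g f"
  by (simp_all add: add_M_def)

lemma add_S_Ob: "F \<in> Ob (add_S k n d) \<longleftrightarrow> F \<in> Ob (Rep k d) \<and>
    (\<exists>m \<mu>. (\<forall>j<m. \<mu> j \<in> compositions n d) \<and> spf_summand k d F (Ssum n d m \<mu>))"
  by (simp add: add_S_def)

lemma add_M_Ob: "N \<in> Ob (add_M k n d) \<longleftrightarrow> left_module (kS k d) N \<and>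
    (\<exists>m \<mu>. (\<forall>j<m. \<mu> j \<in> compositions n d) \<and> summand (kS k d) N (Msum n d m \<mu>))"
  by (simp add: add_M_def)

text \<open>Sums of the \<open>S_fun\<close> are traded for \<open>G\<^sub>\<otimes>\<close> of sums
  of the \<open>M_mod\<close>, so every object of \<open>add_S\<close> becomes a retract of a value
  of \<open>G\<^sub>\<otimes>\<close>, as needed for the counit.\<close>

lemma add_S_retract:
  fixes F :: "('k, 'v, 'w) spf"
  assumes "F \<in> Ob (add_S k n d)"
  obtains m \<mu> i p where "\<forall>j<m. \<mu> j \<in> compositions n d"
    "i \<in> nat_trans k (GammaP k d) F (Gtensor_ob k d (Msum n d m \<mu>))"
    "p \<in> nat_trans k (GammaP k d) (Gtensor_ob k d (Msum n d m \<mu>)) F"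
    "\<And>V x. \<lbrakk>V \<in> fg_projectives k; x \<in> carrier (fob F V)\<rbrakk> \<Longrightarrow> p V (i V x) = x"
proof -
  obtain m \<mu> where F: "F \<in> Ob (Rep k d)" and c: "\<forall>j<m. \<mu> j \<in> compositions n d"
    and s: "spf_summand k d F (Ssum n d m \<mu>)"
    using assms add_S_Ob by blast
  obtain i p where i: "i \<in> nat_trans k (GammaP k d) F (Ssum n d m \<mu>)"
    and p: "p \<in> nat_trans k (GammaP k d) (Ssum n d m \<mu>) F"
    and pi: "\<And>V x. \<lbrakk>V \<in> fg_projectives k; x \<in> carrier (fob F V)\<rbrakk> \<Longrightarrow> p V (i V x) = x"
    using spf_summandD[OF Ssum_Rep[OF c] F s] by blast
  obtain a b where
    a: "a \<in> nat_trans k (GammaP k d) (Gtensor_ob k d (Msum n d m \<mu>)) (Ssum n d m \<mu> :: ('k, 'v, _) spf)" and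
    b: "b \<in> nat_trans k (GammaP k d) (Ssum n d m \<mu> :: ('k, 'v, _) spf) (Gtensor_ob k d (Msum n d m \<mu>))" and
    ab: "\<And>V s. \<lbrakk>V \<in> fg_projectives k; s \<in> carrier (fob (Ssum n d m \<mu>) V)\<rbrakk> \<Longrightarrow> a V (b V s) = s"
    using G_Msum_iso[OF c] by metis
  note GP = Gtensor_ob_Rep[OF Msum_module[OF c]]
  show ?thesis
  proof (rule that[OF c])
    show "vcomp (GammaP k d) F b i \<in> nat_trans k (GammaP k d) F (Gtensor_ob k d (Msum n d m \<mu>))"
      by (rule vcomp_nat_trans[OF Rep_functor[OF F] i b])
    show "vcomp (GammaP k d) (Gtensor_ob k d (Msum n d m \<mu>)) p a \<in>
        nat_trans k (GammaP k d) (Gtensor_ob k d (Msum n d m \<mu>)) F"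
      by (rule vcomp_nat_trans[OF Rep_functor[OF GP] a p])
    fix V x assume V: "V \<in> fg_projectives k" and x: "x \<in> carrier (fob F V)"
    have ix: "i V x \<in> carrier (fob (Ssum n d m \<mu>) V)" using nat_trans_closed[OF i, of V x] V x by simp
    have bx: "b V (i V x) \<in> carrier (fob (Gtensor_ob k d (Msum n d m \<mu>)) V)"
      using nat_trans_closed[OF b, of V "i V x"] V ix by simp
    show "vcomp (GammaP k d) (Gtensor_ob k d (Msum n d m \<mu>)) p a V (vcomp (GammaP k d) F b i V x) = x"
      using V x bx ab[OF V ix] pi[OF V x] by (simp add: vcomp_apply)
  qed
qed

section \<open>The equivalence when \<open>'v\<close> has room for the free modules of finite
  rank\<close>

context
  fixes d :: nat and c :: "'k list \<Rightarrow> 'v"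
  assumes c: "inj_on c (lists (carrier k))"
begin

text \<open>The injection \<open>c\<close> supplies the free object of rank \<open>d\<close>, whose
  dual bases give \<open>u\<close> and \<pi>.\<close>

lemma unit_bij_all:
  assumes N: "left_module (kS k d) N"
  shows "bij_betw (unit d N :: 'a \<Rightarrow> ('k, 'v, _, _) spf_hom) (carrier N) (carrier (Schur_ob k d (Gtensor_ob k d N)))"
proof (rule free_object[OF c, of d])
  fix E :: "('k, 'v) module" and e lam
  assume E: "E \<in> fg_projectives k"
    and lam: "\<And>l. l \<in> {1..d} \<Longrightarrow> lin k E (self_mod k) (lam l)" and e: "\<And>l. l \<in> {1..d} \<Longrightarrow> e l \<in> carrier E"
    and dual: "\<And>l m. \<lbrakk>l \<in> {1..d}; m \<in> {1..d}\<rbrakk> \<Longrightarrow> lam l (e m) = (if l = m then \<one>\<^bsub>k\<^esub> else \<zero>\<^bsub>k\<^esub>)"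
  show ?thesis
  proof (rule regular_retract[OF fg_proj_module[OF E] lam e dual])
    fix u \<pi>
    assume "u \<in> carrier (tpow k d E)" "lin k (tpow k d E) (free_mod k (carrier (sym_group d))) \<pi>"
      "\<pi> u = \<one>\<^bsub>kS k d\<^esub>"
      "\<And>x a. \<lbrakk>x \<in> carrier (tpow k d E); a \<in> carrier (kS k d)\<rbrakk> \<Longrightarrow> \<pi> (kS_ract k d E x a) = \<pi> x \<otimes>\<^bsub>kS k d\<^esub> a"
    then show ?thesis by (rule unit_bij[OF N E])
  qed
qed

lemma counit_iso_add_S:
  fixes F :: "('k, 'v, 'w) spf"
  assumes F: "F \<in> Ob (add_S k n d)"
  shows "counit d F \<in> nat_isos k (GammaP k d) (Gtensor_ob k d (Schur_ob k d F)) F"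
proof -
  have R: "F \<in> Ob (Rep k d)" using F add_S_Ob by blast
  obtain m \<mu> i p where c: "\<forall>j<m. \<mu> j \<in> compositions n d"
    and i: "i \<in> nat_trans k (GammaP k d) F (Gtensor_ob k d (Msum n d m \<mu>))"
    and p: "p \<in> nat_trans k (GammaP k d) (Gtensor_ob k d (Msum n d m \<mu>)) F"
    and pi: "\<And>V x. \<lbrakk>V \<in> fg_projectives k; x \<in> carrier (fob F V)\<rbrakk> \<Longrightarrow> p V (i V x) = x"
    using add_S_retract[OF F] by metis
  note P = Msum_module[OF c]
  show ?thesis by (rule counit_iso[OF R P unit_bij_all[OF P] i p pi])
qed

text \<open>The Schur functor carries the retraction of \<open>F\<close> to one from its value at
  \<open>G\<^sub>\<otimes>(P)\<close>, and the unit identifies that value with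
  \<open>P\<close>.\<close>

lemma Schur_ob_add_M:
  fixes F :: "('k, 'v, 'w) spf"
  assumes F: "F \<in> Ob (add_S k n d)"
  shows "Schur_ob k d F \<in> Ob (add_M k n d)"
proof -
  have R: "F \<in> Ob (Rep k d)" using F add_S_Ob by blast
  obtain m \<mu> i p where c: "\<forall>j<m. \<mu> j \<in> compositions n d"
    and i: "i \<in> nat_trans k (GammaP k d) F (Gtensor_ob k d (Msum n d m \<mu>))"
    and p: "p \<in> nat_trans k (GammaP k d) (Gtensor_ob k d (Msum n d m \<mu>)) F"
    and pi: "\<And>V x. \<lbrakk>V \<in> fg_projectives k; x \<in> carrier (fob F V)\<rbrakk> \<Longrightarrow> p V (i V x) = x"
    using add_S_retract[OF F] by metis
  let ?P = "Msum n d m \<mu>"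
  let ?G = "Gtensor_ob k d ?P :: ('k, 'v, _) spf"
  note P = Msum_module[OF c]
  note GP = Gtensor_ob_Rep[OF P]
  note S = Schur_ob_module[OF R]
  note ub = unit_bij_all[OF P]
  note Si = Smap_lin[OF R GP i] and Sp = Smap_lin[OF GP R p]
  have vl: "lin (kS k d) (Schur_ob k d ?G) ?P (inv_into (carrier ?P) (unit d ?P))"
    by (rule lin_inv[OF P unit_lin[OF P] ub])
  have "summand (kS k d) (Schur_ob k d F) ?P"
  proof (rule summandI[OF S P lin_compose[OF Si vl] lin_compose[OF unit_lin[OF P] Sp]])
    fix \<phi> assume ph: "\<phi> \<in> carrier (Schur_ob k d F)"
    have "Smap d p (unit d ?P (inv_into (carrier ?P) (unit d ?P) (Smap d i \<phi>))) = Smap d p (Smap d i \<phi>)"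
      using bij_betw_inv_into_right[OF ub lin_closed[OF Si ph]] by simp
    also have "\<dots> = \<phi>"
    proof (rule nat_trans_omega_eqI)
      show "Smap d p (Smap d i \<phi>) \<in> nat_trans k (GammaP k d) (Gamma_omega k d) F"
        using lin_closed[OF Sp lin_closed[OF Si ph]] by simp
      show "\<phi> \<in> nat_trans k (GammaP k d) (Gamma_omega k d) F" using ph by simp
      then show "Smap d p (Smap d i \<phi>) W x = \<phi> W x" if "W \<in> fg_projectives k" "x \<in> carrier (tpow k d W)" for W x
        using that by (simp add: Smap_apply pi nat_trans_omega_closed)
    qed
    finally show "Smap d p (unit d ?P (inv_into (carrier ?P) (unit d ?P) (Smap d i \<phi>))) = \<phi>" .
  qed
  then show ?thesis using S c add_M_Ob by blast
qed

lemma Schur_functor: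
  "is_functor (add_S k n d :: (('k, 'v, 'w) spf, ('k, 'v, 'w, 'w) spf_hom) cat) (add_M k n d) (Schur k d)"
  unfolding is_functor_def
proof (intro conjI ballI)
  fix F :: "('k, 'v, 'w) spf" assume "F \<in> Ob (add_S k n d)"
  then show "fob (Schur k d) F \<in> Ob (add_M k n d)" using Schur_ob_add_M by simp
next
  fix F F' :: "('k, 'v, 'w) spf" and \<alpha>
  assume "F \<in> Ob (add_S k n d)" "F' \<in> Ob (add_S k n d)" and a: "\<alpha> \<in> Hom (add_S k n d) F F'"
  then have F: "F \<in> Ob (Rep k d)" and F': "F' \<in> Ob (Rep k d)" using add_S_Ob by blast+
  show "fmor (Schur k d) F F' \<alpha> \<in> Hom (add_M k n d) (fob (Schur k d) F) (fob (Schur k d) F')"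
    using Smap_lin[OF F F'] a by (simp add: restrict_linmaps_iff[OF Schur_ob_module[OF F]] del: Schur_ob_simps(1))
next
  fix F :: "('k, 'v, 'w) spf" assume "F \<in> Ob (add_S k n d)"
  then have F: "F \<in> Ob (Rep k d)" using add_S_Ob by blast
  have id: "Id (add_S k n d) F \<in> nat_trans k (GammaP k d) F F"
    by (rule nat_transI) (use Rep_closed[OF F] in \<open>auto simp: restrict_linmaps_iff[OF Rep_module[OF F]] lin_id\<close>)
  show "fmor (Schur k d) F F (Id (add_S k n d) F) = Id (add_M k n d) (fob (Schur k d) F)"
    unfolding Schur_simps add_M_simps
  proof (rule restrict_ext)
    fix \<phi> assume "\<phi> \<in> carrier (Schur_ob k d F)"
    then have p: "\<phi> \<in> nat_trans k (GammaP k d) (Gamma_omega k d) F" by simp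
    show "Smap d (Id (add_S k n d) F) \<phi> = \<phi>"
      by (rule nat_trans_omega_eqI[OF Smap_closed[OF p id] p])
        (use nat_trans_omega_closed[OF p] in \<open>simp add: Smap_apply\<close>)
  qed
next
  fix F F' F'' :: "('k, 'v, 'w) spf" and \<alpha> \<beta>
  assume "F \<in> Ob (add_S k n d)" and a: "\<alpha> \<in> Hom (add_S k n d) F F'" and b: "\<beta> \<in> Hom (add_S k n d) F' F''"
  then have F: "F \<in> Ob (Rep k d)" using add_S_Ob by blast
  have a: "\<alpha> \<in> nat_trans k (GammaP k d) F F'" and b: "\<beta> \<in> nat_trans k (GammaP k d) F' F''" using a b by simp_all
  note ab = vcomp_nat_trans[OF Rep_functor[OF F] a b]
  show "fmor (Schur k d) F F'' (Comp (add_S k n d) F \<beta> \<alpha>) =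
     Comp (add_M k n d) (fob (Schur k d) F) (fmor (Schur k d) F' F'' \<beta>) (fmor (Schur k d) F F' \<alpha>)"
    unfolding Schur_simps add_M_simps compose_def
  proof (rule restrict_ext)
    fix \<phi> assume "\<phi> \<in> carrier (Schur_ob k d F)"
    then have p: "\<phi> \<in> nat_trans k (GammaP k d) (Gamma_omega k d) F" by simp
    note pa = Smap_closed[OF p a]
    have "Smap d (vcomp (GammaP k d) F \<beta> \<alpha>) \<phi> = Smap d \<beta> (Smap d \<alpha> \<phi>)"
      by (rule nat_trans_omega_eqI[OF Smap_closed[OF p ab] Smap_closed[OF pa b]])
        (use nat_trans_omega_closed[OF p] in \<open>simp add: Smap_apply vcomp_apply[of _ "GammaP k d" _ F]\<close>)
    then show "Smap d (Comp (add_S k n d) F \<beta> \<alpha>) \<phi> =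
        restrict (Smap d \<beta>) (carrier (Schur_ob k d F')) (restrict (Smap d \<alpha>) (carrier (Schur_ob k d F)) \<phi>)"
      using p pa by simp
  qed
qed

text \<open>\<open>G\<^sub>\<otimes>\<close> carries a retraction of \<open>P\<close> onto
  \<open>N\<close> to one of functors, and \<open>G\<^sub>\<otimes>(P)\<close> is isomorphic to a
  sum of the \<open>S_fun\<close>.\<close>

lemma Gtensor_ob_add_S:
  assumes N: "N \<in> Ob (add_M k n d)"
  shows "(Gtensor_ob k d N :: ('k, 'v, _) spf) \<in> Ob (add_S k n d)"
proof -
  obtain m \<mu> where M: "left_module (kS k d) N" and c: "\<forall>j<m. \<mu> j \<in> compositions n d"
    and s: "summand (kS k d) N (Msum n d m \<mu>)"
    using N add_M_Ob by blast
  let ?P = "Msum n d m \<mu>"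
  let ?GP = "Gtensor_ob k d ?P :: ('k, 'v, _) spf" and ?GN = "Gtensor_ob k d N :: ('k, 'v, _) spf"
  note P = Msum_module[OF c]
  obtain i p where i: "lin (kS k d) N ?P i" and p: "lin (kS k d) ?P N p" and pi: "\<And>x. x \<in> carrier N \<Longrightarrow> p (i x) = x"
    using summandD[OF P s] by blast
  obtain a b where
    a: "a \<in> nat_trans k (GammaP k d) ?GP (Ssum n d m \<mu>)" and
    b: "b \<in> nat_trans k (GammaP k d) (Ssum n d m \<mu>) ?GP" and
    ba: "\<And>V z. \<lbrakk>V \<in> fg_projectives k; z \<in> carrier (BT d ?P V)\<rbrakk> \<Longrightarrow> b V (a V z) = z"
    using G_Msum_iso[OF c] by metis
  note GN = Gtensor_ob_Rep[OF M] and SS = Ssum_Rep[OF c]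
  note Gi = Gmap_nat_trans[OF M P i] and Gp = Gmap_nat_trans[OF P M p]
  have "spf_summand k d ?GN (Ssum n d m \<mu>)"
  proof (rule spf_summandI[OF SS GN vcomp_nat_trans[OF Rep_functor[OF GN] Gi a] vcomp_nat_trans[OF Rep_functor[OF SS] b Gp]])
    fix V :: "('k, 'v) module" and x assume V: "V \<in> fg_projectives k" and "x \<in> carrier (fob ?GN V)"
    then have x: "x \<in> carrier (BT d N V)" by simp
    have ix: "Gmap d N ?P i V x \<in> carrier (BT d ?P V)" by (rule lin_closed[OF Gmap_lin[OF M P i V] x])
    have ax: "a V (Gmap d N ?P i V x) \<in> carrier (fob (Ssum n d m \<mu>) V)"
      using nat_trans_closed[OF a, of V "Gmap d N ?P i V x"] V ix by simp
    have "Gmap d ?P N p V (Gmap d N ?P i V x) = x"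
      using Gmap_comp[OF M P M i p refl V x] Gmap_id[OF M V _ x, of "\<lambda>y. p (i y)"] pi by simp
    then show "vcomp (GammaP k d) (Ssum n d m \<mu>) (Gmap d ?P N p) b V (vcomp (GammaP k d) ?GN a (Gmap d N ?P i) V x) = x"
      using V x ax ba[OF V ix] by (simp add: vcomp_apply[of V] del: spf_dsum_simps)
  qed
  then show ?thesis using GN c add_S_Ob by blast
qed

lemma Gtensor_functor:
  "is_functor (add_M k n d :: ((perm \<Rightarrow> 'k, 'a) module, 'a \<Rightarrow> 'a) cat)
     (add_S k n d :: (('k, 'v, (('k, 'v) tens \<times> 'a \<Rightarrow> 'k) set) spf, _) cat) (Gtensor k d)"
  unfolding is_functor_def
proof (intro conjI ballI)
  fix N :: "(perm \<Rightarrow> 'k, 'a) module" assume "N \<in> Ob (add_M k n d)"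
  then show "fob (Gtensor k d) N \<in> Ob (add_S k n d :: (('k, 'v, (('k, 'v) tens \<times> 'a \<Rightarrow> 'k) set) spf, _) cat)"
    using Gtensor_ob_add_S by simp
next
  fix N N' :: "(perm \<Rightarrow> 'k, 'a) module" and g
  assume "N \<in> Ob (add_M k n d)" "N' \<in> Ob (add_M k n d)" and "g \<in> Hom (add_M k n d) N N'"
  then have N: "left_module (kS k d) N" and N': "left_module (kS k d) N'" and g: "lin (kS k d) N N' g"
    using add_M_Ob lin_linmaps by auto
  show "fmor (Gtensor k d) N N' g \<in>
      Hom (add_S k n d :: (('k, 'v, (('k, 'v) tens \<times> 'a \<Rightarrow> 'k) set) spf, _) cat) (fob (Gtensor k d) N) (fob (Gtensor k d) N')"
    using Gmap_nat_trans[OF N N' g] by simp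
next
  fix N :: "(perm \<Rightarrow> 'k, 'a) module" assume "N \<in> Ob (add_M k n d)"
  then have N: "left_module (kS k d) N" using add_M_Ob by blast
  have l: "lin (kS k d) N N (\<lambda>x\<in>carrier N. x)" using lin_cong[OF N, of "\<lambda>x\<in>carrier N. x" "\<lambda>x. x" N] lin_id by simp
  show "fmor (Gtensor k d) N N (Id (add_M k n d) N) =
      Id (add_S k n d :: (('k, 'v, (('k, 'v) tens \<times> 'a \<Rightarrow> 'k) set) spf, _) cat) (fob (Gtensor k d) N)"
    unfolding Gtensor_simps add_M_simps add_S_simps
  proof (rule extensionalityI[of _ "fg_projectives k"])
    fix V :: "('k, 'v) module" assume V: "V \<in> fg_projectives k"
    show "Gmap d N N (\<lambda>x\<in>carrier N. x) V = (\<lambda>V\<in>fg_projectives k. \<lambda>x\<in>carrier (fob (Gtensor_ob k d N) V). x) V"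
    proof (rule extensionalityI[of _ "carrier (BT d N V)"])
      show "Gmap d N N (\<lambda>x\<in>carrier N. x) V \<in> extensional (carrier (BT d N V))"
        using Gmap_linmaps[OF N N l V] by (simp add: linmaps_iff)
    qed (use V Gmap_id[OF N V, of "\<lambda>x\<in>carrier N. x"] in auto)
  qed (simp_all add: Gmap_def)
next
  fix N N' N'' :: "(perm \<Rightarrow> 'k, 'a) module" and f g
  assume "N \<in> Ob (add_M k n d)" "N' \<in> Ob (add_M k n d)" "N'' \<in> Ob (add_M k n d)"
    and "f \<in> Hom (add_M k n d) N N'" and "g \<in> Hom (add_M k n d) N' N''"
  then have N: "left_module (kS k d) N" and N': "left_module (kS k d) N'" and N'': "left_module (kS k d) N''"
    and f: "lin (kS k d) N N' f" and g: "lin (kS k d) N' N'' g"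
    using add_M_Ob lin_linmaps by auto
  let ?G = "Gtensor_ob k d :: _ \<Rightarrow> ('k, 'v, (('k, 'v) tens \<times> 'a \<Rightarrow> 'k) set) spf"
  let ?gf = "compose (carrier N) g f"
  have gf: "lin (kS k d) N N'' ?gf"
    using lin_cong[OF N, of ?gf "\<lambda>x. g (f x)" N''] lin_compose[OF f g] by (simp add: compose_def)
  show "fmor (Gtensor k d) N N'' (Comp (add_M k n d) N g f) =
     Comp (add_S k n d :: (('k, 'v, (('k, 'v) tens \<times> 'a \<Rightarrow> 'k) set) spf, _) cat) (fob (Gtensor k d) N)
       (fmor (Gtensor k d) N' N'' g) (fmor (Gtensor k d) N N' f)"
    unfolding Gtensor_simps add_M_simps add_S_simps
  proof (rule nat_trans_eqI[OF Gmap_nat_trans[OF N N'' gf]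
        vcomp_nat_trans[OF Rep_functor[OF Gtensor_ob_Rep[OF N]] Gmap_nat_trans[OF N N' f] Gmap_nat_trans[OF N' N'' g]]])
    fix V :: "('k, 'v) module" and x assume V: "V \<in> Ob (GammaP k d)" and x: "x \<in> carrier (fob (?G N) V)"
    show "Gmap d N N'' ?gf V x = vcomp (GammaP k d) (?G N) (Gmap d N' N'' g) (Gmap d N N' f) V x"
      unfolding vcomp_apply[OF V x]
      by (rule Gmap_comp[OF N N' N'' f g]) (use V x in \<open>simp_all add: compose_def\<close>)
  qed
qed

lemma counit_equivalence:
  "(\<lambda>F\<in>Ob (add_S k n d). counit d F) \<in> Rep_nat_isos k d
     (add_S k n d :: (('k, 'v, 'w) spf, ('k, 'v, 'w, 'w) spf_hom) cat)
     (comp_func (Gtensor k d) (Schur k d)) id_func"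
proof -
  let ?C = "add_S k n d :: (('k, 'v, 'w) spf, ('k, 'v, 'w, 'w) spf_hom) cat"
  let ?GS = "comp_func (Gtensor k d) (Schur k d) ::
    (('k, 'v, 'w) spf, ('k, 'v, 'w, 'w) spf_hom, ('k, 'v, (('k, 'v) tens \<times> _ \<Rightarrow> 'k) set) spf, _) func"
  have ob: "fob ?GS F = Gtensor_ob k d (Schur_ob k d F)" for F by (simp add: comp_func_def)
  have mor: "fmor ?GS F F' \<alpha> =
      Gmap d (Schur_ob k d F) (Schur_ob k d F') (restrict (Smap d \<alpha>) (carrier (Schur_ob k d F)))" for F F' \<alpha>
    by (simp add: comp_func_def del: Schur_ob_simps(1))
  have iob: "fob id_func F = F" and imor: "fmor id_func F F' \<alpha> = \<alpha>"
    for F F' :: "('k, 'v, 'w) spf" and \<alpha> :: "('k, 'v, 'w, 'w) spf_hom" by (simp_all add: id_func_def)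
  show ?thesis
    unfolding Rep_nat_isos_def
  proof (intro CollectI conjI ballI, unfold ob mor iob imor)
    show "(\<lambda>F\<in>Ob ?C. counit d F) \<in> extensional (Ob ?C)" by simp
  next
    fix F :: "('k, 'v, 'w) spf" assume F: "F \<in> Ob ?C"
    show "(\<lambda>F\<in>Ob ?C. counit d F) F \<in> nat_isos k (GammaP k d) (Gtensor_ob k d (Schur_ob k d F)) F"
      using counit_iso_add_S[OF F] F by simp
  next
    fix F F' :: "('k, 'v, 'w) spf" and \<alpha>
    assume aF: "F \<in> Ob ?C" and aF': "F' \<in> Ob ?C" and "\<alpha> \<in> Hom ?C F F'"
    then have a: "\<alpha> \<in> nat_trans k (GammaP k d) F F'" by simp
    have F: "F \<in> Ob (Rep k d)" and F': "F' \<in> Ob (Rep k d)" using aF aF' add_S_Ob by blast+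
    note S = Schur_ob_module[OF F] and S' = Schur_ob_module[OF F']
    let ?G = "Gtensor_ob k d (Schur_ob k d F) :: ('k, 'v, _) spf"
    let ?g = "restrict (Smap d \<alpha>) (carrier (Schur_ob k d F))"
    have "vcomp (GammaP k d) ?G (counit d F') (Gmap d (Schur_ob k d F) (Schur_ob k d F') ?g) =
      vcomp (GammaP k d) ?G \<alpha> (counit d F)"
      unfolding vcomp_def[of _ ?G] compose_def
    proof (intro restrict_ext)
      fix V x assume "V \<in> Ob (GammaP k d)" and "x \<in> carrier (fob ?G V)"
      then have V: "V \<in> fg_projectives k" and x: "x \<in> carrier (BT d (Schur_ob k d F) V)" by simp_all
      have "Gmap d (Schur_ob k d F) (Schur_ob k d F') ?g V x = Gmap d (Schur_ob k d F) (Schur_ob k d F') (Smap d \<alpha>) V x"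
        by (rule Gmap_cong[OF S S' Smap_lin[OF F F' a] _ V x]) simp
      then show "counit d F' V (Gmap d (Schur_ob k d F) (Schur_ob k d F') ?g V x) = \<alpha> V (counit d F V x)"
        using counit_natural[OF F F' a V x] by simp
    qed
    then show "vcomp (GammaP k d) (Gtensor_ob k d (Schur_ob k d F)) ((\<lambda>F\<in>Ob ?C. counit d F) F')
        (Gmap d (Schur_ob k d F) (Schur_ob k d F') (restrict (Smap d \<alpha>) (carrier (Schur_ob k d F)))) =
      vcomp (GammaP k d) (Gtensor_ob k d (Schur_ob k d F)) \<alpha> ((\<lambda>F\<in>Ob ?C. counit d F) F)"
      using aF aF' by (simp only: restrict_apply')
  qed
qed

lemma unit_equivalence:
  "(\<lambda>N\<in>Ob (add_M k n d). restrict (unit d N) (carrier N)) \<in> nat_isos (kS k d)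
     (add_M k n d :: ((perm \<Rightarrow> 'k, 'a) module, 'a \<Rightarrow> 'a) cat) id_func
     (comp_func (Schur k d :: (('k, 'v, (('k, 'v) tens \<times> 'a \<Rightarrow> 'k) set) spf, _, _, _) func) (Gtensor k d))"
proof -
  let ?C = "add_M k n d :: ((perm \<Rightarrow> 'k, 'a) module, 'a \<Rightarrow> 'a) cat"
  let ?\<eta> = "\<lambda>N\<in>Ob ?C. restrict (unit d N :: 'a \<Rightarrow> ('k, 'v, _, _) spf_hom) (carrier N)"
  let ?SG = "comp_func (Schur k d :: (('k, 'v, (('k, 'v) tens \<times> 'a \<Rightarrow> 'k) set) spf, _, _, _) func) (Gtensor k d)"
  have ob: "fob ?SG N = Schur_ob k d (Gtensor_ob k d N)" for N by (simp add: comp_func_def)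
  have mor: "fmor ?SG N N' f = (\<lambda>\<phi>\<in>carrier (Schur_ob k d (Gtensor_ob k d N)). Smap d (Gmap d N N' f) \<phi>)" for N N' f
    by (simp add: comp_func_def)
  have iob: "fob id_func N = N" and imor: "fmor id_func N N' f = f"
    for N N' :: "(perm \<Rightarrow> 'k, 'a) module" and f :: "'a \<Rightarrow> 'a" by (simp_all add: id_func_def)
  have n: "?\<eta> \<in> nat_trans (kS k d) ?C id_func ?SG"
  proof (rule nat_transI; (unfold ob iob)?)
    fix N assume aN: "N \<in> Ob ?C"
    then have N: "left_module (kS k d) N" using add_M_Ob by blast
    show "?\<eta> N \<in> linmaps (kS k d) N (Schur_ob k d (Gtensor_ob k d N))"
      using unit_lin[OF N] aN by (simp add: restrict_linmaps_iff[OF N])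
  next
    fix N N' f x assume aN: "N \<in> Ob ?C" and aN': "N' \<in> Ob ?C" and "f \<in> Hom ?C N N'" and x: "x \<in> carrier N"
    then have N: "left_module (kS k d) N" and N': "left_module (kS k d) N'" and f: "lin (kS k d) N N' f"
      using add_M_Ob lin_linmaps by auto
    note fx = lin_closed[OF f x]
    have "unit d N' (f x) = Smap d (Gmap d N N' f) (unit d N x :: ('k, 'v, _, _) spf_hom)"
    proof (rule nat_trans_omega_eqI)
      show "unit d N' (f x) \<in> nat_trans k (GammaP k d) (Gamma_omega k d) (Gtensor_ob k d N' :: ('k, 'v, _) spf)"
        using unit_closed[OF N' fx] by simp
      show "Smap d (Gmap d N N' f) (unit d N x) \<in> nat_trans k (GammaP k d) (Gamma_omega k d) (Gtensor_ob k d N' :: ('k, 'v, _) spf)"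
        using unit_closed[OF N x] by (intro Smap_closed[OF _ Gmap_nat_trans[OF N N' f]]) simp
      show "unit d N' (f x) V t = Smap d (Gmap d N N' f) (unit d N x) V t"
        if "V \<in> fg_projectives k" "t \<in> carrier (tpow k d V)" for V :: "('k, 'v) module" and t
        using that by (simp add: Smap_apply unit_apply[OF N] unit_apply[OF N'] Gmap_pure[OF N N' f _ _ x])
    qed
    moreover have "(unit d N x :: ('k, 'v, _, _) spf_hom) \<in> carrier (Schur_ob k d (Gtensor_ob k d N))"
      by (rule unit_closed[OF N x])
    ultimately show "?\<eta> N' (fmor id_func N N' f x) = fmor ?SG N N' f (?\<eta> N x)"
      unfolding imor mor using aN aN' x fx by (simp del: Schur_ob_simps(1))
  qed simp
  show ?thesis
    unfolding nat_isos_def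
  proof (intro CollectI conjI ballI n, unfold ob iob)
    fix N assume aN: "N \<in> Ob ?C"
    then have N: "left_module (kS k d) N" using add_M_Ob by blast
    show "?\<eta> N \<in> lin_isos (kS k d) N (Schur_ob k d (Gtensor_ob k d N))"
      using unit_bij_all[OF N] unit_lin[OF N] aN
      by (simp add: lin_isos_def restrict_linmaps_iff[OF N] bij_betw_restrict_eq del: Schur_ob_simps(1) cong: bij_betw_cong)
  qed
qed

end

end

text \<open>The condition \<open>universe\<close> puts a copy of each free module of finite rank
  among the objects of \<open>GammaP\<close>; it holds, for example, when \<open>'v\<close> is
  \<open>'k list\<close>. The value types \<open>'w\<close> and \<open>'a\<close> are arbitrary. The
  composites of the two functors leave these types, so the isomorphisms with the identities connect
  functors whose values have different carrier types.\<close>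

theorem corollary4p2:
  fixes k :: "'k ring" and n d :: nat
  assumes "cring k" and "n \<ge> 1" and "d \<ge> 1"
    and universe: "\<exists>c :: 'k list \<Rightarrow> 'v. inj_on c (lists (carrier k))"
  shows
    "is_functor
       (add_S k n d :: (('k, 'v, 'w) spf, ('k, 'v, 'w, 'w) spf_hom) cat) (add_M k n d) (Schur k d) \<and>
     is_functor
       (add_M k n d :: ((perm \<Rightarrow> 'k, 'a) module, 'a \<Rightarrow> 'a) cat)
       (add_S k n d :: (('k, 'v, (('k, 'v) tens \<times> 'a \<Rightarrow> 'k) set) spf, _) cat) (Gtensor k d) \<and>
     (\<exists>\<epsilon>. \<epsilon> \<in> Rep_nat_isos k d
       (add_S k n d :: (('k, 'v, 'w) spf, ('k, 'v, 'w, 'w) spf_hom) cat)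
       (comp_func (Gtensor k d) (Schur k d)) id_func) \<and>
     (\<exists>\<eta>. \<eta> \<in> nat_isos (kS k d)
       (add_M k n d :: ((perm \<Rightarrow> 'k, 'a) module, 'a \<Rightarrow> 'a) cat)
       id_func
       (comp_func
         (Schur k d :: (('k, 'v, (('k, 'v) tens \<times> 'a \<Rightarrow> 'k) set) spf, _, _, _) func)
         (Gtensor k d)))"
proof -
  interpret base k by (rule base.intro) (rule assms(1))
  obtain c :: "'k list \<Rightarrow> 'v" where c: "inj_on c (lists (carrier k))" using universe by blast
  show ?thesis
    using Schur_functor[OF c] Gtensor_functor[OF c] counit_equivalence[OF c] unit_equivalence[OF c] by blast
qed

end
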